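(* Let $\Omega\subset\mathbb{R}^n$ be a bounded uniformly convex domain with $\partial\Omega\in C^2$. Assume $0\in\partial\Omega$ and that the $x_n$ coordinate axis lies in the direction $\nu_0$, the unit inner normal to $\partial\Omega$ at $0$. Let $u:\overline{\Omega}\to\mathbb{R}$ be continuous and convex, satisfying $$\det D^2u=f,\qquad\lambda_0\,d_{\partial\Omega}^{-\alpha}\le f\le\Lambda_0\,d_{\partial\Omega}^{-\alpha}\quad\text{in }\Omega$$ for some $\alpha\in[1,2)$ and constants $0<\lambda_0\le\Lambda_0$, and assume $u|_{\partial\Omega}=\varphi\in C^2$. Let $y_0\in\Omega$ and suppose that $S_{\bar h}(y_0)$ is the maximal section centered at $y_0$ included in $\Omega$, and that it becomes tangent to $\partial\Omega$ at $0$. Then $$\nabla_{x'}u(y_0)=\nabla_{x'}\varphi(0),\qquad M:=-u_n(y_0)\ge -C,$$ and the following hold: (i) If $\alpha\in(1,2)$, denote $\beta:=\frac{n+\alpha-1}{n}$. Then $$c\,\bar h^{\frac{1-\beta}{2-\beta}}\le\max\{M,1\}\le C\,\bar h^{\frac{1-\beta}{2-\beta}},\qquad c\,\bar h^{\frac1{2-\beta}}\le d_{\partial\Omega}(y_0)\le C\,\bar h^{\frac1{2-\beta}},$$ $$\{|x'|^2+|x_n|\le c\,\bar h^{\frac1{2-\beta}}\}\subset S_{\bar h}(y_0)-y_0\subset\{|x'|^2+|x_n|\le C\,\bar h^{\frac1{2-\beta}}\}.$$ (ii) If $\alpha=1$, denote $\bar h_*:=\min\{\bar h,1\}$. Then $$-c\log(C\bar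 h)\le|M|^n\le-C\log(c\bar h),\qquad c\,\bar h_*^{C}\le d_{\partial\Omega}(y_0)\le C\,\bar h_*^{c},$$ $$B_{c\bar h_*^{C}}\subset S_{\bar h}(y_0)-y_0\subset B_{C\bar h_*^{c}}.$$ Here the constants $c,C>0$ depend only on $n,\lambda_0,\Lambda_0,\alpha,\mathrm{diam}(\Omega)$, and on $\varphi,\partial\Omega$ up to their second derivatives.
   Context: Points of $\mathbb{R}^n$ are written $x=(x',x_n)$ with $x'\in\mathbb{R}^{n-1}$; $\nabla_{x'}$ denotes the gradient in the first $n-1$ variables and $u_n=\partial u/\partial x_n$. $d_{\partial\Omega}(x)$ is the distance from $x$ to $\partial\Omega$; $B_r$ is the ball of radius $r$ centered at the origin; $E-y_0$ is the translate of the set $E$ by $-y_0$. The equation $\det D^2u=f$ for a convex function is understood in the Alexandrov sense. Near $0$, $\partial\Omega$ is a graph over its tangent plane $\{x_n=0\}$ and $\varphi$ is regarded there as a function of $x'$, so $\nabla_{x'}\varphi(0)$ is its tangential gradient at $0$. For $y_0\in\Omega$ and $h>0$, $S_h(y_0):=\{x\in\overline\Omega:\ u(x)<u(y_0)+\nabla u(y_0)\cdot(x-y_0)+h\}$. The maximal section $S_{\bar h}(y_0)$ included in $\Omega$ is the one corresponding to the largest $h=\bar h$ for which $S_h(y_0)\subset\Omega$; its closure then touches $\partial\Omega$, and "becomes tangent to $\partial\Omega$ at $0$" means that it touches $\partial\Omega$ at the point $0$. The dependence of the constants on $\partial\Omega$ up to second derivatives includes the uniform convexity of $\Omega$ (the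 positive lower bound of the principal curvatures). *)

theory Defs
  imports "HOL-Analysis.Analysis"
begin

text \<open>
  Throughout, \<open>\<real>\<^sup>n\<close> is \<open>'a \<times> real\<close> with \<open>'a\<close> Euclidean of dimension \<open>n - 1\<close> (so \<open>n \<ge> 2\<close>);
  the point \<open>x = (x', x\<^sub>n)\<close> has \<open>x' = fst x\<close> and \<open>x\<^sub>n = snd x\<close>.
\<close>

definition grad :: "('a::euclidean_space \<Rightarrow> real) \<Rightarrow> 'a \<Rightarrow> 'a" where
  "grad u x = (THE p. GDERIV u x :> p)"

definition dist_bdry :: "'a::euclidean_space set \<Rightarrow> 'a \<Rightarrow> real" where
  "dist_bdry \<Omega> x = infdist x (frontier \<Omega>)"

text \<open>\<open>G\<close> is the gradient and \<open>H\<close> the Hessian of the \<open>C\<^sup>2\<close> function \<open>f\<close> on the open set \<open>S\<close>.\<close>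

definition C2_on ::
  "'a::euclidean_space set \<Rightarrow> ('a \<Rightarrow> real) \<Rightarrow> ('a \<Rightarrow> 'a) \<Rightarrow> ('a \<Rightarrow> 'a \<Rightarrow>\<^sub>L 'a) \<Rightarrow> bool" where
  "C2_on S f G H \<longleftrightarrow>
     (\<forall>x\<in>S. GDERIV f x :> G x) \<and>
     (\<forall>x\<in>S. (G has_derivative blinfun_apply (H x)) (at x)) \<and>
     continuous_on S H"

text \<open>
  In the Cartesian coordinates \<open>(x', t) \<mapsto> z + T (x', t)\<close>, and inside the cylinder
  \<open>|x'| < r\<close>, \<open>|t| < r\<close>, the set \<open>\<Omega>\<close> is the part above the graph of \<open>g\<close> (hence \<open>\<partial>\<Omega>\<close> is the graph),
  and \<open>t = 0\<close> is the tangent plane of \<open>\<partial>\<Omega>\<close> at \<open>z\<close>. The unit inner normal at \<open>z\<close> is \<open>T (0, 1)\<close>.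
\<close>

definition tangent_graph ::
  "('a::euclidean_space \<times> real) set \<Rightarrow> 'a \<times> real \<Rightarrow> ('a \<times> real \<Rightarrow> 'a \<times> real) \<Rightarrow>
   real \<Rightarrow> ('a \<Rightarrow> real) \<Rightarrow> bool" where
  "tangent_graph \<Omega> z T r g \<longleftrightarrow>
     0 < r \<and> orthogonal_transformation T \<and> g 0 = 0 \<and> GDERIV g 0 :> 0 \<and>
     (\<forall>x'\<in>ball 0 r. \<bar>g x'\<bar> < r \<and>
        (\<forall>t. \<bar>t\<bar> < r \<longrightarrow> (z + T (x', t) \<in> \<Omega> \<longleftrightarrow> g x' < t)))"

definition inner_unit_normal ::
  "('a::euclidean_space \<times> real) set \<Rightarrow> 'a \<times> real \<Rightarrow> 'a \<times> real \<Rightarrow> bool" where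
  "inner_unit_normal \<Omega> z \<nu> \<longleftrightarrow> (\<exists>T r g. tangent_graph \<Omega> z T r g \<and> T (0, 1) = \<nu>)"

text \<open>
  Bounded uniformly convex domains with \<open>C\<^sup>2\<close> boundary. Since \<open>g\<close> is the graph over the tangent
  plane at \<open>z\<close>, the eigenvalues of its Hessian at \<open>0\<close> are the principal curvatures of \<open>\<partial>\<Omega>\<close> at \<open>z\<close>;
  they are required to lie in \<open>[\<kappa>, K]\<close> at every boundary point. By compactness of \<open>\<partial>\<Omega>\<close>, every
  bounded uniformly convex \<open>C\<^sup>2\<close> domain satisfies this for some \<open>\<kappa> > 0\<close> and \<open>K\<close>.
\<close>

definition unif_convex_C2_domain ::
  "('a::euclidean_space \<times> real) set \<Rightarrow> real \<Rightarrow> real \<Rightarrow> bool" where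
  "unif_convex_C2_domain \<Omega> \<kappa> K \<longleftrightarrow>
     open \<Omega> \<and> bounded \<Omega> \<and> convex \<Omega> \<and> \<Omega> \<noteq> {} \<and>
     (\<forall>z\<in>frontier \<Omega>. \<exists>T r g G H.
        tangent_graph \<Omega> z T r g \<and> C2_on (ball 0 r) g G H \<and>
        (\<forall>v. \<kappa> * (norm v)\<^sup>2 \<le> v \<bullet> blinfun_apply (H 0) v \<and>
             v \<bullet> blinfun_apply (H 0) v \<le> K * (norm v)\<^sup>2))"

text \<open>
  \<open>\<phi> \<in> C\<^sup>2(\<partial>\<Omega>)\<close>, with \<open>\<phi>\<close>, its tangential gradient and its tangential Hessian bounded by \<open>K\<close>:
  near each \<open>z \<in> \<partial>\<Omega>\<close> one regards \<open>\<phi>\<close> as a function on the tangent plane at \<open>z\<close>.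
\<close>

definition C2_boundary_data ::
  "('a::euclidean_space \<times> real) set \<Rightarrow> ('a \<times> real \<Rightarrow> real) \<Rightarrow> real \<Rightarrow> bool" where
  "C2_boundary_data \<Omega> \<phi> K \<longleftrightarrow>
     (\<forall>z\<in>frontier \<Omega>. \<exists>T r g G H.
        tangent_graph \<Omega> z T r g \<and> C2_on (ball 0 r) (\<lambda>x'. \<phi> (z + T (x', g x'))) G H \<and>
        \<bar>\<phi> z\<bar> \<le> K \<and> norm (G 0) \<le> K \<and> norm (H 0) \<le> K)"

text \<open>
  \<open>\<nabla>\<^bsub>x'\<^esub> \<phi>(0) = p\<close>, where \<open>\<partial>\<Omega>\<close> is near \<open>0\<close> the graph of \<open>g\<close> over \<open>{x\<^sub>n = 0}\<close>. The germ of \<open>g\<close>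
  at \<open>0\<close> is determined by \<open>\<Omega>\<close>, so the choice of \<open>r\<close> and \<open>g\<close> is immaterial.
\<close>

definition has_tangential_grad_at_0 ::
  "('a::euclidean_space \<times> real) set \<Rightarrow> ('a \<times> real \<Rightarrow> real) \<Rightarrow> 'a \<Rightarrow> bool" where
  "has_tangential_grad_at_0 \<Omega> \<phi> p \<longleftrightarrow>
     (\<exists>r g. tangent_graph \<Omega> 0 id r g \<and> GDERIV (\<lambda>x'. \<phi> (x', g x')) 0 :> p)"

definition subdifferential ::
  "'a::euclidean_space set \<Rightarrow> ('a \<Rightarrow> real) \<Rightarrow> 'a \<Rightarrow> 'a set" where
  "subdifferential \<Omega> u x = {p. \<forall>y\<in>\<Omega>. u x + p \<bullet> (y - x) \<le> u y}"

text \<open>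
  \<open>det D\<^sup>2u = f\<close> in \<open>\<Omega>\<close> in the Alexandrov sense: the Monge-Ampere measure
  \<open>E \<mapsto> |\<partial>u(E)|\<close> has density \<open>f\<close>.
\<close>

definition alexandrov_solution ::
  "'a::euclidean_space set \<Rightarrow> ('a \<Rightarrow> real) \<Rightarrow> ('a \<Rightarrow> real) \<Rightarrow> bool" where
  "alexandrov_solution \<Omega> u f \<longleftrightarrow>
     f \<in> borel_measurable (lebesgue_on \<Omega>) \<and>
     (\<forall>E\<in>sets borel. E \<subseteq> \<Omega> \<longrightarrow>
        emeasure lebesgue (\<Union>x\<in>E. subdifferential \<Omega> u x) =
        (\<integral>\<^sup>+x\<in>E. ennreal (f x) \<partial>lebesgue))"

definition MA_section ::
  "'a::euclidean_space set \<Rightarrow> ('a \<Rightarrow> real) \<Rightarrow> 'a \<Rightarrow> real \<Rightarrow> 'a set" where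
  "MA_section \<Omega> u y h = {x \<in> closure \<Omega>. u x < u y + grad u y \<bullet> (x - y) + h}"

definition maximal_section_height ::
  "'a::euclidean_space set \<Rightarrow> ('a \<Rightarrow> real) \<Rightarrow> 'a \<Rightarrow> real \<Rightarrow> bool" where
  "maximal_section_height \<Omega> u y h \<longleftrightarrow>
     0 < h \<and> MA_section \<Omega> u y h \<subseteq> \<Omega> \<and>
     (\<forall>h'>0. MA_section \<Omega> u y h' \<subseteq> \<Omega> \<longrightarrow> h' \<le> h)"

end

theory Submission
  imports Defs
begin

text \<open>
  Uniform convexity and the \<open>C\<^sup>2\<close> bound give, by Blaschke rolling, interior tangent balls of radius
  \<open>\<rho>\<close> and enclosing tangent balls of radius \<open>R\<close> at every boundary point, and this is all that is used
  of the domain. Let \<open>w\<close> be \<open>u\<close> minus the affine function that cuts off the section.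
  Since \<open>w \<ge> 0\<close> on \<open>\<partial>\<Omega>\<close> and \<open>w(0) = 0\<close>, comparison with the Taylor expansion of \<open>\<phi>\<close> identifies the
  tangential gradient, bounds \<open>M\<close> from below, and gives \<open>(M - C) x\<^sub>n \<le> w\<close> on \<open>\<partial>\<Omega>\<close> and
  \<open>w \<le> C max(M, 1) x\<^sub>n\<close> in \<open>\<Omega>\<close>.

  Everything else follows from two one-dimensional barriers. The Monge-Ampere equation pushes a solution
  that is nonnegative on \<open>\<partial>\<Omega>\<close> down by at most \<open>F(d)\<close> at distance \<open>d\<close> from \<open>\<partial>\<Omega>\<close>, where \<open>F(r)\<close> is
  \<open>r powr ((n + 1 - \<alpha>) / n)\<close>, or \<open>r (log (1/r)) powr (1/n)\<close> if \<open>\<alpha> = 1\<close>: this bounds \<open>h\<close> by \<open>F(d(y\<^sub>0))\<close> and,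
  applied to \<open>w - (M - C) x\<^sub>n\<close>, the width of the section by \<open>M\<close>. Conversely \<open>w \<le> C m x\<^sub>n\<close> with
  \<open>m = max(M, 1)\<close> forces \<open>w\<close> to become negative, which bounds \<open>h\<close> from below in terms of \<open>m\<close>.
  Combining these, \<open>m\<close>, \<open>d(y\<^sub>0)\<close> and the size of the section are comparable to powers of \<open>h\<close>;
  convexity on segments from \<open>y\<^sub>0\<close> gives the inner inclusions.

  The barriers are compared with \<open>u\<close> at a touching point through the volumes of small ellipsoids and of
  the corresponding slopes, so only the definition of the Monge-Ampere measure enters. That
  \<open>\<nabla>u(y\<^sub>0)\<close> exists is itself a case of Caffarelli's strict convexity and regularity theory; the
  upper barrier excludes contact of a supporting plane with \<open>\<partial>\<Omega>\<close>.
\<close>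

section \<open>Monge-Ampere measures and the volume of ellipsoids\<close>

text \<open>An Alexandrov solution is known only through the Lebesgue measure of its sets of slopes,
  so there is no pointwise Hessian to compare. A touching quadratic replaces it: the size of the
  neighbourhood cancels between the two volumes and an inequality for the coefficients remains.
  Since \<open>c\<close> and \<open>C\<close> precede the domain, every lemma fixes its constants
  before \<open>\<Omega>\<close> and \<open>u\<close>.

  The comparisons form a loop. For \<open>\<alpha> > 1\<close> put
  \<open>\<delta> = m powr (- n / (\<alpha> - 1))\<close> and \<open>\<gamma> = 2 - \<beta>\<close>:
  up to constants, \<open>\<delta> powr \<gamma>\<close> is at most \<open>h\<close>,
  \<open>h\<close> at most \<open>d(y0) powr \<gamma>\<close>, and \<open>d(y0)\<close> at most
  \<open>\<delta>\<close>. The exponent \<open>\<gamma>\<close> is the one for which the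
  \<open>\<gamma>\<close>-th power of the distance has a Hessian determinant of order
  \<open>- \<alpha>\<close>. For \<open>\<alpha> = 1\<close> it would be 1, a linear profile without
  second derivative, hence the logarithm; the loop then gives \<open>exp (- k * m ^ n)\<close> on
  both sides of \<open>h\<close> with two different rates \<open>k\<close>, which is why (ii) has
  unspecified powers. The bound \<open>\<alpha> < 2\<close> keeps the total drop of the upper
  barrier finite.\<close>

definition cyl :: "'a::euclidean_space \<Rightarrow> real \<Rightarrow> real \<Rightarrow> 'a set" where
  "cyl e a b = {x. \<bar>e \<bullet> x\<bar> \<le> a \<and> norm (x - (e \<bullet> x) *\<^sub>R e) \<le> b}"

text \<open>Half open in the direction of \<open>e\<close>, so that consecutive translates along
  \<open>e\<close> are disjoint and tile a longer piece. The radius is fixed at 1; other radii come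
  from scaling.\<close>

definition half_cyl :: "'a::euclidean_space \<Rightarrow> real \<Rightarrow> real \<Rightarrow> 'a set" where
  "half_cyl e l r = {x. l \<le> e \<bullet> x \<and> e \<bullet> x < r \<and> norm (x - (e \<bullet> x) *\<^sub>R e) \<le> 1}"

lemma norm_le_axis_perp:
  fixes x e :: "'a::euclidean_space"
  assumes "norm e = 1"
  shows "norm x \<le> \<bar>e \<bullet> x\<bar> + norm (x - (e \<bullet> x) *\<^sub>R e)"
proof -
  have "norm x = norm ((e \<bullet> x) *\<^sub>R e + (x - (e \<bullet> x) *\<^sub>R e))" by simp
  also have "\<dots> \<le> norm ((e \<bullet> x) *\<^sub>R e) + norm (x - (e \<bullet> x) *\<^sub>R e)" by (rule norm_triangle_ineq)
  finally show ?thesis using assms by simp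
qed

lemma norm_perp_sq:
  fixes x e :: "'a::euclidean_space"
  assumes "norm e = 1"
  shows "(norm (x - (e \<bullet> x) *\<^sub>R e))\<^sup>2 = (norm x)\<^sup>2 - (e \<bullet> x)\<^sup>2"
proof -
  have ee: "e \<bullet> e = 1" using assms by (simp add: norm_eq_1)
  show ?thesis
    unfolding power2_norm_eq_inner by (simp add: algebra_simps ee inner_commute power2_eq_square)
qed

lemma norm_perp_le:
  fixes x e :: "'a::euclidean_space"
  assumes "norm e = 1"
  shows "norm (x - (e \<bullet> x) *\<^sub>R e) \<le> norm x"
  by (rule power2_le_imp_le) (use norm_perp_sq[OF assms, of x] in auto)

lemma bounded_half_cyl:
  fixes e :: "'a::euclidean_space"
  assumes "norm e = 1"
  shows "bounded (half_cyl e l r)"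
  unfolding bounded_iff
proof (intro exI ballI)
  fix x assume "x \<in> half_cyl e l r"
  then show "norm x \<le> \<bar>l\<bar> + \<bar>r\<bar> + 1"
    using norm_le_axis_perp[OF assms, of x] by (auto simp: half_cyl_def)
qed

lemma half_cyl_lmeasurable:
  fixes e :: "'a::euclidean_space"
  assumes "norm e = 1"
  shows "half_cyl e l r \<in> lmeasurable"
proof (rule bounded_set_imp_lmeasurable[OF bounded_half_cyl[OF assms]])
  have "half_cyl e l r \<in> sets borel"
    unfolding half_cyl_def by measurable
  then show "half_cyl e l r \<in> sets lebesgue" by simp
qed

lemma cyl_lmeasurable:
  fixes e :: "'a::euclidean_space"
  assumes "norm e = 1"
  shows "cyl e a b \<in> lmeasurable"
proof (rule bounded_set_imp_lmeasurable)
  show "bounded (cyl e a b)"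
    unfolding bounded_iff
  proof (intro exI ballI)
    fix x assume "x \<in> cyl e a b"
    then show "norm x \<le> a + b"
      using norm_le_axis_perp[OF assms, of x] by (auto simp: cyl_def)
  qed
  have "cyl e a b \<in> sets borel"
    unfolding cyl_def by measurable
  then show "cyl e a b \<in> sets lebesgue" by simp
qed

lemma measure_half_cyl_shift:
  fixes e :: "'a::euclidean_space"
  assumes "norm e = 1"
  shows "measure lebesgue (half_cyl e (l + s) (r + s)) = measure lebesgue (half_cyl e l r)"
proof -
  have ee: "e \<bullet> e = 1" using assms by (simp add: norm_eq_1)
  have "half_cyl e (l + s) (r + s) = (+) (s *\<^sub>R e) ` half_cyl e l r"
  proof (intro equalityI subsetI)
    fix x assume "x \<in> half_cyl e (l + s) (r + s)"
    then have "x - s *\<^sub>R e \<in> half_cyl e l r"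
      by (auto simp: half_cyl_def ee inner_diff_right algebra_simps)
    then show "x \<in> (+) (s *\<^sub>R e) ` half_cyl e l r" by (auto intro!: image_eqI)
  next
    fix x assume "x \<in> (+) (s *\<^sub>R e) ` half_cyl e l r"
    then show "x \<in> half_cyl e (l + s) (r + s)"
      by (auto simp: half_cyl_def ee inner_add_right algebra_simps)
  qed
  then show ?thesis by (simp add: measure_translation)
qed

lemma measure_half_cyl_multiple:
  fixes e :: "'a::euclidean_space"
  assumes e: "norm e = 1" and "0 \<le> l"
  shows "measure lebesgue (half_cyl e 0 (real N * l)) = real N * measure lebesgue (half_cyl e 0 l)"
proof (induction N)
  case 0
  have "half_cyl e 0 0 = {}" by (auto simp: half_cyl_def)
  then show ?case by simp
next
  case (Suc N)
  have eq: "half_cyl e 0 (real (Suc N) * l) = half_cyl e 0 (real N * l) \<union> half_cyl e (0 + real N * l) (l + real N * l)"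
    using assms by (auto simp: half_cyl_def algebra_simps) (smt (verit) mult_nonneg_nonneg of_nat_0_le_iff)
  have "measure lebesgue (half_cyl e 0 (real (Suc N) * l)) =
      measure lebesgue (half_cyl e 0 (real N * l)) + measure lebesgue (half_cyl e (0 + real N * l) (l + real N * l))"
  proof -
    have "half_cyl e 0 (real N * l) \<inter> half_cyl e (0 + real N * l) (l + real N * l) = {}"
      by (auto simp: half_cyl_def)
    then show ?thesis
      unfolding eq using measure_Un3[OF half_cyl_lmeasurable[OF e] half_cyl_lmeasurable[OF e]] by simp
  qed
  then show ?case
    using Suc measure_half_cyl_shift[OF e, of 0 "real N * l" l] by (simp add: algebra_simps)
qed

lemma measure_half_cyl_mono:
  fixes e :: "'a::euclidean_space"
  assumes e: "norm e = 1" and "l \<le> r"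
  shows "measure lebesgue (half_cyl e 0 l) \<le> measure lebesgue (half_cyl e 0 r)"
  by (rule measure_mono_fmeasurable)
     (use assms half_cyl_lmeasurable[OF e] in \<open>auto simp: half_cyl_def fmeasurableD\<close>)

text \<open>Tiling gives additivity for integer multiples only. The piece of length
  \<open>N * l\<close> is measured both by \<open>N\<close> copies of length \<open>l\<close> and,
  up to rounding, by copies of length 1; the rounding costs the factors \<open>1 / 2\<close> and
  \<open>2\<close>. This replaces an integration in coordinates adapted to \<open>e\<close>.\<close>

lemma measure_half_cyl_bounds:
  fixes e :: "'a::euclidean_space"
  assumes e: "norm e = 1" and l: "0 < l"
  shows "l / 2 * measure lebesgue (half_cyl e 0 1) \<le> measure lebesgue (half_cyl e 0 l)"
    and "measure lebesgue (half_cyl e 0 l) \<le> 2 * l * measure lebesgue (half_cyl e 0 1)"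
proof -
  define g where "g t = measure lebesgue (half_cyl e 0 t)" for t
  have g0: "g t \<ge> 0" for t by (simp add: g_def)
  \<comment> \<open>\<open>N * l > 2\<close> makes the rounding of \<open>N * l\<close> to an
    integer an error of a factor at most 2.\<close>
  obtain N :: nat where N: "2 / l < real N" using reals_Archimedean2 by blast
  have Npos: "0 < real N" using N l by (smt (verit) divide_pos_pos)
  have Nl: "2 < real N * l" using N l by (simp add: field_simps)
  define k where "k = nat \<lfloor>real N * l\<rfloor>"
  have k: "real k \<le> real N * l" "real N * l < real k + 1"
    using Nl by (auto simp: k_def)
  have gN: "g (real N * l) = real N * g l"
    using measure_half_cyl_multiple[OF e, of l N] l by (simp add: g_def)
  have gk: "g (real k) = real k * g 1" "g (real (Suc k)) = real (Suc k) * g 1"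
    using measure_half_cyl_multiple[OF e, of 1 k] measure_half_cyl_multiple[OF e, of 1 "Suc k"] by (simp_all add: g_def)
  have 1: "real k * g 1 \<le> real N * g l"
    using measure_half_cyl_mono[OF e k(1)] gN gk by (simp add: g_def)
  have 2: "real N * g l \<le> (real k + 1) * g 1"
    using measure_half_cyl_mono[OF e, of "real N * l" "real (Suc k)"] k gN gk by (simp add: g_def add.commute)
  have "real N * (l / 2 * g 1) \<le> real k * g 1"
    using mult_right_mono[of "real N * l / 2" "real k" "g 1"] k Nl g0[of 1] by (simp add: ac_simps)
  also note 1
  finally show "l / 2 * measure lebesgue (half_cyl e 0 1) \<le> measure lebesgue (half_cyl e 0 l)"
    using Npos by (simp add: g_def)
  have "(real k + 1) * g 1 \<le> real N * (2 * l * g 1)"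
    using mult_right_mono[of "real k + 1" "real N * l * 2" "g 1"] k Nl g0[of 1] by (simp add: ac_simps)
  with 2 have "real N * g l \<le> real N * (2 * l * g 1)" by linarith
  then show "measure lebesgue (half_cyl e 0 l) \<le> 2 * l * measure lebesgue (half_cyl e 0 1)"
    using Npos by (simp add: g_def)
qed

lemma measure_lebesgue_scaleR:
  fixes S :: "'a::euclidean_space set"
  assumes "0 < b"
  shows "measure lebesgue ((*\<^sub>R) b ` S) = b ^ DIM('a) * measure lebesgue S"
  using measure_lebesgue_affine[of b 0 S] assms by simp

text \<open>The constants must not depend on the direction \<open>e\<close>. The piece of length 1
  contains a ball of radius \<open>1 / 2\<close> and lies in the ball of radius 2 about the origin,
  whatever \<open>e\<close> is; scaling by \<open>b\<close> and a change of length along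
  \<open>e\<close> do the rest.\<close>

lemma cyl_volume:
  obtains k1 k2 :: real where "0 < k1" "0 < k2"
    "\<And>(e::'a::euclidean_space) a b. norm e = 1 \<Longrightarrow> 0 < a \<Longrightarrow> 0 < b \<Longrightarrow>
       k1 * (a * b ^ (DIM('a) - 1)) \<le> measure lebesgue (cyl e a b) \<and>
       measure lebesgue (cyl e a b) \<le> k2 * (a * b ^ (DIM('a) - 1))"
proof
  let ?n = "DIM('a)"
  define \<omega>1 where "\<omega>1 = measure lebesgue (ball (0::'a) (1/2))"
  define \<omega>2 where "\<omega>2 = measure lebesgue (cball (0::'a) 2)"
  show "0 < \<omega>1 / 2" unfolding \<omega>1_def by (simp add: content_ball_pos)
  show "0 < 6 * \<omega>2" unfolding \<omega>2_def by (simp add: content_cball_pos)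
  fix e :: 'a and a b :: real assume e: "norm e = 1" and a: "0 < a" and b: "0 < b"
  have ee: "e \<bullet> e = 1" using e by (simp add: norm_eq_1)
  have "ball ((1/2) *\<^sub>R e) (1/2) \<subseteq> half_cyl e 0 1"
  proof
    fix x assume x: "x \<in> ball ((1/2) *\<^sub>R e) (1/2)"
    define y where "y = x - (1/2) *\<^sub>R e"
    have y: "norm y < 1/2" using x by (simp add: y_def dist_norm norm_minus_commute)
    have xe: "x = (1/2) *\<^sub>R e + y" by (simp add: y_def)
    have "\<bar>e \<bullet> y\<bar> \<le> norm y" using Cauchy_Schwarz_ineq2[of e y] e by simp
    moreover have "norm (y - (e \<bullet> y) *\<^sub>R e) \<le> norm y" by (rule norm_perp_le[OF e])
    moreover have "x - (e \<bullet> x) *\<^sub>R e = y - (e \<bullet> y) *\<^sub>R e"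
      by (simp add: xe inner_add_right ee algebra_simps)
    moreover have "e \<bullet> x = 1/2 + e \<bullet> y" by (simp add: xe inner_add_right ee)
    ultimately show "x \<in> half_cyl e 0 1" using y by (auto simp: half_cyl_def)
  qed
  then have "measure lebesgue (ball ((1/2) *\<^sub>R e) (1/2)) \<le> measure lebesgue (half_cyl e 0 1)"
    by (intro measure_mono_fmeasurable) (use half_cyl_lmeasurable[OF e] in auto)
  then have w1: "\<omega>1 \<le> measure lebesgue (half_cyl e 0 1)" by (simp add: \<omega>1_def content_ball)
  have "half_cyl e 0 1 \<subseteq> cball 0 2"
  proof
    fix x assume "x \<in> half_cyl e 0 1"
    then show "x \<in> cball 0 2" using norm_le_axis_perp[OF e, of x] by (auto simp: half_cyl_def)
  qed
  then have w2: "measure lebesgue (half_cyl e 0 1) \<le> \<omega>2"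
    unfolding \<omega>2_def by (intro measure_mono_fmeasurable) (use half_cyl_lmeasurable[OF e] in auto)
  have bn: "b ^ ?n = b * b ^ (?n - 1)" using DIM_positive[where 'a='a] by (metis Suc_pred' power_Suc)
  have sc: "(*\<^sub>R) b ` half_cyl e l r = {x. b * l \<le> e \<bullet> x \<and> e \<bullet> x < b * r \<and> norm (x - (e \<bullet> x) *\<^sub>R e) \<le> b}" for l r
  proof (intro equalityI subsetI)
    fix x assume "x \<in> (*\<^sub>R) b ` half_cyl e l r"
    then obtain y where y: "x = b *\<^sub>R y" "y \<in> half_cyl e l r" by auto
    have "x - (e \<bullet> x) *\<^sub>R e = b *\<^sub>R (y - (e \<bullet> y) *\<^sub>R e)" by (simp add: y algebra_simps)
    then show "x \<in> {x. b * l \<le> e \<bullet> x \<and> e \<bullet> x < b * r \<and> norm (x - (e \<bullet> x) *\<^sub>R e) \<le> b}"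
      using y b by (auto simp: half_cyl_def)
  next
    fix x assume x: "x \<in> {x. b * l \<le> e \<bullet> x \<and> e \<bullet> x < b * r \<and> norm (x - (e \<bullet> x) *\<^sub>R e) \<le> b}"
    define y where "y = (1/b) *\<^sub>R x"
    have "y - (e \<bullet> y) *\<^sub>R e = (1/b) *\<^sub>R (x - (e \<bullet> x) *\<^sub>R e)" by (simp add: y_def algebra_simps)
    then have "norm (y - (e \<bullet> y) *\<^sub>R e) = (1/b) * norm (x - (e \<bullet> x) *\<^sub>R e)" using b by simp
    also have "\<dots> \<le> 1" using x b by (simp add: field_simps)
    finally have "y \<in> half_cyl e l r" using x b by (auto simp: half_cyl_def y_def field_simps)
    moreover have "x = b *\<^sub>R y" using b by (simp add: y_def)
    ultimately show "x \<in> (*\<^sub>R) b ` half_cyl e l r" by auto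
  qed
  have meas: "(*\<^sub>R) b ` half_cyl e l r \<in> lmeasurable" for l r
  proof (rule bounded_set_imp_lmeasurable)
    show "bounded ((*\<^sub>R) b ` half_cyl e l r)"
      by (intro bounded_scaling bounded_half_cyl e)
    show "(*\<^sub>R) b ` half_cyl e l r \<in> sets lebesgue"
      unfolding sc by (intro sets_completionI_sets) (simp, measurable)
  qed
  have "(*\<^sub>R) b ` half_cyl e 0 (a / b) \<subseteq> cyl e a b"
    unfolding sc using a b by (auto simp: cyl_def)
  then have "b ^ ?n * measure lebesgue (half_cyl e 0 (a / b)) \<le> measure lebesgue (cyl e a b)"
    unfolding measure_lebesgue_scaleR[OF b, symmetric]
    by (intro measure_mono_fmeasurable) (use meas cyl_lmeasurable[OF e] in \<open>auto simp: fmeasurableD\<close>)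
  moreover have "a / b / 2 * \<omega>1 \<le> measure lebesgue (half_cyl e 0 (a / b))"
    using measure_half_cyl_bounds(1)[OF e, of "a / b"] a b mult_left_mono[OF w1, of "a / b / 2"]
    by simp
  ultimately have "b ^ ?n * (a / b / 2 * \<omega>1) \<le> measure lebesgue (cyl e a b)"
    using b by (meson mult_left_mono order_trans zero_le_power less_imp_le)
  then have L: "\<omega>1 / 2 * (a * b ^ (?n - 1)) \<le> measure lebesgue (cyl e a b)"
    using b by (simp add: bn field_simps)
  \<comment> \<open>The length \<open>3 * a / b\<close> instead of \<open>2 * a / b\<close> covers
    the face \<open>e \<bullet> x = a\<close>, which a half-open piece would miss.\<close>
  have "cyl e a b \<subseteq> (*\<^sub>R) b ` half_cyl e (0 + - (a / b)) (3 * a / b + - (a / b))"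
    unfolding sc using a b by (auto simp: cyl_def field_simps)
  then have "measure lebesgue (cyl e a b) \<le> b ^ ?n * measure lebesgue (half_cyl e (0 + - (a / b)) (3 * a / b + - (a / b)))"
    unfolding measure_lebesgue_scaleR[OF b, symmetric]
    by (intro measure_mono_fmeasurable) (use meas cyl_lmeasurable[OF e] in \<open>auto simp: fmeasurableD\<close>)
  also have "\<dots> = b ^ ?n * measure lebesgue (half_cyl e 0 (3 * a / b))"
    by (subst measure_half_cyl_shift[OF e]) simp
  also have "\<dots> \<le> b ^ ?n * (2 * (3 * a / b) * \<omega>2)"
  proof (rule mult_left_mono)
    show "measure lebesgue (half_cyl e 0 (3 * a / b)) \<le> 2 * (3 * a / b) * \<omega>2"
      using measure_half_cyl_bounds(2)[OF e, of "3 * a / b"] a b mult_left_mono[OF w2, of "2 * (3 * a / b)"]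
      by simp
  qed (use b in simp)
  also have "\<dots> = 6 * \<omega>2 * (a * b ^ (?n - 1))" using b by (simp add: bn field_simps)
  finally show "\<omega>1 / 2 * (a * b ^ (?n - 1)) \<le> measure lebesgue (cyl e a b) \<and>
       measure lebesgue (cyl e a b) \<le> 6 * \<omega>2 * (a * b ^ (?n - 1))" using L by blast
qed

section \<open>Mass of the Monge-Ampere measure, and slopes that are attained\<close>

lemma MA_mass_bounds:
  assumes "alexandrov_solution \<Omega> u f" "E \<in> sets borel" "E \<subseteq> \<Omega>"
  shows "(\<And>x. x \<in> E \<Longrightarrow> lo \<le> f x) \<Longrightarrow>
      ennreal lo * emeasure lebesgue E \<le> emeasure lebesgue (\<Union>x\<in>E. subdifferential \<Omega> u x)"
    and "(\<And>x. x \<in> E \<Longrightarrow> f x \<le> hi) \<Longrightarrow>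
      emeasure lebesgue (\<Union>x\<in>E. subdifferential \<Omega> u x) \<le> ennreal hi * emeasure lebesgue E"
proof -
  have eq: "emeasure lebesgue (\<Union>x\<in>E. subdifferential \<Omega> u x) = (\<integral>\<^sup>+x\<in>E. ennreal (f x) \<partial>lebesgue)"
    using assms by (simp add: alexandrov_solution_def)
  have E: "E \<in> sets lebesgue" using assms(2) by simp
  show "ennreal lo * emeasure lebesgue E \<le> emeasure lebesgue (\<Union>x\<in>E. subdifferential \<Omega> u x)"
    if "\<And>x. x \<in> E \<Longrightarrow> lo \<le> f x"
  proof -
    have "ennreal lo * emeasure lebesgue E = (\<integral>\<^sup>+x. ennreal lo * indicator E x \<partial>lebesgue)"
      using E by (simp add: nn_integral_cmult_indicator)
    also have "\<dots> \<le> (\<integral>\<^sup>+x\<in>E. ennreal (f x) \<partial>lebesgue)"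
      by (rule nn_integral_mono) (use that in \<open>auto simp: indicator_def intro: ennreal_leI\<close>)
    finally show ?thesis using eq by simp
  qed
  show "emeasure lebesgue (\<Union>x\<in>E. subdifferential \<Omega> u x) \<le> ennreal hi * emeasure lebesgue E"
    if "\<And>x. x \<in> E \<Longrightarrow> f x \<le> hi"
  proof -
    have "(\<integral>\<^sup>+x\<in>E. ennreal (f x) \<partial>lebesgue) \<le> (\<integral>\<^sup>+x. ennreal hi * indicator E x \<partial>lebesgue)"
      by (rule nn_integral_mono) (use that in \<open>auto simp: indicator_def intro: ennreal_leI\<close>)
    also have "\<dots> = ennreal hi * emeasure lebesgue E"
      using E by (simp add: nn_integral_cmult_indicator)
    finally show ?thesis using eq by simp
  qed
qed

text \<open>\<open>emeasure\<close> is 0 on sets that are not measurable, so a set of slopes with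
  positive mass must be measurable. Monotonicity of the measure for its subsets depends on
  this.\<close>

lemma MA_image_sets:
  assumes "alexandrov_solution \<Omega> u f" "E \<in> sets borel" "E \<subseteq> \<Omega>"
    and "\<And>x. x \<in> E \<Longrightarrow> lo \<le> f x" "0 < lo" "0 < emeasure lebesgue E"
  shows "(\<Union>x\<in>E. subdifferential \<Omega> u x) \<in> sets lebesgue"
proof (rule ccontr)
  assume "(\<Union>x\<in>E. subdifferential \<Omega> u x) \<notin> sets lebesgue"
  then have "emeasure lebesgue (\<Union>x\<in>E. subdifferential \<Omega> u x) = 0" by (rule emeasure_notin_sets)
  with MA_mass_bounds(1)[OF assms(1-3), of lo] assms(4-6) show False
    by (auto simp: ennreal_eq_0_iff)
qed

lemma convex_on_segment_le:
  fixes u :: "'a::euclidean_space \<Rightarrow> real"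
  assumes "convex_on S u" "x \<in> S" "y \<in> S" "0 \<le> t" "t \<le> 1"
  shows "u (x + t *\<^sub>R (y - x)) \<le> u x + t * (u y - u x)"
proof -
  have "x + t *\<^sub>R (y - x) = (1 - t) *\<^sub>R x + t *\<^sub>R y" by (simp add: algebra_simps)
  then show ?thesis
    using convex_onD[OF assms(1), of t x y] assms by (simp add: algebra_simps)
qed

text \<open>Tilting \<open>u\<close> by \<open>q\<close> and minimising over
  \<open>closure E\<close> gives a minimum inside \<open>E\<close>, since the boundary values exceed
  the value at \<open>x1\<close>. By convexity a local minimum is global in \<open>\<Omega>\<close>,
  so \<open>q\<close> is a subgradient there. Lower bounds for sets of slopes are produced in this
  way.\<close>

lemma subgradient_at_interior_minimum:
  fixes u :: "'a::euclidean_space \<Rightarrow> real"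
  assumes cvx: "convex_on \<Omega> u" and E: "open E" "bounded E" "closure E \<subseteq> \<Omega>"
    and cont: "continuous_on (closure E) u" and x1: "x1 \<in> E"
    and bd: "\<And>y. y \<in> closure E - E \<Longrightarrow> u x1 - q \<bullet> x1 < u y - q \<bullet> y"
  obtains x where "x \<in> E" "q \<in> subdifferential \<Omega> u x"
proof -
  have "compact (closure E)" using E by (simp add: compact_closure)
  moreover have "closure E \<noteq> {}" using x1 closure_subset by blast
  moreover have "continuous_on (closure E) (\<lambda>x. u x - q \<bullet> x)" by (intro continuous_intros cont)
  ultimately obtain x where x: "x \<in> closure E" "\<And>y. y \<in> closure E \<Longrightarrow> u x - q \<bullet> x \<le> u y - q \<bullet> y"
    using continuous_attains_inf[of "closure E" "\<lambda>x. u x - q \<bullet> x"] by blast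
  have "x \<in> E" using x(2)[of x1] bd[of x] x x1 closure_subset by fastforce
  moreover have "q \<in> subdifferential \<Omega> u x"
    unfolding subdifferential_def
  proof (clarify)
    fix y assume y: "y \<in> \<Omega>"
    obtain r where r: "r > 0" "ball x r \<subseteq> E" using E(1) \<open>x \<in> E\<close> openE by blast
    \<comment> \<open>Small enough for the point on the segment towards \<open>y\<close> to stay in
      \<open>E\<close>, where the minimum is known.\<close>
    define t where "t = min 1 (r / (2 * (norm (y - x) + 1)))"
    have np: "norm (y - x) + 1 > 0" by (smt (verit) norm_ge_zero)
    have t: "0 < t" "t \<le> 1" using r np by (auto simp: t_def)
    have "t * norm (y - x) \<le> r / (2 * (norm (y - x) + 1)) * norm (y - x)"
      by (rule mult_right_mono) (auto simp: t_def)
    also have "\<dots> \<le> r / 2" using r np by (simp add: field_simps)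
    finally have "x + t *\<^sub>R (y - x) \<in> ball x r" using r t by (simp add: dist_norm)
    then have "x + t *\<^sub>R (y - x) \<in> closure E" using r closure_subset by blast
    then have "u x - q \<bullet> x \<le> u (x + t *\<^sub>R (y - x)) - q \<bullet> (x + t *\<^sub>R (y - x))" by (rule x(2))
    moreover have "u (x + t *\<^sub>R (y - x)) \<le> u x + t * (u y - u x)"
      by (rule convex_on_segment_le[OF cvx]) (use y t x E closure_subset in auto)
    ultimately have "t * (q \<bullet> (y - x)) \<le> t * (u y - u x)"
      by (simp add: inner_add_right)
    then show "u x + q \<bullet> (y - x) \<le> u y" using t by simp
  qed
  ultimately show ?thesis using that by blast
qed

lemma abs_inner_axis_perp_le:
  fixes e q y :: "'a::euclidean_space"
  assumes "norm e = 1"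
  shows "\<bar>q \<bullet> y\<bar> \<le> \<bar>e \<bullet> q\<bar> * \<bar>e \<bullet> y\<bar> + norm (q - (e \<bullet> q) *\<^sub>R e) * norm (y - (e \<bullet> y) *\<^sub>R e)"
proof -
  have ee: "e \<bullet> e = 1" using assms by (simp add: norm_eq_1)
  have "q \<bullet> y = (e \<bullet> q) * (e \<bullet> y) + (q - (e \<bullet> q) *\<^sub>R e) \<bullet> (y - (e \<bullet> y) *\<^sub>R e)"
    by (simp add: inner_diff_left inner_diff_right ee inner_commute algebra_simps)
  then have "\<bar>q \<bullet> y\<bar> \<le> \<bar>(e \<bullet> q) * (e \<bullet> y)\<bar> + \<bar>(q - (e \<bullet> q) *\<^sub>R e) \<bullet> (y - (e \<bullet> y) *\<^sub>R e)\<bar>"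
    by (simp only: abs_triangle_ineq)
  then show ?thesis
    using Cauchy_Schwarz_ineq2[of "q - (e \<bullet> q) *\<^sub>R e" "y - (e \<bullet> y) *\<^sub>R e"]
    unfolding abs_mult by linarith
qed

lemma emeasure_translation_lebesgue:
  fixes S :: "'a::euclidean_space set"
  shows "emeasure lebesgue ((+) a ` S) = emeasure lebesgue S"
proof -
  have "(+) a ` S = (\<lambda>x. 1 *\<^sub>R x + a) ` S" by (simp add: add.commute)
  then show ?thesis using emeasure_lebesgue_affine[of 1 a S] by (simp only:) simp
qed

text \<open>Both touching lemmas compare the volume of a small ellipsoid with that of its polar.\<close>

lemma touching_from_below:
  obtains C :: real where "0 < C"
    "\<And>\<Omega> u f (x1::'a::euclidean_space) p e A B lo hi r.
      \<lbrakk>convex_on \<Omega> u; alexandrov_solution \<Omega> u f; continuous_on (ball x1 r) u; norm e = 1;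
       0 \<le> A; 0 < B; 0 < r; ball x1 r \<subseteq> \<Omega>; 0 < lo;
       \<And>x. x \<in> ball x1 r \<Longrightarrow> lo \<le> f x \<and> f x \<le> hi;
       \<And>y. norm y < r \<Longrightarrow> u x1 + p \<bullet> y + A * (e \<bullet> y)\<^sup>2 + B * (norm y)\<^sup>2 \<le> u (x1 + y)\<rbrakk>
      \<Longrightarrow> (A + B) * B ^ (DIM('a) - 1) \<le> C * hi"
proof -
  let ?n = "DIM('a)"
  obtain k1 k2 :: real where k: "0 < k1" "0 < k2"
    "\<And>(e::'a) a b. norm e = 1 \<Longrightarrow> 0 < a \<Longrightarrow> 0 < b \<Longrightarrow>
       k1 * (a * b ^ (?n - 1)) \<le> measure lebesgue (cyl e a b) \<and>
       measure lebesgue (cyl e a b) \<le> k2 * (a * b ^ (?n - 1))"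
    using cyl_volume by metis
  show ?thesis
  proof
    show "0 < 3 ^ ?n * k2 / k1" using k by simp
    fix \<Omega> u f and x1 p e :: 'a and A B lo hi r :: real
    assume cvx: "convex_on \<Omega> u" and MA: "alexandrov_solution \<Omega> u f"
      and cont: "continuous_on (ball x1 r) u" and e: "norm e = 1"
      and A: "0 \<le> A" and B: "0 < B" and r: "0 < r" and sub: "ball x1 r \<subseteq> \<Omega>" and lo: "0 < lo"
      and f: "\<And>x. x \<in> ball x1 r \<Longrightarrow> lo \<le> f x \<and> f x \<le> hi"
      and touch: "\<And>y. norm y < r \<Longrightarrow> u x1 + p \<bullet> y + A * (e \<bullet> y)\<^sup>2 + B * (norm y)\<^sup>2 \<le> u (x1 + y)"
    define Q where "Q y = A * (e \<bullet> y)\<^sup>2 + B * (norm y)\<^sup>2" for y :: 'a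
    \<comment> \<open>At this level the ellipsoid \<open>Q < \<delta>\<close> lies in the ball of
      radius \<open>b = r / 2\<close>, inside the region of the touching inequality;
      \<open>a\<close> is its semi-axis in direction \<open>e\<close>.\<close>
    define \<delta> where "\<delta> = B * r\<^sup>2 / 4"
    have \<delta>: "0 < \<delta>" using B r by (simp add: \<delta>_def)
    define a b where "a = sqrt (\<delta> / (A + B))" and "b = sqrt (\<delta> / B)"
    have ab: "0 < a" "0 < b" using A B \<delta> by (auto simp: a_def b_def)
    have a2: "a\<^sup>2 * (A + B) = \<delta>" and b2: "b\<^sup>2 * B = \<delta>" using A B \<delta> by (auto simp: a_def b_def)
    have bval: "b = r / 2" using B r by (simp add: b_def \<delta>_def real_sqrt_divide)
    have Qc: "continuous_on UNIV Q" unfolding Q_def by (intro continuous_intros)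
    define E where "E = {x. Q (x - x1) < \<delta>}"
    have contQ: "continuous_on UNIV (\<lambda>x. Q (x - x1))" unfolding Q_def by (intro continuous_intros)
    have E_open: "open E" unfolding E_def
      using open_Collect_less[OF contQ continuous_on_const] by simp
    have "closed {x. Q (x - x1) \<le> \<delta>}"
      using closed_Collect_le[OF contQ continuous_on_const] by simp
    then have clE: "closure E \<subseteq> {x. Q (x - x1) \<le> \<delta>}"
      by (intro closure_minimal) (auto simp: E_def)
    have Qb: "\<bar>e \<bullet> y\<bar> \<le> a" "norm y \<le> b" if "Q y \<le> \<delta>" for y
    proof -
      have ey: "(e \<bullet> y)\<^sup>2 \<le> (norm y)\<^sup>2"
        using norm_perp_sq[OF e, of y] by (smt (verit) zero_le_power2)
      have "(e \<bullet> y)\<^sup>2 * (A + B) \<le> Q y" using mult_left_mono[OF ey, of B] B by (simp add: Q_def algebra_simps)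
      then have "(e \<bullet> y)\<^sup>2 * (A + B) \<le> a\<^sup>2 * (A + B)" using that a2 by simp
      then have "(e \<bullet> y)\<^sup>2 \<le> a\<^sup>2" using A B by simp
      then show "\<bar>e \<bullet> y\<bar> \<le> a" using ab by (simp add: abs_le_square_iff[symmetric])
      have "(norm y)\<^sup>2 * B \<le> b\<^sup>2 * B" using that b2 A by (simp add: Q_def algebra_simps)  (smt (verit) mult_nonneg_nonneg zero_le_power2)
      then have "(norm y)\<^sup>2 \<le> b\<^sup>2" using B by simp
      then show "norm y \<le> b" by (rule power2_le_imp_le) (use ab in simp)
    qed
    have clsub: "closure E \<subseteq> ball x1 r"
    proof
      fix x assume "x \<in> closure E"
      then have "norm (x - x1) \<le> b" using clE Qb(2) by auto
      then show "x \<in> ball x1 r" using bval r by (simp add: dist_norm norm_minus_commute)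
    qed
    have Esub: "E \<subseteq> ball x1 r" using clsub closure_subset by blast
    have x1E: "x1 \<in> E" using \<delta> by (simp add: E_def Q_def)
    have Ecyl: "E \<subseteq> (+) x1 ` cyl e a b"
    proof
      fix x assume "x \<in> E"
      then have "x - x1 \<in> cyl e a b"
        using Qb[of "x - x1"] norm_perp_le[OF e, of "x - x1"] by (auto simp: E_def cyl_def)
      then show "x \<in> (+) x1 ` cyl e a b" by (auto intro!: image_eqI)
    qed
    have Eemb: "emeasure lebesgue E \<le> ennreal (k2 * (a * b ^ (?n - 1)))"
    proof -
      have "emeasure lebesgue E \<le> emeasure lebesgue ((+) x1 ` cyl e a b)"
        by (rule emeasure_mono[OF Ecyl]) (use cyl_lmeasurable[OF e] in \<open>auto intro!: fmeasurableD measurable_translation\<close>)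
      also have "\<dots> = ennreal (measure lebesgue (cyl e a b))"
        by (simp add: emeasure_translation_lebesgue emeasure_eq_measure2 cyl_lmeasurable[OF e] fmeasurableD2)
      also have "\<dots> \<le> ennreal (k2 * (a * b ^ (?n - 1)))"
        using k(3)[OF e ab] by (simp add: ennreal_leI)
      finally show ?thesis .
    qed
    \<comment> \<open>For \<open>q\<close> in this cylinder \<open>q \<bullet> w\<close> is at most
      \<open>2 * \<delta> / 3\<close> on the ellipsoid, less than the rise \<open>\<delta>\<close>
      at its boundary; so each slope \<open>p + q\<close> is attained inside
      \<open>E\<close>.\<close>
    define D where "D = (+) p ` cyl e (\<delta> / a / 3) (\<delta> / b / 3)"
    have pos3: "0 < \<delta> / a / 3" "0 < \<delta> / b / 3" using \<delta> ab by auto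
    have "D \<subseteq> (\<Union>x\<in>E. subdifferential \<Omega> u x)"
    proof
      fix q0 assume "q0 \<in> D"
      then obtain q where q: "q0 = p + q" "q \<in> cyl e (\<delta> / a / 3) (\<delta> / b / 3)" by (auto simp: D_def)
      have bd: "u x1 - q0 \<bullet> x1 < u y - q0 \<bullet> y" if y: "y \<in> closure E - E" for y
      proof -
        define w where "w = y - x1"
        have Qw: "Q w = \<delta>" using y clE by (auto simp: E_def w_def)
        have w: "\<bar>e \<bullet> w\<bar> \<le> a" "norm w \<le> b" using Qb[of w] Qw by auto
        have "\<bar>e \<bullet> q\<bar> * \<bar>e \<bullet> w\<bar> \<le> (\<delta> / a / 3) * a"
          by (rule mult_mono) (use q w pos3 in \<open>auto simp: cyl_def\<close>)
        moreover have "norm (q - (e \<bullet> q) *\<^sub>R e) * norm (w - (e \<bullet> w) *\<^sub>R e) \<le> (\<delta> / b / 3) * b"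
          by (rule mult_mono) (use q w pos3 norm_perp_le[OF e, of w] in \<open>auto simp: cyl_def\<close>)
        ultimately have "\<bar>q \<bullet> w\<bar> \<le> \<delta> / 3 + \<delta> / 3"
          using abs_inner_axis_perp_le[OF e, of q w] ab by simp
        moreover have "norm w < r" using w bval r by simp
        then have "u x1 + p \<bullet> w + \<delta> \<le> u (x1 + w)" using touch[of w] Qw by (simp add: Q_def)
        moreover have "x1 + w = y" by (simp add: w_def)
        moreover have "q0 \<bullet> y = q0 \<bullet> x1 + p \<bullet> w + q \<bullet> w"
          by (simp add: q w_def inner_add_left inner_diff_right)
        ultimately show ?thesis using \<delta> by simp
      qed
      obtain x where "x \<in> E" "q0 \<in> subdifferential \<Omega> u x"
      proof (rule subgradient_at_interior_minimum[OF cvx E_open _ _ _ x1E bd])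
        show "bounded E" using Esub bounded_ball bounded_subset by blast
        show "closure E \<subseteq> \<Omega>" using clsub sub by blast
        show "continuous_on (closure E) u" using cont clsub continuous_on_subset by blast
      qed
      then show "q0 \<in> (\<Union>x\<in>E. subdifferential \<Omega> u x)" by blast
    qed
    have Eb: "E \<in> sets borel" using E_open by simp
    have ES: "E \<subseteq> \<Omega>" using Esub sub by blast
    have Epos: "0 < emeasure lebesgue E"
    proof -
      obtain s where s: "s > 0" "ball x1 s \<subseteq> E" using E_open x1E openE by blast
      have "0 < emeasure lebesgue (ball x1 s)"
        using content_ball_pos[OF s(1), of x1] by (simp add: emeasure_eq_measure2)
      also have "\<dots> \<le> emeasure lebesgue E" by (rule emeasure_mono[OF s(2)]) (use Eb in simp)
      finally show ?thesis .
    qed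
    have hi: "0 \<le> hi" using f[of x1] lo r by auto
    have "ennreal (k1 * (\<delta> / a / 3 * (\<delta> / b / 3) ^ (?n - 1))) \<le> ennreal (measure lebesgue (cyl e (\<delta> / a / 3) (\<delta> / b / 3)))"
      using k(3)[OF e pos3] by (simp add: ennreal_leI)
    also have "\<dots> = emeasure lebesgue D"
      by (simp add: D_def emeasure_translation_lebesgue emeasure_eq_measure2 cyl_lmeasurable[OF e] fmeasurableD2)
    also have "\<dots> \<le> emeasure lebesgue (\<Union>x\<in>E. subdifferential \<Omega> u x)"
      by (rule emeasure_mono[OF \<open>D \<subseteq> _\<close>])
         (rule MA_image_sets[OF MA Eb ES _ lo Epos], use f Esub in blast)
    also have "\<dots> \<le> ennreal hi * emeasure lebesgue E"
      by (rule MA_mass_bounds(2)[OF MA Eb ES]) (use f Esub in blast)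
    also have "\<dots> \<le> ennreal hi * ennreal (k2 * (a * b ^ (?n - 1)))"
      by (intro mult_left_mono Eemb) simp
    also have "\<dots> = ennreal (hi * (k2 * (a * b ^ (?n - 1))))"
      using hi k ab by (simp add: ennreal_mult)
    finally have main: "k1 * (\<delta> / a / 3 * (\<delta> / b / 3) ^ (?n - 1)) \<le> hi * (k2 * (a * b ^ (?n - 1)))"
      using hi k ab by (subst (asm) ennreal_le_iff) auto
    have n3: "(3::real) ^ ?n = 3 * 3 ^ (?n - 1)" using DIM_positive[where 'a='a] by (metis Suc_pred' power_Suc)
    \<comment> \<open>In these terms the quotient of the two volumes is the product of the
      curvatures, and the scale \<open>r\<close> cancels.\<close>
    have AB: "A + B = \<delta> / a / a" "B = \<delta> / b / b"
      using a2 b2 ab by (simp_all add: field_simps power2_eq_square)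
    have "(A + B) * B ^ (?n - 1) = (\<delta> / a / 3 * (\<delta> / b / 3) ^ (?n - 1)) * (3 ^ ?n / (a * b ^ (?n - 1)))"
      unfolding AB(1) unfolding AB(2) n3 using ab by (simp add: power_divide power_mult_distrib)
    also have "\<dots> \<le> (hi * (k2 * (a * b ^ (?n - 1))) / k1) * (3 ^ ?n / (a * b ^ (?n - 1)))"
      using main k ab by (intro mult_right_mono) (simp_all add: field_simps)
    also have "\<dots> = 3 ^ ?n * k2 / k1 * hi" using ab by simp
    finally show "(A + B) * B ^ (?n - 1) \<le> 3 ^ ?n * k2 / k1 * hi" .
  qed
qed

lemma touching_from_above:
  obtains C :: real where "0 < C"
    "\<And>\<Omega> u f (x1::'a::euclidean_space) p e A B lo r.
      \<lbrakk>convex_on \<Omega> u; alexandrov_solution \<Omega> u f; norm e = 1; 0 < A; 0 < B; 0 < r; ball x1 r \<subseteq> \<Omega>;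
       \<And>x. x \<in> ball x1 r \<Longrightarrow> lo \<le> f x;
       \<And>y. norm y < r \<Longrightarrow> u (x1 + y) \<le> u x1 + p \<bullet> y + A * (e \<bullet> y)\<^sup>2 + B * (norm (y - (e \<bullet> y) *\<^sub>R e))\<^sup>2\<rbrakk>
      \<Longrightarrow> lo \<le> C * (A * B ^ (DIM('a) - 1))"
proof -
  let ?n = "DIM('a)"
  obtain k1 k2 :: real where k: "0 < k1" "0 < k2"
    "\<And>(e::'a) a b. norm e = 1 \<Longrightarrow> 0 < a \<Longrightarrow> 0 < b \<Longrightarrow>
       k1 * (a * b ^ (?n - 1)) \<le> measure lebesgue (cyl e a b) \<and>
       measure lebesgue (cyl e a b) \<le> k2 * (a * b ^ (?n - 1))"
    using cyl_volume by metis
  show ?thesis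
  proof
    show "0 < 16 ^ ?n * k2 / k1" using k by simp
    fix \<Omega> u f and x1 p e :: 'a and A B lo r :: real
    assume cvx: "convex_on \<Omega> u" and MA: "alexandrov_solution \<Omega> u f" and e: "norm e = 1"
      and A: "0 < A" and B: "0 < B" and r: "0 < r" and sub: "ball x1 r \<subseteq> \<Omega>"
      and f: "\<And>x. x \<in> ball x1 r \<Longrightarrow> lo \<le> f x"
      and touch: "\<And>y. norm y < r \<Longrightarrow>
         u (x1 + y) \<le> u x1 + p \<bullet> y + A * (e \<bullet> y)\<^sup>2 + B * (norm (y - (e \<bullet> y) *\<^sub>R e))\<^sup>2"
    have ee: "e \<bullet> e = 1" using e by (simp add: norm_eq_1)
    \<comment> \<open>The scale \<open>h\<close> is chosen so that \<open>a + b = r / 2\<close>,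
      which keeps the cylinder in the ball, while both quadratic terms are at most
      \<open>\<delta> = h\<^sup>2\<close> on it.\<close>
    define s where "s = 1 / sqrt A + 1 / sqrt B"
    have s: "0 < s" using A B by (simp add: s_def add_pos_pos)
    define h where "h = r / (2 * s)"
    have h: "0 < h" using r s by (simp add: h_def)
    define \<delta> where "\<delta> = h\<^sup>2"
    have \<delta>: "0 < \<delta>" using h by (simp add: \<delta>_def)
    define a b where "a = h / sqrt A" and "b = h / sqrt B"
    have ab: "0 < a" "0 < b" using A B h by (auto simp: a_def b_def)
    have a2: "a\<^sup>2 * A = \<delta>" and b2: "b\<^sup>2 * B = \<delta>" using A B by (auto simp: a_def b_def \<delta>_def power_divide)
    have "a + b = h * s" by (simp add: a_def b_def s_def distrib_left)
    then have abr: "a + b = r / 2" using s by (simp add: h_def)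
    have nb: "norm y < r" if "y \<in> cyl e a b" for y
      using that norm_le_axis_perp[OF e, of y] abr r by (auto simp: cyl_def)
    define w where "w y = u (x1 + y) - u x1 - p \<bullet> y" for y
    have wup: "w y \<le> 2 * \<delta>" if y: "y \<in> cyl e a b" for y
    proof -
      have "A * (e \<bullet> y)\<^sup>2 \<le> A * a\<^sup>2"
        using y A ab by (intro mult_left_mono) (auto simp: cyl_def abs_le_square_iff[symmetric])
      moreover have "B * (norm (y - (e \<bullet> y) *\<^sub>R e))\<^sup>2 \<le> B * b\<^sup>2"
        using y B ab by (intro mult_left_mono power_mono) (auto simp: cyl_def)
      ultimately show ?thesis using touch[OF nb[OF y]] a2 b2 by (simp add: w_def algebra_simps)
    qed
    have cyl_neg: "- y \<in> cyl e a' b'" if "y \<in> cyl e a' b'" for y a' b'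
    proof -
      have "- y - (e \<bullet> - y) *\<^sub>R e = - (y - (e \<bullet> y) *\<^sub>R e)" by simp
      then show ?thesis using that unfolding cyl_def by (simp only: mem_Collect_eq norm_minus_cancel) simp
    qed
    have cyl_add: "y + z \<in> cyl e (a' + a'') (b' + b'')" if "y \<in> cyl e a' b'" "z \<in> cyl e a'' b''" for y z a' b' a'' b''
    proof -
      have "y + z - (e \<bullet> (y + z)) *\<^sub>R e = (y - (e \<bullet> y) *\<^sub>R e) + (z - (e \<bullet> z) *\<^sub>R e)" by (simp add: algebra_simps)
      then have "norm (y + z - (e \<bullet> (y + z)) *\<^sub>R e) \<le> norm (y - (e \<bullet> y) *\<^sub>R e) + norm (z - (e \<bullet> z) *\<^sub>R e)"
        by (simp only: norm_triangle_ineq)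
      moreover have "\<bar>e \<bullet> (y + z)\<bar> \<le> \<bar>e \<bullet> y\<bar> + \<bar>e \<bullet> z\<bar>" by (simp add: inner_add_right)
      ultimately show ?thesis using that unfolding cyl_def mem_Collect_eq by linarith
    qed
    have inO: "x1 + y \<in> \<Omega>" if "y \<in> cyl e a b" for y
      using nb[OF that] sub by (auto simp: dist_norm subset_iff)
    \<comment> \<open>The lower bound comes from convexity at the midpoint \<open>x1\<close> of
      \<open>x1 + y\<close> and \<open>x1 - y\<close>, where \<open>w\<close> vanishes.\<close>
    have wlo: "- 2 * \<delta> \<le> w y" if y: "y \<in> cyl e a b" for y
    proof -
      have "u ((1 - 1/2) *\<^sub>R (x1 + y) + (1/2) *\<^sub>R (x1 + - y)) \<le> (1 - 1/2) * u (x1 + y) + 1/2 * u (x1 + - y)"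
        by (rule convex_onD[OF cvx]) (use inO[OF y] inO[OF cyl_neg[OF y]] in auto)
      moreover have "(1 - 1/2) *\<^sub>R (x1 + y) + (1/2) *\<^sub>R (x1 + - y) = x1" by (simp add: algebra_simps flip: scaleR_add_left)
      ultimately have "0 \<le> w y + w (- y)" by (simp add: w_def field_simps)
      then show ?thesis using wup[OF cyl_neg[OF y]] by simp
    qed
    define E where "E = (+) x1 ` cyl e (a/2) (b/2)"
    have Ecyl: "cyl e (a/2) (b/2) \<subseteq> cyl e a b" using ab by (auto simp: cyl_def)
    have ES: "E \<subseteq> \<Omega>" using inO Ecyl by (auto simp: E_def)
    have Er: "E \<subseteq> ball x1 r" using nb Ecyl by (auto simp: E_def dist_norm)
    have Eb: "E \<in> sets borel"
    proof -
      have "E = (\<lambda>x. x - x1) -` cyl e (a/2) (b/2)"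
        unfolding E_def by (auto simp: image_iff) (metis add_diff_cancel_left' diff_add_cancel add.commute)
      moreover have "closed (cyl e (a/2) (b/2))"
        unfolding cyl_def by (intro closed_Collect_conj closed_Collect_le continuous_intros)
      ultimately have "closed E" by (simp only:) (intro closed_vimage continuous_intros)
      then show ?thesis by simp
    qed
    have Eem: "emeasure lebesgue E = ennreal (measure lebesgue (cyl e (a/2) (b/2)))"
      by (simp add: E_def emeasure_translation_lebesgue emeasure_eq_measure2 cyl_lmeasurable[OF e] fmeasurableD2)
    define D where "D = (+) p ` cyl e (8 * \<delta> / a) (8 * \<delta> / b)"
    have subD: "(\<Union>x\<in>E. subdifferential \<Omega> u x) \<subseteq> D"
    proof clarify
      fix x q0 assume x: "x \<in> E" and q0: "q0 \<in> subdifferential \<Omega> u x"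
      obtain y where y: "x = x1 + y" "y \<in> cyl e (a/2) (b/2)" using x by (auto simp: E_def)
      define q where "q = q0 - p"
      \<comment> \<open>The subgradient inequality is tested at \<open>y + \<xi>\<close>. Both
        summands lie in the half-size cylinder, so the sum lies in the full one, where
        \<open>w\<close> oscillates by at most \<open>4 * \<delta>\<close>.\<close>
      have key: "q \<bullet> \<xi> \<le> 4 * \<delta>" if "\<xi> \<in> cyl e (a/2) (b/2)" for \<xi>
      proof -
        have yx: "y + \<xi> \<in> cyl e a b" using cyl_add[OF y(2) that] by simp
        have "u x + q0 \<bullet> (x1 + (y + \<xi>) - x) \<le> u (x1 + (y + \<xi>))"
          using q0 inO[OF yx] by (auto simp: subdifferential_def)
        then have "q0 \<bullet> \<xi> \<le> w (y + \<xi>) - w y + p \<bullet> \<xi>" by (simp add: w_def y inner_add_right add.assoc)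
        then show ?thesis using wup[OF yx] wlo[of y] y(2) Ecyl by (auto simp: q_def inner_diff_left)
      qed
      have "\<bar>e \<bullet> q\<bar> \<le> 8 * \<delta> / a"
      proof -
        have 1: "(a/2) *\<^sub>R e \<in> cyl e (a/2) (b/2)" using ab by (auto simp: cyl_def ee)
        have "\<bar>a / 2 * (e \<bullet> q)\<bar> \<le> 4 * \<delta>"
          using key[OF 1] key[OF cyl_neg[OF 1]] by (simp add: inner_commute)
        then show ?thesis using ab by (simp add: abs_mult field_simps)
      qed
      moreover have "norm (q - (e \<bullet> q) *\<^sub>R e) \<le> 8 * \<delta> / b"
      proof (cases "q - (e \<bullet> q) *\<^sub>R e = 0")
        case True then show ?thesis using \<delta> ab by simp
      next
        case False
        define t where "t = q - (e \<bullet> q) *\<^sub>R e"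
        have et: "e \<bullet> t = 0" by (simp add: t_def inner_diff_right ee)
        have nt: "norm t > 0" using False by (simp add: t_def)
        define \<xi> where "\<xi> = (b / 2 / norm t) *\<^sub>R t"
        have "norm \<xi> = b / 2" using nt ab by (simp add: \<xi>_def)
        then have "\<xi> \<in> cyl e (a/2) (b/2)" using ab by (auto simp: cyl_def \<xi>_def et)
        from key[OF this] have "b / 2 / norm t * (q \<bullet> t) \<le> 4 * \<delta>" by (simp add: \<xi>_def)
        moreover have "q \<bullet> t = (norm t)\<^sup>2"
        proof -
          have "q = t + (e \<bullet> q) *\<^sub>R e" by (simp add: t_def)
          then have "q \<bullet> t = t \<bullet> t + (e \<bullet> q) * (e \<bullet> t)" by (metis inner_add_left inner_scaleR_left)
          then show ?thesis by (simp add: et power2_norm_eq_inner)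
        qed
        ultimately show ?thesis using nt ab by (simp add: t_def[symmetric] power2_eq_square field_simps)
      qed
      ultimately have "q \<in> cyl e (8 * \<delta> / a) (8 * \<delta> / b)" by (simp add: cyl_def)
      then show "q0 \<in> D" by (auto simp: D_def q_def intro!: image_eqI[of _ _ "q0 - p"])
    qed
    have Dsets: "D \<in> sets lebesgue"
      using cyl_lmeasurable[OF e] by (auto simp: D_def intro!: fmeasurableD measurable_translation)
    have hab: "0 < a/2" "0 < b/2" "0 < 8 * \<delta> / a" "0 < 8 * \<delta> / b" using ab \<delta> by auto
    show "lo \<le> 16 ^ ?n * k2 / k1 * (A * B ^ (?n - 1))"
    \<comment> \<open>Nonpositive \<open>lo\<close> is treated apart because \<open>ennreal\<close>
      truncates it to 0.\<close>
    proof (cases "lo \<le> 0")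
      case True
      have "0 \<le> 16 ^ ?n * k2 / k1 * (A * B ^ (?n - 1))" using k A B by simp
      then show ?thesis using True by linarith
    next
      case False
      have "ennreal (lo * (k1 * (a/2 * (b/2) ^ (?n - 1)))) \<le> ennreal lo * emeasure lebesgue E"
        unfolding Eem using False k ab k(3)[OF e hab(1,2)]
        by (simp add: ennreal_mult[symmetric] ennreal_leI mult_left_mono)
      also have "\<dots> \<le> emeasure lebesgue (\<Union>x\<in>E. subdifferential \<Omega> u x)"
        by (rule MA_mass_bounds(1)[OF MA Eb ES]) (use f Er in blast)
      also have "\<dots> \<le> emeasure lebesgue D" by (rule emeasure_mono[OF subD Dsets])
      also have "\<dots> = ennreal (measure lebesgue (cyl e (8 * \<delta> / a) (8 * \<delta> / b)))"
        by (simp add: D_def emeasure_translation_lebesgue emeasure_eq_measure2 cyl_lmeasurable[OF e] fmeasurableD2)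
      also have "\<dots> \<le> ennreal (k2 * (8 * \<delta> / a * (8 * \<delta> / b) ^ (?n - 1)))"
        using k(3)[OF e hab(3,4)] by (simp add: ennreal_leI)
      finally have "ennreal (lo * (k1 * (a/2 * (b/2) ^ (?n - 1)))) \<le> ennreal (k2 * (8 * \<delta> / a * (8 * \<delta> / b) ^ (?n - 1)))" .
      moreover have "0 \<le> k2 * (8 * \<delta> / a * (8 * \<delta> / b) ^ (?n - 1))"
        using k hab by (intro mult_nonneg_nonneg zero_le_power less_imp_le)
      ultimately have main: "lo * (k1 * (a/2 * (b/2) ^ (?n - 1))) \<le> k2 * (8 * \<delta> / a * (8 * \<delta> / b) ^ (?n - 1))"
        by (simp only: ennreal_le_iff)
      have n16: "(16::real) ^ ?n = 16 * 16 ^ (?n - 1)" using DIM_positive[where 'a='a] by (metis Suc_pred' power_Suc)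
      have AB: "A = \<delta> / a / a" "B = \<delta> / b / b"
        using a2 b2 ab by (simp_all add: field_simps power2_eq_square)
      have hp: "0 < k1 * (a/2 * (b/2) ^ (?n - 1))" using k hab by simp
      have "lo \<le> k2 * (8 * \<delta> / a * (8 * \<delta> / b) ^ (?n - 1)) / (k1 * (a/2 * (b/2) ^ (?n - 1)))"
        using main by (simp only: pos_le_divide_eq[OF hp])
      also have "\<dots> = k2 / k1 * ((8 * \<delta> / a) / (a/2) * ((8 * \<delta> / b) / (b/2)) ^ (?n - 1))"
      proof -
        have "k2 * (X * Y ^ (?n - 1)) / (k1 * (P * R ^ (?n - 1))) = k2 / k1 * (X / P * (Y / R) ^ (?n - 1))" for X Y P R :: real
          by (simp add: power_divide)
        then show ?thesis .
      qed
      also have "(8 * \<delta> / a) / (a/2) = 16 * A" using AB by simp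
      also have "(8 * \<delta> / b) / (b/2) = 16 * B" using AB by simp
      also have "k2 / k1 * (16 * A * (16 * B) ^ (?n - 1)) = 16 ^ ?n * k2 / k1 * (A * B ^ (?n - 1))"
        unfolding n16 by (simp add: power_mult_distrib)
      finally show ?thesis .
    qed
  qed
qed

section \<open>Curvature bounds and tangent balls\<close>

text \<open>Local supporting lines at every point make a continuous function convex, so the sign
  near 0 persists. If \<open>g 1 < 0\<close>, subtracting the chord \<open>s * g 1\<close> leaves a
  positive interior maximum; at the last maximum point the supporting line cannot fall to the right,
  so the maximum is attained further right as well.\<close>

lemma locally_supported_nonneg:
  fixes g :: "real \<Rightarrow> real"
  assumes cont: "continuous_on {0..1} g" and g0: "g 0 = 0"
    and supp: "\<And>s. s \<in> {0..1} \<Longrightarrow> \<exists>b. \<exists>\<delta>>0. \<forall>t\<in>{0..1}. \<bar>t - s\<bar> < \<delta> \<longrightarrow> g s + b * (t - s) \<le> g t"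
    and near0: "\<exists>\<delta>>0. \<forall>t\<in>{0..1}. t < \<delta> \<longrightarrow> 0 \<le> g t"
  shows "0 \<le> g 1"
proof (rule ccontr)
  assume "\<not> 0 \<le> g 1"
  then have g1: "g 1 < 0" by simp
  define m where "m s = g s - s * g 1" for s
  have mc: "continuous_on {0..1} m" unfolding m_def by (intro continuous_intros cont)
  obtain s0 where s0: "s0 \<in> {0..1}" "\<And>t. t \<in> {0..1} \<Longrightarrow> m t \<le> m s0"
    using continuous_attains_sup[of "{0..1::real}" m] mc by auto
  obtain \<delta> where \<delta>: "\<delta> > 0" "\<And>t. t \<in> {0..1} \<Longrightarrow> t < \<delta> \<Longrightarrow> 0 \<le> g t" using near0 by blast
  define t0 where "t0 = min (\<delta> / 2) (1 / 2)"
  have "0 < t0" "t0 \<in> {0..1}" "t0 < \<delta>" using \<delta>(1) by (auto simp: t0_def)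
  then have "0 < m t0" using \<delta>(2)[of t0] mult_pos_neg[of t0 "g 1"] g1 by (simp add: m_def)
  then have pos: "0 < m s0" using s0(2)[OF \<open>t0 \<in> {0..1}\<close>] by simp
  \<comment> \<open>The set of maximum points is compact, so there is a last one.\<close>
  define A where "A = {s \<in> {0..1}. m s = m s0}"
  have "closed A" unfolding A_def using continuous_closed_preimage_constant[OF mc] by simp
  moreover have "bounded A" unfolding A_def by (rule bounded_subset[of "{0..1}"]) auto
  ultimately have "compact A" by (simp add: compact_eq_bounded_closed)
  moreover have "A \<noteq> {}" using s0 by (auto simp: A_def)
  ultimately obtain s where s: "s \<in> A" "\<And>t. t \<in> A \<Longrightarrow> t \<le> s"
    using compact_attains_sup[of A] by auto
  have ms: "m s = m s0" and s01: "0 \<le> s" "s \<le> 1" using s by (auto simp: A_def)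
  have "s \<noteq> 0" using pos ms g0 by (auto simp: m_def)
  moreover have "s \<noteq> 1" using pos ms by (auto simp: m_def)
  ultimately have s_int: "0 < s" "s < 1" using s01 by auto
  obtain b \<eta> where \<eta>: "\<eta> > 0" "\<And>t. t \<in> {0..1} \<Longrightarrow> \<bar>t - s\<bar> < \<eta> \<Longrightarrow> g s + b * (t - s) \<le> g t"
    using supp[of s] s01 by (metis atLeastAtMost_iff)
  define e where "e = min (\<eta> / 2) (min (s / 2) ((1 - s) / 2))"
  have "0 < e" using \<eta>(1) s_int by (simp add: e_def)
  moreover have "e \<le> \<eta> / 2" "e \<le> s / 2" "e \<le> (1 - s) / 2" unfolding e_def by linarith+
  ultimately have e: "0 < e" "e < \<eta>" "s - e \<in> {0..1}" "s + e \<in> {0..1}"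
    using \<eta>(1) s_int by auto
  have 1: "m s + (b - g 1) * e \<le> m (s + e)"
    using \<eta>(2)[of "s + e"] e by (simp add: m_def algebra_simps)
  have 2: "m s - (b - g 1) * e \<le> m (s - e)"
    using \<eta>(2)[of "s - e"] e by (simp add: m_def algebra_simps)
  have "0 \<le> (b - g 1) * e" using 2 s0(2)[OF e(3)] ms by simp
  then have "m (s + e) = m s0" using 1 s0(2)[OF e(4)] ms by simp
  then have "s + e \<in> A" using e by (simp add: A_def)
  then show False using s(2)[of "s + e"] e by simp
qed

text \<open>Adding \<open>C * t\<^sup>2\<close> turns the local lower parabolas into local
  supporting lines. The radii \<open>\<delta>\<close> may depend on the point without a uniform
  bound.\<close>

lemma locally_semiconvex_lower_bound:
  fixes F :: "real \<Rightarrow> real"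
  assumes cont: "continuous_on {0..1} F"
    and supp: "\<And>s. s \<in> {0..1} \<Longrightarrow> \<exists>\<delta>>0. \<forall>t\<in>{0..1}. \<bar>t - s\<bar> < \<delta> \<longrightarrow> F s + b s * (t - s) - C * (t - s)\<^sup>2 \<le> F t"
  shows "F 0 + b 0 - C \<le> F 1"
proof -
  define g where "g t = F t - F 0 - b 0 * t + C * t\<^sup>2" for t
  have "0 \<le> g 1"
  proof (rule locally_supported_nonneg)
    show "continuous_on {0..1} g" unfolding g_def by (intro continuous_intros cont)
    show "g 0 = 0" by (simp add: g_def)
    show "\<exists>\<delta>>0. \<forall>t\<in>{0..1}. t < \<delta> \<longrightarrow> 0 \<le> g t"
      using supp[of 0] by (fastforce simp: g_def)
    fix s :: real assume "s \<in> {0..1}"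
    then obtain \<delta> where \<delta>: "\<delta> > 0" "\<And>t. t \<in> {0..1} \<Longrightarrow> \<bar>t - s\<bar> < \<delta> \<Longrightarrow> F s + b s * (t - s) - C * (t - s)\<^sup>2 \<le> F t"
      using supp[of s] by blast
    have "g s + (b s - b 0 + 2 * C * s) * (t - s) \<le> g t" if "t \<in> {0..1}" "\<bar>t - s\<bar> < \<delta>" for t
      using \<delta>(2)[OF that] by (simp add: g_def algebra_simps power2_eq_square)
    then show "\<exists>b. \<exists>\<delta>>0. \<forall>t\<in>{0..1}. \<bar>t - s\<bar> < \<delta> \<longrightarrow> g s + b * (t - s) \<le> g t"
      using \<delta>(1) by blast
  qed
  then show ?thesis by (simp add: g_def)
qed

text \<open>Homogeneity transports the local support at a unit vector to its whole ray, so along a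
  segment from \<open>\<nu>\<close> to \<open>y\<close> that avoids 0 the one-dimensional statement
  applies. If the segment meets 0, \<open>y\<close> is moved slightly in a direction orthogonal to
  \<open>\<nu>\<close>, which is where dimension at least 2 enters, and continuity gives the
  limit.\<close>

lemma homogeneous_locally_supported:
  fixes f :: "'a::euclidean_space \<Rightarrow> real"
  assumes dim: "2 \<le> DIM('a)" and cont: "continuous_on UNIV f"
    and hom: "\<And>c x. 0 < c \<Longrightarrow> f (c *\<^sub>R x) = c * f x"
    and loc: "\<And>\<nu>. norm \<nu> = 1 \<Longrightarrow> \<exists>a. \<exists>\<delta>>0. f \<nu> = a \<bullet> \<nu> \<and> (\<forall>y. norm (y - \<nu>) < \<delta> \<longrightarrow> a \<bullet> y \<le> f y)"
    and nu: "norm \<nu> = 1" "f \<nu> = a \<bullet> \<nu>" "0 < \<delta>" "\<And>y. norm (y - \<nu>) < \<delta> \<Longrightarrow> a \<bullet> y \<le> f y"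
  shows "a \<bullet> y \<le> f y"
proof -
  have avoid: "a \<bullet> y \<le> f y" if nz: "\<And>s. s \<in> {0..1} \<Longrightarrow> \<nu> + s *\<^sub>R (y - \<nu>) \<noteq> 0" for y
  proof -
    define x where "x s = \<nu> + s *\<^sub>R (y - \<nu>)" for s
    define g where "g s = f (x s) - a \<bullet> x s" for s
    have xc: "continuous_on {0..1} x" unfolding x_def by (intro continuous_intros)
    have "0 \<le> g 1"
    proof (rule locally_supported_nonneg)
      show "continuous_on {0..1} g" unfolding g_def
        by (intro continuous_intros xc continuous_on_compose2[OF cont xc]) auto
      show "g 0 = 0" using nu by (simp add: g_def x_def)
      show "\<exists>\<delta>>0. \<forall>t\<in>{0..1}. t < \<delta> \<longrightarrow> 0 \<le> g t"
      proof (intro exI[of _ "\<delta> / (norm (y - \<nu>) + 1)"] conjI ballI impI)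
        have np: "norm (y - \<nu>) + 1 > 0" by (smt (verit) norm_ge_zero)
        then show "0 < \<delta> / (norm (y - \<nu>) + 1)" using nu by simp
        fix t :: real assume t: "t \<in> {0..1}" "t < \<delta> / (norm (y - \<nu>) + 1)"
        have "norm (x t - \<nu>) = t * norm (y - \<nu>)" using t by (simp add: x_def)
        also have "\<dots> \<le> t * (norm (y - \<nu>) + 1)" using t by (simp add: mult_left_mono)
        also have "\<dots> < \<delta>" using t np by (simp add: pos_less_divide_eq)
        finally show "0 \<le> g t" using nu(4)[of "x t"] by (simp add: g_def)
      qed
      fix s :: real assume s: "s \<in> {0..1}"
      define r where "r = norm (x s)"
      have r: "0 < r" using nz[OF s] by (simp add: r_def x_def)
      have "norm ((1 / r) *\<^sub>R x s) = 1" using r by (simp add: r_def)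
      then obtain a' \<eta> where a': "\<eta> > 0" "f ((1 / r) *\<^sub>R x s) = a' \<bullet> ((1 / r) *\<^sub>R x s)"
          "\<And>y. norm (y - (1 / r) *\<^sub>R x s) < \<eta> \<Longrightarrow> a' \<bullet> y \<le> f y"
        using loc by meson
      have fx: "f (x s) = a' \<bullet> x s"
        using a'(2) hom[of "1 / r" "x s"] r by simp
      have np: "norm (y - \<nu>) + 1 > 0" by (smt (verit) norm_ge_zero)
      show "\<exists>b. \<exists>\<delta>>0. \<forall>t\<in>{0..1}. \<bar>t - s\<bar> < \<delta> \<longrightarrow> g s + b * (t - s) \<le> g t"
      proof (rule exI[of _ "(a' - a) \<bullet> (y - \<nu>)"], rule exI[of _ "\<eta> * r / (norm (y - \<nu>) + 1)"], intro conjI ballI impI)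
        show "0 < \<eta> * r / (norm (y - \<nu>) + 1)" using a' r np by simp
        fix t :: real assume t: "t \<in> {0..1}" "\<bar>t - s\<bar> < \<eta> * r / (norm (y - \<nu>) + 1)"
        have xts: "x t = x s + (t - s) *\<^sub>R (y - \<nu>)" by (simp add: x_def algebra_simps)
        have "norm ((1 / r) *\<^sub>R x t - (1 / r) *\<^sub>R x s) = (1 / r) * (\<bar>t - s\<bar> * norm (y - \<nu>))"
          using r by (simp add: xts scaleR_diff_right[symmetric])
        also have "\<dots> \<le> (1 / r) * (\<bar>t - s\<bar> * (norm (y - \<nu>) + 1))"
          using r by (intro mult_left_mono) auto
        also have "\<dots> < (1 / r) * (\<eta> * r)"
          using t np r by (intro mult_strict_left_mono) (simp_all add: pos_less_divide_eq)
        also have "\<dots> = \<eta>" using r by simp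
        finally have "a' \<bullet> ((1 / r) *\<^sub>R x t) \<le> f ((1 / r) *\<^sub>R x t)" by (rule a'(3))
        then have "a' \<bullet> x t \<le> f (x t)" using hom[of "1 / r" "x t"] r by (simp add: divide_right_mono field_simps)
        then show "g s + (a' - a) \<bullet> (y - \<nu>) * (t - s) \<le> g t"
          by (simp add: g_def fx xts inner_add_right inner_diff_left algebra_simps)
      qed
    qed
    then show ?thesis by (simp add: g_def x_def)
  qed
  show ?thesis
  proof (cases "\<forall>s\<in>{0..1}. \<nu> + s *\<^sub>R (y - \<nu>) \<noteq> 0")
    case True then show ?thesis using avoid by blast
  next
    case False
    then obtain s where s: "s \<in> {0..1}" "\<nu> + s *\<^sub>R (y - \<nu>) = 0" by blast
    have "s \<noteq> 0" using s nu by auto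
    \<comment> \<open>When the segment passes through 0, \<open>y\<close> is a multiple of
      \<open>\<nu>\<close> and hence orthogonal to \<open>w\<close> too; the component along
      \<open>w\<close> then keeps the perturbed segments away from 0.\<close>
    obtain w where w: "w \<noteq> 0" "orthogonal \<nu> w" using orthogonal_to_vector_exists[OF dim] by blast
    have nu0: "\<nu> \<bullet> \<nu> = 1" using nu by (simp add: norm_eq_1)
    have wy: "w \<bullet> y = 0"
    proof -
      have "w \<bullet> (\<nu> + s *\<^sub>R (y - \<nu>)) = 0" using s by simp
      then show ?thesis using w \<open>s \<noteq> 0\<close> by (simp add: inner_add_right inner_diff_right orthogonal_def inner_commute)
    qed
    have ev: "a \<bullet> (y + inverse (real (Suc k)) *\<^sub>R w) \<le> f (y + inverse (real (Suc k)) *\<^sub>R w)" for k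
    proof (rule avoid)
      fix t :: real assume "t \<in> {0..1}"
      show "\<nu> + t *\<^sub>R (y + inverse (real (Suc k)) *\<^sub>R w - \<nu>) \<noteq> 0"
      proof
        assume eq: "\<nu> + t *\<^sub>R (y + inverse (real (Suc k)) *\<^sub>R w - \<nu>) = 0"
        then have "w \<bullet> (\<nu> + t *\<^sub>R (y + inverse (real (Suc k)) *\<^sub>R w - \<nu>)) = 0" by simp
        then have "t * (inverse (real (Suc k)) * (w \<bullet> w)) = 0"
          using w wy by (simp add: inner_add_right inner_diff_right orthogonal_def inner_commute)
        then have "t = 0" using w by simp
        then show False using eq nu by simp
      qed
    qed
    have lim: "(\<lambda>k. y + inverse (real (Suc k)) *\<^sub>R w) \<longlonglongrightarrow> y + 0 *\<^sub>R w"
      by (intro tendsto_intros LIMSEQ_inverse_real_of_nat)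
    have "(\<lambda>k. f (y + inverse (real (Suc k)) *\<^sub>R w)) \<longlonglongrightarrow> f (y + 0 *\<^sub>R w)"
      using cont lim by (intro continuous_on_tendsto_compose[OF cont lim]) auto
    moreover have "(\<lambda>k. a \<bullet> (y + inverse (real (Suc k)) *\<^sub>R w)) \<longlonglongrightarrow> a \<bullet> (y + 0 *\<^sub>R w)"
      by (intro tendsto_intros lim)
    ultimately show ?thesis using ev LIMSEQ_le[of _ _ _ "f (y + 0 *\<^sub>R w)"] by fastforce
  qed
qed

text \<open>For \<open>c > 0\<close> the inequality
  \<open>c * (norm (x - z))\<^sup>2 \<le> \<nu> \<bullet> (x - z)\<close> describes the closed ball
  of radius \<open>1 / (2 * c)\<close> tangent at \<open>z\<close> with inner normal
  \<open>\<nu>\<close>. Near \<open>z\<close> the domain thus lies between two tangent balls, on a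
  neighbourhood of uncontrolled size.\<close>

definition pinched :: "'a::euclidean_space set \<Rightarrow> real \<Rightarrow> real \<Rightarrow> 'a \<Rightarrow> 'a \<Rightarrow> bool" where
  "pinched \<Omega> c K z \<nu> \<longleftrightarrow> norm \<nu> = 1 \<and>
     (\<exists>\<delta>>0. \<forall>x. norm (x - z) < \<delta> \<longrightarrow>
        (x \<in> \<Omega> \<longrightarrow> c * (norm (x - z))\<^sup>2 \<le> \<nu> \<bullet> (x - z)) \<and>
        (K * (norm (x - z))\<^sup>2 < \<nu> \<bullet> (x - z) \<longrightarrow> x \<in> \<Omega>))"

lemma small_step:
  fixes \<delta> N :: real
  assumes "0 < \<delta>" "0 \<le> N"
  obtains t where "0 < t" "t \<le> 1" "t * N < \<delta>"
proof
  let ?t = "min 1 (\<delta> / (N + 1))"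
  show "0 < ?t" "?t \<le> 1" using assms by auto
  have "?t * N \<le> \<delta> / (N + 1) * N" using assms by (intro mult_right_mono) auto
  also have "\<dots> < \<delta>" using assms by (simp add: pos_divide_less_eq algebra_simps)
  finally show "?t * N < \<delta>" .
qed

lemma segment_in_convex_open:
  fixes \<Omega> :: "'a::euclidean_space set"
  assumes "open \<Omega>" "convex \<Omega>" "z \<in> closure \<Omega>" "x \<in> \<Omega>" "0 < t" "t \<le> 1"
  shows "z + t *\<^sub>R (x - z) \<in> \<Omega>"
proof -
  have "z - t *\<^sub>R (z - x) \<in> interior \<Omega>"
    by (rule mem_interior_closure_convex_shrink) (use assms in \<open>auto simp: interior_open\<close>)
  then show ?thesis using assms by (simp add: interior_open algebra_simps)
qed

text \<open>Points of \<open>\<Omega>\<close> are contracted towards \<open>z\<close> until the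
  local inequality applies; the sign of the height does not change under this contraction.\<close>

lemma pinched_halfspace:
  fixes \<Omega> :: "'a::euclidean_space set"
  assumes \<Omega>: "open \<Omega>" "convex \<Omega>" and z: "z \<in> closure \<Omega>" and c: "0 \<le> c" and pin: "pinched \<Omega> c K z \<nu>"
    and x: "x \<in> closure \<Omega>"
  shows "0 \<le> \<nu> \<bullet> (x - z)"
proof -
  obtain \<delta> where \<delta>: "\<delta> > 0" "\<And>x. norm (x - z) < \<delta> \<Longrightarrow> x \<in> \<Omega> \<Longrightarrow> c * (norm (x - z))\<^sup>2 \<le> \<nu> \<bullet> (x - z)"
    using pin by (auto simp: pinched_def)
  have "\<Omega> \<subseteq> {x. \<nu> \<bullet> z \<le> \<nu> \<bullet> x}"
  proof
    fix x assume x: "x \<in> \<Omega>"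
    obtain t where t: "0 < t" "t \<le> 1" and tn: "t * norm (x - z) < \<delta>"
      using small_step[OF \<delta>(1), of "norm (x - z)"] by auto
    have "norm (z + t *\<^sub>R (x - z) - z) < \<delta>" using t tn by simp
    from \<delta>(2)[OF this segment_in_convex_open[OF \<Omega> z x t]]
    have "0 \<le> \<nu> \<bullet> (z + t *\<^sub>R (x - z) - z)" using c by (smt (verit) mult_nonneg_nonneg zero_le_power2)
    then have "0 \<le> t * (\<nu> \<bullet> (x - z))" by simp
    then show "x \<in> {x. \<nu> \<bullet> z \<le> \<nu> \<bullet> x}" using t by (simp add: zero_le_mult_iff inner_diff_right)
  qed
  then have "closure \<Omega> \<subseteq> {x. \<nu> \<bullet> z \<le> \<nu> \<bullet> x}"
    by (rule closure_minimal) (simp add: closed_halfspace_ge)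
  then show ?thesis using x by (auto simp: inner_diff_right)
qed

text \<open>If the normals differed, a short step from \<open>z\<close> in direction
  \<open>\<nu> - \<mu>\<close> would enter the inner tangent ball and leave the half-space of
  \<open>\<mu>\<close>.\<close>

lemma pinched_normal_unique:
  fixes \<Omega> :: "'a::euclidean_space set"
  assumes pin: "pinched \<Omega> c K z \<nu>" and \<mu>: "norm \<mu> = 1" and sup: "\<And>x. x \<in> \<Omega> \<Longrightarrow> 0 \<le> \<mu> \<bullet> (x - z)"
  shows "\<mu> = \<nu>"
proof (rule ccontr)
  assume ne: "\<mu> \<noteq> \<nu>"
  obtain \<delta> where \<delta>: "\<delta> > 0" "\<And>x. norm (x - z) < \<delta> \<Longrightarrow> K * (norm (x - z))\<^sup>2 < \<nu> \<bullet> (x - z) \<Longrightarrow> x \<in> \<Omega>"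
    and \<nu>: "norm \<nu> = 1"
    using pin by (auto simp: pinched_def)
  define w where "w = \<nu> - \<mu>"
  have nn: "\<nu> \<bullet> \<nu> = 1" "\<mu> \<bullet> \<mu> = 1" using \<nu> \<mu> by (simp_all add: norm_eq_1)
  have ww: "w \<bullet> w = 2 * (1 - \<nu> \<bullet> \<mu>)" by (simp add: w_def inner_diff_left inner_diff_right nn inner_commute)
  have "0 < w \<bullet> w" using ne by (simp add: w_def)
  then have p: "0 < 1 - \<nu> \<bullet> \<mu>" using ww by simp
  have \<nu>w: "\<nu> \<bullet> w = 1 - \<nu> \<bullet> \<mu>" and \<mu>w: "\<mu> \<bullet> w = - (1 - \<nu> \<bullet> \<mu>)"
    by (simp_all add: w_def inner_diff_right nn inner_commute)
  have w0: "norm w > 0" using \<open>0 < w \<bullet> w\<close> by simp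
  define t where "t = min (\<delta> / 2 / norm w) ((1 - \<nu> \<bullet> \<mu>) / (2 * ((\<bar>K\<bar> + 1) * (norm w)\<^sup>2)))"
  have t: "0 < t" using \<delta> w0 p by (auto simp: t_def)
  have "t * norm w \<le> \<delta> / 2 / norm w * norm w" by (rule mult_right_mono) (auto simp: t_def)
  then have 1: "norm (z + t *\<^sub>R w - z) < \<delta>" using \<delta> w0 t by simp
  have "t * ((\<bar>K\<bar> + 1) * (norm w)\<^sup>2) \<le> (1 - \<nu> \<bullet> \<mu>) / (2 * ((\<bar>K\<bar> + 1) * (norm w)\<^sup>2)) * ((\<bar>K\<bar> + 1) * (norm w)\<^sup>2)"
    by (rule mult_right_mono) (auto simp: t_def)
  also have "\<dots> = (1 - \<nu> \<bullet> \<mu>) / 2"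
  proof -
    have "(\<bar>K\<bar> + 1) * (norm w)\<^sup>2 \<noteq> 0" using w0 by (simp add: add_nonneg_eq_0_iff)
    then show ?thesis by simp
  qed
  finally have "t * ((\<bar>K\<bar> + 1) * (norm w)\<^sup>2) < 1 - \<nu> \<bullet> \<mu>" using p by simp
  moreover have "t * (K * (norm w)\<^sup>2) \<le> t * ((\<bar>K\<bar> + 1) * (norm w)\<^sup>2)"
    using t by (intro mult_left_mono mult_right_mono) auto
  ultimately have "t * (K * (norm w)\<^sup>2) < 1 - \<nu> \<bullet> \<mu>" by linarith
  then have "t * (t * (K * (norm w)\<^sup>2)) < t * (1 - \<nu> \<bullet> \<mu>)"
    using t by (rule mult_strict_left_mono)
  moreover have "K * (norm (z + t *\<^sub>R w - z))\<^sup>2 = t * (t * (K * (norm w)\<^sup>2))"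
    by (simp add: power2_eq_square)
  moreover have "\<nu> \<bullet> (z + t *\<^sub>R w - z) = t * (1 - \<nu> \<bullet> \<mu>)" by (simp add: \<nu>w)
  ultimately have 2: "K * (norm (z + t *\<^sub>R w - z))\<^sup>2 < \<nu> \<bullet> (z + t *\<^sub>R w - z)" by linarith
  have "0 \<le> \<mu> \<bullet> (z + t *\<^sub>R w - z)" by (rule sup[OF \<delta>(2)[OF 1 2]])
  then have "0 \<le> t * - (1 - \<nu> \<bullet> \<mu>)" by (simp add: \<mu>w)
  then show False using t p by (simp add: zero_le_mult_iff)
qed

lemma norm_add_scaled_unit_sq:
  fixes w \<mu> :: "'a::real_inner"
  assumes "norm \<mu> = 1"
  shows "(norm (w + r *\<^sub>R \<mu>))\<^sup>2 = (norm w)\<^sup>2 + 2 * r * (\<mu> \<bullet> w) + r\<^sup>2"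
proof -
  have "\<mu> \<bullet> \<mu> = 1" using assms by (simp add: norm_eq_1)
  then show ?thesis
    unfolding power2_norm_eq_inner
    by (simp add: inner_add_left inner_add_right inner_commute power2_eq_square algebra_simps)
qed

section \<open>Support functions and rolling balls\<close>

definition support_fun :: "'a::euclidean_space set \<Rightarrow> 'a \<Rightarrow> real" where
  "support_fun \<Omega> y = (SUP x\<in>closure \<Omega>. y \<bullet> x)"

lemma support_fun_max:
  fixes \<Omega> :: "'a::euclidean_space set"
  assumes "bounded \<Omega>" "\<Omega> \<noteq> {}"
  obtains z where "z \<in> closure \<Omega>" "support_fun \<Omega> y = y \<bullet> z" "\<And>x. x \<in> closure \<Omega> \<Longrightarrow> y \<bullet> x \<le> y \<bullet> z"
proof -
  have "compact (closure \<Omega>)" using assms by (simp add: compact_closure)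
  moreover have "closure \<Omega> \<noteq> {}" using assms by simp
  moreover have "continuous_on (closure \<Omega>) (\<lambda>x. y \<bullet> x)" by (intro continuous_intros)
  ultimately obtain z where z: "z \<in> closure \<Omega>" "\<And>x. x \<in> closure \<Omega> \<Longrightarrow> y \<bullet> x \<le> y \<bullet> z"
    using continuous_attains_sup[of "closure \<Omega>" "\<lambda>x. y \<bullet> x"] by blast
  have "support_fun \<Omega> y = y \<bullet> z"
    unfolding support_fun_def by (rule cSup_eq_maximum) (use z in auto)
  then show ?thesis using that z by blast
qed

lemma support_fun_upper:
  fixes \<Omega> :: "'a::euclidean_space set"
  assumes "bounded \<Omega>" "x \<in> closure \<Omega>"
  shows "y \<bullet> x \<le> support_fun \<Omega> y"
proof -
  have "\<Omega> \<noteq> {}" using assms(2) by auto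
  then show ?thesis using support_fun_max[OF assms(1), of y] assms(2) by metis
qed

lemma support_fun_scale:
  fixes \<Omega> :: "'a::euclidean_space set"
  assumes b: "bounded \<Omega>" "\<Omega> \<noteq> {}" and c: "0 < c"
  shows "support_fun \<Omega> (c *\<^sub>R y) = c * support_fun \<Omega> y"
proof -
  obtain z where z: "z \<in> closure \<Omega>" "support_fun \<Omega> y = y \<bullet> z" "\<And>x. x \<in> closure \<Omega> \<Longrightarrow> y \<bullet> x \<le> y \<bullet> z"
    using support_fun_max[OF b] by blast
  obtain z' where z': "z' \<in> closure \<Omega>" "support_fun \<Omega> (c *\<^sub>R y) = (c *\<^sub>R y) \<bullet> z'"
    using support_fun_max[OF b] by blast
  have "(c *\<^sub>R y) \<bullet> z' \<le> c * (y \<bullet> z)" using z(3)[OF z'(1)] c by simp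
  moreover have "(c *\<^sub>R y) \<bullet> z \<le> support_fun \<Omega> (c *\<^sub>R y)" by (rule support_fun_upper[OF b(1) z(1)])
  ultimately show ?thesis using z(2) z'(2) by auto
qed

lemma support_fun_continuous:
  fixes \<Omega> :: "'a::euclidean_space set"
  assumes b: "bounded \<Omega>" "\<Omega> \<noteq> {}"
  shows "continuous_on UNIV (support_fun \<Omega>)"
proof -
  obtain B where B: "\<And>x. x \<in> closure \<Omega> \<Longrightarrow> norm x \<le> B" using bounded_closure[OF b(1)] by (auto simp: bounded_iff)
  have le: "support_fun \<Omega> x - support_fun \<Omega> y \<le> B * norm (x - y)" for x y
  proof -
    obtain z where z: "z \<in> closure \<Omega>" "support_fun \<Omega> x = x \<bullet> z" using support_fun_max[OF b] by blast
    have "y \<bullet> z \<le> support_fun \<Omega> y" by (rule support_fun_upper[OF b(1) z(1)])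
    then have "support_fun \<Omega> x - support_fun \<Omega> y \<le> (x - y) \<bullet> z" using z by (simp add: inner_diff_left)
    also have "\<dots> \<le> norm (x - y) * norm z" by (rule norm_cauchy_schwarz)
    also have "\<dots> \<le> norm (x - y) * B" by (rule mult_left_mono[OF B[OF z(1)]]) simp
    finally show ?thesis by (simp add: mult.commute)
  qed
  have "B-lipschitz_on UNIV (support_fun \<Omega>)"
  proof (rule lipschitz_onI)
    obtain x0 where "x0 \<in> \<Omega>" using b by blast
    then have "x0 \<in> closure \<Omega>" using closure_subset by blast
    then show "0 \<le> B" using B[of x0] norm_ge_zero[of x0] by linarith
    fix x y
    show "dist (support_fun \<Omega> x) (support_fun \<Omega> y) \<le> B * dist x y"
      using le[of x y] le[of y x] by (simp add: dist_norm norm_minus_commute abs_le_iff)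
  qed
  then show ?thesis by (rule lipschitz_on_continuous_on)
qed

text \<open>A boundary point with prescribed outer normal is found by maximising
  \<open>\<mu> \<bullet> x\<close>: the maximum supplies a supporting half-space, and uniqueness of
  the normal identifies the pinching direction with \<open>- \<mu>\<close>.\<close>

lemma pinched_maximizer:
  fixes \<Omega> :: "'a::euclidean_space set"
  assumes \<Omega>: "open \<Omega>" "bounded \<Omega>" "\<Omega> \<noteq> {}"
    and pin: "\<And>z. z \<in> frontier \<Omega> \<Longrightarrow> \<exists>\<nu>. pinched \<Omega> c K z \<nu>" and \<mu>: "norm \<mu> = 1"
  obtains z where "z \<in> frontier \<Omega>" "support_fun \<Omega> \<mu> = \<mu> \<bullet> z" "pinched \<Omega> c K z (- \<mu>)"
proof -
  obtain z where z: "z \<in> closure \<Omega>" "support_fun \<Omega> \<mu> = \<mu> \<bullet> z" "\<And>x. x \<in> closure \<Omega> \<Longrightarrow> \<mu> \<bullet> x \<le> \<mu> \<bullet> z"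
    using support_fun_max[OF \<Omega>(2,3)] by blast
  have "z \<notin> \<Omega>"
  proof
    assume "z \<in> \<Omega>"
    then obtain r where r: "r > 0" "ball z r \<subseteq> \<Omega>" using \<Omega>(1) openE by blast
    have "z + (r/2) *\<^sub>R \<mu> \<in> ball z r" using r \<mu> by (simp add: dist_norm)
    then have "\<mu> \<bullet> (z + (r/2) *\<^sub>R \<mu>) \<le> \<mu> \<bullet> z" using z(3) r closure_subset by blast
    then show False using r \<mu> by (simp add: inner_add_right norm_eq_1)
  qed
  then have fr: "z \<in> frontier \<Omega>" using z(1) \<Omega>(1) by (simp add: frontier_def interior_open)
  obtain \<nu> where \<nu>: "pinched \<Omega> c K z \<nu>" using pin[OF fr] by blast
  have "- \<mu> = \<nu>"
  proof (rule pinched_normal_unique[OF \<nu>])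
    fix x assume "x \<in> \<Omega>"
    then have "\<mu> \<bullet> x \<le> \<mu> \<bullet> z" using z(3) closure_subset by blast
    then show "0 \<le> - \<mu> \<bullet> (x - z)" by (simp add: inner_diff_right)
  qed (use \<mu> in simp)
  then show ?thesis using that fr z \<nu> by blast
qed

text \<open>
  A version of Blaschke's rolling theorem. The functions \<open>R |y| - h(y)\<close> and \<open>h(y) - \<rho> |y|\<close>, with \<open>h\<close> the
  support function, are positively homogeneous and, by the local pinching, locally supported from
  below by linear functions, so they are globally so.
\<close>

lemma pinched_outer_ball:
  fixes \<Omega> :: "'a::euclidean_space set"
  assumes dim: "2 \<le> DIM('a)" and \<Omega>: "open \<Omega>" "bounded \<Omega>" "convex \<Omega>" "\<Omega> \<noteq> {}" and c: "0 < c"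
    and pin: "\<And>z. z \<in> frontier \<Omega> \<Longrightarrow> \<exists>\<nu>. pinched \<Omega> c K z \<nu>"
    and z0: "z0 \<in> frontier \<Omega>" and \<nu>0: "pinched \<Omega> c K z0 \<nu>0"
  shows "closure \<Omega> \<subseteq> cball (z0 + (1 / (2 * c)) *\<^sub>R \<nu>0) (1 / (2 * c))"
proof -
  define R where "R = 1 / (2 * c)"
  have R: "0 < R" using c by (simp add: R_def)
  define f where "f y = R * norm y - support_fun \<Omega> y" for y
  obtain B where B: "\<And>x. x \<in> closure \<Omega> \<Longrightarrow> norm x \<le> B" "0 < B"
    using bounded_closure[OF \<Omega>(2)] by (metis bounded_pos)
  have local: "\<exists>\<delta>>0. f \<mu> = (R *\<^sub>R \<mu> - z) \<bullet> \<mu> \<and> (\<forall>y. norm (y - \<mu>) < \<delta> \<longrightarrow> (R *\<^sub>R \<mu> - z) \<bullet> y \<le> f y)"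
    if zf: "z \<in> frontier \<Omega>" and pz: "pinched \<Omega> c K z (- \<mu>)" for z \<mu>
  proof -
    have \<mu>: "norm \<mu> = 1" using pz by (simp add: pinched_def)
    have zc: "z \<in> closure \<Omega>" using zf by (simp add: frontier_def)
    have half: "0 \<le> - \<mu> \<bullet> (x - z)" if "x \<in> closure \<Omega>" for x
      by (rule pinched_halfspace[OF \<Omega>(1,3) zc _ pz that]) (use c in simp)
    have hz: "support_fun \<Omega> \<mu> = \<mu> \<bullet> z"
      unfolding support_fun_def
      by (rule cSup_eq_maximum) (use zc half in \<open>auto simp: inner_diff_right\<close>)
    obtain \<delta> where \<delta>: "\<delta> > 0" "\<And>x. norm (x - z) < \<delta> \<Longrightarrow> x \<in> \<Omega> \<Longrightarrow> c * (norm (x - z))\<^sup>2 \<le> - \<mu> \<bullet> (x - z)"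
      using pz by (auto simp: pinched_def)
    \<comment> \<open>Points of \<open>\<Omega>\<close> at distance at least \<open>\<delta>\<close>
      from \<open>z\<close> lie at depth at least \<open>\<eta>\<close> behind the supporting plane,
      by contraction to the sphere of radius \<open>\<delta> / 2\<close>. This margin absorbs the
      change from \<open>\<mu>\<close> to a nearby \<open>y\<close>.\<close>
    define \<eta> where "\<eta> = c * (\<delta> / 2)\<^sup>2"
    have \<eta>: "0 < \<eta>" using c \<delta> by (simp add: \<eta>_def)
    have main: "x \<bullet> y \<le> (z - R *\<^sub>R \<mu>) \<bullet> y + R * norm y" if x: "x \<in> \<Omega>" and y: "norm (y - \<mu>) < \<eta> / (2 * B)" for x y
    proof (cases "norm (x - z) < \<delta>")
      case True
      define v where "v = x - (z - R *\<^sub>R \<mu>)"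
      have "(norm v)\<^sup>2 = (norm (x - z))\<^sup>2 + 2 * R * (\<mu> \<bullet> (x - z)) + R\<^sup>2"
      proof -
        have "v = (x - z) + R *\<^sub>R \<mu>" by (simp add: v_def)
        then show ?thesis by (simp only: norm_add_scaled_unit_sq[OF \<mu>])
      qed
      also have "\<dots> \<le> R\<^sup>2"
      proof -
        have "2 * R * (c * (norm (x - z))\<^sup>2) \<le> 2 * R * (- \<mu> \<bullet> (x - z))"
          using \<delta>(2)[OF True x] R by (intro mult_left_mono) auto
        moreover have "2 * R * (c * (norm (x - z))\<^sup>2) = (norm (x - z))\<^sup>2" using c by (simp add: R_def)
        ultimately show ?thesis by simp
      qed
      finally have "norm v \<le> R" using R by (simp add: power2_le_iff_abs_le)
      then have "v \<bullet> y \<le> R * norm y"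
        using norm_cauchy_schwarz[of v y] mult_right_mono[of "norm v" R "norm y"] by simp
      moreover have "x \<bullet> y = (z - R *\<^sub>R \<mu>) \<bullet> y + v \<bullet> y" by (simp add: v_def inner_add_left[symmetric])
      ultimately show ?thesis by simp
    next
      case False
      define t where "t = \<delta> / 2 / norm (x - z)"
      have nx: "0 < norm (x - z)" using False \<delta>(1) by linarith
      have t: "0 < t" "t \<le> 1" using False \<delta> nx by (auto simp: t_def field_simps)
      have tn: "norm (z + t *\<^sub>R (x - z) - z) = \<delta> / 2" using t nx \<delta> by (simp add: t_def)
      have "c * (norm (z + t *\<^sub>R (x - z) - z))\<^sup>2 \<le> - \<mu> \<bullet> (z + t *\<^sub>R (x - z) - z)"
        by (rule \<delta>(2)[OF _ segment_in_convex_open[OF \<Omega>(1,3) zc x t]]) (use tn \<delta> in simp)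
      then have "\<eta> \<le> t * (- \<mu> \<bullet> (x - z))" unfolding tn by (simp add: \<eta>_def)
      also have "\<dots> \<le> - \<mu> \<bullet> (x - z)"
      proof (rule mult_left_le_one_le)
        have "x \<in> closure \<Omega>" using x closure_subset by blast
        then show "0 \<le> - \<mu> \<bullet> (x - z)" by (rule half)
      qed (use t in auto)
      finally have e: "\<mu> \<bullet> (x - z) \<le> - \<eta>" by simp
      have "(y - \<mu>) \<bullet> (x - z) \<le> norm (y - \<mu>) * norm (x - z)" by (rule norm_cauchy_schwarz)
      also have "\<dots> \<le> \<eta> / (2 * B) * (2 * B)"
      proof (rule mult_mono)
        have "norm (x - z) \<le> norm x + norm z" by (rule norm_triangle_ineq4)
        moreover have "x \<in> closure \<Omega>" using x closure_subset by blast
        ultimately show "norm (x - z) \<le> 2 * B" using B(1)[of x] B(1)[OF zc] by simp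
      qed (use y \<eta> B in auto)
      also have "\<dots> = \<eta>" using B by simp
      finally have "y \<bullet> (x - z) \<le> 0" using e by (simp add: inner_diff_left)
      moreover have "R * (\<mu> \<bullet> y) \<le> R * norm y"
        using norm_cauchy_schwarz[of \<mu> y] \<mu> R by (intro mult_left_mono) auto
      ultimately show ?thesis by (simp add: inner_diff_left inner_diff_right inner_commute)
    qed
    have "(R *\<^sub>R \<mu> - z) \<bullet> y \<le> f y" if y: "norm (y - \<mu>) < \<eta> / (2 * B)" for y
    proof -
      have "closure \<Omega> \<subseteq> {x. y \<bullet> x \<le> (z - R *\<^sub>R \<mu>) \<bullet> y + R * norm y}"
      proof (rule closure_minimal)
        show "\<Omega> \<subseteq> {x. y \<bullet> x \<le> (z - R *\<^sub>R \<mu>) \<bullet> y + R * norm y}"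
          using main[OF _ y] by (auto simp: inner_commute[of y])
      qed (rule closed_halfspace_le)
      moreover obtain x where "x \<in> closure \<Omega>" "support_fun \<Omega> y = y \<bullet> x" using support_fun_max[OF \<Omega>(2,4)] by blast
      ultimately show ?thesis by (auto simp: f_def inner_diff_left)
    qed
    moreover have "f \<mu> = (R *\<^sub>R \<mu> - z) \<bullet> \<mu>"
      using \<mu> hz dot_square_norm[of \<mu>] by (simp add: f_def inner_diff_left inner_commute[of z])
    moreover have "0 < \<eta> / (2 * B)" using \<eta> B by simp
    ultimately show ?thesis by blast
  qed
  have "pinched \<Omega> c K z0 (- (- \<nu>0))" using \<nu>0 by simp
  note loc0 = local[OF z0 this]
  then obtain \<delta>0 where \<delta>0: "\<delta>0 > 0" "f (- \<nu>0) = (R *\<^sub>R - \<nu>0 - z0) \<bullet> - \<nu>0"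
     "\<And>y. norm (y - - \<nu>0) < \<delta>0 \<Longrightarrow> (R *\<^sub>R - \<nu>0 - z0) \<bullet> y \<le> f y" by blast
  have glob: "(R *\<^sub>R - \<nu>0 - z0) \<bullet> y \<le> f y" for y
  proof (rule homogeneous_locally_supported[OF dim, where \<nu> = "- \<nu>0" and \<delta> = \<delta>0])
    show "continuous_on UNIV f" unfolding f_def
      by (intro continuous_intros support_fun_continuous[OF \<Omega>(2,4)])
    show "f (k *\<^sub>R x) = k * f x" if "0 < k" for k x
      using that support_fun_scale[OF \<Omega>(2,4) that] by (simp add: f_def algebra_simps)
    show "\<exists>a. \<exists>\<delta>>0. f \<mu> = a \<bullet> \<mu> \<and> (\<forall>y. norm (y - \<mu>) < \<delta> \<longrightarrow> a \<bullet> y \<le> f y)" if "norm \<mu> = 1" for \<mu>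
      using pinched_maximizer[OF \<Omega>(1,2,4) pin that] local by metis
    show "norm (- \<nu>0) = 1" using \<nu>0 by (simp add: pinched_def)
  qed (use \<delta>0 in auto)
  show ?thesis
  proof
    fix x assume x: "x \<in> closure \<Omega>"
    \<comment> \<open>Tested in the direction from the centre to \<open>x\<close>, the global
      inequality becomes \<open>norm y * norm y \<le> R * norm y\<close>.\<close>
    define y where "y = x - (z0 + R *\<^sub>R \<nu>0)"
    have "y \<bullet> x \<le> support_fun \<Omega> y" by (rule support_fun_upper[OF \<Omega>(2) x])
    then have "y \<bullet> x - (z0 + R *\<^sub>R \<nu>0) \<bullet> y \<le> R * norm y" using glob[of y] by (simp add: f_def inner_diff_left inner_add_left)
    moreover have "y \<bullet> x - (z0 + R *\<^sub>R \<nu>0) \<bullet> y = y \<bullet> y" by (subst y_def) (simp add: inner_diff_left inner_diff_right inner_commute y_def)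
    ultimately have "norm y * norm y \<le> R * norm y" by (metis power2_norm_eq_inner power2_eq_square)
    then have "norm y \<le> R" using R by (cases "norm y = 0") auto
    then show "x \<in> cball (z0 + (1 / (2 * c)) *\<^sub>R \<nu>0) (1 / (2 * c))"
      by (simp add: y_def R_def dist_norm norm_minus_commute)
  qed
qed

lemma pinched_inner_ball:
  fixes \<Omega> :: "'a::euclidean_space set"
  assumes dim: "2 \<le> DIM('a)" and \<Omega>: "open \<Omega>" "bounded \<Omega>" "convex \<Omega>" "\<Omega> \<noteq> {}" and c: "0 \<le> c" and K: "0 < K"
    and pin: "\<And>z. z \<in> frontier \<Omega> \<Longrightarrow> \<exists>\<nu>. pinched \<Omega> c K z \<nu>"
    and z0: "z0 \<in> frontier \<Omega>" and \<nu>0: "pinched \<Omega> c K z0 \<nu>0"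
  shows "ball (z0 + (1 / (4 * K)) *\<^sub>R \<nu>0) (1 / (4 * K)) \<subseteq> \<Omega>"
proof -
  \<comment> \<open>Half of the radius \<open>1 / (2 * K)\<close> of the inner pinching ball: points
    of the smaller sphere near \<open>z\<close>, other than \<open>z\<close>, then satisfy the
    strict inequality in \<open>pinched\<close>.\<close>
  define \<rho> where "\<rho> = 1 / (4 * K)"
  have \<rho>: "0 < \<rho>" using K by (simp add: \<rho>_def)
  define f where "f y = support_fun \<Omega> y - \<rho> * norm y" for y
  have local: "\<exists>\<delta>>0. f \<mu> = (z - \<rho> *\<^sub>R \<mu>) \<bullet> \<mu> \<and> (\<forall>y. norm (y - \<mu>) < \<delta> \<longrightarrow> (z - \<rho> *\<^sub>R \<mu>) \<bullet> y \<le> f y)"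
    if zf: "z \<in> frontier \<Omega>" and pz: "pinched \<Omega> c K z (- \<mu>)" for z \<mu>
  proof -
    have \<mu>: "norm \<mu> = 1" using pz by (simp add: pinched_def)
    have zc: "z \<in> closure \<Omega>" using zf by (simp add: frontier_def)
    have half: "0 \<le> - \<mu> \<bullet> (x - z)" if "x \<in> closure \<Omega>" for x
      by (rule pinched_halfspace[OF \<Omega>(1,3) zc c pz that])
    have hz: "support_fun \<Omega> \<mu> = \<mu> \<bullet> z"
      unfolding support_fun_def
      by (rule cSup_eq_maximum) (use zc half in \<open>auto simp: inner_diff_right\<close>)
    obtain \<delta> where \<delta>: "\<delta> > 0" "\<And>x. norm (x - z) < \<delta> \<Longrightarrow> K * (norm (x - z))\<^sup>2 < - \<mu> \<bullet> (x - z) \<Longrightarrow> x \<in> \<Omega>"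
      using pz by (auto simp: pinched_def)
    \<comment> \<open>The point of the tangent sphere with outer normal \<open>y\<close> depends
      continuously on \<open>y\<close> and is \<open>z\<close> for \<open>y = \<mu>\<close>, so
      directions near \<open>\<mu>\<close> only see the neighbourhood in which the pinching
      holds.\<close>
    have "(\<lambda>y. z - \<rho> *\<^sub>R \<mu> + (\<rho> / norm y) *\<^sub>R y) \<midarrow>\<mu>\<rightarrow> z - \<rho> *\<^sub>R \<mu> + (\<rho> / norm \<mu>) *\<^sub>R \<mu>"
      using \<mu> by (intro tendsto_intros) auto
    then have "\<forall>\<^sub>F y in at \<mu>. dist (z - \<rho> *\<^sub>R \<mu> + (\<rho> / norm y) *\<^sub>R y) (z - \<rho> *\<^sub>R \<mu> + (\<rho> / norm \<mu>) *\<^sub>R \<mu>) < \<delta>"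
      using \<delta>(1) by (rule tendstoD)
    then obtain \<eta>0 where \<eta>0: "\<eta>0 > 0" "\<And>y. y \<noteq> \<mu> \<Longrightarrow> dist y \<mu> < \<eta>0 \<Longrightarrow> norm (z - \<rho> *\<^sub>R \<mu> + (\<rho> / norm y) *\<^sub>R y - z) < \<delta>"
      unfolding eventually_at using \<mu> by (auto simp: dist_norm)
    define \<eta> where "\<eta> = min \<eta>0 1"
    have "(z - \<rho> *\<^sub>R \<mu>) \<bullet> y \<le> f y" if y: "norm (y - \<mu>) < \<eta>" for y
    proof -
      have y0: "y \<noteq> 0" using y \<mu> by (auto simp: \<eta>_def)
      define v where "v = (\<rho> / norm y) *\<^sub>R y"
      define x where "x = z - \<rho> *\<^sub>R \<mu> + v"
      have v: "norm v = \<rho>" using \<rho> y0 by (simp add: v_def)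
      have "x \<in> closure \<Omega>"
      proof (cases "x = z")
        case True then show ?thesis using zc by simp
      next
        case False
        then have "y \<noteq> \<mu>" using \<mu> by (auto simp: x_def v_def)
        then have n: "norm (x - z) < \<delta>" using \<eta>0(2)[of y] y by (simp add: x_def v_def \<eta>_def dist_norm)
        have "v = (x - z) + \<rho> *\<^sub>R \<mu>" by (simp add: x_def)
        then have "\<rho>\<^sup>2 = (norm ((x - z) + \<rho> *\<^sub>R \<mu>))\<^sup>2" using v by simp
        also have "\<dots> = (norm (x - z))\<^sup>2 + 2 * \<rho> * (\<mu> \<bullet> (x - z)) + \<rho>\<^sup>2"
          by (rule norm_add_scaled_unit_sq[OF \<mu>])
        finally have "(norm (x - z))\<^sup>2 = 2 * \<rho> * (- \<mu> \<bullet> (x - z))" by simp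
        then have "- \<mu> \<bullet> (x - z) = 2 * (K * (norm (x - z))\<^sup>2)" using K by (simp add: \<rho>_def)
        moreover have "0 < K * (norm (x - z))\<^sup>2" using K False by simp
        ultimately have "x \<in> \<Omega>" by (intro \<delta>(2)[OF n]) simp
        then show ?thesis using closure_subset by blast
      qed
      then have "y \<bullet> x \<le> support_fun \<Omega> y" by (rule support_fun_upper[OF \<Omega>(2)])
      moreover have "y \<bullet> v = \<rho> * norm y"
        using y0 by (simp add: v_def power2_norm_eq_inner[symmetric] power2_eq_square)
      ultimately show ?thesis by (simp add: x_def f_def inner_add_right inner_commute)
    qed
    moreover have "f \<mu> = (z - \<rho> *\<^sub>R \<mu>) \<bullet> \<mu>"
      using \<mu> hz dot_square_norm[of \<mu>] by (simp add: f_def inner_diff_left inner_commute[of z])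
    moreover have "0 < \<eta>" using \<eta>0 by (simp add: \<eta>_def)
    ultimately show ?thesis by blast
  qed
  have "pinched \<Omega> c K z0 (- (- \<nu>0))" using \<nu>0 by simp
  then obtain \<delta>0 where \<delta>0: "\<delta>0 > 0" "f (- \<nu>0) = (z0 - \<rho> *\<^sub>R - \<nu>0) \<bullet> - \<nu>0"
     "\<And>y. norm (y - - \<nu>0) < \<delta>0 \<Longrightarrow> (z0 - \<rho> *\<^sub>R - \<nu>0) \<bullet> y \<le> f y" using local[OF z0] by blast
  have glob: "(z0 - \<rho> *\<^sub>R - \<nu>0) \<bullet> y \<le> f y" for y
  proof (rule homogeneous_locally_supported[OF dim, where \<nu> = "- \<nu>0" and \<delta> = \<delta>0])
    show "continuous_on UNIV f" unfolding f_def
      by (intro continuous_intros support_fun_continuous[OF \<Omega>(2,4)])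
    show "f (k *\<^sub>R x) = k * f x" if "0 < k" for k x
      using that support_fun_scale[OF \<Omega>(2,4) that] by (simp add: f_def algebra_simps)
    show "\<exists>a. \<exists>\<delta>>0. f \<mu> = a \<bullet> \<mu> \<and> (\<forall>y. norm (y - \<mu>) < \<delta> \<longrightarrow> a \<bullet> y \<le> f y)" if "norm \<mu> = 1" for \<mu>
      using pinched_maximizer[OF \<Omega>(1,2,4) pin that] local by metis
    show "norm (- \<nu>0) = 1" using \<nu>0 by (simp add: pinched_def)
  qed (use \<delta>0 in auto)
  have "ball (z0 + \<rho> *\<^sub>R \<nu>0) \<rho> \<subseteq> closure \<Omega>"
  proof
    fix x assume x: "x \<in> ball (z0 + \<rho> *\<^sub>R \<nu>0) \<rho>"
    show "x \<in> closure \<Omega>"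
    proof (rule ccontr)
      assume nx: "x \<notin> closure \<Omega>"
      \<comment> \<open>A point of the ball outside \<open>closure \<Omega>\<close> is cut off by a
        hyperplane. At \<open>- a\<close> the global inequality says that the support function of
        the ball does not exceed that of \<open>\<Omega>\<close>, which contradicts the
        separation.\<close>
      obtain a b where ab: "a \<bullet> x < b" "\<And>y. y \<in> closure \<Omega> \<Longrightarrow> b < a \<bullet> y"
        using separating_hyperplane_closed_point[of "closure \<Omega>" x] nx \<Omega> by (auto simp: convex_closure)
      obtain w where w: "w \<in> closure \<Omega>" "support_fun \<Omega> (- a) = - a \<bullet> w" using support_fun_max[OF \<Omega>(2,4)] by blast
      have "(z0 + \<rho> *\<^sub>R \<nu>0) \<bullet> (- a) + \<rho> * norm a \<le> - a \<bullet> w" using glob[of "- a"] w by (simp add: f_def)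
      also have "\<dots> < - a \<bullet> x" using ab(1) ab(2)[OF w(1)] by simp
      finally have "\<rho> * norm a < (z0 + \<rho> *\<^sub>R \<nu>0 - x) \<bullet> a" by (simp add: inner_diff_left inner_diff_right inner_commute)
      also have "\<dots> \<le> norm (z0 + \<rho> *\<^sub>R \<nu>0 - x) * norm a" by (rule norm_cauchy_schwarz)
      also have "\<dots> \<le> \<rho> * norm a" using x by (intro mult_right_mono) (auto simp: dist_norm)
      finally show False by simp
    qed
  qed
  then have "ball (z0 + \<rho> *\<^sub>R \<nu>0) \<rho> \<subseteq> interior (closure \<Omega>)" by (simp add: interior_maximal)
  then show ?thesis using \<Omega> by (simp add: convex_interior_closure interior_open \<rho>_def)
qed

section \<open>Boundary data\<close>

text \<open>Taylor's theorem in Peano's form: the mean value theorem is applied to the remainder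
  along the segment, whose derivative is controlled by the differentiability of \<open>G\<close> at
  \<open>x0\<close>.\<close>

lemma second_order_expansion:
  fixes f :: "'a::euclidean_space \<Rightarrow> real"
  assumes r: "0 < r" and G: "\<And>x. x \<in> ball x0 r \<Longrightarrow> GDERIV f x :> G x"
    and H: "(G has_derivative H) (at x0)" and e: "0 < e"
  obtains \<delta> where "0 < \<delta>" "\<delta> \<le> r"
    "\<And>y. norm y < \<delta> \<Longrightarrow> \<bar>f (x0 + y) - f x0 - G x0 \<bullet> y - (y \<bullet> H y) / 2\<bar> \<le> e * (norm y)\<^sup>2"
proof -
  from H e obtain d where d: "d > 0" "\<And>y. norm (y - x0) < d \<Longrightarrow> norm (G y - G x0 - H (y - x0)) \<le> e * norm (y - x0)"
    unfolding has_derivative_at_alt by blast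
  have lin: "linear H" using H by (rule has_derivative_linear)
  show ?thesis
  proof (rule that[of "min d r"])
    show "0 < min d r" using d r by simp
    fix y :: 'a assume y: "norm y < min d r"
    define \<psi> where "\<psi> t = f (x0 + t *\<^sub>R y) - t * (G x0 \<bullet> y) - t\<^sup>2 / 2 * (y \<bullet> H y)" for t
    define \<psi>' where "\<psi>' t = (G (x0 + t *\<^sub>R y) - G x0 - H (t *\<^sub>R y)) \<bullet> y" for t
    have small: "norm (t *\<^sub>R y) < min d r" if "0 \<le> t" "t \<le> 1" for t
      using that y mult_right_mono[of t 1 "norm y"] by simp
    have der: "DERIV \<psi> t :> \<psi>' t" if t: "0 \<le> t" "t \<le> 1" for t
    proof -
      have "x0 + t *\<^sub>R y \<in> ball x0 r" using small[OF t] by (simp add: dist_norm)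
      then have "(f has_derivative (\<lambda>h. h \<bullet> G (x0 + t *\<^sub>R y))) (at (x0 + t *\<^sub>R y))"
        using G by (simp add: gderiv_def)
      moreover have "((\<lambda>t. x0 + t *\<^sub>R y) has_derivative (\<lambda>s. s *\<^sub>R y)) (at t)"
        by (auto intro!: derivative_eq_intros)
      ultimately have "((\<lambda>t. f (x0 + t *\<^sub>R y)) has_derivative (\<lambda>s. (s *\<^sub>R y) \<bullet> G (x0 + t *\<^sub>R y))) (at t)"
        using has_derivative_compose[of "\<lambda>t. x0 + t *\<^sub>R y"] by blast
      then have "((\<lambda>t. f (x0 + t *\<^sub>R y)) has_real_derivative (G (x0 + t *\<^sub>R y) \<bullet> y)) (at t)"
        by (simp add: has_field_derivative_def inner_commute mult_commute_abs)
      then show ?thesis unfolding \<psi>_def \<psi>'_def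
        by (auto intro!: derivative_eq_intros simp: inner_diff_left inner_diff_right linear_scale[OF lin] inner_commute)
    qed
    obtain t where t: "0 < t" "t < 1" "\<psi> 1 - \<psi> 0 = (1 - 0) * \<psi>' t"
      using MVT2[of 0 1 \<psi> \<psi>'] der by auto
    have "\<bar>\<psi>' t\<bar> \<le> norm (G (x0 + t *\<^sub>R y) - G x0 - H (t *\<^sub>R y)) * norm y"
      unfolding \<psi>'_def by (rule Cauchy_Schwarz_ineq2)
    also have "\<dots> \<le> (e * norm (t *\<^sub>R y)) * norm y"
      using d(2)[of "x0 + t *\<^sub>R y"] small[of t] t by (intro mult_right_mono) auto
    also have "\<dots> \<le> (e * norm y) * norm y"
      using t e mult_right_mono[of t 1 "norm y"] by (intro mult_right_mono mult_left_mono) auto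
    finally have "\<bar>\<psi> 1 - \<psi> 0\<bar> \<le> e * (norm y)\<^sup>2" using t by (simp add: power2_eq_square mult.assoc)
    then show "\<bar>f (x0 + y) - f x0 - G x0 \<bullet> y - (y \<bullet> H y) / 2\<bar> \<le> e * (norm y)\<^sup>2"
      by (simp add: \<psi>_def)
  qed simp
qed

lemma gderiv_unique: "GDERIV f x :> a \<Longrightarrow> GDERIV f x :> b \<Longrightarrow> a = (b :: 'a::euclidean_space)"
proof -
  assume "GDERIV f x :> a" "GDERIV f x :> b"
  then have "(\<lambda>h. h \<bullet> a) = (\<lambda>h. h \<bullet> b)" unfolding gderiv_def by (rule has_derivative_unique)
  then have "(a - b) \<bullet> a = (a - b) \<bullet> b" by metis
  then have "(a - b) \<bullet> (a - b) = 0" by (simp add: inner_diff_right)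
  then show "a = b" by simp
qed

lemma orthogonal_transformation_inner: "orthogonal_transformation T \<Longrightarrow> T v \<bullet> T w = v \<bullet> w"
  unfolding orthogonal_transformation_def by blast

lemma frame_coordinates:
  fixes T :: "'a::euclidean_space \<times> real \<Rightarrow> 'a \<times> real"
  assumes T: "orthogonal_transformation T"
  obtains y' t where "x = z + T (y', t)" "(norm (x - z))\<^sup>2 = (norm y')\<^sup>2 + t\<^sup>2" "T (0, 1) \<bullet> (x - z) = t"
    "\<And>q. T (q, 0) \<bullet> (x - z) = q \<bullet> y'"
proof -
  obtain w where w: "T w = x - z" using orthogonal_transformation_surj[OF T] by (metis surjD)
  have inn: "T v \<bullet> T u = v \<bullet> u" for v u by (rule orthogonal_transformation_inner[OF T])
  show ?thesis
  proof (rule that[of "fst w" "snd w"])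
    show "x = z + T (fst w, snd w)" using w by simp
    have "norm (x - z) = norm w" using w T by (metis orthogonal_transformation)
    then show "(norm (x - z))\<^sup>2 = (norm (fst w))\<^sup>2 + (snd w)\<^sup>2" by (simp add: norm_prod_def)
    show "T (0, 1) \<bullet> (x - z) = snd w" unfolding w[symmetric] inn by (simp add: inner_prod_def)
    show "T (q, 0) \<bullet> (x - z) = q \<bullet> fst w" for q unfolding w[symmetric] inn by (simp add: inner_prod_def)
  qed
qed

text \<open>Charts and supporting half-spaces specify normals in unrelated ways; this identifies
  them. If \<open>\<mu>\<close> had a horizontal part \<open>a\<close> in the frame, moving along
  \<open>- a\<close> just above the graph would give a negative height, because \<open>g\<close> is
  flat to first order.\<close>

lemma tangent_graph_normal:
  fixes \<Omega> :: "('a::euclidean_space \<times> real) set"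
  assumes tg: "tangent_graph \<Omega> z T r g" and \<mu>: "norm \<mu> = 1" and sup: "\<And>x. x \<in> \<Omega> \<Longrightarrow> 0 \<le> \<mu> \<bullet> (x - z)"
  shows "T (0, 1) = \<mu>"
proof -
  have r: "0 < r" and T: "orthogonal_transformation T" and g0: "g 0 = 0" and dg: "GDERIV g 0 :> 0"
    and gr: "\<And>x' t. norm x' < r \<Longrightarrow> \<bar>t\<bar> < r \<Longrightarrow> z + T (x', t) \<in> \<Omega> \<longleftrightarrow> g x' < t"
    using tg by (auto simp: tangent_graph_def)
  obtain w where w: "T w = \<mu>" using orthogonal_transformation_surj[OF T] by (metis surjD)
  define a s where "a = fst w" and "s = snd w"
  have nw: "norm w = 1" using w \<mu> T by (metis orthogonal_transformation)
  then have as: "(norm a)\<^sup>2 + s\<^sup>2 = 1" by (simp add: norm_prod_def a_def s_def)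
  have key: "0 \<le> a \<bullet> y + s * t" if "norm y < r" "\<bar>t\<bar> < r" "g y < t" for y t
  proof -
    have "0 \<le> \<mu> \<bullet> (z + T (y, t) - z)" by (rule sup) (use gr that in blast)
    also have "\<dots> = w \<bullet> (y, t)" by (simp add: w[symmetric] orthogonal_transformation_inner[OF T])
    finally show ?thesis by (simp add: a_def s_def inner_prod_def)
  qed
  have "a = 0"
  proof (rule ccontr)
    assume a: "a \<noteq> 0"
    define A where "A = norm a"
    have A: "0 < A" using a by (simp add: A_def)
    have "s\<^sup>2 \<le> 1" using as zero_le_power2[of "norm a"] by linarith
    then have s1: "\<bar>s\<bar> \<le> 1" by (simp add: abs_square_le_1)
    have "(g has_derivative (\<lambda>h. 0)) (at 0)" using dg by (simp add: gderiv_def)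
    moreover have "0 < A / 2" using A by simp
    ultimately have "\<exists>d>0. \<forall>y. norm (y - 0) < d \<longrightarrow> norm (g y - g 0 - 0) \<le> A / 2 * norm (y - 0)"
      unfolding has_derivative_at_alt by blast
    then obtain d where d: "d > 0" "\<And>y. norm y < d \<Longrightarrow> \<bar>g y\<bar> \<le> A / 2 * norm y"
      using g0 by auto
    define k where "k = min (d / 2) (min (r / 2) (r / 2 / A)) / A"
    have k: "0 < k" using d r A by (simp add: k_def)
    have "k * A \<le> d / 2" "k * A \<le> r / 2" "k * A \<le> r / 2 / A" unfolding k_def using A by auto
    then have kA: "k * A < d" "k * A < r" "k * A * A \<le> r / 2"
      using d r A by (auto simp: field_simps)
    have n: "norm (- k *\<^sub>R a) = k * A" using k by (simp add: A_def)
    have "\<bar>g (- k *\<^sub>R a)\<bar> \<le> A / 2 * (k * A)" using d(2)[of "- k *\<^sub>R a"] kA(1) unfolding n by blast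
    also have "\<dots> = k * A * A / 2" by simp
    finally have gk: "\<bar>g (- k *\<^sub>R a)\<bar> \<le> k * A * A / 2" .
    \<comment> \<open>Just above the graph, yet small compared with the horizontal contribution
      \<open>k * A * A\<close>.\<close>
    define t where "t = g (- k *\<^sub>R a) + k * A * A / 4"
    have kAA: "0 < k * A * A" using k A by simp
    have "\<bar>t\<bar> \<le> k * A * A * (3/4)" using gk kAA unfolding t_def by linarith
    then have t: "\<bar>t\<bar> < k * A * A" "\<bar>t\<bar> < r" using kAA kA(3) by linarith+
    have "0 \<le> a \<bullet> (- k *\<^sub>R a) + s * t"
      by (rule key) (use n kA t kAA in \<open>auto simp: t_def\<close>)
    moreover have "s * t \<le> \<bar>t\<bar>" using s1 mult_right_mono[of "\<bar>s\<bar>" 1 "\<bar>t\<bar>"] abs_ge_self[of "s * t"] by (simp add: abs_mult)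
    moreover have "a \<bullet> (- k *\<^sub>R a) = - (k * A * A)"
    proof -
      have "a \<bullet> a = A * A" unfolding A_def dot_square_norm by (rule power2_eq_square)
      then show ?thesis by simp
    qed
    ultimately show False using t by linarith
  qed
  then have "s\<^sup>2 = 1" using as by simp
  moreover have "0 \<le> s * (r / 2)" using key[of 0 "r/2"] r g0 by simp
  ultimately have "s = 1" using r by (simp add: power2_eq_1_iff zero_le_mult_iff)
  then have "w = (0, 1)" using \<open>a = 0\<close> by (simp add: a_def s_def prod_eq_iff)
  then show ?thesis using w by simp
qed

text \<open>\<open>tangent_graph\<close> only describes membership in \<open>\<Omega>\<close>. A
  closure point strictly below the graph could be joined to a point of \<open>\<Omega>\<close>
  vertically above it, and by convexity the graph point in between would belong to
  \<open>\<Omega>\<close>.\<close>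

lemma tangent_graph_frontier:
  fixes \<Omega> :: "('a::euclidean_space \<times> real) set"
  assumes tg: "tangent_graph \<Omega> z T r g" and \<Omega>: "open \<Omega>" "convex \<Omega>"
    and x: "z + T (y, t) \<in> frontier \<Omega>" "norm y < r" "\<bar>t\<bar> < r"
  shows "t = g y"
proof (rule ccontr)
  assume ne: "t \<noteq> g y"
  have T: "orthogonal_transformation T"
    and gr: "\<And>x' t. norm x' < r \<Longrightarrow> \<bar>t\<bar> < r \<Longrightarrow> z + T (x', t) \<in> \<Omega> \<longleftrightarrow> g x' < t"
    and gb: "\<bar>g y\<bar> < r"
    using tg x by (auto simp: tangent_graph_def)
  have lin: "linear T" using T by (simp add: orthogonal_transformation_def)
  have "z + T (y, t) \<notin> \<Omega>" using x(1) \<Omega>(1) by (simp add: frontier_def interior_open)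
  then have lt: "t < g y" using gr x ne by force
  define t1 where "t1 = (g y + r) / 2"
  have t1: "g y < t1" "\<bar>t1\<bar> < r" using gb by (auto simp: t1_def)
  define s where "s = (g y - t) / (t1 - t)"
  have s: "0 < s" "s \<le> 1" using lt t1 by (auto simp: s_def)
  have "z + T (y, t) + s *\<^sub>R (z + T (y, t1) - (z + T (y, t))) \<in> \<Omega>"
    by (rule segment_in_convex_open[OF \<Omega>]) (use x gr t1 s in \<open>auto simp: frontier_def\<close>)
  moreover have "z + T (y, t) + s *\<^sub>R (z + T (y, t1) - (z + T (y, t))) = z + T (y, g y)"
  proof -
    have "s * (t1 - t) = g y - t" using lt t1 by (simp add: s_def)
    then have "(y, t) + s *\<^sub>R ((y, t1) - (y, t)) = (y, g y)" by simp
    moreover have "T ((y, t) + s *\<^sub>R ((y, t1) - (y, t))) = T (y, t) + s *\<^sub>R (T (y, t1) - T (y, t))"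
      by (simp only: linear_add[OF lin] linear_diff[OF lin] linear_scale[OF lin])
    ultimately have "T (y, t) + s *\<^sub>R (T (y, t1) - T (y, t)) = T (y, g y)" by simp
    then show ?thesis by (simp add: algebra_simps)
  qed
  ultimately have "z + T (y, g y) \<in> \<Omega>" by (simp only:)
  then show False using gr[of y "g y"] x gb by simp
qed

text \<open>In the chart \<open>g\<close> lies between \<open>3 * \<kappa> / 8\<close> and
  \<open>max K 1\<close> times \<open>(norm y)\<^sup>2\<close>. The loss from
  \<open>3 * \<kappa> / 8\<close> to \<open>\<kappa> / 4\<close> pays for the vertical part of
  \<open>norm (x - z)\<close>, with the help of \<open>\<kappa> * t \<le> 1\<close>.\<close>

lemma unif_convex_pinched:
  fixes \<Omega> :: "('a::euclidean_space \<times> real) set"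
  assumes uc: "unif_convex_C2_domain \<Omega> \<kappa> K" and \<kappa>: "0 < \<kappa>" and z: "z \<in> frontier \<Omega>"
  shows "\<exists>\<nu>. pinched \<Omega> (\<kappa> / 4) (max K 1) z \<nu>"
proof -
  obtain T r g G H where tg: "tangent_graph \<Omega> z T r g" and C2: "C2_on (ball 0 r) g G H"
    and H: "\<And>v. \<kappa> * (norm v)\<^sup>2 \<le> v \<bullet> blinfun_apply (H 0) v \<and> v \<bullet> blinfun_apply (H 0) v \<le> K * (norm v)\<^sup>2"
    using uc z unfolding unif_convex_C2_domain_def by meson
  have r: "0 < r" and T: "orthogonal_transformation T" and g0: "g 0 = 0" and dg: "GDERIV g 0 :> 0"
    and gr: "\<And>x' t. norm x' < r \<Longrightarrow> \<bar>t\<bar> < r \<Longrightarrow> z + T (x', t) \<in> \<Omega> \<longleftrightarrow> g x' < t"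
    using tg by (auto simp: tangent_graph_def)
  have G: "\<And>x. x \<in> ball 0 r \<Longrightarrow> GDERIV g x :> G x" and dG: "(G has_derivative blinfun_apply (H 0)) (at 0)"
    using C2 r by (auto simp: C2_on_def)
  have G0: "G 0 = 0" by (rule gderiv_unique[OF G dg]) (use r in simp)
  \<comment> \<open>The Taylor error is at most \<open>\<kappa> / 8\<close> in the lower and
    \<open>1 / 8\<close> in the upper bound, against the Hessian contributions
    \<open>\<kappa> / 2\<close> and \<open>K / 2\<close>.\<close>
  define e where "e = min \<kappa> 1 / 8"
  have e: "0 < e" "e \<le> \<kappa> / 8" "e \<le> 1 / 8" using \<kappa> by (auto simp: e_def)
  obtain \<delta>0 where \<delta>0: "0 < \<delta>0" "\<delta>0 \<le> r"
     "\<And>y. norm y < \<delta>0 \<Longrightarrow> \<bar>g (0 + y) - g 0 - G 0 \<bullet> y - (y \<bullet> blinfun_apply (H 0) y) / 2\<bar> \<le> e * (norm y)\<^sup>2"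
    using second_order_expansion[OF r G dG e(1)] by blast
  have gl: "(3 * \<kappa> / 8) * (norm y)\<^sup>2 \<le> g y" and gu: "g y \<le> max K 1 * (norm y)\<^sup>2" if y: "norm y < \<delta>0" for y
  proof -
    have a: "\<bar>g y - (y \<bullet> blinfun_apply (H 0) y) / 2\<bar> \<le> e * (norm y)\<^sup>2" using \<delta>0(3)[OF y] g0 G0 by simp
    have "e * (norm y)\<^sup>2 \<le> \<kappa> / 8 * (norm y)\<^sup>2" "e * (norm y)\<^sup>2 \<le> 1 / 8 * (norm y)\<^sup>2"
      using e by (intro mult_right_mono; simp)+
    moreover have "K * (norm y)\<^sup>2 \<le> max K 1 * (norm y)\<^sup>2" "1 * (norm y)\<^sup>2 \<le> max K 1 * (norm y)\<^sup>2"
      by (intro mult_right_mono; simp)+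
    ultimately show "(3 * \<kappa> / 8) * (norm y)\<^sup>2 \<le> g y" "g y \<le> max K 1 * (norm y)\<^sup>2"
      using a H[of y] unfolding abs_le_iff by linarith+
  qed
  define \<delta> where "\<delta> = min \<delta>0 (1 / \<kappa>)"
  have \<delta>: "0 < \<delta>" using \<delta>0 \<kappa> by (simp add: \<delta>_def)
  show ?thesis
    unfolding pinched_def
  proof (rule exI[of _ "T (0, 1)"], intro conjI, goal_cases)
    case 1
    have "norm (T (0, 1)) = norm (0 :: 'a, 1 :: real)" using T by (metis orthogonal_transformation)
    then show ?case by (simp add: norm_prod_def)
  next
    case 2
    show ?case
    proof (rule exI[of _ \<delta>], intro conjI allI impI)
      show "0 < \<delta>" by fact
      fix x assume x: "norm (x - z) < \<delta>"
      obtain y t where yt: "x = z + T (y, t)" "(norm (x - z))\<^sup>2 = (norm y)\<^sup>2 + t\<^sup>2" "T (0, 1) \<bullet> (x - z) = t"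
        using frame_coordinates[OF T] by metis
      have "(norm y)\<^sup>2 \<le> (norm (x - z))\<^sup>2" "t\<^sup>2 \<le> (norm (x - z))\<^sup>2" using yt(2) by auto
      then have "norm y \<le> norm (x - z)" "\<bar>t\<bar> \<le> norm (x - z)"
        by (auto intro: power2_le_imp_le simp: abs_le_square_iff)
      then have ny: "norm y < \<delta>0" and nt: "\<bar>t\<bar> < \<delta>0" "\<bar>t\<bar> \<le> 1 / \<kappa>" using x by (auto simp: \<delta>_def)
      have iff: "x \<in> \<Omega> \<longleftrightarrow> g y < t" unfolding yt(1) by (rule gr) (use ny nt \<delta>0 in auto)
      show "\<kappa> / 4 * (norm (x - z))\<^sup>2 \<le> T (0, 1) \<bullet> (x - z)" if "x \<in> \<Omega>"
      proof -
        have t: "(3 * \<kappa> / 8) * (norm y)\<^sup>2 \<le> t" using gl[OF ny] iff that by simp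
        moreover have "0 \<le> (3 * \<kappa> / 8) * (norm y)\<^sup>2" using \<kappa> by simp
        ultimately have t0: "0 \<le> t" by linarith
        have "\<kappa> * t \<le> 1" using nt(2) t0 \<kappa> by (simp add: field_simps)
        then have "\<kappa> * t\<^sup>2 \<le> t" using mult_right_mono[of "\<kappa> * t" 1 t] t0 by (simp add: power2_eq_square mult.assoc)
        then show ?thesis using t t0 unfolding yt(2,3) by (simp add: algebra_simps)
      qed
      show "x \<in> \<Omega>" if "max K 1 * (norm (x - z))\<^sup>2 < T (0, 1) \<bullet> (x - z)"
      proof -
        have "max K 1 * (norm y)\<^sup>2 \<le> max K 1 * (norm (x - z))\<^sup>2" using yt(2) by (intro mult_left_mono) auto
        then show ?thesis using that gu[OF ny] iff yt(3) by simp
      qed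
    qed
  qed
qed

text \<open>Global counterpart of \<open>pinched\<close>, with both radii fixed in advance.
  Expanding the two balls compares the height over the tangent plane with the squared distance to
  \<open>z\<close>, which is how the condition is used.\<close>

definition ball_normal :: "'a::euclidean_space set \<Rightarrow> real \<Rightarrow> real \<Rightarrow> 'a \<Rightarrow> 'a \<Rightarrow> bool" where
  "ball_normal \<Omega> \<rho> R z \<nu> \<longleftrightarrow> norm \<nu> = 1 \<and> closure \<Omega> \<subseteq> cball (z + R *\<^sub>R \<nu>) R \<and> ball (z + \<rho> *\<^sub>R \<nu>) \<rho> \<subseteq> \<Omega>"

lemma ball_normal_upper:
  assumes "ball_normal \<Omega> \<rho> R z \<nu>" "x \<in> closure \<Omega>" "0 < R"
  shows "(norm (x - z))\<^sup>2 \<le> 2 * R * (\<nu> \<bullet> (x - z))"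
proof -
  have n: "norm \<nu> = 1" and "norm (x - (z + R *\<^sub>R \<nu>)) \<le> R"
    using assms by (auto simp: ball_normal_def dist_norm norm_minus_commute)
  then have "(norm (x - z + (- R) *\<^sub>R \<nu>))\<^sup>2 \<le> R\<^sup>2" by (intro power_mono) (auto simp: algebra_simps)
  then show ?thesis unfolding norm_add_scaled_unit_sq[OF n] by simp
qed

lemma ball_normal_lower:
  assumes "ball_normal \<Omega> \<rho> R z \<nu>" "x \<notin> \<Omega>" "0 < \<rho>"
  shows "2 * \<rho> * (\<nu> \<bullet> (x - z)) \<le> (norm (x - z))\<^sup>2"
proof -
  have n: "norm \<nu> = 1" and "\<rho> \<le> norm (x - (z + \<rho> *\<^sub>R \<nu>))"
    using assms by (auto simp: ball_normal_def dist_norm norm_minus_commute subset_iff not_less)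
  then have "\<rho>\<^sup>2 \<le> (norm (x - z + (- \<rho>) *\<^sub>R \<nu>))\<^sup>2" using assms(3) by (intro power_mono) (auto simp: algebra_simps)
  then show ?thesis unfolding norm_add_scaled_unit_sq[OF n] by simp
qed

lemma ball_normal_nonneg:
  assumes "ball_normal \<Omega> \<rho> R z \<nu>" "x \<in> closure \<Omega>" "0 < R"
  shows "0 \<le> \<nu> \<bullet> (x - z)"
proof -
  have "0 \<le> 2 * R * (\<nu> \<bullet> (x - z))"
    using ball_normal_upper[OF assms] zero_le_power2[of "norm (x - z)"] by linarith
  then show ?thesis using assms(3) by (simp add: zero_le_mult_iff)
qed

lemma ball_normal_pos:
  assumes "ball_normal \<Omega> \<rho> R z \<nu>" "open \<Omega>" "z \<in> frontier \<Omega>" "x \<in> \<Omega>" "0 < R"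
  shows "0 < \<nu> \<bullet> (x - z)"
proof -
  have "x \<noteq> z" using assms by (auto simp: frontier_def interior_open)
  then have "0 < (norm (x - z))\<^sup>2" by simp
  also have "\<dots> \<le> 2 * R * (\<nu> \<bullet> (x - z))"
    by (rule ball_normal_upper[OF assms(1) _ assms(5)]) (use assms closure_subset in blast)
  finally show ?thesis using assms(5) by (simp add: zero_less_mult_iff)
qed

text \<open>The inner ball at \<open>z0\<close> lies in the supporting half-space at
  \<open>z\<close>, so its centre has height at least \<open>\<rho>\<close> there. This bounds the
  angle between the normals by the height of \<open>z0\<close> over the tangent plane at
  \<open>z\<close>.\<close>

lemma ball_normal_tilt:
  assumes n: "ball_normal \<Omega> \<rho> R z \<nu>" and n0: "ball_normal \<Omega> \<rho> R z0 \<nu>0"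
    and \<Omega>: "open \<Omega>" "z \<in> frontier \<Omega>" and pos: "0 < R" "0 < \<rho>"
  shows "\<rho> * (1 - \<nu> \<bullet> \<nu>0) \<le> \<nu> \<bullet> (z0 - z)"
proof (rule ccontr)
  assume "\<not> ?thesis"
  then have lt: "\<nu> \<bullet> (z0 - z) + \<rho> * (\<nu> \<bullet> \<nu>0) < \<rho>" by (simp add: algebra_simps)
  define s where "s = max 0 (\<nu> \<bullet> (z0 - z) + \<rho> * (\<nu> \<bullet> \<nu>0))"
  have s: "0 \<le> s" "s < \<rho>" using lt pos by (auto simp: s_def)
  have nn: "norm \<nu> = 1" using n by (simp add: ball_normal_def)
  have "z0 + \<rho> *\<^sub>R \<nu>0 - s *\<^sub>R \<nu> \<in> ball (z0 + \<rho> *\<^sub>R \<nu>0) \<rho>" using s nn by (simp add: dist_norm)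
  then have "z0 + \<rho> *\<^sub>R \<nu>0 - s *\<^sub>R \<nu> \<in> \<Omega>" using n0 by (auto simp: ball_normal_def)
  then have "0 < \<nu> \<bullet> (z0 + \<rho> *\<^sub>R \<nu>0 - s *\<^sub>R \<nu> - z)"
    by (rule ball_normal_pos[OF n \<Omega> _ pos(1)])
  also have "\<dots> = \<nu> \<bullet> (z0 - z) + \<rho> * (\<nu> \<bullet> \<nu>0) - s"
    using dot_square_norm[of \<nu>] nn by (simp add: inner_diff_right inner_add_right)
  finally show False by (simp add: s_def)
qed

text \<open>The normal line over \<open>z + w\<close> starts outside \<open>\<Omega>\<close> and
  ends in the inner ball, so it crosses the boundary; the inner ball makes the height of the
  crossing quadratic in \<open>w\<close>.\<close>

lemma frontier_point_above:
  fixes \<Omega> :: "'a::euclidean_space set"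
  assumes n: "ball_normal \<Omega> \<rho> R z \<nu>" and \<Omega>: "open \<Omega>" "z \<in> frontier \<Omega>" and pos: "0 < R" "0 < \<rho>"
    and w: "\<nu> \<bullet> w = 0" "norm w \<le> \<rho> / 2"
  obtains \<tau> where "0 \<le> \<tau>" "\<rho> * \<tau> \<le> (norm w)\<^sup>2" "z + w + \<tau> *\<^sub>R \<nu> \<in> frontier \<Omega>"
proof -
  have nn: "norm \<nu> = 1" using n by (simp add: ball_normal_def)
  have n1: "\<nu> \<bullet> \<nu> = 1" using nn by (simp add: norm_eq_1)
  define c where "c \<tau> = z + w + \<tau> *\<^sub>R \<nu>" for \<tau>
  have "c \<rho> \<in> ball (z + \<rho> *\<^sub>R \<nu>) \<rho>" using w pos by (simp add: c_def dist_norm)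
  then have top: "c \<rho> \<in> \<Omega>" using n by (auto simp: ball_normal_def)
  have bot: "c 0 \<notin> \<Omega>" using ball_normal_pos[OF n \<Omega>(1,2) _ pos(1), of "c 0"] w by (auto simp: c_def)
  have "connected (c ` {0..\<rho>})"
    by (rule connected_continuous_image) (auto simp: c_def intro!: continuous_intros)
  then have "c ` {0..\<rho>} \<inter> frontier \<Omega> \<noteq> {}"
  proof (rule connected_Int_frontier)
    show "c ` {0..\<rho>} \<inter> \<Omega> \<noteq> {}" using top pos by (intro ex_in_conv[THEN iffD1] exI[of _ "c \<rho>"]) auto
    show "c ` {0..\<rho>} - \<Omega> \<noteq> {}" using bot pos by (intro ex_in_conv[THEN iffD1] exI[of _ "c 0"]) auto
  qed
  then obtain \<tau> where \<tau>: "0 \<le> \<tau>" "\<tau> \<le> \<rho>" "c \<tau> \<in> frontier \<Omega>" by auto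
  have "c \<tau> \<notin> \<Omega>" using \<tau> \<Omega> by (simp add: frontier_def interior_open)
  from ball_normal_lower[OF n this pos(2)] have "2 * \<rho> * \<tau> \<le> (norm (w + \<tau> *\<^sub>R \<nu>))\<^sup>2"
    using w n1 by (simp add: c_def inner_add_right algebra_simps)
  also have "\<dots> = (norm w)\<^sup>2 + \<tau> * \<tau>" using norm_add_scaled_unit_sq[OF nn, of w \<tau>] w by (simp add: power2_eq_square)
  also have "\<tau> * \<tau> \<le> \<rho> * \<tau>" using \<tau> by (intro mult_right_mono) auto
  finally show ?thesis using that \<tau> by (simp add: c_def)
qed

text \<open>The chart of \<open>\<phi>\<close> may differ from the one that carries the curvature
  bounds; \<open>tangent_graph_normal\<close> shows that both have the same normal, so the expansion
  can be restated without coordinates, with a vector \<open>q\<close> tangential for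
  \<open>\<nu>\<close>.\<close>

lemma boundary_jet:
  fixes \<Omega> :: "('a::euclidean_space \<times> real) set"
  assumes bd: "C2_boundary_data \<Omega> \<phi> K" and \<Omega>: "open \<Omega>" "convex \<Omega>" and pos: "0 < R"
    and z: "z \<in> frontier \<Omega>" and n: "ball_normal \<Omega> \<rho> R z \<nu>"
  shows "\<exists>q. q \<bullet> \<nu> = 0 \<and> norm q \<le> K \<and> \<bar>\<phi> z\<bar> \<le> K \<and>
     (\<exists>\<delta>>0. \<forall>x\<in>frontier \<Omega>. norm (x - z) < \<delta> \<longrightarrow> \<bar>\<phi> x - \<phi> z - q \<bullet> (x - z)\<bar> \<le> (K + 1) * (norm (x - z))\<^sup>2)"
proof -
  obtain T r g G H where tg: "tangent_graph \<Omega> z T r g" and C2: "C2_on (ball 0 r) (\<lambda>x'. \<phi> (z + T (x', g x'))) G H"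
    and K: "\<bar>\<phi> z\<bar> \<le> K" "norm (G 0) \<le> K" "norm (H 0) \<le> K"
    using bd z unfolding C2_boundary_data_def by meson
  have r: "0 < r" and T: "orthogonal_transformation T" and g0: "g 0 = 0"
    using tg by (auto simp: tangent_graph_def)
  have lin: "linear T" using T by (simp add: orthogonal_transformation_def)
  have nu: "T (0, 1) = \<nu>"
  proof (rule tangent_graph_normal[OF tg])
    show "norm \<nu> = 1" using n by (simp add: ball_normal_def)
    show "0 \<le> \<nu> \<bullet> (x - z)" if "x \<in> \<Omega>" for x
      by (rule ball_normal_nonneg[OF n _ pos]) (use that closure_subset in blast)
  qed
  define F where "F y = \<phi> (z + T (y, g y))" for y
  have G: "\<And>x. x \<in> ball 0 r \<Longrightarrow> GDERIV F x :> G x" and dG: "(G has_derivative blinfun_apply (H 0)) (at 0)"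
    using C2 r by (auto simp: C2_on_def F_def[abs_def])
  obtain \<delta> where \<delta>: "0 < \<delta>" "\<delta> \<le> r"
     "\<And>y. norm y < \<delta> \<Longrightarrow> \<bar>F (0 + y) - F 0 - G 0 \<bullet> y - (y \<bullet> blinfun_apply (H 0) y) / 2\<bar> \<le> (1/2) * (norm y)\<^sup>2"
    using second_order_expansion[OF r G dG, of "1/2"] by auto
  have F0: "F 0 = \<phi> z" using lin g0 linear_0[OF lin] by (simp add: F_def zero_prod_def[symmetric])
  have Kpos: "0 \<le> K" using K(1) by simp
  show ?thesis
  proof (rule exI[of _ "T (G 0, 0)"], intro conjI)
    show "T (G 0, 0) \<bullet> \<nu> = 0" using T unfolding nu[symmetric] orthogonal_transformation_inner[OF T] by (simp add: inner_prod_def)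
    have "norm (T (G 0, 0)) = norm (G 0, 0 :: real)" using T by (metis orthogonal_transformation)
    then show "norm (T (G 0, 0)) \<le> K" using K by (simp add: norm_prod_def)
    show "\<exists>\<delta>>0. \<forall>x\<in>frontier \<Omega>. norm (x - z) < \<delta> \<longrightarrow> \<bar>\<phi> x - \<phi> z - T (G 0, 0) \<bullet> (x - z)\<bar> \<le> (K + 1) * (norm (x - z))\<^sup>2"
    proof (rule exI[of _ \<delta>], intro conjI ballI impI)
      show "0 < \<delta>" by fact
      fix x assume x: "x \<in> frontier \<Omega>" "norm (x - z) < \<delta>"
      obtain y t where yt: "x = z + T (y, t)" "(norm (x - z))\<^sup>2 = (norm y)\<^sup>2 + t\<^sup>2"
        "\<And>q. T (q, 0) \<bullet> (x - z) = q \<bullet> y"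
        using frame_coordinates[OF T, of x z] by metis
      have "(norm y)\<^sup>2 \<le> (norm (x - z))\<^sup>2" "t\<^sup>2 \<le> (norm (x - z))\<^sup>2" using yt(2) by auto
      then have nyx: "norm y \<le> norm (x - z)" "\<bar>t\<bar> \<le> norm (x - z)"
        by (auto intro: power2_le_imp_le simp: abs_le_square_iff)
      then have ny: "norm y < \<delta>" and nt: "\<bar>t\<bar> < r" using x \<delta> by auto
      have "t = g y" by (rule tangent_graph_frontier[OF tg \<Omega>]) (use x yt ny nt \<delta> in auto)
      then have Fy: "F y = \<phi> x" by (simp add: F_def yt)
      have "\<bar>y \<bullet> blinfun_apply (H 0) y\<bar> \<le> norm y * norm (blinfun_apply (H 0) y)" by (rule Cauchy_Schwarz_ineq2)
      also have "\<dots> \<le> norm y * (norm (H 0) * norm y)" by (intro mult_left_mono norm_blinfun) simp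
      also have "\<dots> \<le> norm y * (K * norm y)" using K by (intro mult_left_mono mult_right_mono) auto
      finally have "\<bar>y \<bullet> blinfun_apply (H 0) y\<bar> \<le> K * (norm y)\<^sup>2" by (simp add: power2_eq_square ac_simps)
      moreover have "\<bar>\<phi> x - \<phi> z - G 0 \<bullet> y - (y \<bullet> blinfun_apply (H 0) y) / 2\<bar> \<le> (1/2) * (norm y)\<^sup>2"
        using \<delta>(3)[OF ny] Fy F0 by simp
      moreover have "0 \<le> K * (norm y)\<^sup>2" "0 \<le> (norm y)\<^sup>2" using Kpos by auto
      ultimately have "\<bar>\<phi> x - \<phi> z - G 0 \<bullet> y\<bar> \<le> K * (norm y)\<^sup>2 + (norm y)\<^sup>2" by linarith
      also have "\<dots> = (K + 1) * (norm y)\<^sup>2" by (simp add: algebra_simps)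
      also have "\<dots> \<le> (K + 1) * (norm (x - z))\<^sup>2" using nyx Kpos by (intro mult_left_mono power_mono) auto
      finally show "\<bar>\<phi> x - \<phi> z - T (G 0, 0) \<bullet> (x - z)\<bar> \<le> (K + 1) * (norm (x - z))\<^sup>2"
        unfolding yt(3) .
    qed
  qed (use K in simp)
qed

text \<open>The one-sided propagation is applied to \<open>F\<close> and to \<open>- F\<close>;
  continuity of \<open>F\<close> is itself a consequence of the local bounds.\<close>

lemma local_quadratic_bound_imp_global:
  fixes F :: "real \<Rightarrow> real"
  assumes loc: "\<And>s. s \<in> {0..1} \<Longrightarrow> \<exists>\<delta>>0. \<forall>t\<in>{0..1}. \<bar>t - s\<bar> < \<delta> \<longrightarrow> \<bar>F t - F s - b s * (t - s)\<bar> \<le> C * (t - s)\<^sup>2"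
  shows "\<bar>F 1 - F 0 - b 0\<bar> \<le> C"
proof -
  have cont: "continuous_on {0..1} F"
    unfolding continuous_on_eq_continuous_within
  proof
    fix s :: real assume s: "s \<in> {0..1}"
    obtain \<delta> where \<delta>: "\<delta> > 0" "\<And>t. t \<in> {0..1} \<Longrightarrow> \<bar>t - s\<bar> < \<delta> \<Longrightarrow> \<bar>F t - F s - b s * (t - s)\<bar> \<le> C * (t - s)\<^sup>2"
      using loc[OF s] by blast
    have "((\<lambda>t. F t - F s) \<longlongrightarrow> 0) (at s within {0..1})"
    proof (rule Lim_null_comparison)
      show "\<forall>\<^sub>F t in at s within {0..1}. norm (F t - F s) \<le> \<bar>b s\<bar> * \<bar>t - s\<bar> + C * (t - s)\<^sup>2"
        unfolding eventually_at
      proof (intro exI[of _ \<delta>] conjI ballI impI \<delta>(1))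
        fix t assume t: "t \<in> {0..1}" "t \<noteq> s \<and> dist t s < \<delta>"
        then have "\<bar>F t - F s - b s * (t - s)\<bar> \<le> C * (t - s)\<^sup>2" by (intro \<delta>(2)) (auto simp: dist_real_def)
        then show "norm (F t - F s) \<le> \<bar>b s\<bar> * \<bar>t - s\<bar> + C * (t - s)\<^sup>2"
          unfolding abs_mult[symmetric] by simp
      qed
      have "((\<lambda>t. \<bar>b s\<bar> * \<bar>t - s\<bar> + C * (t - s)\<^sup>2) \<longlongrightarrow> \<bar>b s\<bar> * \<bar>s - s\<bar> + C * (s - s)\<^sup>2) (at s within {0..1})"
        by (intro tendsto_intros)
      then show "((\<lambda>t. \<bar>b s\<bar> * \<bar>t - s\<bar> + C * (t - s)\<^sup>2) \<longlongrightarrow> 0) (at s within {0..1})" by simp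
    qed
    then show "continuous (at s within {0..1}) F" unfolding continuous_within by (simp add: LIM_zero_iff)
  qed
  have "F 0 + b 0 - C \<le> F 1"
  proof (rule locally_semiconvex_lower_bound[OF cont])
    fix s :: real assume s: "s \<in> {0..1}"
    then show "\<exists>\<delta>>0. \<forall>t\<in>{0..1}. \<bar>t - s\<bar> < \<delta> \<longrightarrow> F s + b s * (t - s) - C * (t - s)\<^sup>2 \<le> F t"
      using loc[OF s] by (fastforce simp: abs_le_iff)
  qed
  moreover have "- F 0 + - b 0 - C \<le> - F 1"
  proof (rule locally_semiconvex_lower_bound[where F = "\<lambda>t. - F t" and b = "\<lambda>s. - b s"])
    show "continuous_on {0..1} (\<lambda>t. - F t)" using cont by (rule continuous_on_minus)
    fix s :: real assume s: "s \<in> {0..1}"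
    then show "\<exists>\<delta>>0. \<forall>t\<in>{0..1}. \<bar>t - s\<bar> < \<delta> \<longrightarrow> - F s + - b s * (t - s) - C * (t - s)\<^sup>2 \<le> - F t"
      using loc[OF s] by (fastforce simp: abs_le_iff)
  qed
  ultimately show ?thesis by (simp add: abs_le_iff)
qed

text \<open>
  The local expansions hold on neighbourhoods without a uniform size, so they are propagated along
  the boundary curve lying above the segment from \<open>z\<close> to the projection of \<open>x\<close> on the tangent plane.
\<close>

lemma boundary_taylor_near:
  fixes \<Omega> :: "'a::euclidean_space set"
  assumes \<Omega>: "open \<Omega>" and pos: "0 < R" "0 < \<rho>" "0 \<le> K"
    and N: "\<And>z. z \<in> frontier \<Omega> \<Longrightarrow> ball_normal \<Omega> \<rho> R z (N z)"
    and q: "\<And>z. z \<in> frontier \<Omega> \<Longrightarrow> q z \<bullet> N z = 0 \<and> norm (q z) \<le> K \<and>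
        (\<exists>\<delta>>0. \<forall>x\<in>frontier \<Omega>. norm (x - z) < \<delta> \<longrightarrow> \<bar>\<phi> x - \<phi> z - q z \<bullet> (x - z)\<bar> \<le> (K + 1) * (norm (x - z))\<^sup>2)"
    and z: "z \<in> frontier \<Omega>" and x: "x \<in> frontier \<Omega>" and near: "norm (x - z) \<le> \<rho> / 2"
  shows "\<bar>\<phi> x - \<phi> z - q z \<bullet> (x - z)\<bar> \<le> (5 * (K + 1) + 4 * K / \<rho>) * (norm (x - z))\<^sup>2"
proof -
  define e where "e = N z"
  have ne: "norm e = 1" and bn: "ball_normal \<Omega> \<rho> R z e" using N[OF z] by (auto simp: e_def ball_normal_def)
  have ee: "e \<bullet> e = 1" using ne by (simp add: norm_eq_1)
  define \<tau>x where "\<tau>x = e \<bullet> (x - z)"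
  define w where "w = x - z - \<tau>x *\<^sub>R e"
  have ew: "e \<bullet> w = 0" by (simp add: w_def inner_diff_right ee \<tau>x_def)
  define L where "L = norm w"
  have L0: "0 \<le> L" by (simp add: L_def)
  have Lx: "L \<le> norm (x - z)" using norm_perp_le[OF ne, of "x - z"] by (simp add: L_def w_def \<tau>x_def)
  then have L: "L \<le> \<rho> / 2" using near by simp
  have frn: "y \<notin> \<Omega>" if "y \<in> frontier \<Omega>" for y using that \<Omega> by (simp add: frontier_def interior_open)
  have frc: "y \<in> closure \<Omega>" if "y \<in> frontier \<Omega>" for y using that by (simp add: frontier_def)
  have nsq: "(norm (s *\<^sub>R w + t *\<^sub>R e))\<^sup>2 = s\<^sup>2 * L\<^sup>2 + t\<^sup>2" for s t
    using norm_add_scaled_unit_sq[OF ne, of "s *\<^sub>R w" t] ew by (simp add: L_def power_mult_distrib)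
  \<comment> \<open>\<open>t\<close> is a possible height of the boundary over the point
    \<open>z + s *\<^sub>R w\<close> of the tangent plane.\<close>
  define P where "P s t \<longleftrightarrow> 0 \<le> t \<and> \<rho> * t \<le> s\<^sup>2 * L\<^sup>2 \<and> z + s *\<^sub>R w + t *\<^sub>R e \<in> frontier \<Omega>" for s t
  have P0: "P 0 0" using z by (simp add: P_def)
  have P1: "P 1 \<tau>x"
  proof -
    have t0: "0 \<le> \<tau>x" unfolding \<tau>x_def by (rule ball_normal_nonneg[OF bn frc[OF x] pos(1)])
    have "\<tau>x \<le> norm (x - z)" unfolding \<tau>x_def using norm_cauchy_schwarz[of e "x - z"] ne by simp
    then have "\<tau>x \<le> \<rho>" using near pos by simp
    then have tt: "\<tau>x\<^sup>2 \<le> \<rho> * \<tau>x" unfolding power2_eq_square using t0 by (rule mult_right_mono)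
    have xz: "x - z = 1 *\<^sub>R w + \<tau>x *\<^sub>R e" by (simp add: w_def)
    have "2 * \<rho> * \<tau>x \<le> (norm (x - z))\<^sup>2" unfolding \<tau>x_def by (rule ball_normal_lower[OF bn frn[OF x] pos(2)])
    also have "\<dots> = 1\<^sup>2 * L\<^sup>2 + \<tau>x\<^sup>2" unfolding xz by (rule nsq)
    finally have "\<rho> * \<tau>x \<le> 1\<^sup>2 * L\<^sup>2" using tt by linarith
    then show ?thesis using t0 x by (simp add: P_def w_def)
  qed
  have Ps: "\<exists>t. P s t" if "s \<in> {0..1}" for s
  proof -
    have "norm (s *\<^sub>R w) \<le> \<rho> / 2" using that L L0 mult_right_mono[of s 1 L] by (simp add: L_def)
    then obtain t where "0 \<le> t" "\<rho> * t \<le> (norm (s *\<^sub>R w))\<^sup>2" "z + s *\<^sub>R w + t *\<^sub>R e \<in> frontier \<Omega>"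
      using frontier_point_above[OF bn \<Omega> z pos(1,2), of "s *\<^sub>R w"] ew by auto
    then show ?thesis by (auto simp: P_def L_def power_mult_distrib)
  qed
  \<comment> \<open>The height is an arbitrary choice in between but prescribed at the ends, so that
    the curve runs from \<open>z\<close> to \<open>x\<close>. Its regularity follows from
    \<open>step\<close>.\<close>
  define \<tau> where "\<tau> s = (if s = 0 then 0 else if s = 1 then \<tau>x else SOME t. P s t)" for s :: real
  have P\<tau>: "P s (\<tau> s)" if "s \<in> {0..1}" for s
    using P0 P1 someI_ex[OF Ps[OF that]] by (simp add: \<tau>_def)
  define c where "c s = z + s *\<^sub>R w + \<tau> s *\<^sub>R e" for s
  have c0: "c 0 = z" and c1: "c 1 = x" by (simp_all add: c_def \<tau>_def w_def)
  have cf: "c s \<in> frontier \<Omega>" if "s \<in> {0..1}" for s using P\<tau>[OF that] by (simp add: P_def c_def)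
  have \<tau>b: "0 \<le> \<tau> s" "\<tau> s \<le> \<rho> / 4" if s: "s \<in> {0..1}" for s
  proof -
    show "0 \<le> \<tau> s" using P\<tau>[OF s] by (simp add: P_def)
    have "s\<^sup>2 \<le> 1" using s by (simp add: power_le_one)
    then have "s\<^sup>2 * L\<^sup>2 \<le> 1 * L\<^sup>2" by (rule mult_right_mono) simp
    also have "\<dots> \<le> (\<rho> / 2)\<^sup>2" using L L0 by (simp add: power_mono)
    finally have "\<rho> * \<tau> s \<le> (\<rho> / 2)\<^sup>2" using P\<tau>[OF s] by (simp add: P_def)
    then have "\<rho> * \<tau> s \<le> \<rho> * (\<rho> / 4)" by (simp add: power2_eq_square)
    then show "\<tau> s \<le> \<rho> / 4" using pos(2) by simp
  qed
  define \<nu> where "\<nu> s = N (c s)" for s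
  \<comment> \<open>The slope for which \<open>w + b s *\<^sub>R e\<close> is tangent to the
    boundary at \<open>c s\<close>, that is, orthogonal to \<open>\<nu> s\<close>.\<close>
  define b where "b s = - (\<nu> s \<bullet> w) / (\<nu> s \<bullet> e)" for s
  have step: "(norm (c t - c s))\<^sup>2 \<le> 5 * (L\<^sup>2 * (t - s)\<^sup>2)"
     "\<bar>\<tau> t - \<tau> s - b s * (t - s)\<bar> \<le> 4 / \<rho> * (L\<^sup>2 * (t - s)\<^sup>2)"
    if s: "s \<in> {0..1}" and t: "t \<in> {0..1}" for s t
  proof -
    have bs: "ball_normal \<Omega> \<rho> R (c s) (\<nu> s)" unfolding \<nu>_def by (rule N[OF cf[OF s]])
    have nn: "norm (\<nu> s) = 1" using bs by (simp add: ball_normal_def)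
    define k where "k = \<nu> s \<bullet> e"
    have "\<rho> * (1 - e \<bullet> \<nu> s) \<le> e \<bullet> (c s - z)" by (rule ball_normal_tilt[OF bn bs \<Omega> z pos(1,2)])
    also have "\<dots> = \<tau> s" by (simp add: c_def inner_add_right ew ee)
    also have "\<dots> \<le> \<rho> * (1/4)" using \<tau>b(2)[OF s] by simp
    finally have "1 - e \<bullet> \<nu> s \<le> 1/4" using pos(2) by simp
    \<comment> \<open>The tilt estimate and \<open>\<tau> s \<le> \<rho> / 4\<close> keep the
      normals along the curve close to \<open>e\<close>, which permits the division by
      \<open>k\<close>.\<close>
    then have k: "3/4 \<le> k" by (simp add: k_def inner_commute)
    define \<Delta> d where "\<Delta> = t - s" and "d = \<tau> t - \<tau> s"
    have D: "c t - c s = \<Delta> *\<^sub>R w + d *\<^sub>R e" by (simp add: c_def \<Delta>_def d_def algebra_simps)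
    have nD: "(norm (c t - c s))\<^sup>2 = \<Delta>\<^sup>2 * L\<^sup>2 + d\<^sup>2" unfolding D by (rule nsq)
    define I where "I = \<nu> s \<bullet> (c t - c s)"
    have I: "I = \<Delta> * (\<nu> s \<bullet> w) + d * k" unfolding I_def D by (simp add: inner_add_right k_def)
    have I0: "0 \<le> I" unfolding I_def by (rule ball_normal_nonneg[OF bs frc[OF cf[OF t]] pos(1)])
    have "2 * \<rho> * I \<le> \<Delta>\<^sup>2 * L\<^sup>2 + d\<^sup>2" unfolding I_def nD[symmetric]
      by (rule ball_normal_lower[OF bs frn[OF cf[OF t]] pos(2)])
    then have I2: "I \<le> (\<Delta>\<^sup>2 * L\<^sup>2 + d\<^sup>2) / (2 * \<rho>)" using pos(2) by (simp add: field_simps)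
    have "\<bar>\<nu> s \<bullet> w\<bar> \<le> L" using Cauchy_Schwarz_ineq2[of "\<nu> s" w] nn by (simp add: L_def)
    then have vw: "\<bar>\<Delta> * (\<nu> s \<bullet> w)\<bar> \<le> \<bar>\<Delta>\<bar> * L" unfolding abs_mult by (rule mult_left_mono) simp
    have d1: "\<bar>d\<bar> \<le> \<rho> / 4" using \<tau>b[OF s] \<tau>b[OF t] unfolding d_def by linarith
    have "d\<^sup>2 \<le> \<bar>d\<bar> * (\<rho> / 4)" using mult_left_mono[OF d1, of "\<bar>d\<bar>"] by (simp add: power2_eq_square)
    then have d2: "d\<^sup>2 / (2 * \<rho>) \<le> \<bar>d\<bar> / 8" using pos(2) by (simp add: field_simps)
    have \<Delta>1: "\<bar>\<Delta>\<bar> \<le> 1" using s t by (simp add: \<Delta>_def abs_le_iff)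
    have \<Delta>L: "\<bar>\<Delta>\<bar> * L \<le> \<rho> / 2" using mult_mono[OF \<Delta>1 L] L0 by simp
    have "\<Delta>\<^sup>2 * L\<^sup>2 = (\<bar>\<Delta>\<bar> * L) * (\<bar>\<Delta>\<bar> * L)" by (simp add: power2_eq_square) 
    also have "\<dots> \<le> (\<bar>\<Delta>\<bar> * L) * (\<rho> / 2)" using \<Delta>L L0 by (intro mult_left_mono) auto
    finally have \<Delta>2: "\<Delta>\<^sup>2 * L\<^sup>2 / (2 * \<rho>) \<le> \<bar>\<Delta>\<bar> * L / 4" using pos(2) by (simp add: field_simps)
    have "\<bar>d\<bar> * k = \<bar>I - \<Delta> * (\<nu> s \<bullet> w)\<bar>" using I k by (simp add: abs_mult)
    also have "\<dots> \<le> \<bar>\<Delta>\<bar> * L + (\<Delta>\<^sup>2 * L\<^sup>2 + d\<^sup>2) / (2 * \<rho>)" using I0 I2 vw by linarith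
    also have "\<dots> \<le> \<bar>\<Delta>\<bar> * L + (\<bar>\<Delta>\<bar> * L / 4 + \<bar>d\<bar> / 8)" unfolding add_divide_distrib using \<Delta>2 d2 by linarith
    finally have "\<bar>d\<bar> * k \<le> \<bar>\<Delta>\<bar> * L + (\<bar>\<Delta>\<bar> * L / 4 + \<bar>d\<bar> / 8)" .
    moreover have "\<bar>d\<bar> * (3/4) \<le> \<bar>d\<bar> * k" using k by (intro mult_left_mono) auto
    \<comment> \<open>The quadratic term in \<open>d\<close> has been absorbed on the left by means
      of the a priori bound \<open>\<bar>d\<bar> \<le> \<rho> / 4\<close>.\<close>
    ultimately have d3: "\<bar>d\<bar> \<le> 2 * (\<bar>\<Delta>\<bar> * L)" by linarith
    have "\<bar>d\<bar>\<^sup>2 \<le> (2 * (\<bar>\<Delta>\<bar> * L))\<^sup>2" using d3 by (rule power_mono) simp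
    then have d4: "d\<^sup>2 \<le> 4 * (\<Delta>\<^sup>2 * L\<^sup>2)" by (simp add: power_mult_distrib)
    then show "(norm (c t - c s))\<^sup>2 \<le> 5 * (L\<^sup>2 * (t - s)\<^sup>2)" unfolding nD \<Delta>_def[symmetric] by (simp add: mult.commute)
    have "d - b s * \<Delta> = I / k" using I k by (simp add: b_def k_def[symmetric] field_simps)
    moreover have "I / k \<le> I / (3/4)" using I0 k by (intro divide_left_mono) auto
    moreover have "0 \<le> I / k" using I0 k by simp
    moreover have "I / (3/4) \<le> 4 / \<rho> * (L\<^sup>2 * \<Delta>\<^sup>2)"
    proof -
      define X where "X = (\<Delta>\<^sup>2 * L\<^sup>2) / \<rho>"
      have X0: "0 \<le> X" using pos(2) by (simp add: X_def)
      have "\<Delta>\<^sup>2 * L\<^sup>2 + d\<^sup>2 \<le> 5 * (\<Delta>\<^sup>2 * L\<^sup>2)" using d4 by linarith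
      then have "(\<Delta>\<^sup>2 * L\<^sup>2 + d\<^sup>2) / (2 * \<rho>) \<le> (5 * (\<Delta>\<^sup>2 * L\<^sup>2)) / (2 * \<rho>)"
        using pos(2) by (intro divide_right_mono) auto
      also have "\<dots> = 5/2 * X" by (simp add: X_def)
      finally have "I \<le> 5/2 * X" using I2 by linarith
      moreover have "4 / \<rho> * (L\<^sup>2 * \<Delta>\<^sup>2) = 4 * X" by (simp add: X_def mult.commute)
      ultimately have "I / (3/4) \<le> 4 * X" using X0 by simp
      then show ?thesis using \<open>4 / \<rho> * (L\<^sup>2 * \<Delta>\<^sup>2) = 4 * X\<close> by simp
    qed
    ultimately show "\<bar>\<tau> t - \<tau> s - b s * (t - s)\<bar> \<le> 4 / \<rho> * (L\<^sup>2 * (t - s)\<^sup>2)"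
      unfolding d_def[symmetric] \<Delta>_def[symmetric] by linarith
  qed
  \<comment> \<open>The derivative of \<open>\<phi>\<close> along the tangent of the curve. In
    \<open>C\<close>, the part \<open>5 * (K + 1)\<close> is the error of the local expansion and
    \<open>4 * K / \<rho>\<close> that of replacing the curve by its tangent.\<close>
  define B where "B s = q (c s) \<bullet> w + b s * (q (c s) \<bullet> e)" for s
  define C where "C = (5 * (K + 1) + 4 * K / \<rho>) * L\<^sup>2"
  have "\<bar>\<phi> (c 1) - \<phi> (c 0) - B 0\<bar> \<le> C"
  proof (rule local_quadratic_bound_imp_global[where F = "\<lambda>s. \<phi> (c s)" and b = B])
    fix s :: real assume s: "s \<in> {0..1}"
    obtain \<delta> where \<delta>: "\<delta> > 0"
       "\<And>x. x \<in> frontier \<Omega> \<Longrightarrow> norm (x - c s) < \<delta> \<Longrightarrow> \<bar>\<phi> x - \<phi> (c s) - q (c s) \<bullet> (x - c s)\<bar> \<le> (K + 1) * (norm (x - c s))\<^sup>2"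
      using q[OF cf[OF s]] by blast
    have qe: "\<bar>q (c s) \<bullet> e\<bar> \<le> K" using q[OF cf[OF s]] Cauchy_Schwarz_ineq2[of "q (c s)" e] ne by simp
    show "\<exists>\<delta>>0. \<forall>t\<in>{0..1}. \<bar>t - s\<bar> < \<delta> \<longrightarrow> \<bar>\<phi> (c t) - \<phi> (c s) - B s * (t - s)\<bar> \<le> C * (t - s)\<^sup>2"
    proof (rule exI[of _ "\<delta> / (3 * (L + 1))"], intro conjI ballI impI)
      show "0 < \<delta> / (3 * (L + 1))" using \<delta> L0 by simp
      fix t :: real assume t: "t \<in> {0..1}" "\<bar>t - s\<bar> < \<delta> / (3 * (L + 1))"
      note st = step[OF s t(1)]
      have "(norm (c t - c s))\<^sup>2 \<le> (3 * (L * \<bar>t - s\<bar>))\<^sup>2"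
      proof -
        have "0 \<le> L\<^sup>2 * (t - s)\<^sup>2" by simp
        moreover have "(3 * (L * \<bar>t - s\<bar>))\<^sup>2 = 9 * (L\<^sup>2 * (t - s)\<^sup>2)" by (simp add: power_mult_distrib)
        ultimately show ?thesis using st(1) by linarith
      qed
      then have "norm (c t - c s) \<le> 3 * (L * \<bar>t - s\<bar>)" by (rule power2_le_imp_le) (use L0 in simp)
      also have "\<dots> \<le> 3 * ((L + 1) * \<bar>t - s\<bar>)" by (simp add: mult_right_mono)
      also have "\<dots> = \<bar>t - s\<bar> * (3 * (L + 1))" by (simp add: algebra_simps)
      also have "\<dots> < \<delta>" using t(2) L0 by (simp add: pos_less_divide_eq)
      finally have 1: "\<bar>\<phi> (c t) - \<phi> (c s) - q (c s) \<bullet> (c t - c s)\<bar> \<le> (K + 1) * (norm (c t - c s))\<^sup>2"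
        by (rule \<delta>(2)[OF cf[OF t(1)]])
      have "(K + 1) * (norm (c t - c s))\<^sup>2 \<le> (K + 1) * (5 * (L\<^sup>2 * (t - s)\<^sup>2))"
        by (rule mult_left_mono[OF st(1)]) (use pos in simp)
      moreover have "q (c s) \<bullet> (c t - c s) = B s * (t - s) + (\<tau> t - \<tau> s - b s * (t - s)) * (q (c s) \<bullet> e)"
      proof -
        have eq: "c t - c s = (t - s) *\<^sub>R w + (\<tau> t - \<tau> s) *\<^sub>R e" by (simp add: c_def algebra_simps)
        show ?thesis unfolding eq by (simp add: inner_add_right B_def algebra_simps)
      qed
      moreover have "\<bar>(\<tau> t - \<tau> s - b s * (t - s)) * (q (c s) \<bullet> e)\<bar> \<le> (4 / \<rho> * (L\<^sup>2 * (t - s)\<^sup>2)) * K"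
        unfolding abs_mult by (rule mult_mono[OF st(2) qe]) (use pos in auto)
      ultimately have "\<bar>\<phi> (c t) - \<phi> (c s) - B s * (t - s)\<bar> \<le> (K + 1) * (5 * (L\<^sup>2 * (t - s)\<^sup>2)) + (4 / \<rho> * (L\<^sup>2 * (t - s)\<^sup>2)) * K"
        using 1 by linarith
      also have "\<dots> = C * (t - s)\<^sup>2" by (simp add: C_def algebra_simps)
      finally show "\<bar>\<phi> (c t) - \<phi> (c s) - B s * (t - s)\<bar> \<le> C * (t - s)\<^sup>2" .
    qed
  qed
  moreover have "B 0 = q z \<bullet> (x - z)"
  proof -
    have "q z \<bullet> e = 0" using q[OF z] by (simp add: e_def)
    moreover have "x - z = w + \<tau>x *\<^sub>R e" by (simp add: w_def)
    ultimately show ?thesis by (simp add: B_def c0 inner_add_right)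
  qed
  ultimately have "\<bar>\<phi> x - \<phi> z - q z \<bullet> (x - z)\<bar> \<le> C" by (simp add: c0 c1)
  also have "C \<le> (5 * (K + 1) + 4 * K / \<rho>) * (norm (x - z))\<^sup>2"
    unfolding C_def using Lx L0 pos by (intro mult_left_mono power_mono) auto
  finally show ?thesis .
qed

text \<open>Beyond distance \<open>\<rho> / 2\<close> the plain bounds on \<open>\<phi>\<close> and
  \<open>q\<close> suffice: dividing by powers of \<open>\<rho> / 2\<close> produces the additional
  terms in \<open>K / \<rho>\<close> and \<open>K / \<rho>\<^sup>2\<close>.\<close>

lemma boundary_taylor:
  fixes \<Omega> :: "'a::euclidean_space set"
  assumes \<Omega>: "open \<Omega>" and pos: "0 < R" "0 < \<rho>" "0 \<le> K"
    and N: "\<And>z. z \<in> frontier \<Omega> \<Longrightarrow> ball_normal \<Omega> \<rho> R z (N z)"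
    and jet: "\<And>z. z \<in> frontier \<Omega> \<Longrightarrow> \<exists>q. q \<bullet> N z = 0 \<and> norm q \<le> K \<and> \<bar>\<phi> z\<bar> \<le> K \<and>
        (\<exists>\<delta>>0. \<forall>x\<in>frontier \<Omega>. norm (x - z) < \<delta> \<longrightarrow> \<bar>\<phi> x - \<phi> z - q \<bullet> (x - z)\<bar> \<le> (K + 1) * (norm (x - z))\<^sup>2)"
    and z: "z \<in> frontier \<Omega>"
  obtains q where "q \<bullet> N z = 0" "norm q \<le> K"
    "\<And>x. x \<in> frontier \<Omega> \<Longrightarrow> \<bar>\<phi> x - \<phi> z - q \<bullet> (x - z)\<bar> \<le> (5 * (K + 1) + 6 * K / \<rho> + 8 * K / \<rho>\<^sup>2) * (norm (x - z))\<^sup>2"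
proof -
  obtain q where q: "\<And>z. z \<in> frontier \<Omega> \<Longrightarrow> q z \<bullet> N z = 0 \<and> norm (q z) \<le> K \<and> \<bar>\<phi> z\<bar> \<le> K \<and>
        (\<exists>\<delta>>0. \<forall>x\<in>frontier \<Omega>. norm (x - z) < \<delta> \<longrightarrow> \<bar>\<phi> x - \<phi> z - q z \<bullet> (x - z)\<bar> \<le> (K + 1) * (norm (x - z))\<^sup>2)"
    using jet by metis
  show ?thesis
  proof (rule that[of "q z"])
    show "q z \<bullet> N z = 0" "norm (q z) \<le> K" using q[OF z] by auto
    fix x assume x: "x \<in> frontier \<Omega>"
    define D where "D = norm (x - z)"
    have D0: "0 \<le> D" by (simp add: D_def)
    have nn: "0 \<le> K / \<rho>" "0 \<le> K / \<rho>\<^sup>2" using pos by auto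
    show "\<bar>\<phi> x - \<phi> z - q z \<bullet> (x - z)\<bar> \<le> (5 * (K + 1) + 6 * K / \<rho> + 8 * K / \<rho>\<^sup>2) * (norm (x - z))\<^sup>2"
    proof (cases "D \<le> \<rho> / 2")
      case True
      have "\<bar>\<phi> x - \<phi> z - q z \<bullet> (x - z)\<bar> \<le> (5 * (K + 1) + 4 * K / \<rho>) * (norm (x - z))\<^sup>2"
        by (rule boundary_taylor_near[OF \<Omega> pos N _ z x]) (use q True in \<open>auto simp: D_def\<close>)
      also have "\<dots> \<le> (5 * (K + 1) + 6 * K / \<rho> + 8 * K / \<rho>\<^sup>2) * (norm (x - z))\<^sup>2"
        using nn by (intro mult_right_mono) auto
      finally show ?thesis .
    next
      case False
      have "\<bar>q z \<bullet> (x - z)\<bar> \<le> norm (q z) * norm (x - z)" by (rule Cauchy_Schwarz_ineq2)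
      also have "\<dots> \<le> K * D" using q[OF z] by (simp add: D_def mult_right_mono)
      finally have "\<bar>\<phi> x - \<phi> z - q z \<bullet> (x - z)\<bar> \<le> 2 * K + K * D" using q[OF z] q[OF x] by linarith
      moreover have "1 \<le> 2 * D / \<rho>" using False pos by (simp add: field_simps)
      then have "K * D * 1 \<le> K * D * (2 * D / \<rho>)" using pos D0 by (intro mult_left_mono) auto
      moreover have "1 \<le> (2 * D / \<rho>)\<^sup>2" using \<open>1 \<le> 2 * D / \<rho>\<close> by (simp add: one_le_power)
      then have "2 * K * 1 \<le> 2 * K * (2 * D / \<rho>)\<^sup>2" using pos by (intro mult_left_mono) auto
      ultimately have "\<bar>\<phi> x - \<phi> z - q z \<bullet> (x - z)\<bar> \<le> 2 * K * (2 * D / \<rho>)\<^sup>2 + K * D * (2 * D / \<rho>)" by linarith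
      also have "\<dots> = (2 * K / \<rho> + 8 * K / \<rho>\<^sup>2) * D\<^sup>2" by (simp add: power2_eq_square field_simps)
      also have "\<dots> \<le> (5 * (K + 1) + 6 * K / \<rho> + 8 * K / \<rho>\<^sup>2) * D\<^sup>2"
        using nn pos by (intro mult_right_mono) (auto simp: field_simps)
      finally show ?thesis by (simp add: D_def)
    qed
  qed
qed

section \<open>Barriers\<close>

text \<open>\<open>N\<close> is a choice of inner normal at each boundary point. The barrier
  constants are to depend on \<open>\<rho>\<close>, \<open>R\<close>, \<open>\<alpha>\<close>,
  \<open>lam\<close>, \<open>Lam\<close> and the dimension, while \<open>\<Omega>\<close>,
  \<open>N\<close>, \<open>u\<close> and \<open>f\<close> vary.\<close>

definition ma_data ::
  "'a::euclidean_space set \<Rightarrow> real \<Rightarrow> real \<Rightarrow> ('a \<Rightarrow> 'a) \<Rightarrow> real \<Rightarrow> real \<Rightarrow> real \<Rightarrow> ('a \<Rightarrow> real) \<Rightarrow> ('a \<Rightarrow> real) \<Rightarrow> bool" where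
  "ma_data \<Omega> \<rho> R N \<alpha> lam Lam u f \<longleftrightarrow>
     open \<Omega> \<and> bounded \<Omega> \<and> convex \<Omega> \<and> \<Omega> \<noteq> {} \<and>
     (\<forall>z\<in>frontier \<Omega>. ball_normal \<Omega> \<rho> R z (N z)) \<and>
     continuous_on (closure \<Omega>) u \<and> convex_on (closure \<Omega>) u \<and> alexandrov_solution \<Omega> u f \<and>
     (\<forall>x\<in>\<Omega>. lam * dist_bdry \<Omega> x powr (-\<alpha>) \<le> f x \<and> f x \<le> Lam * dist_bdry \<Omega> x powr (-\<alpha>))"

section \<open>Distance to the boundary and the density near an interior point\<close>

lemma frontier_nonempty_bounded:
  fixes \<Omega> :: "'a::euclidean_space set"
  assumes "bounded \<Omega>" "\<Omega> \<noteq> {}"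
  shows "frontier \<Omega> \<noteq> {}"
  by (rule frontier_not_empty) (use assms not_bounded_UNIV in auto)

lemma dist_bdry_attained:
  fixes \<Omega> :: "'a::euclidean_space set"
  assumes "bounded \<Omega>" "\<Omega> \<noteq> {}"
  obtains z where "z \<in> frontier \<Omega>" "dist_bdry \<Omega> x = norm (x - z)"
  using infdist_attains_inf[OF frontier_closed frontier_nonempty_bounded[OF assms], of x]
  by (auto simp: dist_bdry_def dist_norm)

lemma dist_bdry_le: "z \<in> frontier \<Omega> \<Longrightarrow> dist_bdry \<Omega> x \<le> norm (x - z)"
  unfolding dist_bdry_def dist_norm[symmetric] by (rule infdist_le)

lemma dist_bdry_pos:
  fixes \<Omega> :: "'a::euclidean_space set"
  assumes "open \<Omega>" "bounded \<Omega>" "x \<in> \<Omega>"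
  shows "0 < dist_bdry \<Omega> x"
proof -
  obtain z where z: "z \<in> frontier \<Omega>" "dist_bdry \<Omega> x = norm (x - z)"
    using dist_bdry_attained[OF assms(2)] assms(3) by blast
  have "z \<notin> \<Omega>" using z assms(1) by (simp add: frontier_def interior_open)
  then show ?thesis using z assms(3) by auto
qed

lemma dist_bdry_lipschitz: "dist_bdry \<Omega> x \<le> dist_bdry \<Omega> y + norm (x - y)"
  unfolding dist_bdry_def dist_norm[symmetric] by (metis infdist_triangle)

lemma frontier_on_segment:
  fixes \<Omega> :: "'a::euclidean_space set"
  assumes "x \<in> \<Omega>" "y \<notin> \<Omega>"
  obtains t where "0 \<le> t" "t \<le> 1" "x + t *\<^sub>R (y - x) \<in> frontier \<Omega>"
proof -
  have "connected ((\<lambda>t. x + t *\<^sub>R (y - x)) ` {0..1})"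
    by (rule connected_continuous_image) (auto intro!: continuous_intros)
  then have "(\<lambda>t. x + t *\<^sub>R (y - x)) ` {0..1} \<inter> frontier \<Omega> \<noteq> {}"
  proof (rule connected_Int_frontier)
    show "(\<lambda>t. x + t *\<^sub>R (y - x)) ` {0..1} \<inter> \<Omega> \<noteq> {}"
      using assms by (intro ex_in_conv[THEN iffD1] exI[of _ x]) (auto intro!: image_eqI[of _ _ 0])
    show "(\<lambda>t. x + t *\<^sub>R (y - x)) ` {0..1} - \<Omega> \<noteq> {}"
      using assms by (intro ex_in_conv[THEN iffD1] exI[of _ y]) (auto intro!: image_eqI[of _ _ 1])
  qed
  then show ?thesis using that by auto
qed

lemma dist_bdry_le_outside:
  fixes \<Omega> :: "'a::euclidean_space set"
  assumes "x \<in> \<Omega>" "y \<notin> \<Omega>"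
  shows "dist_bdry \<Omega> x \<le> norm (x - y)"
proof -
  obtain t where t: "0 \<le> t" "t \<le> 1" "x + t *\<^sub>R (y - x) \<in> frontier \<Omega>" using frontier_on_segment[OF assms] by blast
  have "dist_bdry \<Omega> x \<le> norm (x - (x + t *\<^sub>R (y - x)))" by (rule dist_bdry_le[OF t(3)])
  also have "\<dots> = t * norm (x - y)" using t by (simp add: norm_minus_commute)
  also have "\<dots> \<le> norm (x - y)" using t by (simp add: mult_left_le_one_le)
  finally show ?thesis .
qed

lemma dist_bdry_ball_subset:
  fixes \<Omega> :: "'a::euclidean_space set"
  assumes "x \<in> \<Omega>"
  shows "ball x (dist_bdry \<Omega> x) \<subseteq> \<Omega>"
  using dist_bdry_le_outside[OF assms] by (fastforce simp: dist_norm not_le[symmetric])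

text \<open>The foot of the perpendicular from \<open>x\<close> to the supporting plane at
  \<open>z\<close> lies outside \<open>\<Omega>\<close>.\<close>

lemma dist_bdry_le_height:
  fixes \<Omega> :: "'a::euclidean_space set"
  assumes n: "ball_normal \<Omega> \<rho> R z \<nu>" and \<Omega>: "open \<Omega>" "z \<in> frontier \<Omega>" "x \<in> \<Omega>" and R: "0 < R"
  shows "dist_bdry \<Omega> x \<le> \<nu> \<bullet> (x - z)"
proof -
  define t where "t = \<nu> \<bullet> (x - z)"
  have nn: "norm \<nu> = 1" using n by (simp add: ball_normal_def)
  have t: "0 < t" unfolding t_def by (rule ball_normal_pos[OF n \<Omega> R])
  have "\<nu> \<bullet> (x - t *\<^sub>R \<nu> - z) = 0" using nn dot_square_norm[of \<nu>] by (simp add: inner_diff_right t_def)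
  then have "x - t *\<^sub>R \<nu> \<notin> \<Omega>" using ball_normal_pos[OF n \<Omega>(1,2) _ R] by fastforce
  from dist_bdry_le_outside[OF \<Omega>(3) this] show ?thesis using nn t by (simp add: t_def)
qed

lemma dist_bdry_near:
  assumes "0 < d1" "d1 = dist_bdry \<Omega> x1" "norm (x - x1) < d1 / 2"
  shows "d1 / 2 \<le> dist_bdry \<Omega> x" "dist_bdry \<Omega> x \<le> 2 * d1"
  using dist_bdry_lipschitz[of \<Omega> x1 x] dist_bdry_lipschitz[of \<Omega> x x1] assms
  by (auto simp: norm_minus_commute)

text \<open>Within half the distance to the boundary that distance changes by a factor at most 2,
  hence its power by at most \<open>2 powr \<alpha> \<le> 4\<close>. On such a ball the density has
  the constant bounds that the touching lemmas require.\<close>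

lemma ma_data_density_near:
  fixes \<Omega> :: "'a::euclidean_space set"
  assumes ma: "ma_data \<Omega> \<rho> R N \<alpha> lam Lam u f" and \<alpha>: "1 \<le> \<alpha>" "\<alpha> < 2" and lam: "0 < lam" "0 < Lam"
    and x1: "x1 \<in> \<Omega>" and x: "norm (x - x1) < dist_bdry \<Omega> x1 / 2"
  shows "lam / 4 * dist_bdry \<Omega> x1 powr (-\<alpha>) \<le> f x" "f x \<le> 4 * Lam * dist_bdry \<Omega> x1 powr (-\<alpha>)"
proof -
  define d1 where "d1 = dist_bdry \<Omega> x1"
  have d1: "0 < d1" unfolding d1_def by (rule dist_bdry_pos) (use ma x1 in \<open>auto simp: ma_data_def\<close>)
  have d: "d1 / 2 \<le> dist_bdry \<Omega> x" "dist_bdry \<Omega> x \<le> 2 * d1"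
    using dist_bdry_near[OF d1 d1_def] x by (auto simp: d1_def)
  have "x \<in> ball x1 (dist_bdry \<Omega> x1)" using x d1 by (simp add: dist_norm d1_def norm_minus_commute)
  then have "x \<in> \<Omega>" using dist_bdry_ball_subset[OF x1] by blast
  then have f: "lam * dist_bdry \<Omega> x powr (-\<alpha>) \<le> f x" "f x \<le> Lam * dist_bdry \<Omega> x powr (-\<alpha>)"
    using ma by (auto simp: ma_data_def)
  have p4: "2 powr \<alpha> \<le> 4"
  proof -
    have "(2::real) powr \<alpha> \<le> 2 powr 2" using \<alpha> by (intro powr_mono) auto
    then show ?thesis by simp
  qed
  have "(1/4) * d1 powr (-\<alpha>) \<le> 2 powr (-\<alpha>) * d1 powr (-\<alpha>)"
    using p4 by (intro mult_right_mono) (simp_all add: powr_minus field_simps)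
  also have "\<dots> = (2 * d1) powr (-\<alpha>)" using d1 by (simp add: powr_mult)
  also have "\<dots> \<le> dist_bdry \<Omega> x powr (-\<alpha>)" using d d1 \<alpha> by (intro powr_mono2') auto
  finally have "lam * ((1/4) * d1 powr (-\<alpha>)) \<le> lam * dist_bdry \<Omega> x powr (-\<alpha>)" using lam by (intro mult_left_mono) auto
  then show "lam / 4 * dist_bdry \<Omega> x1 powr (-\<alpha>) \<le> f x" using f by (simp add: d1_def)
  have "dist_bdry \<Omega> x powr (-\<alpha>) \<le> (d1 / 2) powr (-\<alpha>)" using d d1 \<alpha> by (intro powr_mono2') auto
  also have "\<dots> = 2 powr \<alpha> * d1 powr (-\<alpha>)" using d1 by (simp add: powr_divide powr_minus field_simps)
  also have "\<dots> \<le> 4 * d1 powr (-\<alpha>)" using p4 by (intro mult_right_mono) auto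
  finally have "Lam * dist_bdry \<Omega> x powr (-\<alpha>) \<le> Lam * (4 * d1 powr (-\<alpha>))" using lam by (intro mult_left_mono) auto
  then show "f x \<le> 4 * Lam * dist_bdry \<Omega> x1 powr (-\<alpha>)" using f by (simp add: d1_def)
qed

text \<open>\<open>F2\<close> stands for minus the second derivative of \<open>F\<close>. Up to
  curvature factors the product with \<open>F' r ^ (n - 1)\<close> is the Hessian determinant of
  \<open>- F\<close> composed with the distance: one normal and \<open>n - 1\<close> tangential
  directions. The bound \<open>c1\<close> serves far from the boundary, where only the tangential
  curvatures are used.\<close>

definition lower_profile :: "nat \<Rightarrow> real \<Rightarrow> real \<Rightarrow> (real \<Rightarrow> real) \<Rightarrow> bool" where
  "lower_profile n \<alpha> R F \<longleftrightarrow> F 0 = 0 \<and> continuous_on {0..R/2} F \<and>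
     (\<exists>F' F2 c0 c1. 0 < c0 \<and> 0 < c1 \<and>
       (\<forall>r\<in>{0<..<R}. (F has_real_derivative F' r) (at r) \<and> (F' has_real_derivative - F2 r) (at r) \<and>
          c1 \<le> F' r \<and> 0 < F2 r \<and> c0 * r powr (-\<alpha>) \<le> F2 r * F' r ^ (n - 1)))"

text \<open>
  Each ball of radius \<open>R\<close> that contains \<open>\<Omega>\<close> gives a smooth function \<open>-A F(\<rho>\<^sub>c)\<close>. It has a large
  Monge-Ampere density only where \<open>\<rho>\<^sub>c\<close> is comparable to the distance to the boundary, so \<open>v + A F(\<rho>\<^sub>c)\<close>
  is minimised simultaneously over the point and the centre \<open>c\<close> of the ball.
\<close>

lemma lower_barrier:
  assumes prof: "lower_profile (DIM('a::euclidean_space)) \<alpha> R F" and R: "0 < R"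
    and \<alpha>: "1 \<le> \<alpha>" "\<alpha> < 2" and lam: "0 < lam" "0 < Lam"
  obtains A where "0 < A"
    "\<And>(\<Omega> :: 'a set) \<rho> N u f a b x. \<lbrakk>ma_data \<Omega> \<rho> R N \<alpha> lam Lam u f;
        \<And>x. x \<in> frontier \<Omega> \<Longrightarrow> a \<bullet> x + b \<le> u x; x \<in> \<Omega>\<rbrakk>
      \<Longrightarrow> \<exists>r. 0 < r \<and> r \<le> R / 2 \<and> r \<le> dist_bdry \<Omega> x \<and> a \<bullet> x + b - A * F r \<le> u x"
proof -
  let ?n = "DIM('a)"
  obtain F' F2 c0 c1 where F0: "F 0 = 0" and Fc: "continuous_on {0..R/2} F" and c: "0 < c0" "0 < c1"
    and Fall: "\<forall>r\<in>{0<..<R}. (F has_real_derivative F' r) (at r) \<and> (F' has_real_derivative - F2 r) (at r) \<and>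
          c1 \<le> F' r \<and> 0 < F2 r \<and> c0 * r powr (-\<alpha>) \<le> F2 r * F' r ^ (?n - 1)"
    using prof unfolding lower_profile_def by blast
  have F: "\<And>r. 0 < r \<Longrightarrow> r < R \<Longrightarrow> (F has_real_derivative F' r) (at r)"
      "\<And>r. 0 < r \<Longrightarrow> r < R \<Longrightarrow> (F' has_real_derivative - F2 r) (at r)"
      "\<And>r. 0 < r \<Longrightarrow> r < R \<Longrightarrow> c1 \<le> F' r" "\<And>r. 0 < r \<Longrightarrow> r < R \<Longrightarrow> 0 < F2 r"
      "\<And>r. 0 < r \<Longrightarrow> r < R \<Longrightarrow> c0 * r powr (-\<alpha>) \<le> F2 r * F' r ^ (?n - 1)"
    using Fall by auto
  have Fmono: "F r < F s" if "0 \<le> r" "r < s" "s \<le> R / 2" for r s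
  proof (rule DERIV_pos_imp_increasing_open[OF that(2)])
    show "\<exists>y. DERIV F x :> y \<and> y > 0" if "r < x" "x < s" for x
      using F(1,3)[of x] that \<open>0 \<le> r\<close> \<open>s \<le> R/2\<close> c R by (intro exI[of _ "F' x"]) force
    show "continuous_on {r..s} F" using Fc by (rule continuous_on_subset) (use that in auto)
  qed
  obtain C where C: "0 < C" "\<And>\<Omega> u f (x1::'a) p e A B lo hi r.
      \<lbrakk>convex_on \<Omega> u; alexandrov_solution \<Omega> u f; continuous_on (ball x1 r) u; norm e = 1;
       0 \<le> A; 0 < B; 0 < r; ball x1 r \<subseteq> \<Omega>; 0 < lo;
       \<And>x. x \<in> ball x1 r \<Longrightarrow> lo \<le> f x \<and> f x \<le> hi;
       \<And>y. norm y < r \<Longrightarrow> u x1 + p \<bullet> y + A * (e \<bullet> y)\<^sup>2 + B * (norm y)\<^sup>2 \<le> u (x1 + y)\<rbrakk>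
      \<Longrightarrow> (A + B) * B ^ (?n - 1) \<le> C * hi"
    using touching_from_below[where 'a = 'a] by blast
  \<comment> \<open>\<open>k1\<close> and \<open>k2\<close> are the coefficients of
    \<open>A ^ n\<close> in the determinant of the barrier near the sphere and deep inside it. Since
    \<open>A \<ge> 1\<close> gives \<open>A \<le> A ^ n\<close>, linear conditions on
    \<open>A\<close> are enough.\<close>
  define k1 where "k1 = c0 / (16 * (4 * R) ^ (?n - 1))"
  define k2 where "k2 = (c1 / (4 * R)) ^ ?n * (R / 4) powr \<alpha>"
  have k: "0 < k1" "0 < k2" using c R by (auto simp: k1_def k2_def)
  define A where "A = max 1 (max (8 * C * Lam / k1) (8 * C * Lam / k2))"
  have A1: "1 \<le> A" and A: "0 < A" by (auto simp: A_def)
  have An: "A \<le> A ^ ?n" using A1 by (simp add: self_le_power)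
  have "8 * C * Lam / k1 \<le> A" unfolding A_def by simp
  then have Ak1: "8 * C * Lam \<le> A * k1" using k by (simp only: pos_divide_le_eq)
  have "8 * C * Lam / k2 \<le> A" unfolding A_def by simp
  then have Ak2: "8 * C * Lam \<le> A * k2" using k by (simp only: pos_divide_le_eq)
  show ?thesis
  proof (rule that[OF A])
    fix \<Omega> :: "'a set" and \<rho> N u f a b x
    assume ma: "ma_data \<Omega> \<rho> R N \<alpha> lam Lam u f" and bd: "\<And>x. x \<in> frontier \<Omega> \<Longrightarrow> a \<bullet> x + b \<le> u x" and xO: "x \<in> \<Omega>"
    have \<Omega>: "open \<Omega>" "bounded \<Omega>" "convex \<Omega>" "\<Omega> \<noteq> {}" and N: "\<And>z. z \<in> frontier \<Omega> \<Longrightarrow> ball_normal \<Omega> \<rho> R z (N z)"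
      and uc: "continuous_on (closure \<Omega>) u" and ucv: "convex_on (closure \<Omega>) u" and MA: "alexandrov_solution \<Omega> u f"
      using ma by (auto simp: ma_data_def)
    have cvO: "convex_on \<Omega> u" using ucv closure_subset convex_on_subset \<Omega>(3) by blast
    \<comment> \<open>A smooth substitute for the distance to the sphere of radius \<open>R\<close>
      about \<open>c\<close>: it vanishes on the sphere, has gradient of norm 1 there, and never
      exceeds \<open>R / 2\<close>.\<close>
    define \<rho>f where "\<rho>f c y = (R\<^sup>2 - (norm (y - c))\<^sup>2) / (2 * R)" for c y :: 'a
    define Z where "Z = {c. \<forall>y\<in>closure \<Omega>. norm (y - c) \<le> R}"
    define J where "J p = u (fst p) - (a \<bullet> fst p + b) + A * F (\<rho>f (snd p) (fst p))" for p :: "'a \<times> 'a"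
    have rng: "0 \<le> \<rho>f c y \<and> \<rho>f c y \<le> R / 2" if "c \<in> Z" "y \<in> closure \<Omega>" for c y
    proof -
      have "norm (y - c) \<le> R" using that by (simp add: Z_def)
      then have "(norm (y - c))\<^sup>2 \<le> R\<^sup>2" by (simp add: power_mono)
      then have "0 \<le> \<rho>f c y" unfolding \<rho>f_def using R by simp
      moreover have "\<rho>f c y \<le> R\<^sup>2 / (2 * R)" unfolding \<rho>f_def using R by (intro divide_right_mono) auto
      ultimately show ?thesis using R by (simp add: power2_eq_square)
    qed
    have ZN: "z + R *\<^sub>R N z \<in> Z" "\<rho>f (z + R *\<^sub>R N z) y \<le> norm (y - z)" if z: "z \<in> frontier \<Omega>" for z y
    proof -
      have nn: "norm (N z) = 1" using N[OF z] by (simp add: ball_normal_def)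
      show "z + R *\<^sub>R N z \<in> Z"
        using N[OF z] by (auto simp: ball_normal_def Z_def dist_norm norm_minus_commute)
      have eq: "y - (z + R *\<^sub>R N z) = (y - z) + (- R) *\<^sub>R N z" by simp
      have "(norm (y - (z + R *\<^sub>R N z)))\<^sup>2 = (norm (y - z))\<^sup>2 - 2 * R * (N z \<bullet> (y - z)) + R\<^sup>2"
        unfolding eq norm_add_scaled_unit_sq[OF nn] by simp
      then have "\<rho>f (z + R *\<^sub>R N z) y = N z \<bullet> (y - z) - (norm (y - z))\<^sup>2 / (2 * R)"
        unfolding \<rho>f_def using R by (simp add: field_simps)
      also have "\<dots> \<le> N z \<bullet> (y - z)" using R by simp
      also have "\<dots> \<le> norm (y - z)" using norm_cauchy_schwarz[of "N z" "y - z"] nn by simp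
      finally show "\<rho>f (z + R *\<^sub>R N z) y \<le> norm (y - z)" .
    qed
    have "compact (closure \<Omega>)" using \<Omega> by (simp add: compact_closure)
    moreover have "compact Z"
    proof -
      have Z_eq: "Z = (\<Inter>y\<in>closure \<Omega>. cball y R)" by (auto simp: Z_def dist_norm)
      have "x \<in> closure \<Omega>" using xO closure_subset by blast
      then have "Z \<subseteq> cball x R" unfolding Z_eq by blast
      then have "bounded Z" using bounded_cball bounded_subset by blast
      moreover have "closed Z" unfolding Z_eq by (intro closed_INT) auto
      ultimately show ?thesis by (simp add: compact_eq_bounded_closed)
    qed
    ultimately have cK: "compact (closure \<Omega> \<times> Z)" by (rule compact_Times)
    obtain z0 where z0: "z0 \<in> frontier \<Omega>" using frontier_nonempty_bounded[OF \<Omega>(2,4)] by blast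
    have ne: "closure \<Omega> \<times> Z \<noteq> {}" using ZN(1)[OF z0] \<Omega>(4) by auto
    have Jc: "continuous_on (closure \<Omega> \<times> Z) J"
    proof -
      have 1: "continuous_on (closure \<Omega> \<times> Z) (\<lambda>p. u (fst p))"
        by (rule continuous_on_compose2[OF uc]) (auto intro!: continuous_intros)
      have 2: "continuous_on (closure \<Omega> \<times> Z) (\<lambda>p. F (\<rho>f (snd p) (fst p)))"
        by (rule continuous_on_compose2[OF Fc]) (use rng R in \<open>auto simp: \<rho>f_def intro!: continuous_intros\<close>)
      show ?thesis unfolding J_def by (intro continuous_intros 1 2)
    qed
    obtain p where p: "p \<in> closure \<Omega> \<times> Z" "\<And>p'. p' \<in> closure \<Omega> \<times> Z \<Longrightarrow> J p \<le> J p'"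
      using continuous_attains_inf[OF cK ne Jc] by blast
    define x1 c1' where "x1 = fst p" and "c1' = snd p"
    have x1c: "x1 \<in> closure \<Omega>" and c1Z: "c1' \<in> Z" using p by (auto simp: x1_def c1'_def)
    have Jmin: "J (x1, c1') \<le> J (y, c)" if "y \<in> closure \<Omega>" "c \<in> Z" for y c
      using p that by (simp add: x1_def c1'_def)
    \<comment> \<open>If the minimum were negative, \<open>x1\<close> would be interior, and
      minimality in the point would bound \<open>u\<close> from below near \<open>x1\<close> by a
      quadratic with too large a determinant for the density.\<close>
    have J0: "0 \<le> J (x1, c1')"
    proof (rule ccontr)
      assume neg: "\<not> 0 \<le> J (x1, c1')"
      define r1 where "r1 = \<rho>f c1' x1"
      have "0 \<le> F r1" using Fmono[of 0 r1] rng[OF c1Z x1c] F0 by (cases "r1 = 0") (auto simp: r1_def)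
      then have "0 \<le> A * F r1" using A by simp
      then have "u x1 < a \<bullet> x1 + b" using neg unfolding J_def r1_def fst_conv snd_conv by linarith
      then have "x1 \<notin> frontier \<Omega>" using bd by fastforce
      then have x1O: "x1 \<in> \<Omega>" using x1c \<Omega>(1) by (simp add: frontier_def interior_open)
      define d1 where "d1 = dist_bdry \<Omega> x1"
      have d1: "0 < d1" unfolding d1_def by (rule dist_bdry_pos[OF \<Omega>(1,2) x1O])
      \<comment> \<open>Minimality in the centre: the ball tangent at the nearest boundary point
        competes, and for it \<open>\<rho>f\<close> is at most the distance. This is what bounds the
        density near \<open>x1\<close> by a multiple of \<open>r1 powr (- \<alpha>)\<close>.\<close>
      have r1d: "r1 \<le> d1"
      proof -
        obtain z where z: "z \<in> frontier \<Omega>" "dist_bdry \<Omega> x1 = norm (x1 - z)" using dist_bdry_attained[OF \<Omega>(2,4)] by blast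
        have "J (x1, c1') \<le> J (x1, z + R *\<^sub>R N z)" by (rule Jmin[OF x1c ZN(1)[OF z(1)]])
        then have "F r1 \<le> F (\<rho>f (z + R *\<^sub>R N z) x1)" using A by (simp add: J_def r1_def)
        then have "r1 \<le> \<rho>f (z + R *\<^sub>R N z) x1"
          using Fmono[of "\<rho>f (z + R *\<^sub>R N z) x1" r1] rng[OF ZN(1)[OF z(1)] x1c] rng[OF c1Z x1c] by (force simp: r1_def)
        then show ?thesis using ZN(2)[OF z(1), of x1] z(2) by (simp add: d1_def)
      qed
      \<comment> \<open>The gradient of \<open>\<rho>f c1'\<close> at \<open>x1\<close>. It
        degenerates at the centre of the ball, hence the later case distinction on its size.\<close>
      define E where "E = (- 1 / R) *\<^sub>R (x1 - c1')"
      have r1E: "r1 = R / 2 * (1 - (norm E)\<^sup>2)"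
      proof -
        have "(norm E)\<^sup>2 = (norm (x1 - c1'))\<^sup>2 / R\<^sup>2" by (simp add: E_def power_divide)
        then show ?thesis using R by (simp add: r1_def \<rho>f_def power2_eq_square field_simps)
      qed
      have r1: "0 < r1" "r1 < R"
      proof -
        have "\<Omega> \<subseteq> cball c1' R" using c1Z closure_subset[of \<Omega>] by (auto simp: Z_def dist_norm norm_minus_commute)
        then have "\<Omega> \<subseteq> ball c1' R" using interior_maximal[OF _ \<Omega>(1), of "cball c1' R"] by simp
        then have "norm (x1 - c1') < R" using x1O by (auto simp: dist_norm norm_minus_commute)
        then have "(norm (x1 - c1'))\<^sup>2 < R\<^sup>2" by (simp add: power_strict_mono)
        then show "0 < r1" using R by (simp add: r1_def \<rho>f_def)
        show "r1 < R" using rng[OF c1Z x1c] R by (simp add: r1_def)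
      qed
      define G1 G2 where "G1 = F' r1" and "G2 = F2 r1"
      have G1: "c1 \<le> G1" and G2: "0 < G2" and G12: "c0 * r1 powr (-\<alpha>) \<le> G2 * G1 ^ (?n - 1)"
        using F(3-5)[OF r1] by (auto simp: G1_def G2_def)
      have G1p: "0 < G1" using G1 c by simp
      obtain \<delta> where \<delta>: "0 < \<delta>"
         "\<And>y. norm y < \<delta> \<Longrightarrow> \<bar>F (r1 + y) - F r1 - F' r1 \<bullet> y - (y \<bullet> (- F2 r1 * y)) / 2\<bar> \<le> (G2 / 4) * (norm y)\<^sup>2"
      proof (rule second_order_expansion[where f = F and G = F' and ?x0.0 = r1 and r = "min r1 (R - r1)" and H = "\<lambda>y. - F2 r1 * y" and e = "G2 / 4"])
        show "0 < min r1 (R - r1)" using r1 by simp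
        show "GDERIV F y :> F' y" if "y \<in> ball r1 (min r1 (R - r1))" for y
          using that F(1)[of y] by (auto simp: dist_real_def)
        show "(F' has_derivative (\<lambda>y. - F2 r1 * y)) (at r1)"
          using F(2)[OF r1] unfolding has_field_derivative_def .
        show "0 < G2 / 4" using G2 by simp
      qed (use that in blast)
      have Fup: "F (r1 + \<sigma>) \<le> F r1 + G1 * \<sigma> - G2 / 4 * \<sigma>\<^sup>2" if "\<bar>\<sigma>\<bar> < \<delta>" for \<sigma>
      proof -
        have "\<bar>F (r1 + \<sigma>) - F r1 - G1 * \<sigma> + G2 / 2 * \<sigma>\<^sup>2\<bar> \<le> (G2 / 4) * \<sigma>\<^sup>2"
          using \<delta>(2)[of \<sigma>] that by (simp add: G1_def G2_def power2_eq_square algebra_simps)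
        then show ?thesis by linarith
      qed
      have nE: "norm E \<le> 1"
      proof -
        have "0 < R / 2 * (1 - (norm E)\<^sup>2)" using r1(1) unfolding r1E .
        then have "0 < 1 - (norm E)\<^sup>2" by (rule zero_less_mult_pos) (use R in simp)
        then have "(norm E)\<^sup>2 < 1\<^sup>2" by simp
        then have "norm E < 1" by (rule power2_less_imp_less) simp
        then show ?thesis by simp
      qed
      \<comment> \<open>Any unit vector serves when \<open>E = 0\<close>, since \<open>Aq\<close>
        vanishes then.\<close>
      define e where "e = (if E = 0 then (SOME i. i \<in> Basis) else (1 / norm E) *\<^sub>R E)"
      have e: "norm e = 1" by (auto simp: e_def SOME_Basis)
      have Ee: "E = norm E *\<^sub>R e" by (simp add: e_def)
      \<comment> \<open>The bounds keep the ball in the region of comparable density, make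
        \<open>norm y\<close> at most 1, keep \<open>\<sigma>\<close> in the range of the expansion
        of \<open>F\<close>, and let the error of fourth order be absorbed by half of the tangential
        term.\<close>
      define r where "r = min (d1 / 2) (min 1 (min (\<delta> / (2 * (1 + 1 / R))) (2 * R * sqrt (G1 / (R * G2)))))"
      have rpos: "0 < r" using d1 \<delta> R G1p G2 by (simp add: r_def add_pos_pos)
      have rle: "r \<le> d1 / 2" "r \<le> 1" "r \<le> \<delta> / (2 * (1 + 1 / R))" "r \<le> 2 * R * sqrt (G1 / (R * G2))"
        unfolding r_def by linarith+
      \<comment> \<open>\<open>Aq\<close> comes from the concavity of \<open>F\<close> in direction
        \<open>E\<close>, \<open>Bq\<close> from the curvature of the spheres on which
        \<open>\<rho>f\<close> is constant, each after the losses in the expansion.\<close>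
      define Aq Bq where "Aq = A * G2 / 8 * (norm E)\<^sup>2" and "Bq = A * G1 / (4 * R)"
      have Aq0: "0 \<le> Aq" and Bq0: "0 < Bq" using A G2 G1p R by (auto simp: A_def Aq_def Bq_def)
      define q where "q = a - (A * G1) *\<^sub>R E"
      have touch: "u x1 + q \<bullet> y + Aq * (e \<bullet> y)\<^sup>2 + Bq * (norm y)\<^sup>2 \<le> u (x1 + y)" if y: "norm y < r" for y
      proof -
        have yc: "x1 + y \<in> closure \<Omega>"
        proof -
          have "x1 + y \<in> ball x1 (dist_bdry \<Omega> x1)" using y rle(1) d1 by (simp add: dist_norm d1_def)
          then show ?thesis using dist_bdry_ball_subset[OF x1O] closure_subset by blast
        qed
        define \<sigma> where "\<sigma> = E \<bullet> y - (norm y)\<^sup>2 / (2 * R)"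
        have \<rho>y: "\<rho>f c1' (x1 + y) = r1 + \<sigma>"
        proof -
          have gen: "(R\<^sup>2 - (n + 2 * i + m)) / (2 * R) = (R\<^sup>2 - n) / (2 * R) + (- (i / R) - m / (2 * R))" for n i m :: real
            using R by (simp add: field_simps)
          have eq: "x1 + y - c1' = (x1 - c1') + y" by simp
          have nq: "(norm ((x1 - c1') + y))\<^sup>2 = (norm (x1 - c1'))\<^sup>2 + 2 * ((x1 - c1') \<bullet> y) + (norm y)\<^sup>2"
            using dot_norm[of "x1 - c1'" y] by (simp add: field_simps)
          have Ey: "E \<bullet> y = - (((x1 - c1') \<bullet> y) / R)" by (simp add: E_def)
          show ?thesis unfolding \<rho>f_def eq r1_def \<sigma>_def nq Ey by (rule gen)
        qed
        have Ey: "\<bar>E \<bullet> y\<bar> \<le> norm y"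
          using Cauchy_Schwarz_ineq2[of E y] mult_right_mono[OF nE, of "norm y"] by simp
        have y1: "(norm y)\<^sup>2 \<le> norm y * 1" unfolding power2_eq_square using y rle(2) by (intro mult_left_mono) auto
        have "\<bar>\<sigma>\<bar> \<le> norm y + norm y / (2 * R)"
        proof -
          have "(norm y)\<^sup>2 / (2 * R) \<le> norm y / (2 * R)" using y1 R by (intro divide_right_mono) auto
          moreover have "0 \<le> (norm y)\<^sup>2 / (2 * R)" using R by simp
          ultimately show ?thesis using Ey unfolding \<sigma>_def by linarith
        qed
        also have "\<dots> \<le> norm y * (1 + 1 / R)" using R by (simp add: field_simps)
        also have "\<dots> < \<delta>"
        proof -
          have "norm y * (1 + 1 / R) \<le> \<delta> / (2 * (1 + 1 / R)) * (1 + 1 / R)"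
            using y rle(3) R by (intro mult_right_mono) auto
          also have "\<dots> = \<delta> / 2"
          proof -
            have gen: "\<delta> / (2 * k) * k = \<delta> / 2" if "k \<noteq> 0" for k using that by simp
            show ?thesis by (rule gen) (use R in \<open>simp add: add_pos_pos less_imp_neq[symmetric]\<close>)
          qed
          finally show ?thesis using \<delta>(1) by linarith
        qed
        finally have s\<delta>: "\<bar>\<sigma>\<bar> < \<delta>" .
        have "J (x1, c1') \<le> J (x1 + y, c1')" by (rule Jmin[OF yc c1Z])
        then have "u x1 - (a \<bullet> x1 + b) + A * F r1 \<le> u (x1 + y) - (a \<bullet> (x1 + y) + b) + A * F (r1 + \<sigma>)"
          by (simp add: J_def \<rho>y r1_def)
        moreover have "A * F (r1 + \<sigma>) \<le> A * (F r1 + G1 * \<sigma> - G2 / 4 * \<sigma>\<^sup>2)"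
          using Fup[OF s\<delta>] A by (intro mult_left_mono) auto
        ultimately have 1: "u x1 + a \<bullet> y - A * (G1 * \<sigma> - G2 / 4 * \<sigma>\<^sup>2) \<le> u (x1 + y)"
          by (simp add: inner_add_right algebra_simps)
        define M where "M = (norm y)\<^sup>2"
        have M0: "0 \<le> M" by (simp add: M_def)
        \<comment> \<open>The concavity of \<open>F\<close> controls \<open>\<sigma>\<close> and not
          \<open>E \<bullet> y\<close>; the two differ by a term quadratic in
          \<open>y\<close>.\<close>
        have "(E \<bullet> y)\<^sup>2 = (\<sigma> + M / (2 * R))\<^sup>2" by (simp add: \<sigma>_def M_def)
        also have "\<dots> \<le> 2 * \<sigma>\<^sup>2 + 2 * (M / (2 * R))\<^sup>2" using zero_le_power2[of "\<sigma> - M / (2 * R)"] by (simp add: power2_sum power2_diff)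
        finally have 2: "(E \<bullet> y)\<^sup>2 / 2 - (M / (2 * R))\<^sup>2 \<le> \<sigma>\<^sup>2" by simp
        have 3: "G2 / 4 * (M / (2 * R))\<^sup>2 \<le> G1 / (4 * R) * M"
        proof -
          have "M \<le> r\<^sup>2" unfolding M_def using y by (intro power_mono) auto
          also have "\<dots> \<le> (2 * R * sqrt (G1 / (R * G2)))\<^sup>2" using rle(4) rpos by (intro power_mono) auto
          also have "\<dots> = 4 * R\<^sup>2 * (G1 / (R * G2))" using R G1p G2 by (simp add: power_mult_distrib)
          finally have "M * (M * G2) \<le> 4 * R\<^sup>2 * (G1 / (R * G2)) * (M * G2)"
            using M0 G2 by (intro mult_right_mono) auto
          also have "\<dots> = 4 * R * G1 * M" using R G2 by (simp add: power2_eq_square)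
          finally show ?thesis using R by (simp add: power2_eq_square field_simps)
        qed
        have 4: "G1 * \<sigma> = G1 * (E \<bullet> y) - G1 / (2 * R) * M" by (simp add: \<sigma>_def M_def algebra_simps)
        have "G2 / 4 * ((E \<bullet> y)\<^sup>2 / 2 - (M / (2 * R))\<^sup>2) \<le> G2 / 4 * \<sigma>\<^sup>2" using 2 G2 by (intro mult_left_mono) auto
        then have "G1 * \<sigma> - G2 / 4 * \<sigma>\<^sup>2 \<le> G1 * (E \<bullet> y) - G1 / (4 * R) * M - G2 / 8 * (E \<bullet> y)\<^sup>2"
        proof -
          assume "G2 / 4 * ((E \<bullet> y)\<^sup>2 / 2 - (M / (2 * R))\<^sup>2) \<le> G2 / 4 * \<sigma>\<^sup>2"
          moreover have "G2 / 4 * ((E \<bullet> y)\<^sup>2 / 2 - (M / (2 * R))\<^sup>2) = G2 / 8 * (E \<bullet> y)\<^sup>2 - G2 / 4 * (M / (2 * R))\<^sup>2"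
            by (simp add: algebra_simps)
          moreover have "G1 / (2 * R) * M = G1 / (4 * R) * M + G1 / (4 * R) * M" by (simp add: field_simps)
          ultimately show ?thesis using 3 4 by linarith
        qed
        then have "A * (G1 * \<sigma> - G2 / 4 * \<sigma>\<^sup>2) \<le> A * (G1 * (E \<bullet> y) - G1 / (4 * R) * M - G2 / 8 * (E \<bullet> y)\<^sup>2)"
          using A by (intro mult_left_mono) auto
        also have "\<dots> = (A * G1) * (E \<bullet> y) - Bq * M - Aq * (e \<bullet> y)\<^sup>2"
        proof -
          have "E \<bullet> y = norm E * (e \<bullet> y)" by (subst Ee) simp
          then have "(E \<bullet> y)\<^sup>2 = (norm E)\<^sup>2 * (e \<bullet> y)\<^sup>2" by (simp only: power_mult_distrib)
          then show ?thesis by (simp add: Aq_def Bq_def algebra_simps)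
        qed
        finally show ?thesis using 1 by (simp add: q_def M_def inner_diff_left algebra_simps)
      qed
      have "(Aq + Bq) * Bq ^ (?n - 1) \<le> C * (4 * Lam * d1 powr (-\<alpha>))"
      proof (rule C(2)[where f = f and u = u and \<Omega> = \<Omega> and lo = "lam / 4 * d1 powr (-\<alpha>)"])
        show "ball x1 r \<subseteq> \<Omega>" using dist_bdry_ball_subset[OF x1O] rle(1) d1 by (force simp: d1_def)
        then show "continuous_on (ball x1 r) u" using uc closure_subset continuous_on_subset by blast
        show "0 < lam / 4 * d1 powr (-\<alpha>)" using lam d1 by simp
        show "lam / 4 * d1 powr (-\<alpha>) \<le> f x \<and> f x \<le> 4 * Lam * d1 powr (-\<alpha>)" if "x \<in> ball x1 r" for x
          using ma_data_density_near[OF ma \<alpha> lam x1O, of x] that rle(1) by (simp add: d1_def dist_norm norm_minus_commute)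
      qed (use cvO MA e Aq0 Bq0 rpos touch in auto)
      also have "\<dots> \<le> C * (4 * Lam * r1 powr (-\<alpha>))"
        using C lam r1 r1d \<alpha> by (intro mult_left_mono powr_mono2') auto
      finally have up: "(Aq + Bq) * Bq ^ (?n - 1) \<le> C * (4 * Lam * r1 powr (-\<alpha>))" .
      have n1: "A ^ ?n = A * A ^ (?n - 1)" using DIM_positive[where 'a='a] by (metis Suc_pred' power_Suc)
      have pr: "0 < r1 powr (-\<alpha>)" using r1 by simp
      have "8 * C * Lam * r1 powr (-\<alpha>) \<le> (Aq + Bq) * Bq ^ (?n - 1)"
      \<comment> \<open>Close to the sphere the profile inequality bounds
        \<open>Aq * Bq ^ (n - 1)\<close> from below. Otherwise \<open>r1 \<ge> R / 4\<close>, so the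
        required density is bounded and \<open>Bq ^ n\<close> alone suffices.\<close>
      proof (cases "1/2 \<le> (norm E)\<^sup>2")
        case True
        have "A * k1 \<le> A ^ ?n * k1" using k by (intro mult_right_mono[OF An]) auto
        then have "8 * C * Lam \<le> A ^ ?n * k1" using Ak1 by linarith
        then have "8 * C * Lam * r1 powr (-\<alpha>) \<le> A ^ ?n * k1 * r1 powr (-\<alpha>)"
          by (rule mult_right_mono) simp
        also have "\<dots> = A ^ ?n * (c0 * r1 powr (-\<alpha>)) / (16 * (4 * R) ^ (?n - 1))" by (simp add: k1_def)
        also have "\<dots> \<le> A ^ ?n * (G2 * G1 ^ (?n - 1)) / (16 * (4 * R) ^ (?n - 1))"
          using A G12 R by (intro divide_right_mono mult_left_mono) auto
        also have "\<dots> = (A * G2 / 8 * (1/2)) * (A * G1 / (4 * R)) ^ (?n - 1)"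
          unfolding n1 by (simp add: power_divide power_mult_distrib)
        also have "\<dots> \<le> Aq * Bq ^ (?n - 1)"
          unfolding Aq_def Bq_def using True A G2 G1p R by (intro mult_right_mono mult_left_mono) auto
        also have "\<dots> \<le> (Aq + Bq) * Bq ^ (?n - 1)" using Bq0 by (intro mult_right_mono) auto
        finally show ?thesis .
      next
        case False
        then have "R / 4 \<le> r1" unfolding r1E using R by simp
        then have a: "r1 powr (-\<alpha>) \<le> (R / 4) powr (-\<alpha>)" using R \<alpha> by (intro powr_mono2') auto
        have "A * k2 \<le> A ^ ?n * k2" using k by (intro mult_right_mono[OF An]) auto
        then have b: "8 * C * Lam \<le> A ^ ?n * k2" using Ak2 by linarith
        have "8 * C * Lam * r1 powr (-\<alpha>) \<le> A ^ ?n * k2 * (R / 4) powr (-\<alpha>)"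
          by (rule mult_mono[OF b a]) (use k A in auto)
        also have "\<dots> = A ^ ?n * (c1 / (4 * R)) ^ ?n" using R by (simp add: k2_def powr_minus)
        also have "\<dots> = (A * (c1 / (4 * R))) ^ ?n" by (simp only: power_mult_distrib)
        also have "\<dots> \<le> Bq ^ ?n"
        proof (rule power_mono)
          have "A * c1 \<le> A * G1" using A G1 by (intro mult_left_mono) auto
          then show "A * (c1 / (4 * R)) \<le> Bq" unfolding Bq_def using R by (simp add: divide_right_mono)
          show "0 \<le> A * (c1 / (4 * R))" using A c R by simp
        qed
        also have "\<dots> = Bq * Bq ^ (?n - 1)" using DIM_positive[where 'a='a] by (metis Suc_pred' power_Suc)
        also have "\<dots> \<le> (Aq + Bq) * Bq ^ (?n - 1)" using Aq0 Bq0 by (intro mult_right_mono) auto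
        finally show ?thesis .
      qed
      \<comment> \<open>The factor 8 built into \<open>A\<close> beats the factor 4 of the density
        bound.\<close>
      with up have "8 * C * Lam * r1 powr (-\<alpha>) \<le> 4 * C * Lam * r1 powr (-\<alpha>)" by simp
      then show False using C lam pr by simp
    qed
    obtain z where z: "z \<in> frontier \<Omega>" "dist_bdry \<Omega> x = norm (x - z)" using dist_bdry_attained[OF \<Omega>(2,4)] by blast
    \<comment> \<open>At the given point the ball tangent at a nearest boundary point is used, so
      that \<open>\<rho>f c x\<close> is at most the distance to the boundary.\<close>
    define c where "c = z + R *\<^sub>R N z"
    have cZ: "c \<in> Z" unfolding c_def by (rule ZN(1)[OF z(1)])
    have xc: "x \<in> closure \<Omega>" using xO closure_subset by blast
    show "\<exists>r. 0 < r \<and> r \<le> R / 2 \<and> r \<le> dist_bdry \<Omega> x \<and> a \<bullet> x + b - A * F r \<le> u x"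
    proof (intro exI conjI)
      have "\<Omega> \<subseteq> cball c R" using cZ closure_subset[of \<Omega>] by (auto simp: Z_def dist_norm norm_minus_commute)
      then have "\<Omega> \<subseteq> ball c R" using interior_maximal[OF _ \<Omega>(1), of "cball c R"] by simp
      then have "norm (x - c) < R" using xO by (auto simp: dist_norm norm_minus_commute)
      then have "(norm (x - c))\<^sup>2 < R\<^sup>2" by (simp add: power_strict_mono)
      then show "0 < \<rho>f c x" using R by (simp add: \<rho>f_def)
      show "\<rho>f c x \<le> R / 2" using rng[OF cZ xc] by simp
      show "\<rho>f c x \<le> dist_bdry \<Omega> x" using ZN(2)[OF z(1), of x] z(2) by (simp add: c_def)
      have "0 \<le> J (x, c)" using J0 Jmin[OF xc cZ] by linarith
      then show "a \<bullet> x + b - A * F (\<rho>f c x) \<le> u x" by (simp add: J_def)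
    qed
  qed
qed

text \<open>The exponent solves
  \<open>(\<gamma> - 2) + (n - 1) * (\<gamma> - 1) = - \<alpha>\<close>. It is below 1 precisely
  because \<open>\<alpha> > 1\<close>, and this makes the profile concave.\<close>

lemma lower_profile_powr:
  assumes n: "2 \<le> n" and \<alpha>: "1 < \<alpha>" "\<alpha> < 2" and R: "0 < R"
  shows "lower_profile n \<alpha> R (\<lambda>r. r powr ((real n + 1 - \<alpha>) / real n))"
proof -
  define \<gamma> where "\<gamma> = (real n + 1 - \<alpha>) / real n"
  have \<gamma>: "0 < \<gamma>" "\<gamma> < 1" using n \<alpha> by (auto simp: \<gamma>_def field_simps)
  have n\<gamma>: "real n * \<gamma> = real n + 1 - \<alpha>" using n by (simp add: \<gamma>_def)
  define F' F2 where "F' r = \<gamma> * r powr (\<gamma> - 1)" and "F2 r = \<gamma> * (1 - \<gamma>) * r powr (\<gamma> - 2)" for r :: real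
  have "lower_profile n \<alpha> R (\<lambda>r. r powr \<gamma>)"
    unfolding lower_profile_def
  proof (intro conjI)
    show "(0::real) powr \<gamma> = 0" by simp
    show "continuous_on {0..R/2} (\<lambda>r. r powr \<gamma>)"
      using \<gamma> by (intro continuous_on_powr' continuous_intros) auto
    show "\<exists>F' F2 c0 c1. 0 < c0 \<and> 0 < c1 \<and>
       (\<forall>r\<in>{0<..<R}. ((\<lambda>r. r powr \<gamma>) has_real_derivative F' r) (at r) \<and> (F' has_real_derivative - F2 r) (at r) \<and>
          c1 \<le> F' r \<and> 0 < F2 r \<and> c0 * r powr (-\<alpha>) \<le> F2 r * F' r ^ (n - 1))"
    proof (rule exI[of _ F'], rule exI[of _ F2], rule exI[of _ "\<gamma> * (1 - \<gamma>) * \<gamma> ^ (n - 1)"],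
        rule exI[of _ "\<gamma> * R powr (\<gamma> - 1)"], intro conjI ballI)
      show "0 < \<gamma> * (1 - \<gamma>) * \<gamma> ^ (n - 1)" "0 < \<gamma> * R powr (\<gamma> - 1)" using \<gamma> R by auto
      fix r :: real assume "r \<in> {0<..<R}"
      then have r: "0 < r" "r < R" by auto
      show "((\<lambda>r. r powr \<gamma>) has_real_derivative F' r) (at r)"
        using r by (auto simp: F'_def intro!: derivative_eq_intros)
      show "(F' has_real_derivative - F2 r) (at r)"
        using r unfolding F'_def[abs_def] F2_def
        by (auto intro!: derivative_eq_intros simp: algebra_simps)
      show "\<gamma> * R powr (\<gamma> - 1) \<le> F' r"
        using r \<gamma> by (auto simp: F'_def intro!: mult_left_mono powr_mono2')
      show "0 < F2 r" using r \<gamma> by (simp add: F2_def)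
      have "F2 r * F' r ^ (n - 1) = \<gamma> * (1 - \<gamma>) * \<gamma> ^ (n - 1) * (r powr (\<gamma> - 2) * (r powr (\<gamma> - 1)) ^ (n - 1))"
        by (simp add: F2_def F'_def power_mult_distrib)
      also have "(r powr (\<gamma> - 1)) ^ (n - 1) = r powr ((\<gamma> - 1) * real (n - 1))"
        using r by (simp add: powr_realpow[symmetric] powr_powr)
      also have "r powr (\<gamma> - 2) * r powr ((\<gamma> - 1) * real (n - 1)) = r powr (\<gamma> - 2 + (\<gamma> - 1) * real (n - 1))"
        by (simp add: powr_add)
      also have "\<gamma> - 2 + (\<gamma> - 1) * real (n - 1) = - \<alpha>"
        using n n\<gamma> by (simp add: of_nat_diff algebra_simps)
      finally show "\<gamma> * (1 - \<gamma>) * \<gamma> ^ (n - 1) * r powr (-\<alpha>) \<le> F2 r * F' r ^ (n - 1)" by simp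
    qed
  qed
  then show ?thesis by (simp add: \<gamma>_def)
qed

text \<open>The power \<open>1 / n\<close> makes the logarithmic factors in
  \<open>F2 * F' ^ (n - 1)\<close> cancel, which leaves \<open>1 / r\<close>. The factor
  \<open>exp 2\<close> keeps the logarithm above 2 for \<open>0 < r < R\<close>.\<close>

definition log_profile :: "nat \<Rightarrow> real \<Rightarrow> real \<Rightarrow> real" where
  "log_profile n R r = r * ln (exp 2 * R / r) powr (1 / real n)"

text \<open>A power in place of the logarithm: it gives continuity at 0 and suffices wherever only
  some power of the distance is wanted.\<close>

lemma log_profile_le_sqrt:
  assumes n: "2 \<le> n" and r: "0 < r" "r < R"
  shows "log_profile n R r \<le> 2 * sqrt (exp 2 * R * r)" "0 \<le> log_profile n R r"
proof -
  have "exp 2 < exp 2 * R / r" using r by (simp add: field_simps)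
  then have "ln (exp 2) < ln (exp 2 * R / r)" by (subst ln_less_cancel_iff) (use r in auto)
  then have L: "2 < ln (exp 2 * R / r)" by simp
  define Y where "Y = exp 2 * R / r"
  have Y: "0 < Y" using r by (simp add: Y_def)
  have "ln Y powr (1 / real n) \<le> ln Y powr 1" using L n by (intro powr_mono) (auto simp: Y_def)
  also have "\<dots> = ln Y" using L by (simp add: Y_def)
  also have "ln Y = 2 * ln (sqrt Y)" using Y by (simp add: ln_sqrt)
  also have "\<dots> \<le> 2 * sqrt Y" using ln_le_minus_one[of "sqrt Y"] Y by simp
  finally have "log_profile n R r \<le> r * (2 * sqrt Y)" unfolding log_profile_def Y_def[symmetric] using r by (intro mult_left_mono) auto
  also have "\<dots> = 2 * sqrt (exp 2 * R * r)"
  proof -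
    have "r * sqrt Y = sqrt (r\<^sup>2 * Y)" using r by (simp add: real_sqrt_mult)
    also have "r\<^sup>2 * Y = exp 2 * R * r" using r by (simp add: Y_def power2_eq_square)
    finally show ?thesis by simp
  qed
  finally show "log_profile n R r \<le> 2 * sqrt (exp 2 * R * r)" .
  show "0 \<le> log_profile n R r" using r by (simp add: log_profile_def)
qed

lemma lower_profile_log:
  assumes n: "2 \<le> n" and R: "0 < R"
  shows "lower_profile n 1 R (log_profile n R)"
proof -
  define C0 where "C0 = exp 2 * R"
  define p where "p = 1 / real n"
  have p: "0 < p" "p \<le> 1 / 2" using n by (auto simp: p_def field_simps)
  define L where "L r = ln (C0 / r)" for r
  have L2: "2 < L r" if "0 < r" "r < R" for r
  proof -
    have "exp 2 < C0 / r" using that by (simp add: C0_def field_simps)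
    then have "ln (exp 2) < L r" unfolding L_def by (subst ln_less_cancel_iff) (use that in \<open>auto simp: C0_def\<close>)
    then show ?thesis by simp
  qed
  have F: "log_profile n R r = r * L r powr p" for r by (simp add: log_profile_def L_def C0_def p_def)
  define F' where "F' r = L r powr p - p * L r powr (p - 1)" for r
  define F2 where "F2 r = p / r * (L r powr (p - 1) + (1 - p) * L r powr (p - 2))" for r
  have dL: "(L has_real_derivative - (1 / r)) (at r)" if "0 < r" for r
    using that R unfolding L_def[abs_def] C0_def by (auto intro!: derivative_eq_intros simp: field_simps)
  have d: "(log_profile n R has_real_derivative F' r) (at r)" "(F' has_real_derivative - F2 r) (at r)"
    if r: "0 < r" "r < R" for r
  proof -
    have L0: "0 < L r" using L2[OF r] by simp
    note dp = DERIV_powr[OF dL[OF r(1)] L0 DERIV_const]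
    have dq: "((\<lambda>r. L r powr q) has_real_derivative - (q / r * L r powr (q - 1))) (at r)" for q
      using dp[of q] L0 r by (simp add: powr_diff field_simps)
    have "((\<lambda>r. r * L r powr p) has_real_derivative (1 * L r powr p + (- (p / r * L r powr (p - 1))) * r)) (at r)"
      by (rule DERIV_mult'[OF DERIV_ident dq, THEN DERIV_cong]) simp
    then show "(log_profile n R has_real_derivative F' r) (at r)"
      using r by (simp add: F[abs_def] F'_def)
    have "(F' has_real_derivative (- (p / r * L r powr (p - 1)) - p * - ((p - 1) / r * L r powr (p - 1 - 1)))) (at r)"
      unfolding F'_def[abs_def] by (intro DERIV_diff DERIV_cmult dq)
    moreover have "- (p / r * L r powr (p - 1)) - p * - ((p - 1) / r * L r powr (p - 1 - 1)) = - F2 r"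
      using r by (simp add: F2_def field_simps)
    ultimately show "(F' has_real_derivative - F2 r) (at r)" by simp
  qed
  \<comment> \<open>\<open>L > 2\<close> and \<open>p \<le> 1 / 2\<close> leave half of the leading
    term of \<open>F'\<close>.\<close>
  have F'lb: "L r powr p / 2 \<le> F' r" if r: "0 < r" "r < R" for r
  proof -
    have L0: "2 < L r" by (rule L2[OF r])
    have "p * L r powr (p - 1) \<le> L r / 2 * L r powr (p - 1)" using p L0 by (intro mult_right_mono) auto
    also have "\<dots> = L r powr p / 2" using L0 by (simp add: powr_diff)
    finally show ?thesis by (simp add: F'_def)
  qed
  have Lp1: "1 \<le> L r powr p" if "0 < r" "r < R" for r using L2[OF that] p by (intro ge_one_powr_ge_zero) auto
  show ?thesis
    unfolding lower_profile_def
  proof (intro conjI)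
    show "log_profile n R 0 = 0" by (simp add: log_profile_def)
    show "continuous_on {0..R/2} (log_profile n R)"
      unfolding continuous_on_eq_continuous_within
    proof
      fix r assume r: "r \<in> {0..R/2}"
      show "continuous (at r within {0..R/2}) (log_profile n R)"
      proof (cases "r = 0")
        case False
        then have "isCont (log_profile n R) r" using d(1)[of r] r R by (intro DERIV_isCont) auto
        then show ?thesis by (rule continuous_at_imp_continuous_within)
      next
        case True
        have "(log_profile n R \<longlongrightarrow> 0) (at 0 within {0..R/2})"
        proof (rule Lim_null_comparison)
          show "\<forall>\<^sub>F r in at 0 within {0..R/2}. norm (log_profile n R r) \<le> 2 * sqrt (exp 2 * R * r)"
            unfolding eventually_at
            using log_profile_le_sqrt[OF n] R by (intro exI[of _ 1]) auto
          have "((\<lambda>r. 2 * sqrt (exp 2 * R * r)) \<longlongrightarrow> 2 * sqrt (exp 2 * R * 0)) (at 0 within {0..R/2})"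
            by (intro tendsto_intros)
          then show "((\<lambda>r. 2 * sqrt (exp 2 * R * r)) \<longlongrightarrow> 0) (at 0 within {0..R/2})" by simp
        qed
        then show ?thesis unfolding True continuous_within by (simp add: log_profile_def)
      qed
    qed
    show "\<exists>F' F2 c0 c1. 0 < c0 \<and> 0 < c1 \<and>
       (\<forall>r\<in>{0<..<R}. (log_profile n R has_real_derivative F' r) (at r) \<and> (F' has_real_derivative - F2 r) (at r) \<and>
          c1 \<le> F' r \<and> 0 < F2 r \<and> c0 * r powr (-1) \<le> F2 r * F' r ^ (n - 1))"
    proof (rule exI[of _ F'], rule exI[of _ F2], rule exI[of _ "p / 2 ^ (n - 1)"],
        rule exI[of _ "1 / 2"], intro conjI ballI)
      show "0 < p / 2 ^ (n - 1)" "(0::real) < 1 / 2" using p by auto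
      fix r :: real assume "r \<in> {0<..<R}"
      then have r: "0 < r" "r < R" by auto
      show "(log_profile n R has_real_derivative F' r) (at r)" "(F' has_real_derivative - F2 r) (at r)" using d[OF r] by auto
      show "1 / 2 \<le> F' r" using F'lb[OF r] Lp1[OF r] by simp
      have L0: "0 < L r" using L2[OF r] by simp
      have F2lb: "p / r * L r powr (p - 1) \<le> F2 r"
        unfolding F2_def using p r by (intro mult_left_mono) auto
      moreover have pos: "0 < p / r * L r powr (p - 1)" using p r L0 by simp
      ultimately show "0 < F2 r" by linarith
      have "L r powr (p - 1) * (L r powr p) ^ (n - 1) = L r powr (p - 1 + p * real (n - 1))"
        using L0 by (simp add: powr_realpow[symmetric] powr_powr powr_add)
      also have "p - 1 + p * real (n - 1) = 0" using n by (simp add: p_def of_nat_diff field_simps)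
      finally have one: "L r powr (p - 1) * (L r powr p) ^ (n - 1) = 1" using L0 by simp
      have "p / 2 ^ (n - 1) * r powr (-1) = (p / r * L r powr (p - 1)) * (L r powr p / 2) ^ (n - 1)"
      proof -
        have "(p / r * L r powr (p - 1)) * (L r powr p / 2) ^ (n - 1) = p / r / 2 ^ (n - 1) * (L r powr (p - 1) * (L r powr p) ^ (n - 1))"
          by (simp add: power_divide)
        then show ?thesis unfolding one using r by (simp add: powr_minus field_simps)
      qed
      also have "\<dots> \<le> F2 r * F' r ^ (n - 1)"
        using F2lb pos F'lb[OF r] by (intro mult_mono power_mono) auto
      finally show "p / 2 ^ (n - 1) * r powr (-1) \<le> F2 r * F' r ^ (n - 1)" .
    qed
  qed
qed

text \<open>The number \<open>s\<close> for which the integral of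
  \<open>\<tau> powr (- \<alpha>)\<close> from \<open>2 * s\<close> to \<open>t0\<close> equals
  \<open>P\<close>. A profile whose second derivative is this power shifted by \<open>s\<close>, and
  which is flat at \<open>t0\<close>, then has slope at most \<open>- P\<close> at
  \<open>s\<close>.\<close>

definition upper_depth :: "real \<Rightarrow> real \<Rightarrow> real \<Rightarrow> real" where
  "upper_depth \<alpha> t0 P = (if \<alpha> = 1 then t0 / 2 * exp (- P)
     else (t0 powr (1 - \<alpha>) + (\<alpha> - 1) * P) powr (- 1 / (\<alpha> - 1)) / 2)"

text \<open>\<open>k\<close> is a second primitive of \<open>(\<tau> + s) powr (- \<alpha>)\<close>
  with \<open>k'\<close> vanishing at \<open>t0\<close>; the shift by \<open>s\<close> removes the
  singularity at 0. Doubling the argument changes the integrals by a bounded factor, so the slope at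
  0 has size at most \<open>Q * P\<close>, and \<open>\<alpha> < 2\<close> bounds the drop of
  \<open>k\<close> independently of \<open>P\<close>.\<close>

lemma upper_profile_exists:
  assumes t0: "0 < t0" and \<alpha>: "1 \<le> \<alpha>" "\<alpha> < 2"
  obtains C4 Q where "0 \<le> C4" "0 < Q"
    "\<And>P. 1 \<le> P \<Longrightarrow> 0 < upper_depth \<alpha> t0 P \<and> upper_depth \<alpha> t0 P \<le> t0 / 2 \<and>
      (\<exists>k k'. (\<forall>\<tau>. - upper_depth \<alpha> t0 P < \<tau> \<longrightarrow> (k has_real_derivative k' \<tau>) (at \<tau>) \<and>
          (k' has_real_derivative (\<tau> + upper_depth \<alpha> t0 P) powr (-\<alpha>)) (at \<tau>)) \<and>
        k' (upper_depth \<alpha> t0 P) \<le> - P \<and> - (Q * P) \<le> k' 0 \<and> - C4 \<le> k t0 - k 0)"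
proof (cases "\<alpha> = 1")
  case True
  show ?thesis
  \<comment> \<open>\<open>3 * P\<close> consists of \<open>P\<close> from \<open>ln s\<close> and
    \<open>2 * P\<close> for the two terms \<open>ln 2 \<le> 1\<close>.\<close>
  proof (rule that[of t0 3])
    fix P :: real assume P: "1 \<le> P"
    define s where "s = t0 / 2 * exp (- P)"
    have sd: "upper_depth \<alpha> t0 P = s" by (simp add: upper_depth_def True s_def)
    have s: "0 < s" "s \<le> t0 / 2" using t0 P by (auto simp: s_def)
    define k where "k \<tau> = (\<tau> + s) * (ln (\<tau> + s) - ln (t0 + s)) - \<tau>" for \<tau>
    define k' where "k' \<tau> = ln (\<tau> + s) - ln (t0 + s)" for \<tau>
    have ts: "0 < t0 + s" using t0 s by simp
    have lns: "ln s = ln (t0 / 2) - P" using t0 ln_mult[of "t0 / 2" "exp (- P)"] by (simp add: s_def)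
    show "0 < upper_depth \<alpha> t0 P \<and> upper_depth \<alpha> t0 P \<le> t0 / 2 \<and>
      (\<exists>k k'. (\<forall>\<tau>. - upper_depth \<alpha> t0 P < \<tau> \<longrightarrow> (k has_real_derivative k' \<tau>) (at \<tau>) \<and>
          (k' has_real_derivative (\<tau> + upper_depth \<alpha> t0 P) powr (-\<alpha>)) (at \<tau>)) \<and>
        k' (upper_depth \<alpha> t0 P) \<le> - P \<and> - (3 * P) \<le> k' 0 \<and> - t0 \<le> k t0 - k 0)"
      unfolding sd
    proof (intro conjI s, rule exI[of _ k], rule exI[of _ k'], intro conjI allI impI)
      fix \<tau> assume "- s < \<tau>"
      then have \<tau>: "0 < \<tau> + s" by simp
      show "(k has_real_derivative k' \<tau>) (at \<tau>)"
        unfolding k_def[abs_def] k'_def using \<tau> ts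
        by (auto intro!: derivative_eq_intros)
      show "(k' has_real_derivative (\<tau> + s) powr (-\<alpha>)) (at \<tau>)"
        unfolding k'_def[abs_def] True using \<tau> ts
        by (auto intro!: derivative_eq_intros simp: powr_minus field_simps)
    next
      have "k' s = ln (2 * s) - ln (t0 + s)" by (simp add: k'_def)
      also have "\<dots> \<le> ln (2 * s) - ln t0" using t0 s by simp
      also have "\<dots> = - P" using lns t0 s by (simp add: ln_mult ln_div)
      finally show "k' s \<le> - P" .
      have "ln (t0 + s) \<le> ln (2 * t0)" using t0 s by (subst ln_le_cancel_iff) auto
      moreover have "k' 0 = ln s - ln (t0 + s)" by (simp add: k'_def)
      moreover have "ln (2 * t0) = ln 2 + ln t0" "ln (t0 / 2) = ln t0 - ln 2" using t0 by (simp_all add: ln_mult ln_div)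
      moreover have "ln 2 \<le> (1::real)" using ln_le_minus_one[of 2] by simp
      ultimately show "- (3 * P) \<le> k' 0" using P lns by linarith
      have "ln s \<le> ln (t0 + s)" using s t0 by (subst ln_le_cancel_iff) auto
      then have "s * (ln s - ln (t0 + s)) \<le> 0" using s by (simp add: mult_nonneg_nonpos)
      then show "- t0 \<le> k t0 - k 0" using ts by (simp add: k_def)
    qed
  qed (use t0 in auto)
next
  case False
  then have \<alpha>1: "1 < \<alpha>" using \<alpha> by simp
  define X where "X = t0 powr (1 - \<alpha>) / (\<alpha> - 1)"
  define Q where "Q = 2 * (X + 1)"
  define C4 where "C4 = (2 * t0) powr (2 - \<alpha>) / (2 - \<alpha>) / (\<alpha> - 1)"
  have X0: "0 \<le> X" using \<alpha>1 by (simp add: X_def)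
  then have Q0: "0 < Q" by (simp add: Q_def)
  show ?thesis
  proof (rule that[of C4 Q])
    show "0 \<le> C4" using \<alpha>1 \<alpha> by (simp add: C4_def)
    fix P :: real assume P: "1 \<le> P"
    define E where "E = t0 powr (1 - \<alpha>) + (\<alpha> - 1) * P"
    have E0: "t0 powr (1 - \<alpha>) \<le> E" "0 < t0 powr (1 - \<alpha>)" using P \<alpha>1 t0 by (auto simp: E_def)
    have Ep: "0 < E" using E0 by linarith
    define s where "s = E powr (- 1 / (\<alpha> - 1)) / 2"
    have sd: "upper_depth \<alpha> t0 P = s" using False by (simp add: upper_depth_def s_def E_def)
    have s2: "2 * s = E powr (- 1 / (\<alpha> - 1))" by (simp add: s_def)
    have s0: "0 < s" using Ep by (simp add: s_def)
    have "2 * s \<le> (t0 powr (1 - \<alpha>)) powr (- 1 / (\<alpha> - 1))"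
      unfolding s2 using E0 \<alpha>1 by (intro powr_mono2') auto
    also have "\<dots> = t0"
    proof -
      have "(1 - \<alpha>) * (- 1 / (\<alpha> - 1)) = 1" using \<alpha>1 by (simp add: field_simps)
      then show ?thesis using t0 by (simp only: powr_powr) simp
    qed
    finally have s1: "s \<le> t0 / 2" by simp
    have E2: "(2 * s) powr (1 - \<alpha>) = E"
    proof -
      have "- 1 / (\<alpha> - 1) * (1 - \<alpha>) = 1" using \<alpha>1 by (simp add: field_simps)
      then show ?thesis unfolding s2 using Ep by (simp only: powr_powr) simp
    qed
    define c where "c = (t0 + s) powr (1 - \<alpha>)"
    define k where "k \<tau> = - ((\<tau> + s) powr (2 - \<alpha>) / (2 - \<alpha>) - c * \<tau>) / (\<alpha> - 1)" for \<tau>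
    define k' where "k' \<tau> = - ((\<tau> + s) powr (1 - \<alpha>) - c) / (\<alpha> - 1)" for \<tau>
    have c0: "0 \<le> c" by (simp add: c_def)
    show "0 < upper_depth \<alpha> t0 P \<and> upper_depth \<alpha> t0 P \<le> t0 / 2 \<and>
      (\<exists>k k'. (\<forall>\<tau>. - upper_depth \<alpha> t0 P < \<tau> \<longrightarrow> (k has_real_derivative k' \<tau>) (at \<tau>) \<and>
          (k' has_real_derivative (\<tau> + upper_depth \<alpha> t0 P) powr (-\<alpha>)) (at \<tau>)) \<and>
        k' (upper_depth \<alpha> t0 P) \<le> - P \<and> - (Q * P) \<le> k' 0 \<and> - C4 \<le> k t0 - k 0)"
      unfolding sd
    proof (intro conjI s0 s1, rule exI[of _ k], rule exI[of _ k'], intro conjI allI impI)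
      fix \<tau> assume "- s < \<tau>"
      then have \<tau>: "0 < \<tau> + s" by simp
      show "(k has_real_derivative k' \<tau>) (at \<tau>)"
        unfolding k_def[abs_def] k'_def using \<tau> \<alpha> \<alpha>1
        by (auto intro!: derivative_eq_intros)
      have "((\<lambda>\<tau>. (\<tau> + s) powr (1 - \<alpha>)) has_real_derivative (1 - \<alpha>) * (\<tau> + s) powr (1 - \<alpha> - 1)) (at \<tau>)"
        using \<tau> by (auto intro!: derivative_eq_intros)
      then have "((\<lambda>\<tau>. - ((\<tau> + s) powr (1 - \<alpha>) - c) / (\<alpha> - 1)) has_real_derivative
           - ((1 - \<alpha>) * (\<tau> + s) powr (1 - \<alpha> - 1) - 0) / (\<alpha> - 1)) (at \<tau>)"
        by (intro DERIV_cdivide DERIV_minus DERIV_diff DERIV_const)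
      moreover have "- ((1 - \<alpha>) * (\<tau> + s) powr (1 - \<alpha> - 1) - 0) / (\<alpha> - 1) = (\<tau> + s) powr (-\<alpha>)"
        using \<alpha>1 by (simp add: field_simps)
      ultimately show "(k' has_real_derivative (\<tau> + s) powr (-\<alpha>)) (at \<tau>)"
        unfolding k'_def[abs_def] by simp
    next
      have "c \<le> t0 powr (1 - \<alpha>)" unfolding c_def using t0 s0 \<alpha>1 by (intro powr_mono2') auto
      then have "(\<alpha> - 1) * P \<le> E - c" by (simp add: E_def)
      then have "P \<le> (E - c) / (\<alpha> - 1)" using \<alpha>1 by (simp add: field_simps)
      moreover have "k' s = - ((E - c) / (\<alpha> - 1))" using E2 by (simp add: k'_def mult_2[symmetric] minus_divide_left)
      ultimately show "k' s \<le> - P" by simp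
      \<comment> \<open>Passing from \<open>2 * s\<close> to \<open>s\<close> costs the factor
        \<open>2 powr (\<alpha> - 1) \<le> 2\<close>.\<close>
      have "s powr (1 - \<alpha>) = 2 powr (\<alpha> - 1) * (2 * s) powr (1 - \<alpha>)"
      proof -
        have "2 powr (\<alpha> - 1) * (2 * s) powr (1 - \<alpha>) = (2 powr (\<alpha> - 1) * 2 powr (1 - \<alpha>)) * s powr (1 - \<alpha>)"
          using s0 by (simp add: powr_mult)
        also have "2 powr (\<alpha> - 1) * 2 powr (1 - \<alpha>) = (1::real)" by (simp add: powr_add[symmetric])
        finally show ?thesis by simp
      qed
      also have "\<dots> \<le> 2 * E"
      proof -
        have "2 powr (\<alpha> - 1) \<le> (2::real) powr 1" using \<alpha> by (intro powr_mono) auto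
        then show ?thesis unfolding E2 using Ep by (intro mult_right_mono) auto
      qed
      finally have "s powr (1 - \<alpha>) / (\<alpha> - 1) \<le> 2 * E / (\<alpha> - 1)" using \<alpha>1 by (intro divide_right_mono) auto
      also have "\<dots> = 2 * (X + P)" using \<alpha>1 by (simp add: E_def X_def field_simps)
      also have "\<dots> \<le> Q * P"
      proof -
        have "X * 1 \<le> X * P" using P X0 by (intro mult_left_mono) auto
        then show ?thesis by (simp add: Q_def algebra_simps)
      qed
      finally have "s powr (1 - \<alpha>) / (\<alpha> - 1) \<le> Q * P" .
      moreover have "k' 0 = - (s powr (1 - \<alpha>) / (\<alpha> - 1)) + c / (\<alpha> - 1)" by (simp add: k'_def diff_divide_distrib)
      moreover have "0 \<le> c / (\<alpha> - 1)" using c0 \<alpha>1 by simp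
      ultimately show "- (Q * P) \<le> k' 0" by linarith
      have "(t0 + s) powr (2 - \<alpha>) \<le> (2 * t0) powr (2 - \<alpha>)" using s0 s1 t0 \<alpha> by (intro powr_mono2) auto
      then have "(t0 + s) powr (2 - \<alpha>) / (2 - \<alpha>) / (\<alpha> - 1) \<le> C4"
        unfolding C4_def using \<alpha> \<alpha>1 by (intro divide_right_mono) auto
      moreover have "k t0 - k 0 = - ((t0 + s) powr (2 - \<alpha>) / (2 - \<alpha>) / (\<alpha> - 1)) + c * t0 / (\<alpha> - 1) + s powr (2 - \<alpha>) / (2 - \<alpha>) / (\<alpha> - 1)"
        by (simp add: k_def diff_divide_distrib)
      moreover have "0 \<le> c * t0 / (\<alpha> - 1)" "0 \<le> s powr (2 - \<alpha>) / (2 - \<alpha>) / (\<alpha> - 1)" using c0 t0 \<alpha> \<alpha>1 by auto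
      ultimately show "- C4 \<le> k t0 - k 0" by linarith
    qed
  qed (use Q0 in auto)
qed

text \<open>\<open>W\<close> below is quadratic in the tangential directions plus a one-dimensional
  function of the height. A small \<open>a\<close> keeps its determinant below the density, so
  \<open>v - W\<close> has no interior maximum; \<open>B\<close> excludes a positive maximum on
  \<partial>\<Omega> and \<open>A\<close> on the face of height \<open>\<rho>\<close>. If
  \<open>v\<close> stayed above \<open>- A * m * s\<close>, its value at depth \<open>s\<close> on
  the normal would force such a positive maximum.\<close>

lemma upper_barrier:
  assumes pos: "0 < R" "0 < \<rho>" "0 \<le> C3" and \<alpha>: "1 \<le> \<alpha>" "\<alpha> < 2" and lam: "0 < lam" "0 < Lam"
  obtains A a :: real where "1 \<le> A" "0 < a" "a \<le> 1"
    "\<And>(\<Omega> :: 'a::euclidean_space set) N u f z p b m. \<lbrakk>ma_data \<Omega> \<rho> R N \<alpha> lam Lam u f; z \<in> frontier \<Omega>; 1 \<le> m;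
        \<And>x. x \<in> closure \<Omega> \<Longrightarrow> u x - (p \<bullet> x + b) \<le> C3 * m * (N z \<bullet> (x - z))\<rbrakk>
      \<Longrightarrow> \<exists>x\<in>\<Omega>. u x - (p \<bullet> x + b) \<le> - (A * m * upper_depth \<alpha> \<rho> (2 * A * m ^ DIM('a) / a))"
proof -
  let ?n = "DIM('a)"
  obtain C4 Q where C4: "0 \<le> C4" and Q: "0 < Q" and prof:
    "\<And>P. 1 \<le> P \<Longrightarrow> 0 < upper_depth \<alpha> \<rho> P \<and> upper_depth \<alpha> \<rho> P \<le> \<rho> / 2 \<and>
      (\<exists>k k'. (\<forall>\<tau>. - upper_depth \<alpha> \<rho> P < \<tau> \<longrightarrow> (k has_real_derivative k' \<tau>) (at \<tau>) \<and>
          (k' has_real_derivative (\<tau> + upper_depth \<alpha> \<rho> P) powr (-\<alpha>)) (at \<tau>)) \<and>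
        k' (upper_depth \<alpha> \<rho> P) \<le> - P \<and> - (Q * P) \<le> k' 0 \<and> - C4 \<le> k \<rho> - k 0)"
    using upper_profile_exists[OF pos(2) \<alpha>] by blast
  obtain C where C: "0 < C" "\<And>\<Omega> u f (x1::'a) p e A B lo r.
      \<lbrakk>convex_on \<Omega> u; alexandrov_solution \<Omega> u f; norm e = 1; 0 < A; 0 < B; 0 < r; ball x1 r \<subseteq> \<Omega>;
       \<And>x. x \<in> ball x1 r \<Longrightarrow> lo \<le> f x;
       \<And>y. norm y < r \<Longrightarrow> u (x1 + y) \<le> u x1 + p \<bullet> y + A * (e \<bullet> y)\<^sup>2 + B * (norm (y - (e \<bullet> y) *\<^sub>R e))\<^sup>2\<rbrakk>
      \<Longrightarrow> lo \<le> C * (A * B ^ (?n - 1))"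
    using touching_from_above[where 'a = 'a] by blast
  \<comment> \<open>Makes \<open>W\<close> at least \<open>C3 * m * \<tau>\<close> on the face
    \<open>\<tau> = \<rho>\<close>, where \<open>k\<close> may have dropped by
    \<open>C4\<close>.\<close>
  define A where "A = C3 + C4 / \<rho> + 1"
  have A1: "1 \<le> A" using pos C4 by (simp add: A_def)
  \<comment> \<open>On \<partial>\<Omega> the squared tangential distance is at least
    \<open>\<rho> * \<tau>\<close>, so this \<open>B\<close> compensates both the upper bound with
    \<open>C3\<close> and the slope of \<open>k\<close> at 0.\<close>
  define B where "B = (C3 + 2 * Q * A) / \<rho>"
  have B: "0 < B" using pos Q A1 by (simp add: B_def add_nonneg_pos)
  define a where "a = min 1 (lam / (8 * C * B ^ (?n - 1)))"
  have a: "0 < a" "a \<le> 1" using lam C B by (auto simp: a_def)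
  have "a \<le> lam / (8 * C * B ^ (?n - 1))" by (simp add: a_def)
  then have aC: "8 * (C * (a * B ^ (?n - 1))) \<le> lam" using C B by (simp add: field_simps)
  show ?thesis
  proof (rule that[OF A1 a])
    fix \<Omega> :: "'a set" and N u f z p b and m :: real
    assume ma: "ma_data \<Omega> \<rho> R N \<alpha> lam Lam u f" and z: "z \<in> frontier \<Omega>" and m: "1 \<le> m"
      and up: "\<And>x. x \<in> closure \<Omega> \<Longrightarrow> u x - (p \<bullet> x + b) \<le> C3 * m * (N z \<bullet> (x - z))"
    have \<Omega>: "open \<Omega>" "bounded \<Omega>" "convex \<Omega>" and N: "ball_normal \<Omega> \<rho> R z (N z)"
      and uc: "continuous_on (closure \<Omega>) u" and ucv: "convex_on (closure \<Omega>) u" and MA: "alexandrov_solution \<Omega> u f"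
      using ma z by (auto simp: ma_data_def)
    have cvO: "convex_on \<Omega> u" using ucv closure_subset convex_on_subset \<Omega>(3) by blast
    define e where "e = N z"
    have ne: "norm e = 1" using N by (simp add: e_def ball_normal_def)
    have ee: "e \<bullet> e = 1" using ne by (simp add: norm_eq_1)
    note bn = N[folded e_def]
    define P where "P = 2 * A * m ^ ?n / a"
    have m1: "1 \<le> m ^ k" for k using m by (rule one_le_power)
    have mn: "m ^ ?n = m * m ^ (?n - 1)" using DIM_positive[where 'a='a] by (metis Suc_pred' power_Suc)
    have P1: "1 \<le> P"
    proof -
      have "1 * 1 \<le> A * m ^ ?n" using A1 m1 by (intro mult_mono) auto
      then have "a \<le> 2 * A * m ^ ?n" using a by linarith
      then show ?thesis using a by (simp add: P_def)
    qed
    define s where "s = upper_depth \<alpha> \<rho> P"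
    obtain k k' where s: "0 < s" "s \<le> \<rho> / 2"
      and k: "\<And>\<tau>. - s < \<tau> \<Longrightarrow> (k has_real_derivative k' \<tau>) (at \<tau>)"
      and k2: "\<And>\<tau>. - s < \<tau> \<Longrightarrow> (k' has_real_derivative (\<tau> + s) powr (-\<alpha>)) (at \<tau>)"
      and ks: "k' s \<le> - P" "- (Q * P) \<le> k' 0" "- C4 \<le> k \<rho> - k 0"
      using prof[OF P1] unfolding s_def[symmetric] by blast
    have kmono: "k' x \<le> k' y" if "- s < x" "x \<le> y" for x y
    proof (rule DERIV_nonneg_imp_nondecreasing[OF that(2)])
      fix t assume "x \<le> t" "t \<le> y"
      then show "\<exists>y. (k' has_real_derivative y) (at t) \<and> 0 \<le> y" using k2[of t] that by (intro exI[of _ "(t + s) powr (-\<alpha>)"]) auto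
    qed
    have klow: "\<tau> * k' 0 \<le> k \<tau> - k 0" and kup: "k \<tau> - k 0 \<le> \<tau> * k' \<tau>" if \<tau>: "0 \<le> \<tau>" for \<tau>
    proof -
      have "\<tau> * k' 0 \<le> k \<tau> - k 0 \<and> k \<tau> - k 0 \<le> \<tau> * k' \<tau>"
      proof (cases "\<tau> = 0")
        case False
        then have t: "0 < \<tau>" using \<tau> by simp
        obtain \<xi> where \<xi>: "0 < \<xi>" "\<xi> < \<tau>" "k \<tau> - k 0 = (\<tau> - 0) * k' \<xi>"
          using MVT2[OF t, of k k'] k s by auto
        then show ?thesis using kmono[of 0 \<xi>] kmono[of \<xi> \<tau>] s t by (auto intro: mult_left_mono)
      qed simp
      then show "\<tau> * k' 0 \<le> k \<tau> - k 0" "k \<tau> - k 0 \<le> \<tau> * k' \<tau>" by auto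
    qed
    \<comment> \<open>Balances the powers of \<open>m\<close>: \<open>a' * m ^ (n - 1) = a\<close>
      makes the determinant bound independent of \<open>m\<close>, while \<open>a' * P\<close> is
      twice the coefficient \<open>A * m\<close> of the linear term.\<close>
    define a' where "a' = a / m ^ (?n - 1)"
    have a'0: "0 < a'" using a m by (simp add: a'_def)
    have "a \<le> m ^ (?n - 1)" using a m1[of "?n - 1"] by linarith
    then have a'1: "a' \<le> 1" using m by (simp add: a'_def)
    have a'm: "a' * m ^ (?n - 1) = a" using m by (simp add: a'_def)
    have a'P: "a' * P = 2 * A * m" using a m by (simp add: a'_def P_def mn)
    define v where "v x = u x - (p \<bullet> x + b)" for x
    define \<tau> where "\<tau> x = e \<bullet> (x - z)" for x
    define W where "W x = B * m * ((norm (x - z))\<^sup>2 - (\<tau> x)\<^sup>2) + A * m * \<tau> x + a' * (k (\<tau> x) - k 0)" for x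
    have \<tau>0: "0 \<le> \<tau> x" if "x \<in> closure \<Omega>" for x
      unfolding \<tau>_def by (rule ball_normal_nonneg[OF bn that pos(1)])
    define xs where "xs = z + s *\<^sub>R e"
    have \<tau>s: "\<tau> xs = s" by (simp add: xs_def \<tau>_def ee)
    have xsO: "xs \<in> \<Omega>"
    proof -
      have "xs - (z + \<rho> *\<^sub>R e) = (s - \<rho>) *\<^sub>R e" by (simp add: xs_def algebra_simps)
      then have "norm (xs - (z + \<rho> *\<^sub>R e)) < \<rho>" using ne s pos by simp
      then have "xs \<in> ball (z + \<rho> *\<^sub>R e) \<rho>" by (simp add: dist_norm norm_minus_commute)
      then show ?thesis using bn by (auto simp: ball_normal_def)
    qed
    \<comment> \<open>At depth \<open>s\<close> on the normal, \<open>k\<close> contributes at most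
      \<open>- 2 * A * m * s\<close> against \<open>A * m * s\<close> from the linear term.\<close>
    have Wxs: "W xs \<le> - (A * m * s)"
    proof -
      have "(norm (xs - z))\<^sup>2 - (\<tau> xs)\<^sup>2 = 0" using ne by (simp add: \<tau>s) (simp add: xs_def)
      then have "W xs = A * m * s + a' * (k s - k 0)" by (simp add: W_def \<tau>s)
      also have "a' * (k s - k 0) \<le> a' * (s * (- P))"
        using kup[of s] ks(1) s a'0 mult_left_mono[OF ks(1), of s] by (intro mult_left_mono) auto
      also have "a' * (s * (- P)) = - (s * (a' * P))" by simp
      also have "\<dots> = - (2 * A * m * s)" by (simp add: a'P)
      finally show ?thesis by simp
    qed
    show "\<exists>x\<in>\<Omega>. u x - (p \<bullet> x + b) \<le> - (A * m * upper_depth \<alpha> \<rho> (2 * A * m ^ ?n / a))"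
      unfolding P_def[symmetric] s_def[symmetric] v_def[symmetric]
    proof (rule ccontr)
      assume neg: "\<not> (\<exists>x\<in>\<Omega>. v x \<le> - (A * m * s))"
      \<comment> \<open>The comparison is confined to heights up to \<open>\<rho>\<close>, the end
        of the range on which the profile is controlled.\<close>
      define T where "T = closure \<Omega> \<inter> {x. e \<bullet> x \<le> \<rho> + e \<bullet> z}"
      have T_iff: "x \<in> T \<longleftrightarrow> x \<in> closure \<Omega> \<and> \<tau> x \<le> \<rho>" for x
        by (auto simp: T_def \<tau>_def inner_diff_right)
      have cT: "compact T" unfolding T_def
        using \<Omega>(2) by (intro compact_Int_closed) (auto simp: compact_closure closed_halfspace_le)
      have xsT: "xs \<in> T" using xsO closure_subset s pos by (auto simp: T_iff \<tau>s)
      have kc: "continuous_on {- s<..} k"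
        using DERIV_isCont[OF k] by (intro continuous_at_imp_continuous_on ballI) auto
      have \<tau>c: "continuous_on T \<tau>" unfolding \<tau>_def by (intro continuous_intros)
      have "continuous_on T (\<lambda>x. k (\<tau> x))"
        by (rule continuous_on_compose2[OF kc \<tau>c]) (use \<tau>0 s in \<open>force simp: T_iff\<close>)
      moreover have "continuous_on T u" using uc by (rule continuous_on_subset) (auto simp: T_def)
      ultimately have cont: "continuous_on T (\<lambda>x. v x - W x)"
        unfolding v_def W_def by (intro continuous_intros \<tau>c)
      obtain x1 where x1: "x1 \<in> T" "\<And>x. x \<in> T \<Longrightarrow> v x - W x \<le> v x1 - W x1"
        using continuous_attains_sup[OF cT _ cont] xsT by blast
      have "- (A * m * s) < v xs" using neg xsO by (auto simp: not_le)
      then have posx1: "W x1 < v x1" using x1(2)[OF xsT] Wxs by linarith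
      have x1c: "x1 \<in> closure \<Omega>" and \<tau>1: "\<tau> x1 \<le> \<rho>" using x1(1) by (auto simp: T_iff)
      have vup: "v x1 \<le> C3 * m * \<tau> x1" using up[OF x1c] by (simp add: v_def \<tau>_def e_def)
      have perp0: "0 \<le> (norm (x1 - z))\<^sup>2 - (\<tau> x1)\<^sup>2"
        unfolding \<tau>_def norm_perp_sq[OF ne, symmetric] by simp
      have "x1 \<notin> frontier \<Omega>"
      proof
        assume "x1 \<in> frontier \<Omega>"
        then have "x1 \<notin> \<Omega>" using \<Omega>(1) by (simp add: frontier_def interior_open)
        from ball_normal_lower[OF bn this pos(2)] have 1: "2 * \<rho> * \<tau> x1 \<le> (norm (x1 - z))\<^sup>2" by (simp add: \<tau>_def)
        have "(\<tau> x1)\<^sup>2 \<le> \<rho> * \<tau> x1" unfolding power2_eq_square using \<tau>1 \<tau>0[OF x1c] by (rule mult_right_mono)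
        then have "\<rho> * \<tau> x1 \<le> (norm (x1 - z))\<^sup>2 - (\<tau> x1)\<^sup>2" using 1 by linarith
        then have "B * m * (\<rho> * \<tau> x1) \<le> B * m * ((norm (x1 - z))\<^sup>2 - (\<tau> x1)\<^sup>2)" using B m by (intro mult_left_mono) auto
        moreover have "B * m * (\<rho> * \<tau> x1) = (C3 + 2 * Q * A) * m * \<tau> x1" using pos(2) by (simp add: B_def)
        moreover have "a' * (k (\<tau> x1) - k 0) \<ge> - (2 * Q * A * m * \<tau> x1)"
        proof -
          have "\<tau> x1 * (- (Q * P)) \<le> \<tau> x1 * k' 0" using ks(2) \<tau>0[OF x1c] by (rule mult_left_mono)
          also have "\<dots> \<le> k (\<tau> x1) - k 0" by (rule klow[OF \<tau>0[OF x1c]])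
          finally have "a' * (\<tau> x1 * (- (Q * P))) \<le> a' * (k (\<tau> x1) - k 0)" using a'0 by (intro mult_left_mono) auto
          moreover have "a' * (\<tau> x1 * (- (Q * P))) = - (Q * \<tau> x1 * (a' * P))" by simp
          moreover have "\<dots> = - (2 * Q * A * m * \<tau> x1)" unfolding a'P by simp
          ultimately show ?thesis by linarith
        qed
        moreover have "0 \<le> A * m * \<tau> x1" using A1 m \<tau>0[OF x1c] by simp
        moreover have "(C3 + 2 * Q * A) * m * \<tau> x1 = C3 * m * \<tau> x1 + 2 * Q * A * m * \<tau> x1" by (simp add: algebra_simps)
        ultimately have "C3 * m * \<tau> x1 \<le> W x1" unfolding W_def by linarith
        then show False using vup posx1 by linarith
      qed
      then have x1O: "x1 \<in> \<Omega>" using x1c \<Omega>(1) by (simp add: frontier_def interior_open)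
      have "\<tau> x1 \<noteq> \<rho>"
      proof
        assume eq: "\<tau> x1 = \<rho>"
        have "a' * (- C4) \<le> a' * (k \<rho> - k 0)" using ks(3) a'0 by (intro mult_left_mono) auto
        moreover have "a' * C4 \<le> m * C4" using a'1 m C4 by (intro mult_right_mono) auto
        moreover have "0 \<le> B * m * ((norm (x1 - z))\<^sup>2 - (\<tau> x1)\<^sup>2)" using B m perp0 by simp
        moreover have "A * m * \<rho> = C3 * m * \<rho> + m * C4 + m * \<rho>" using pos(2) by (simp add: A_def algebra_simps)
        moreover have "0 \<le> m * \<rho>" using m pos by simp
        ultimately have "C3 * m * \<rho> \<le> W x1" unfolding W_def eq by simp
        then show False using vup posx1 eq by simp
      qed
      then have \<tau>1': "\<tau> x1 < \<rho>" using \<tau>1 by simp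
      define d1 where "d1 = dist_bdry \<Omega> x1"
      have d1: "0 < d1" unfolding d1_def by (rule dist_bdry_pos[OF \<Omega>(1,2) x1O])
      have d1\<tau>: "d1 \<le> \<tau> x1" unfolding d1_def \<tau>_def by (rule dist_bdry_le_height[OF bn \<Omega>(1) z x1O pos(1)])
      \<comment> \<open>The second derivative of \<open>k\<close> at the touching height. Since
        \<open>d1 \<le> \<tau> x1\<close>, it is at most \<open>d1 powr (- \<alpha>)\<close>, the
        size of the density.\<close>
      define \<kappa> where "\<kappa> = (\<tau> x1 + s) powr (-\<alpha>)"
      have \<kappa>0: "0 < \<kappa>" using d1 d1\<tau> s by (simp add: \<kappa>_def)
      obtain \<delta> where \<delta>: "0 < \<delta>"
         "\<And>y. norm y < \<delta> \<Longrightarrow> \<bar>k (\<tau> x1 + y) - k (\<tau> x1) - k' (\<tau> x1) \<bullet> y - (y \<bullet> (\<kappa> * y)) / 2\<bar> \<le> (\<kappa> / 2) * (norm y)\<^sup>2"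
      proof (rule second_order_expansion[where f = k and G = k' and ?x0.0 = "\<tau> x1" and r = "d1" and H = "\<lambda>y. \<kappa> * y" and e = "\<kappa> / 2"])
        show "GDERIV k y :> k' y" if "y \<in> ball (\<tau> x1) d1" for y
        proof -
          have "0 < y" using that d1\<tau> by (auto simp: dist_real_def)
          then show ?thesis using k[of y] s by simp
        qed
        show "(k' has_derivative (\<lambda>y. \<kappa> * y)) (at (\<tau> x1))"
          using k2[of "\<tau> x1"] d1 d1\<tau> s unfolding \<kappa>_def has_field_derivative_def by simp
        show "0 < \<kappa> / 2" using \<kappa>0 by simp
      qed (use that d1 in blast)+
      define r where "r = min (d1 / 2) (min (\<rho> - \<tau> x1) \<delta>)"
      have r: "0 < r" "r \<le> d1 / 2" "r \<le> \<rho> - \<tau> x1" "r \<le> \<delta>" using d1 \<tau>1' \<delta>(1) unfolding r_def by linarith+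
      \<comment> \<open>The gradient of \<open>W\<close> at \<open>x1\<close>, added to the slope
        \<open>p\<close>.\<close>
      define q where "q = p + (2 * B * m) *\<^sub>R (x1 - z) + (A * m + a' * k' (\<tau> x1) - 2 * B * m * \<tau> x1) *\<^sub>R e"
      have ballsub: "ball x1 r \<subseteq> \<Omega>"
      proof -
        have "ball x1 r \<subseteq> ball x1 (dist_bdry \<Omega> x1)" using r d1 by (intro subset_ball) (simp add: d1_def)
        then show ?thesis using dist_bdry_ball_subset[OF x1O] by blast
      qed
      have "lam / 4 * d1 powr (-\<alpha>) \<le> C * ((a' * \<kappa>) * (B * m) ^ (?n - 1))"
      proof (rule C(2)[where f = f and u = u and \<Omega> = \<Omega> and e = e and p = q and ?x1.0 = x1 and r = r])
        show "lam / 4 * d1 powr (-\<alpha>) \<le> f x" if "x \<in> ball x1 r" for x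
          using ma_data_density_near(1)[OF ma \<alpha> lam x1O, of x] that r(2) by (simp add: d1_def dist_norm norm_minus_commute)
        show "u (x1 + y) \<le> u x1 + q \<bullet> y + a' * \<kappa> * (e \<bullet> y)\<^sup>2 + B * m * (norm (y - (e \<bullet> y) *\<^sub>R e))\<^sup>2" if y: "norm y < r" for y
        proof -
          define \<eta> where "\<eta> = e \<bullet> y"
          have \<eta>: "\<bar>\<eta>\<bar> \<le> norm y" unfolding \<eta>_def using Cauchy_Schwarz_ineq2[of e y] ne by simp
          have ty: "\<tau> (x1 + y) = \<tau> x1 + \<eta>" by (simp add: \<tau>_def \<eta>_def inner_diff_right inner_add_right)
          have "x1 + y \<in> ball x1 r" using y by (simp add: dist_norm)
          then have "x1 + y \<in> closure \<Omega>" using ballsub closure_subset by blast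
          then have "x1 + y \<in> T" using ty \<eta> y r(3) by (auto simp: T_iff)
          then have "v (x1 + y) - W (x1 + y) \<le> v x1 - W x1" by (rule x1(2))
          then have 1: "u (x1 + y) \<le> u x1 + p \<bullet> y + (W (x1 + y) - W x1)" by (simp add: v_def inner_add_right)
          have "\<bar>k (\<tau> x1 + \<eta>) - k (\<tau> x1) - k' (\<tau> x1) * \<eta> - (\<eta> * (\<kappa> * \<eta>)) / 2\<bar> \<le> (\<kappa> / 2) * \<eta>\<^sup>2"
            using \<delta>(2)[of \<eta>] \<eta> y r(4) by simp
          moreover have "(\<eta> * (\<kappa> * \<eta>)) / 2 = \<kappa> / 2 * \<eta>\<^sup>2" by (simp add: power2_eq_square)
          ultimately have "k (\<tau> x1 + \<eta>) - k (\<tau> x1) \<le> k' (\<tau> x1) * \<eta> + \<kappa> * \<eta>\<^sup>2" by linarith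
          then have 2: "a' * (k (\<tau> x1 + \<eta>) - k (\<tau> x1)) \<le> a' * (k' (\<tau> x1) * \<eta> + \<kappa> * \<eta>\<^sup>2)" using a'0 by (intro mult_left_mono) auto
          have eq: "x1 + y - z = (x1 - z) + y" by simp
          have 3: "(norm (x1 + y - z))\<^sup>2 = (norm (x1 - z))\<^sup>2 + 2 * ((x1 - z) \<bullet> y) + (norm y)\<^sup>2"
            unfolding eq using dot_norm[of "x1 - z" y] by (simp add: field_simps)
          have 4: "(norm (y - (e \<bullet> y) *\<^sub>R e))\<^sup>2 = (norm y)\<^sup>2 - \<eta>\<^sup>2" unfolding \<eta>_def by (rule norm_perp_sq[OF ne])
          have "W (x1 + y) - W x1 = B * m * (2 * ((x1 - z) \<bullet> y) + (norm y)\<^sup>2 - 2 * \<tau> x1 * \<eta> - \<eta>\<^sup>2) + A * m * \<eta>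
              + a' * (k (\<tau> x1 + \<eta>) - k (\<tau> x1))"
            unfolding W_def ty 3 by (simp add: power2_eq_square algebra_simps)
          moreover have "q \<bullet> y = p \<bullet> y + 2 * B * m * ((x1 - z) \<bullet> y) + (A * m + a' * k' (\<tau> x1) - 2 * B * m * \<tau> x1) * \<eta>"
            by (simp add: q_def inner_add_left \<eta>_def)
          moreover have "a' * (k' (\<tau> x1) * \<eta> + \<kappa> * \<eta>\<^sup>2) = a' * k' (\<tau> x1) * \<eta> + a' * \<kappa> * \<eta>\<^sup>2"
            by (simp add: algebra_simps)
          moreover have "B * m * (2 * ((x1 - z) \<bullet> y) + (norm y)\<^sup>2 - 2 * \<tau> x1 * \<eta> - \<eta>\<^sup>2) =
              2 * B * m * ((x1 - z) \<bullet> y) + B * m * ((norm y)\<^sup>2 - \<eta>\<^sup>2) - 2 * B * m * \<tau> x1 * \<eta>"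
            by (simp add: algebra_simps)
          moreover have "(A * m + a' * k' (\<tau> x1) - 2 * B * m * \<tau> x1) * \<eta> =
              A * m * \<eta> + a' * k' (\<tau> x1) * \<eta> - 2 * B * m * \<tau> x1 * \<eta>"
            by (simp add: algebra_simps)
          ultimately show ?thesis using 1 2 unfolding 4 unfolding \<eta>_def[symmetric] by linarith
        qed
      qed (use cvO MA ne a'0 \<kappa>0 B m r(1) ballsub in auto)
      also have "(a' * \<kappa>) * (B * m) ^ (?n - 1) = (a' * m ^ (?n - 1)) * B ^ (?n - 1) * \<kappa>"
        by (simp add: power_mult_distrib)
      also have "\<dots> = a * B ^ (?n - 1) * \<kappa>" by (simp only: a'm)
      finally have "lam / 4 * d1 powr (-\<alpha>) \<le> C * (a * B ^ (?n - 1) * \<kappa>)" .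
      also have "\<dots> \<le> C * (a * B ^ (?n - 1) * d1 powr (-\<alpha>))"
        unfolding \<kappa>_def using C a B d1 d1\<tau> s \<alpha> by (intro mult_left_mono powr_mono2') auto
      also have "\<dots> = C * (a * B ^ (?n - 1)) * d1 powr (-\<alpha>)" by simp
      also have "\<dots> \<le> lam / 8 * d1 powr (-\<alpha>)" using aC by (intro mult_right_mono) auto
      finally show False using lam d1 by simp
    qed
  qed
qed

section \<open>Maximum principle and affine functions that touch at a boundary point\<close>

lemma convex_le_on_frontier:
  fixes g :: "'a::euclidean_space \<Rightarrow> real"
  assumes \<Omega>: "open \<Omega>" "bounded \<Omega>" and cv: "convex_on (closure \<Omega>) g"
    and fr: "\<And>x. x \<in> frontier \<Omega> \<Longrightarrow> g x \<le> 0" and x: "x \<in> closure \<Omega>"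
  shows "g x \<le> 0"
proof (cases "x \<in> frontier \<Omega>")
  case False
  then have xO: "x \<in> \<Omega>" using x \<Omega>(1) by (simp add: frontier_def interior_open)
  obtain e :: 'a where e: "norm e = 1" using vector_choose_size[of 1] by auto
  obtain L where L: "0 < L" "\<And>y. y \<in> \<Omega> \<Longrightarrow> norm y \<le> L" using \<Omega>(2) by (metis bounded_pos)
  have far: "x + (2 * L + 1) *\<^sub>R w \<notin> \<Omega>" if "norm w = 1" for w
  proof
    assume "x + (2 * L + 1) *\<^sub>R w \<in> \<Omega>"
    then have "norm (x + (2 * L + 1) *\<^sub>R w) \<le> L" by (rule L(2))
    moreover have "norm ((2 * L + 1) *\<^sub>R w) \<le> norm (x + (2 * L + 1) *\<^sub>R w) + norm x"
      using norm_triangle_ineq4[of "x + (2 * L + 1) *\<^sub>R w" x] by simp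
    ultimately show False using L(2)[OF xO] L(1) that by simp
  qed
  have ray: "\<exists>t>0. x + t *\<^sub>R w \<in> frontier \<Omega>" if w: "norm w = 1" for w
  proof -
    obtain t where t: "0 \<le> t" "x + t *\<^sub>R (x + (2 * L + 1) *\<^sub>R w - x) \<in> frontier \<Omega>"
      using frontier_on_segment[OF xO far[OF w]] by blast
    have "t \<noteq> 0" using t False by auto
    then show ?thesis using t L(1) by (intro exI[of _ "t * (2 * L + 1)"]) auto
  qed
  obtain s t where s: "0 < s" "x + s *\<^sub>R e \<in> frontier \<Omega>" and t: "0 < t" "x + t *\<^sub>R (- e) \<in> frontier \<Omega>"
    using ray[of e] ray[of "- e"] e by auto
  define k where "k = s / (s + t)"
  have k: "0 \<le> k" "k \<le> 1" using s t by (auto simp: k_def)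
  have cl: "x + s *\<^sub>R e \<in> closure \<Omega>" "x + t *\<^sub>R (- e) \<in> closure \<Omega>" using s t by (auto simp: frontier_def)
  have "k * (s + t) = s" using s t by (simp add: k_def)
  then have eqx: "x + s *\<^sub>R e + k *\<^sub>R (x + t *\<^sub>R (- e) - (x + s *\<^sub>R e)) = x"
  proof -
    assume ks: "k * (s + t) = s"
    have "x + s *\<^sub>R e + k *\<^sub>R (x + t *\<^sub>R (- e) - (x + s *\<^sub>R e)) = x + (s - k * (s + t)) *\<^sub>R e"
      by (simp add: algebra_simps)
    then show ?thesis by (simp add: ks)
  qed
  have "g x \<le> g (x + s *\<^sub>R e) + k * (g (x + t *\<^sub>R (- e)) - g (x + s *\<^sub>R e))"
    using convex_on_segment_le[OF cv cl k] unfolding eqx .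
  also have "\<dots> = (1 - k) * g (x + s *\<^sub>R e) + k * g (x + t *\<^sub>R (- e))" by (simp add: algebra_simps)
  also have "\<dots> \<le> 0"
    using fr[OF s(2)] fr[OF t(2)] k by (intro add_nonpos_nonpos mult_nonneg_nonpos) auto
  finally show ?thesis .
qed (use fr in simp)

lemma convex_on_minus_affine:
  fixes u :: "'a::euclidean_space \<Rightarrow> real"
  assumes "convex_on S u"
  shows "convex_on S (\<lambda>x. u x - (p \<bullet> x + b))"
proof -
  have cS: "convex S" using assms by (rule convex_on_imp_convex)
  have "convex_on S (\<lambda>x. - (p \<bullet> x + b))"
  proof (rule convex_onI)
    fix t x y
    show "- (p \<bullet> ((1 - t) *\<^sub>R x + t *\<^sub>R y) + b) \<le> (1 - t) * - (p \<bullet> x + b) + t * - (p \<bullet> y + b)"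
      by (simp add: inner_add_right algebra_simps)
  qed (rule cS)
  from convex_on_add[OF assms this] show ?thesis by (simp only: diff_conv_add_uminus)
qed

text \<open>If the tangential parts of \<open>q\<close> and \<open>P\<close> differed by
  \<open>w\<close>, the boundary point over \<open>- s *\<^sub>R w\<close> would violate the
  inequality for small \<open>s\<close>, all other terms being quadratic in \<open>s\<close>. What
  remains is a multiple of the normal, and \<open>ball_normal_upper\<close> turns the quadratic
  error into one linear in the height. The maximum principle carries the upper bound into
  \<open>\<Omega>\<close>.\<close>

lemma affine_touching_at_boundary:
  fixes \<Omega> :: "'a::euclidean_space set"
  assumes dim: "2 \<le> DIM('a)" and \<Omega>: "open \<Omega>" "bounded \<Omega>" and ucv: "convex_on (closure \<Omega>) u"
    and pos: "0 < R" "0 < \<rho>" "0 \<le> C6" and z: "z \<in> frontier \<Omega>" and bn: "ball_normal \<Omega> \<rho> R z e"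
    and q: "q \<bullet> e = 0" and tay: "\<And>x. x \<in> frontier \<Omega> \<Longrightarrow> \<bar>u x - u z - q \<bullet> (x - z)\<bar> \<le> C6 * (norm (x - z))\<^sup>2"
    and P: "\<And>x. x \<in> frontier \<Omega> \<Longrightarrow> u z + P \<bullet> (x - z) \<le> u x"
  shows "P = q + (P \<bullet> e) *\<^sub>R e" and "- (2 * R * C6) \<le> - (P \<bullet> e)"
    and "x \<in> frontier \<Omega> \<Longrightarrow> (- (P \<bullet> e) - 2 * R * C6) * (e \<bullet> (x - z)) \<le> u x - (u z + P \<bullet> (x - z))"
    and "x \<in> closure \<Omega> \<Longrightarrow> u x - (u z + P \<bullet> (x - z)) \<le> (1 + 2 * R * C6) * max (- (P \<bullet> e)) 1 * (e \<bullet> (x - z))"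
proof -
  have ne: "norm e = 1" using bn by (simp add: ball_normal_def)
  have ee: "e \<bullet> e = 1" using ne by (simp add: norm_eq_1)
  define k where "k = e \<bullet> (q - P)"
  define w where "w = (q - P) - k *\<^sub>R e"
  have ew: "e \<bullet> w = 0" by (simp add: w_def k_def inner_diff_right ee)
  have w0: "w = 0"
  proof (rule ccontr)
    assume nz: "w \<noteq> 0"
    \<comment> \<open>Dominates the coefficients of the quadratic terms: the normal component
      \<open>k\<close> times the height of the boundary, and the Taylor error.\<close>
    define Kb where "Kb = \<bar>k\<bar> / \<rho> + 2 * C6 + 1"
    have Kb: "0 < Kb" using pos by (simp add: Kb_def add_nonneg_pos)
    obtain s where s: "0 < s" "s \<le> 1" "s * (norm w * 2 / \<rho> + Kb) < 1"
      using small_step[of 1 "norm w * 2 / \<rho> + Kb"] pos Kb by auto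
    have "0 \<le> s * Kb" "0 \<le> s * (norm w * 2 / \<rho>)" using s Kb pos by auto
    then have sK: "s * Kb < 1" "s * (norm w * 2 / \<rho>) < 1" using s(3) by (auto simp: distrib_left)
    have nsw: "norm (- s *\<^sub>R w) = s * norm w" using s by simp
    have "norm (- s *\<^sub>R w) \<le> \<rho> / 2" unfolding nsw using sK(2) pos by (simp add: field_simps)
    moreover have "e \<bullet> (- s *\<^sub>R w) = 0" using ew by simp
    ultimately obtain \<tau> where \<tau>: "0 \<le> \<tau>" "\<rho> * \<tau> \<le> (norm (- s *\<^sub>R w))\<^sup>2" "z + - s *\<^sub>R w + \<tau> *\<^sub>R e \<in> frontier \<Omega>"
      using frontier_point_above[OF bn \<Omega>(1) z pos(1,2)] by blast
    define X where "X = s\<^sup>2 * (norm w)\<^sup>2"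
    have X0: "0 \<le> X" by (simp add: X_def)
    have rX: "\<rho> * \<tau> \<le> X" using \<tau>(2) unfolding nsw by (simp add: X_def power_mult_distrib)
    have "X \<le> (\<rho> / 2)\<^sup>2" unfolding X_def power_mult_distrib[symmetric]
      using \<open>norm (- s *\<^sub>R w) \<le> \<rho> / 2\<close> s unfolding nsw by (intro power_mono) auto
    then have "X \<le> \<rho> * \<rho> / 4" by (simp add: power2_eq_square)
    moreover have "0 \<le> \<rho> * \<rho>" by simp
    ultimately have "\<rho> * \<tau> \<le> \<rho> * \<rho>" using rX by linarith
    then have "\<tau> \<le> \<rho>" using pos by simp
    then have t2: "\<tau>\<^sup>2 \<le> X" using mult_right_mono[of \<tau> \<rho> \<tau>] \<tau>(1) rX by (simp add: power2_eq_square)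
    define x where "x = z + - s *\<^sub>R w + \<tau> *\<^sub>R e"
    have xz: "x - z = - s *\<^sub>R w + \<tau> *\<^sub>R e" by (simp add: x_def)
    have nx: "(norm (x - z))\<^sup>2 = X + \<tau>\<^sup>2"
      unfolding xz norm_add_scaled_unit_sq[OF ne] nsw using ew by (simp add: X_def power_mult_distrib)
    have xf: "x \<in> frontier \<Omega>" using \<tau>(3) by (simp add: x_def)
    have "0 \<le> (q - P) \<bullet> (x - z) + C6 * (norm (x - z))\<^sup>2"
      using tay[OF xf] P[OF xf] by (simp add: inner_diff_left abs_le_iff)
    also have "(q - P) \<bullet> (x - z) = - s * (norm w)\<^sup>2 + \<tau> * k"
    proof -
      have qP: "q - P = w + k *\<^sub>R e" by (simp add: w_def)
      show ?thesis unfolding xz qP using ew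
        by (simp add: inner_add_left inner_add_right inner_diff_right ee ne inner_commute[of w e] dot_square_norm)
    qed
    also have "\<tau> * k \<le> X * (\<bar>k\<bar> / \<rho>)"
    proof -
      have "\<tau> * k \<le> \<tau> * \<bar>k\<bar>" using \<tau>(1) by (intro mult_left_mono) auto
      also have "\<dots> \<le> (X / \<rho>) * \<bar>k\<bar>" using rX pos by (intro mult_right_mono) (auto simp: field_simps)
      finally show ?thesis by simp
    qed
    also have "C6 * (norm (x - z))\<^sup>2 \<le> C6 * (2 * X)" using nx t2 pos by (intro mult_left_mono) auto
    finally have "0 \<le> - s * (norm w)\<^sup>2 + X * (\<bar>k\<bar> / \<rho>) + C6 * (2 * X)" by simp
    then have "s * (norm w)\<^sup>2 \<le> X * (\<bar>k\<bar> / \<rho> + 2 * C6)" by (simp add: algebra_simps)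
    also have "\<dots> \<le> X * Kb" using X0 by (intro mult_left_mono) (auto simp: Kb_def)
    also have "\<dots> = s * (norm w)\<^sup>2 * (s * Kb)" by (simp add: X_def power2_eq_square)
    also have "\<dots> < s * (norm w)\<^sup>2 * 1" using sK s nz by (intro mult_strict_left_mono) auto
    finally show False by simp
  qed
  define M where "M = - (P \<bullet> e)"
  have kM: "k = M" using q by (simp add: k_def M_def inner_diff_right inner_commute)
  have "q - P = M *\<^sub>R e" using w0 kM by (simp add: w_def)
  then have "q - (q - P) = q - M *\<^sub>R e" by (simp only:)
  then have PM: "P = q - M *\<^sub>R e" by simp
  show "P = q + (P \<bullet> e) *\<^sub>R e" using PM by (simp add: M_def)
  have l: "u z + P \<bullet> (x - z) = u z + q \<bullet> (x - z) - M * (e \<bullet> (x - z))" for x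
    unfolding PM by (simp add: inner_diff_left)
  have bnd: "C6 * (norm (x - z))\<^sup>2 \<le> 2 * R * C6 * (e \<bullet> (x - z))" if "x \<in> closure \<Omega>" for x
    using mult_left_mono[OF ball_normal_upper[OF bn that pos(1)] pos(3)] by (simp add: ac_simps)
  have frc: "x \<in> closure \<Omega>" if "x \<in> frontier \<Omega>" for x using that by (simp add: frontier_def)
  have two: "(M - 2 * R * C6) * (e \<bullet> (x - z)) \<le> u x - (u z + P \<bullet> (x - z)) \<and>
      u x - (u z + P \<bullet> (x - z)) \<le> (M + 2 * R * C6) * (e \<bullet> (x - z))" if "x \<in> frontier \<Omega>" for x
    using tay[OF that] bnd[OF frc[OF that]] unfolding l by (simp add: abs_le_iff algebra_simps)
  show "x \<in> frontier \<Omega> \<Longrightarrow> (- (P \<bullet> e) - 2 * R * C6) * (e \<bullet> (x - z)) \<le> u x - (u z + P \<bullet> (x - z))"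
    using two by (simp add: M_def)
  \<comment> \<open>A boundary point of positive height is needed in order to divide by the height;
    dimension at least 2 supplies a tangential direction.\<close>
  obtain y where y: "y \<noteq> 0" "orthogonal e y" using orthogonal_to_vector_exists[OF dim] by blast
  define y' where "y' = (\<rho> / 2 / norm y) *\<^sub>R y"
  have ny': "norm y' = \<rho> / 2" using y pos by (simp add: y'_def)
  have ey': "e \<bullet> y' = 0" using y by (simp add: y'_def orthogonal_def)
  obtain \<tau> where \<tau>: "0 \<le> \<tau>" "z + y' + \<tau> *\<^sub>R e \<in> frontier \<Omega>"
    using frontier_point_above[OF bn \<Omega>(1) z pos(1,2) ey'] ny' by auto
  define x0 where "x0 = z + y' + \<tau> *\<^sub>R e"
  have x0f: "x0 \<in> frontier \<Omega>" using \<tau> by (simp add: x0_def)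
  have x0z: "x0 - z = y' + \<tau> *\<^sub>R e" by (simp add: x0_def)
  have "0 < (norm y')\<^sup>2" unfolding ny' using pos by simp
  also have "\<dots> \<le> (norm (x0 - z))\<^sup>2" unfolding x0z norm_add_scaled_unit_sq[OF ne] using ey' by simp
  also have "\<dots> \<le> 2 * R * (e \<bullet> (x0 - z))" by (rule ball_normal_upper[OF bn frc[OF x0f] pos(1)])
  finally have t0: "0 < e \<bullet> (x0 - z)" using pos by (simp add: zero_less_mult_iff)
  have "0 \<le> (M + 2 * R * C6) * (e \<bullet> (x0 - z))" using two[OF x0f] P[OF x0f] by linarith
  then have "0 \<le> M + 2 * R * C6" using t0 by (simp add: zero_le_mult_iff)
  then show "- (2 * R * C6) \<le> - (P \<bullet> e)" by (simp add: M_def)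
  define K where "K = (1 + 2 * R * C6) * max M 1"
  show "u x - (u z + P \<bullet> (x - z)) \<le> (1 + 2 * R * C6) * max (- (P \<bullet> e)) 1 * (e \<bullet> (x - z))" if x: "x \<in> closure \<Omega>"
  proof -
    have K: "M + 2 * R * C6 \<le> K"
    proof -
      have "0 \<le> 2 * R * C6" using pos by simp
      then have "2 * R * C6 * 1 \<le> 2 * R * C6 * max M 1" by (intro mult_left_mono) auto
      then show ?thesis by (simp add: K_def algebra_simps)
    qed
    define g where "g x = u x - ((P + K *\<^sub>R e) \<bullet> x + (u z - (P + K *\<^sub>R e) \<bullet> z))" for x
    have ge: "g x = u x - (u z + P \<bullet> (x - z)) - K * (e \<bullet> (x - z))" for x
      by (simp add: g_def inner_add_left inner_diff_right algebra_simps)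
    have "g x \<le> 0"
    proof (rule convex_le_on_frontier[OF \<Omega> _ _ x])
      show "convex_on (closure \<Omega>) g" unfolding g_def by (rule convex_on_minus_affine[OF ucv])
      fix y assume y: "y \<in> frontier \<Omega>"
      have "(M + 2 * R * C6) * (e \<bullet> (y - z)) \<le> K * (e \<bullet> (y - z))"
        using K ball_normal_nonneg[OF bn frc[OF y] pos(1)] by (intro mult_right_mono) auto
      then show "g y \<le> 0" using two[OF y] by (simp add: ge)
    qed
    then show ?thesis by (simp add: ge K_def M_def)
  qed
qed

section \<open>Subgradients of Alexandrov solutions\<close>

lemma subdifferential_bounded:
  fixes u :: "'a::euclidean_space \<Rightarrow> real"
  assumes \<Omega>: "open \<Omega>" "x0 \<in> \<Omega>" and uc: "continuous_on \<Omega> u"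
  obtains r B where "0 < r" "cball x0 r \<subseteq> \<Omega>" "\<And>x p. x \<in> cball x0 r \<Longrightarrow> p \<in> subdifferential \<Omega> u x \<Longrightarrow> norm p \<le> B"
proof -
  obtain r0 where r0: "r0 > 0" "cball x0 r0 \<subseteq> \<Omega>" using \<Omega> by (meson open_contains_cball)
  define r where "r = r0 / 2"
  have r: "0 < r" using r0 by (simp add: r_def)
  have "bounded (u ` cball x0 r0)"
    by (intro compact_imp_bounded compact_continuous_image continuous_on_subset[OF uc r0(2)]) simp
  then obtain U where "\<forall>y\<in>u ` cball x0 r0. norm y \<le> U" unfolding bounded_iff by blast
  then have U: "\<And>x. x \<in> cball x0 r0 \<Longrightarrow> \<bar>u x\<bar> \<le> U" by auto
  show ?thesis
  proof (rule that[of r "2 * U / r"])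
    show "cball x0 r \<subseteq> \<Omega>" using r0 by (auto simp: r_def)
    fix x p assume x: "x \<in> cball x0 r" and p: "p \<in> subdifferential \<Omega> u x"
    have x': "x \<in> cball x0 r0" using x r0 by (auto simp: r_def)
    show "norm p \<le> 2 * U / r"
    proof (cases "p = 0")
      case True
      have "0 \<le> U" using U[OF x'] by simp
      then show ?thesis using True r by simp
    next
      case False
      define y where "y = x + (r / norm p) *\<^sub>R p"
      have "dist x y = r" using False r by (simp add: y_def dist_norm)
      then have y: "y \<in> cball x0 r0" using x dist_triangle[of x0 y x] by (auto simp: r_def)
      then have "u x + p \<bullet> (y - x) \<le> u y" using p r0 by (auto simp: subdifferential_def)
      moreover have "p \<bullet> (y - x) = r * norm p" using False by (simp add: y_def dot_square_norm power2_eq_square)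
      ultimately have "r * norm p \<le> 2 * U" using U[OF x'] U[OF y] by (simp add: abs_le_iff)
      then show ?thesis using r by (simp add: field_simps)
    qed
  qed (rule r)
qed

text \<open>Compactness: subgradients at points converging to \<open>x0\<close> are bounded, and the
  defining inequality passes to the limit of a subsequence.\<close>

lemma subdifferential_usc:
  fixes u :: "'a::euclidean_space \<Rightarrow> real"
  assumes \<Omega>: "open \<Omega>" "x0 \<in> \<Omega>" and uc: "continuous_on \<Omega> u"
    and V: "open V" "subdifferential \<Omega> u x0 \<subseteq> V"
  obtains \<delta> where "0 < \<delta>" "ball x0 \<delta> \<subseteq> \<Omega>" "\<And>x. x \<in> ball x0 \<delta> \<Longrightarrow> subdifferential \<Omega> u x \<subseteq> V"
proof -
  obtain r B where r: "0 < r" "cball x0 r \<subseteq> \<Omega>"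
    and B: "\<And>x p. x \<in> cball x0 r \<Longrightarrow> p \<in> subdifferential \<Omega> u x \<Longrightarrow> norm p \<le> B"
    using subdifferential_bounded[OF \<Omega> uc] by blast
  have "\<exists>\<delta>>0. \<delta> \<le> r \<and> (\<forall>x\<in>ball x0 \<delta>. subdifferential \<Omega> u x \<subseteq> V)"
  proof (rule ccontr)
    assume neg: "\<not> ?thesis"
    have "\<exists>x p. x \<in> ball x0 (r / real (Suc n)) \<and> p \<in> subdifferential \<Omega> u x \<and> p \<notin> V" for n
    proof -
      have "0 < r / real (Suc n)" "r / real (Suc n) \<le> r" using r by (auto simp: divide_le_eq algebra_simps)
      then have "\<not> (\<forall>x\<in>ball x0 (r / real (Suc n)). subdifferential \<Omega> u x \<subseteq> V)" using neg by blast
      then show ?thesis by blast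
    qed
    then obtain X P where X: "\<And>n. X n \<in> ball x0 (r / real (Suc n))"
      and P: "\<And>n. P n \<in> subdifferential \<Omega> u (X n)" "\<And>n. P n \<notin> V" by metis
    have Xr: "X n \<in> cball x0 r" for n
    proof -
      have "r / real (Suc n) \<le> r" using r by (auto simp: divide_le_eq algebra_simps)
      then show ?thesis using X[of n] by auto
    qed
    have "P n \<in> cball 0 B" for n using B[OF Xr P(1)] by simp
    moreover have "compact (cball (0::'a) B)" by simp
    ultimately obtain p h where h: "strict_mono (h :: nat \<Rightarrow> nat)" "(P \<circ> h) \<longlonglongrightarrow> p"
      unfolding compact_def by metis
    have "X \<longlonglongrightarrow> x0"
    proof (rule metric_tendsto_imp_tendsto)
      have "(\<lambda>n. r * inverse (real (Suc n))) \<longlonglongrightarrow> r * 0"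
        by (intro tendsto_intros LIMSEQ_inverse_real_of_nat)
      then show "(\<lambda>n. r / real (Suc n)) \<longlonglongrightarrow> 0" by (simp add: divide_inverse)
      show "\<forall>\<^sub>F n in sequentially. dist (X n) x0 \<le> dist (r / real (Suc n)) 0"
        using X r by (intro always_eventually allI) (auto simp: dist_commute less_imp_le)
    qed
    then have Xh: "(X \<circ> h) \<longlonglongrightarrow> x0" using h(1) by (rule LIMSEQ_subseq_LIMSEQ)
    have "(X \<circ> h) n \<in> \<Omega>" for n using Xr[of "h n"] r(2) by auto
    then have "(\<lambda>n. u ((X \<circ> h) n)) \<longlonglongrightarrow> u x0"
      by (intro continuous_on_tendsto_compose[OF uc Xh \<Omega>(2)] always_eventually allI)
    have "p \<in> subdifferential \<Omega> u x0"
      unfolding subdifferential_def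
    proof (clarify)
      fix y assume y: "y \<in> \<Omega>"
      have "(\<lambda>n. u ((X \<circ> h) n) + (P \<circ> h) n \<bullet> (y - (X \<circ> h) n)) \<longlonglongrightarrow> u x0 + p \<bullet> (y - x0)"
        by (intro tendsto_intros Xh h(2)) fact
      moreover have "u ((X \<circ> h) n) + (P \<circ> h) n \<bullet> (y - (X \<circ> h) n) \<le> u y" for n
        using P(1)[of "h n"] y by (auto simp: subdifferential_def)
      ultimately show "u x0 + p \<bullet> (y - x0) \<le> u y" by (intro LIMSEQ_le_const2) auto
    qed
    then have "p \<in> V" using V by blast
    moreover have "p \<notin> V"
    proof -
      have "closed (- V)" using V by (simp add: closed_Compl)
      then have "p \<in> - V" by (rule closed_sequentially[OF _ _ h(2)]) (use P(2) in auto)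
      then show ?thesis by simp
    qed
    ultimately show False by simp
  qed
  then obtain \<delta> where "\<delta> > 0" "\<delta> \<le> r" "\<forall>x\<in>ball x0 \<delta>. subdifferential \<Omega> u x \<subseteq> V" by blast
  moreover have "ball x0 \<delta> \<subseteq> \<Omega>" using r(2) \<open>\<delta> \<le> r\<close> by (force simp: subset_iff)
  ultimately show ?thesis using that by blast
qed

lemma subdifferential_closed: "closed (subdifferential \<Omega> u (x :: 'a::euclidean_space))"
proof -
  have "subdifferential \<Omega> u x = (\<Inter>y\<in>\<Omega>. {p. (y - x) \<bullet> p \<le> u y - u x})"
    by (auto simp: subdifferential_def inner_commute le_diff_eq add.commute)
  then show ?thesis by (simp add: closed_INT closed_halfspace_le)
qed

text \<open>The equation itself supplies subgradients: by semicontinuity with the empty open set, an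
  empty subdifferential at \<open>x0\<close> would be empty on a whole ball, and its image would
  have mass 0 against a positive density.\<close>

lemma subdifferential_nonempty:
  fixes u :: "'a::euclidean_space \<Rightarrow> real"
  assumes \<Omega>: "open \<Omega>" "x0 \<in> \<Omega>" and uc: "continuous_on \<Omega> u" and MA: "alexandrov_solution \<Omega> u f"
    and f: "\<And>x. x \<in> ball x0 r \<Longrightarrow> lo \<le> f x" and r: "0 < r" and lo: "0 < lo"
  shows "subdifferential \<Omega> u x0 \<noteq> {}"
proof
  assume "subdifferential \<Omega> u x0 = {}"
  then obtain \<delta> where \<delta>: "0 < \<delta>" "ball x0 \<delta> \<subseteq> \<Omega>" "\<And>x. x \<in> ball x0 \<delta> \<Longrightarrow> subdifferential \<Omega> u x \<subseteq> {}"
    using subdifferential_usc[OF \<Omega> uc, of "{}"] by auto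
  define E where "E = ball x0 (min r \<delta>)"
  have "E \<subseteq> ball x0 \<delta>" "E \<subseteq> ball x0 r" by (auto simp: E_def)
  then have "ennreal lo * emeasure lebesgue E \<le> emeasure lebesgue (\<Union>x\<in>E. subdifferential \<Omega> u x)"
    using f \<delta> by (intro MA_mass_bounds(1)[OF MA]) (auto simp: E_def)
  also have "(\<Union>x\<in>E. subdifferential \<Omega> u x) = {}" using \<delta>(3) \<open>E \<subseteq> ball x0 \<delta>\<close> by auto
  finally have "ennreal lo * emeasure lebesgue E = 0" by simp
  then have "emeasure lebesgue E = 0" using lo by simp
  moreover have "0 < measure lebesgue E" using content_ball_pos[of "min r \<delta>" x0] r \<delta>(1) by (simp add: E_def)
  ultimately show False by (simp add: measure_def)
qed

lemma upper_depth_pos: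
  assumes "0 < t0" "0 \<le> P" "1 \<le> \<alpha>"
  shows "0 < upper_depth \<alpha> t0 P"
proof (cases "\<alpha> = 1")
  case False
  then have "0 \<le> (\<alpha> - 1) * P" "0 < t0 powr (1 - \<alpha>)" using assms by auto
  then have "0 < t0 powr (1 - \<alpha>) + (\<alpha> - 1) * P" by linarith
  then show ?thesis using False by (simp add: upper_depth_def)
qed (use assms in \<open>simp add: upper_depth_def\<close>)

text \<open>
  With two subgradients at \<open>y0\<close>, the section below the plane of slope \<open>p + \<epsilon> b\<close> has \<open>y0\<close> very close to
  its boundary relative to its size, although it is almost deepest at \<open>y0\<close>. Then the polar of the section
  about \<open>y0\<close> contains many disjoint translates of a fixed multiple of the polar about an inner point \<open>c\<close>,
  whereas the Monge-Ampere measure bounds the two volumes by each other.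
\<close>

lemma subgradient_unique:
  fixes u :: "'a::euclidean_space \<Rightarrow> real"
  assumes \<Omega>: "open \<Omega>" "bounded \<Omega>" "convex \<Omega>" "y0 \<in> \<Omega>" and uc: "continuous_on (closure \<Omega>) u"
    and ucv: "convex_on (closure \<Omega>) u" and MA: "alexandrov_solution \<Omega> u f"
    and K: "\<And>K. compact K \<Longrightarrow> K \<subseteq> \<Omega> \<Longrightarrow> \<exists>lo hi. 0 < lo \<and> lo \<le> hi \<and> (\<forall>x\<in>K. lo \<le> f x \<and> f x \<le> hi)"
    and contact: "\<And>p x. p \<in> subdifferential \<Omega> u y0 \<Longrightarrow> x \<in> frontier \<Omega> \<Longrightarrow> u y0 + p \<bullet> (x - y0) < u x"
    and p12: "p1 \<in> subdifferential \<Omega> u y0" "p2 \<in> subdifferential \<Omega> u y0"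
  shows "p1 = p2"
proof (rule ccontr)
  assume ne: "p1 \<noteq> p2"
  let ?n = "DIM('a)"
  have ucO: "continuous_on \<Omega> u" using uc closure_subset by (rule continuous_on_subset)
  have cvO: "convex_on \<Omega> u" using ucv closure_subset convex_on_subset \<Omega>(3) by blast
  define D0 where "D0 = subdifferential \<Omega> u y0"
  obtain r0 B0 where r0: "0 < r0" "cball y0 r0 \<subseteq> \<Omega>"
    and B0: "\<And>x p. x \<in> cball y0 r0 \<Longrightarrow> p \<in> subdifferential \<Omega> u x \<Longrightarrow> norm p \<le> B0"
    using subdifferential_bounded[OF \<Omega>(1,4) ucO] by blast
  have cD0: "compact D0"
  proof -
    have "D0 \<subseteq> cball 0 B0" using B0[of y0] r0 by (auto simp: D0_def)
    then show ?thesis unfolding compact_eq_bounded_closed D0_def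
      using bounded_subset[OF bounded_cball] subdifferential_closed by blast
  qed
  define e0 where "e0 = p1 - p2"
  \<comment> \<open>An extreme subgradient in direction \<open>- e0\<close>: relative to its plane
    \<open>u\<close> grows linearly along \<open>e0\<close> but sublinearly along
    \<open>- e0\<close>.\<close>
  obtain p where p: "p \<in> D0" "\<And>q. q \<in> D0 \<Longrightarrow> p \<bullet> e0 \<le> q \<bullet> e0"
  proof -
    have "D0 \<noteq> {}" using p12 by (auto simp: D0_def)
    moreover have "continuous_on D0 (\<lambda>q. q \<bullet> e0)" by (intro continuous_intros)
    ultimately show ?thesis using continuous_attains_inf[OF cD0, of "\<lambda>q. q \<bullet> e0"] that by blast
  qed
  define b where "b = p1 - p"
  define a where "a = b \<bullet> e0"
  have a: "0 < a"
  proof -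
    have "a = (p1 - p2) \<bullet> e0 + (p2 \<bullet> e0 - p \<bullet> e0)" by (simp add: a_def b_def inner_diff_left)
    moreover have "p \<bullet> e0 \<le> p2 \<bullet> e0" using p(2) p12 by (simp add: D0_def)
    moreover have "0 < (p1 - p2) \<bullet> e0" using ne by (simp add: e0_def)
    ultimately show ?thesis by linarith
  qed
  define w where "w x = u x - u y0 - p \<bullet> (x - y0)" for x
  have wc: "continuous_on (closure \<Omega>) w" unfolding w_def by (intro continuous_intros uc)
  have w0: "0 \<le> w x" "b \<bullet> (x - y0) \<le> w x" if x: "x \<in> \<Omega>" for x
  proof -
    have "u y0 + p \<bullet> (x - y0) \<le> u x" using p(1) x unfolding D0_def subdifferential_def by blast
    then show "0 \<le> w x" by (simp add: w_def)
    have "u y0 + p1 \<bullet> (x - y0) \<le> u x" using p12 x by (simp add: subdifferential_def)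
    then show "b \<bullet> (x - y0) \<le> w x" by (simp add: w_def b_def inner_diff_left)
  qed
  \<comment> \<open>Near \<open>y0\<close> all subgradients have \<open>e0\<close> component above
    \<open>p \<bullet> e0 - \<eta>\<close>; the subgradient inequality from
    \<open>y0 - t *\<^sub>R e0\<close> back to \<open>y0\<close> gives the bound.\<close>
  have one_side: "\<exists>\<delta>>0. \<forall>t. 0 < t \<and> t < \<delta> \<longrightarrow> y0 - t *\<^sub>R e0 \<in> \<Omega> \<and> w (y0 - t *\<^sub>R e0) \<le> \<eta> * t" if \<eta>: "0 < \<eta>" for \<eta>
  proof -
    have "open {q. p \<bullet> e0 - \<eta> < e0 \<bullet> q}" by (rule open_halfspace_gt)
    moreover have "subdifferential \<Omega> u y0 \<subseteq> {q. p \<bullet> e0 - \<eta> < e0 \<bullet> q}"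
      using p(2) \<eta> by (fastforce simp: D0_def inner_commute)
    ultimately obtain \<delta> where \<delta>: "0 < \<delta>" "ball y0 \<delta> \<subseteq> \<Omega>"
        "\<And>x. x \<in> ball y0 \<delta> \<Longrightarrow> subdifferential \<Omega> u x \<subseteq> {q. p \<bullet> e0 - \<eta> < e0 \<bullet> q}"
      using subdifferential_usc[OF \<Omega>(1,4) ucO] by metis
    show ?thesis
    proof (rule exI[of _ "\<delta> / (norm e0 + 1)"], intro conjI allI impI)
      have ep: "0 < norm e0 + 1" by (simp add: add_nonneg_pos)
      show "0 < \<delta> / (norm e0 + 1)" using \<delta> ep by simp
      fix t assume t: "0 < t \<and> t < \<delta> / (norm e0 + 1)"
      have tE: "t * norm e0 < \<delta>"
      proof -
        have "t * norm e0 \<le> t * (norm e0 + 1)" using t by (intro mult_left_mono) auto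
        also have "\<dots> < \<delta>" using t ep by (simp add: pos_less_divide_eq)
        finally show ?thesis .
      qed
      then have inb: "y0 - t *\<^sub>R e0 \<in> ball y0 \<delta>" using t by (simp add: dist_norm)
      then show inO: "y0 - t *\<^sub>R e0 \<in> \<Omega>" using \<delta> by blast
      obtain lo where lohi: "0 < lo" "\<And>x. x \<in> cball (y0 - t *\<^sub>R e0) ((\<delta> - t * norm e0) / 2) \<Longrightarrow> lo \<le> f x"
      proof -
        have "cball (y0 - t *\<^sub>R e0) ((\<delta> - t * norm e0) / 2) \<subseteq> ball y0 \<delta>"
        proof
          fix x assume "x \<in> cball (y0 - t *\<^sub>R e0) ((\<delta> - t * norm e0) / 2)"
          then have "dist (y0 - t *\<^sub>R e0) x \<le> (\<delta> - t * norm e0) / 2" by simp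
          moreover have "dist y0 (y0 - t *\<^sub>R e0) = t * norm e0" using t by (simp add: dist_norm)
          ultimately have "dist y0 x \<le> t * norm e0 + (\<delta> - t * norm e0) / 2"
            using dist_triangle[of y0 x "y0 - t *\<^sub>R e0"] by linarith
          also have "\<dots> < \<delta>" using tE by (simp add: field_simps)
          finally have "dist y0 x < \<delta>" .
          then show "x \<in> ball y0 \<delta>" by simp
        qed
        then have "cball (y0 - t *\<^sub>R e0) ((\<delta> - t * norm e0) / 2) \<subseteq> \<Omega>" using \<delta>(2) by blast
        from K[OF compact_cball this] show ?thesis using that by blast
      qed
      have "subdifferential \<Omega> u (y0 - t *\<^sub>R e0) \<noteq> {}"
        by (rule subdifferential_nonempty[OF \<Omega>(1) inO ucO MA, where r = "(\<delta> - t * norm e0) / 2" and lo = lo])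
           (use lohi tE in auto)
      then obtain q where q: "q \<in> subdifferential \<Omega> u (y0 - t *\<^sub>R e0)" by blast
      then have "p \<bullet> e0 - \<eta> < e0 \<bullet> q" using \<delta>(3)[OF inb] by blast
      then have "t * (p \<bullet> e0 - \<eta>) \<le> t * (q \<bullet> e0)" using t by (intro mult_left_mono) (auto simp: inner_commute)
      moreover have "u (y0 - t *\<^sub>R e0) + q \<bullet> (y0 - (y0 - t *\<^sub>R e0)) \<le> u y0" using q \<Omega>(4) unfolding subdifferential_def by blast
      ultimately show "w (y0 - t *\<^sub>R e0) \<le> \<eta> * t" by (simp add: w_def algebra_simps)
    qed
  qed
  have fr: "frontier \<Omega> \<noteq> {}" using frontier_nonempty_bounded \<Omega> by blast
  have cfr: "compact (frontier \<Omega>)" using \<Omega>(2) by (rule compact_frontier_bounded)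
  have wfr: "continuous_on (frontier \<Omega>) w" using wc by (rule continuous_on_subset) (auto simp: frontier_def)
  obtain z where z: "z \<in> frontier \<Omega>" "\<And>x. x \<in> frontier \<Omega> \<Longrightarrow> w z \<le> w x"
    using continuous_attains_inf[OF cfr fr wfr] by blast
  have wz: "0 < w z" using contact[of p z] p(1) z(1) by (simp add: w_def D0_def)
  \<comment> \<open>A compact subset of \<open>\<Omega>\<close>, on which the density has constant
    bounds; the section used below stays in it.\<close>
  define K0 where "K0 = {x \<in> closure \<Omega>. w x \<le> w z / 2}"
  have K0c: "compact K0"
  proof -
    have "closed K0" unfolding K0_def
      using continuous_closed_preimage[OF wc closed_closure, of "{..w z / 2}"] by (simp add: vimage_def Int_def)
    moreover have "bounded K0" by (rule bounded_subset[OF bounded_closure[OF \<Omega>(2)]]) (auto simp: K0_def)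
    ultimately show ?thesis by (simp add: compact_eq_bounded_closed)
  qed
  have K0O: "K0 \<subseteq> \<Omega>"
  proof
    fix x assume x: "x \<in> K0"
    then have "x \<notin> frontier \<Omega>" using z(2)[of x] wz by (auto simp: K0_def)
    then show "x \<in> \<Omega>" using x \<Omega>(1) by (auto simp: K0_def frontier_def interior_open)
  qed
  obtain lo hi where lohi: "0 < lo" "lo \<le> hi" "\<And>x. x \<in> K0 \<Longrightarrow> lo \<le> f x \<and> f x \<le> hi"
    using K[OF K0c K0O] by blast
  obtain Dm where Dm: "\<And>x. x \<in> closure \<Omega> \<Longrightarrow> norm (x - y0) \<le> Dm"
  proof -
    obtain L where "\<And>x. x \<in> closure \<Omega> \<Longrightarrow> norm x \<le> L" using bounded_closure[OF \<Omega>(2)] by (auto simp: bounded_iff)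
    then have "\<And>x. x \<in> closure \<Omega> \<Longrightarrow> norm (x - y0) \<le> L + norm y0" by (meson add_right_mono norm_triangle_ineq4 order_trans)
    then show ?thesis using that by blast
  qed
  have "y0 \<in> closure \<Omega>" using \<Omega>(4) closure_subset by blast
  then have Dm0: "0 \<le> Dm" using Dm[of y0] by simp
  \<comment> \<open>More translates than the volume bounds can accommodate; \<open>64 ^ n\<close> is
    \<open>32 ^ n\<close> from the scaling of \<open>Pc\<close> times \<open>2 ^ n\<close> from
    halving the section.\<close>
  obtain N :: nat where N: "64 ^ ?n * hi / lo < real N" using reals_Archimedean2 by blast
  have "0 \<le> 64 ^ ?n * hi / lo" using lohi by simp
  then have N0: "0 < real N" using N by linarith
  \<comment> \<open>The first bound lets \<open>N\<close> translates by multiples of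
    \<open>2 * \<epsilon>\<close> times \<open>b\<close> fit into \<open>P0\<close>, the second
    keeps the section in \<open>K0\<close>.\<close>
  define \<epsilon> where "\<epsilon> = min (1 / (16 * real N)) (w z / (8 * (norm b * Dm + 1)))"
  have bD: "0 < norm b * Dm + 1" using Dm0 by (simp add: add_nonneg_pos)
  have \<epsilon>: "0 < \<epsilon>" using N0 wz bD by (simp add: \<epsilon>_def)
  have \<epsilon>N: "16 * (\<epsilon> * real N) \<le> 1"
  proof -
    have "\<epsilon> \<le> 1 / (16 * real N)" by (simp add: \<epsilon>_def)
    then show ?thesis using N0 by (simp add: field_simps)
  qed
  have \<epsilon>1: "\<epsilon> \<le> 1 / 2"
  proof -
    have "1 \<le> real N" using N0 by simp
    then have "\<epsilon> * 1 \<le> \<epsilon> * real N" using \<epsilon> by (intro mult_left_mono) auto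
    then show ?thesis using \<epsilon>N by linarith
  qed
  have \<epsilon>b: "\<epsilon> * (norm b * Dm) \<le> w z / 8"
  proof -
    have "\<epsilon> \<le> w z / (8 * (norm b * Dm + 1))" by (simp add: \<epsilon>_def)
    then have "\<epsilon> * (norm b * Dm + 1) \<le> w z / 8" using bD by (simp add: field_simps)
    then show ?thesis using \<epsilon> by (simp add: distrib_left)
  qed
  obtain \<delta> where \<delta>: "0 < \<delta>" "\<And>t. 0 < t \<Longrightarrow> t < \<delta> \<Longrightarrow> y0 - t *\<^sub>R e0 \<in> \<Omega> \<and> w (y0 - t *\<^sub>R e0) \<le> (\<epsilon> * a / 2) * t"
    using one_side[of "\<epsilon> * a / 2"] \<epsilon> a by auto
  define t where "t = min (\<delta> / 2) (w z / (16 * (\<epsilon> * a)))"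
  have ea: "0 < \<epsilon> * a" using \<epsilon> a by simp
  have t: "0 < t" "t < \<delta>" using \<delta>(1) wz ea by (auto simp: t_def)
  \<comment> \<open>With this lift the section contains \<open>y0 - t *\<^sub>R e0\<close>, whose
    component along \<open>b\<close> relative to \<open>y0\<close> is \<open>- a * t\<close>, while
    beyond \<open>y0\<close> it reaches at most \<open>2 * \<tau> = 4 * \<epsilon> * a * t\<close>
    in that direction. This asymmetry of order \<open>\<epsilon>\<close> drives the
    argument.\<close>
  define \<tau> where "\<tau> = 2 * (\<epsilon> * a) * t"
  have \<tau>0: "0 < \<tau>" using ea t by (simp add: \<tau>_def)
  have \<tau>1: "\<tau> \<le> w z / 8"
  proof -
    have "t \<le> w z / (16 * (\<epsilon> * a))" by (simp add: t_def)
    then show ?thesis using ea by (simp add: \<tau>_def field_simps)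
  qed
  define l where "l x = \<epsilon> * (b \<bullet> (x - y0)) + \<tau>" for x
  define g where "g x = w x - l x" for x
  have gc: "continuous_on (closure \<Omega>) g" unfolding g_def l_def by (intro continuous_intros wc)
  have g_eq: "g = (\<lambda>x. u x - ((p + \<epsilon> *\<^sub>R b) \<bullet> x + (u y0 - (p + \<epsilon> *\<^sub>R b) \<bullet> y0 + \<tau>)))"
    by (simp add: fun_eq_iff g_def w_def l_def inner_add_left inner_diff_right algebra_simps)
  have gcv: "convex_on (closure \<Omega>) g" unfolding g_eq by (rule convex_on_minus_affine[OF ucv])
  define S where "S = \<Omega> \<inter> g -` {..<0}"
  have S_iff: "x \<in> S \<longleftrightarrow> x \<in> \<Omega> \<and> g x < 0" for x by (auto simp: S_def)
  have S_open: "open S" unfolding S_def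
    by (rule continuous_open_preimage[OF continuous_on_subset[OF gc closure_subset] \<Omega>(1)]) simp
  have SO: "S \<subseteq> \<Omega>" by (auto simp: S_def)
  have Sb: "bounded S" using SO \<Omega>(2) bounded_subset by blast
  have lK: "x \<in> K0" if "x \<in> closure \<Omega>" "g x \<le> 0" for x
  proof -
    have "b \<bullet> (x - y0) \<le> norm b * norm (x - y0)" by (rule norm_cauchy_schwarz)
    also have "\<dots> \<le> norm b * Dm" using Dm[OF that(1)] by (intro mult_left_mono) auto
    finally have "\<epsilon> * (b \<bullet> (x - y0)) \<le> \<epsilon> * (norm b * Dm)" using \<epsilon> by (intro mult_left_mono) auto
    then have "l x \<le> w z / 4" unfolding l_def using \<epsilon>b \<tau>1 by linarith
    then show ?thesis using that wz by (simp add: K0_def g_def)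
  qed
  have clS: "closure S \<subseteq> {x \<in> closure \<Omega>. g x \<le> 0}"
  proof (rule closure_minimal)
    show "S \<subseteq> {x \<in> closure \<Omega>. g x \<le> 0}" using closure_subset by (force simp: S_iff)
    show "closed {x \<in> closure \<Omega>. g x \<le> 0}"
      using continuous_closed_preimage[OF gc closed_closure, of "{..0}"] by (simp add: vimage_def Int_def)
  qed
  have clSO: "closure S \<subseteq> \<Omega>" using clS lK K0O by blast
  have SK: "S \<subseteq> K0" using clS lK closure_subset by blast
  have Scv: "x + k *\<^sub>R (y - x) \<in> S" if "x \<in> S" "y \<in> S" "0 \<le> k" "k \<le> 1" for x y k
  proof -
    have xy: "x \<in> closure \<Omega>" "y \<in> closure \<Omega>" "x \<in> \<Omega>" "y \<in> \<Omega>" "g x < 0" "g y < 0"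
      using that closure_subset by (auto simp: S_iff)
    have "x + k *\<^sub>R (y - x) = (1 - k) *\<^sub>R x + k *\<^sub>R y" by (simp add: algebra_simps)
    then have 1: "x + k *\<^sub>R (y - x) \<in> \<Omega>" using \<Omega>(3) xy that by (simp add: convex_def)
    have "g (x + k *\<^sub>R (y - x)) \<le> g x + k * (g y - g x)" by (rule convex_on_segment_le[OF gcv xy(1,2) that(3,4)])
    also have "\<dots> = (1 - k) * g x + k * g y" by (simp add: algebra_simps)
    also have "\<dots> \<le> max (g x) (g y)"
      using that mult_left_mono[of "g x" "max (g x) (g y)" "1 - k"] mult_left_mono[of "g y" "max (g x) (g y)" k]
      by (simp add: algebra_simps)
    also have "\<dots> < 0" using xy by simp
    finally show ?thesis using 1 by (simp add: S_iff)
  qed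
  have y0S: "y0 \<in> S" using \<Omega>(4) \<tau>0 by (simp add: S_iff g_def w_def l_def)
  define z0 where "z0 = y0 - t *\<^sub>R e0"
  have z0S: "z0 \<in> S"
  proof -
    have "w z0 \<le> \<epsilon> * a / 2 * t" "z0 \<in> \<Omega>" using \<delta>(2)[OF t] by (auto simp: z0_def)
    moreover have "l z0 = (\<epsilon> * a) * t" by (simp add: l_def z0_def \<tau>_def a_def)
    moreover have "0 < (\<epsilon> * a) * t" using ea t by simp
    ultimately show ?thesis by (simp add: S_iff g_def)
  qed
  define c where "c = y0 + (1/2) *\<^sub>R (z0 - y0)"
  have cS: "c \<in> S" unfolding c_def by (rule Scv[OF y0S z0S]) auto
  have bS: "b \<bullet> (x - y0) \<le> 2 * \<tau>" if "x \<in> S" for x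
  proof (rule ccontr)
    assume "\<not> ?thesis"
    then have big: "2 * \<tau> < b \<bullet> (x - y0)" by simp
    have "b \<bullet> (x - y0) < \<epsilon> * (b \<bullet> (x - y0)) + \<tau>" using w0(2)[of x] that by (simp add: S_iff g_def l_def)
    also have "\<epsilon> * (b \<bullet> (x - y0)) \<le> 1/2 * (b \<bullet> (x - y0))" using \<epsilon>1 big \<tau>0 by (intro mult_right_mono) auto
    finally show False using big by simp
  qed
  \<comment> \<open>The value at \<open>y0\<close> is \<open>- \<tau>\<close>, so \<open>y0\<close>
    is within a factor 2 of the greatest depth.\<close>
  have gS: "- 2 * \<tau> \<le> g x" if "x \<in> S" for x
  proof -
    have "\<epsilon> * (b \<bullet> (x - y0)) \<le> \<epsilon> * (2 * \<tau>)" using bS[OF that] \<epsilon> by (intro mult_left_mono) auto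
    also have "\<dots> \<le> 1/2 * (2 * \<tau>)" using \<epsilon>1 \<tau>0 by (intro mult_right_mono) auto
    finally have "l x \<le> 2 * \<tau>" by (simp add: l_def)
    then show ?thesis using w0(1)[of x] that by (simp add: S_iff g_def)
  qed
  \<comment> \<open>Polars of the section about \<open>y0\<close> and about the midpoint
    \<open>c\<close>, at the levels needed for the two mass bounds.\<close>
  define P0 where "P0 = {q. \<forall>y\<in>S. q \<bullet> (y - y0) \<le> \<tau> / 2}"
  define Pc where "Pc = {q. \<forall>y\<in>S. q \<bullet> (y - c) \<le> 4 * \<tau>}"
  have P0c: "closed P0"
  proof -
    have eq: "P0 = (\<Inter>y\<in>S. {q. (y - y0) \<bullet> q \<le> \<tau> / 2})" by (auto simp: P0_def inner_commute)
    show ?thesis unfolding eq by (intro closed_INT ballI closed_halfspace_le)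
  qed
  have Pcc: "closed Pc"
  proof -
    have eq: "Pc = (\<Inter>y\<in>S. {q. (y - c) \<bullet> q \<le> 4 * \<tau>})" by (auto simp: Pc_def inner_commute)
    show ?thesis unfolding eq by (intro closed_INT ballI closed_halfspace_le)
  qed
  define p' where "p' = p + \<epsilon> *\<^sub>R b"
  have gp: "g x = u x - (p' \<bullet> x + (u y0 - p' \<bullet> y0 + \<tau>))" for x unfolding g_eq p'_def ..
  have Spos: "0 < emeasure lebesgue S"
  proof -
    obtain s where s: "s > 0" "ball y0 s \<subseteq> S" using S_open y0S openE by blast
    have "0 < emeasure lebesgue (ball y0 s)" using content_ball_pos[OF s(1), of y0] by (simp add: emeasure_eq_measure2)
    also have "\<dots> \<le> emeasure lebesgue S" by (rule emeasure_mono[OF s(2)]) (use S_open in simp)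
    finally show ?thesis .
  qed
  have Slm: "S \<in> lmeasurable" by (rule lmeasurable_open[OF Sb S_open])
  define m where "m = measure lebesgue S"
  have Sm: "emeasure lebesgue S = ennreal m" unfolding m_def using Slm by (simp add: emeasure_eq_measure2)
  have m0: "0 < m" using Spos Sm by simp
  \<comment> \<open>For \<open>q\<close> in \<open>P0\<close> the tilt is at most
    \<open>\<tau> / 2\<close> on the rim, less than the depth \<open>\<tau>\<close> at
    \<open>y0\<close>, so all slopes \<open>p' + q\<close> are attained inside
    \<open>S\<close>.\<close>
  have i: "emeasure lebesgue P0 \<le> ennreal (hi * m)"
  proof -
    have "(+) p' ` P0 \<subseteq> (\<Union>x\<in>S. subdifferential \<Omega> u x)"
    proof clarify
      fix q assume q: "q \<in> P0"
      have "closure S \<subseteq> {y. q \<bullet> y \<le> \<tau> / 2 + q \<bullet> y0}"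
        by (rule closure_minimal) (use q in \<open>auto simp: P0_def inner_diff_right closed_halfspace_le\<close>)
      then have qc: "q \<bullet> (y - y0) \<le> \<tau> / 2" if "y \<in> closure S" for y using that by (auto simp: inner_diff_right)
      obtain x where "x \<in> S" "p' + q \<in> subdifferential \<Omega> u x"
      proof (rule subgradient_at_interior_minimum[OF cvO S_open Sb clSO _ y0S])
        show "continuous_on (closure S) u" using ucO clSO by (rule continuous_on_subset)
        fix y assume y: "y \<in> closure S - S"
        then have "y \<in> \<Omega>" using clSO by blast
        then have "0 \<le> g y" using y by (auto simp: S_iff)
        then show "u y0 - (p' + q) \<bullet> y0 < u y - (p' + q) \<bullet> y"
          using qc[of y] y \<tau>0 by (simp add: gp inner_add_left inner_diff_right)
      qed
      then show "p' + q \<in> (\<Union>x\<in>S. subdifferential \<Omega> u x)" by blast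
    qed
    moreover have "(\<Union>x\<in>S. subdifferential \<Omega> u x) \<in> sets lebesgue"
      by (rule MA_image_sets[OF MA _ SO _ lohi(1) Spos]) (use S_open lohi SK in auto)
    ultimately have "emeasure lebesgue ((+) p' ` P0) \<le> emeasure lebesgue (\<Union>x\<in>S. subdifferential \<Omega> u x)"
      by (rule emeasure_mono)
    also have "\<dots> \<le> ennreal hi * emeasure lebesgue S"
      by (rule MA_mass_bounds(2)[OF MA _ SO]) (use S_open lohi SK in auto)
    also have "\<dots> = ennreal (hi * m)" using lohi m0 by (simp add: Sm ennreal_mult)
    finally show ?thesis by (simp only: emeasure_translation_lebesgue)
  qed
  \<comment> \<open>From a point of the half-size copy of \<open>S\<close> about \<open>c\<close>,
    half of any vector \<open>y - c\<close> with \<open>y\<close> in \<open>S\<close> can be added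
    without leaving \<open>S\<close>. Over \<open>S\<close> the function \<open>g\<close> oscillates
    by at most \<open>2 * \<tau>\<close>, whence the level \<open>4 * \<tau>\<close>.\<close>
  have ii: "ennreal (lo * m / 2 ^ ?n) \<le> emeasure lebesgue Pc"
  proof -
    define Sh where "Sh = (\<lambda>x. (1/2) *\<^sub>R x + (1/2) *\<^sub>R c) ` S"
    have Sh_open: "open Sh"
    proof -
      have "Sh = (\<lambda>x. (1/2) *\<^sub>R c + x) ` ((*\<^sub>R) (1/2) ` S)" by (auto simp: Sh_def image_image add.commute)
      moreover have "open ((\<lambda>x. (1/2) *\<^sub>R c + x) ` ((*\<^sub>R) (1/2) ` S))"
        using open_translation[OF open_scaling[OF _ S_open]] by simp
      ultimately show ?thesis by simp
    qed
    have ShS: "Sh \<subseteq> S"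
    proof
      fix y assume "y \<in> Sh"
      then obtain x where x: "x \<in> S" "y = (1/2) *\<^sub>R x + (1/2) *\<^sub>R c" by (auto simp: Sh_def)
      have "c + (1/2) *\<^sub>R (x - c) \<in> S" by (rule Scv[OF cS x(1)]) auto
      moreover have "c + (1/2) *\<^sub>R (x - c) = y"
      proof -
        have "c = (1/2) *\<^sub>R c + (1/2) *\<^sub>R c" by (simp flip: scaleR_add_left)
        then show ?thesis by (simp add: x(2) algebra_simps)
      qed
      ultimately show "y \<in> S" by simp
    qed
    have "(\<Union>x\<in>Sh. subdifferential \<Omega> u x) \<subseteq> (+) p' ` Pc"
    proof clarify
      fix x q assume x: "x \<in> Sh" and q: "q \<in> subdifferential \<Omega> u x"
      obtain s where s: "s \<in> S" "x = (1/2) *\<^sub>R s + (1/2) *\<^sub>R c" using x by (auto simp: Sh_def)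
      have "(q - p') \<bullet> (y - c) \<le> 4 * \<tau>" if y: "y \<in> S" for y
      proof -
        have "s + (1/2) *\<^sub>R (y - s) \<in> S" by (rule Scv[OF s(1) y]) auto
        define v where "v = s + (1/2) *\<^sub>R (y - s)"
        have vS: "v \<in> S" unfolding v_def by fact
        have vx: "v - x = (1/2) *\<^sub>R (y - c)"
        proof -
          have "s = (1/2) *\<^sub>R s + (1/2) *\<^sub>R s" by (simp flip: scaleR_add_left)
          then have "v = (1/2) *\<^sub>R s + (1/2) *\<^sub>R y" unfolding v_def by (simp add: algebra_simps)
          then show ?thesis by (simp add: s(2) algebra_simps)
        qed
        have "u x + q \<bullet> (v - x) \<le> u v" using q vS SO by (auto simp: subdifferential_def)
        then have "(q - p') \<bullet> (v - x) \<le> g v - g x" by (simp add: gp inner_diff_left inner_diff_right)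
        also have "\<dots> \<le> 2 * \<tau>" using vS gS[of x] x ShS by (force simp: S_iff)
        finally show ?thesis unfolding vx by simp
      qed
      then have "q - p' \<in> Pc" by (simp add: Pc_def)
      then show "q \<in> (+) p' ` Pc" by (auto intro!: image_eqI[of _ _ "q - p'"])
    qed
    moreover have "(+) p' ` Pc \<in> sets lebesgue" using closed_translation[OF Pcc, of p'] by simp
    ultimately have 1: "emeasure lebesgue (\<Union>x\<in>Sh. subdifferential \<Omega> u x) \<le> emeasure lebesgue ((+) p' ` Pc)"
      by (rule emeasure_mono)
    have "emeasure lebesgue Sh = ennreal (\<bar>1/2\<bar> ^ ?n) * emeasure lebesgue S"
      unfolding Sh_def using emeasure_lebesgue_affine[of "1/2" "(1/2) *\<^sub>R c" S] by (simp add: ennreal_power)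
    also have "\<dots> = ennreal (m / 2 ^ ?n)" using m0 by (simp add: Sm ennreal_mult[symmetric] power_divide)
    finally have 2: "emeasure lebesgue Sh = ennreal (m / 2 ^ ?n)" .
    have "ennreal (lo * m / 2 ^ ?n) = ennreal lo * emeasure lebesgue Sh"
      unfolding 2 using lohi m0 by (simp add: ennreal_mult[symmetric])
    also have "\<dots> \<le> emeasure lebesgue (\<Union>x\<in>Sh. subdifferential \<Omega> u x)"
      by (rule MA_mass_bounds(1)[OF MA]) (use Sh_open ShS SO SK lohi in auto)
    also note 1
    finally show ?thesis by (simp only: emeasure_translation_lebesgue)
  qed
  \<comment> \<open>The \<open>e0\<close> components of elements of \<open>Pc\<close> are at most
    \<open>16 * (\<epsilon> * a)\<close> in size, so after scaling by \<open>1 / 32\<close> they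
    differ by at most \<open>\<epsilon> * a\<close>, while consecutive translates are
    \<open>2 * (\<epsilon> * a)\<close> apart. This gives disjointness.\<close>
  have iii: "ennreal (real N / 32 ^ ?n) * emeasure lebesgue Pc \<le> emeasure lebesgue P0"
  proof -
    define F where "F j = (\<lambda>q. (1/32) *\<^sub>R q + (real j * (2 * \<epsilon>)) *\<^sub>R b) ` Pc" for j :: nat
    have Fm: "F j \<in> sets lebesgue" for j
    proof -
      have "F j = (\<lambda>x. (real j * (2 * \<epsilon>)) *\<^sub>R b + x) ` ((*\<^sub>R) (1/32) ` Pc)" by (auto simp: F_def image_image add.commute)
      moreover have "closed ((\<lambda>x. (real j * (2 * \<epsilon>)) *\<^sub>R b + x) ` ((*\<^sub>R) (1/32) ` Pc))"
        by (intro closed_translation closed_scaling Pcc)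
      ultimately show ?thesis by simp
    qed
    have yc: "y0 - c = (t/2) *\<^sub>R e0" "z0 - c = - ((t/2) *\<^sub>R e0)"
    proof -
      show "y0 - c = (t/2) *\<^sub>R e0" by (simp add: c_def z0_def)
      have "z0 - c = (y0 - c) - t *\<^sub>R e0" by (simp add: z0_def)
      also have "\<dots> = (t/2 - t) *\<^sub>R e0" unfolding \<open>y0 - c = (t/2) *\<^sub>R e0\<close> by (simp only: scaleR_diff_left)
      finally show "z0 - c = - ((t/2) *\<^sub>R e0)" by simp
    qed
    have qe: "\<bar>q \<bullet> e0\<bar> \<le> 16 * (\<epsilon> * a)" if q: "q \<in> Pc" for q
    proof -
      have "q \<bullet> (y0 - c) \<le> 4 * \<tau>" "q \<bullet> (z0 - c) \<le> 4 * \<tau>" using q y0S z0S by (auto simp: Pc_def)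
      then have "\<bar>t / 2 * (q \<bullet> e0)\<bar> \<le> 4 * \<tau>" unfolding yc by (simp add: abs_le_iff)
      then have "t * \<bar>q \<bullet> e0\<bar> \<le> t * (16 * (\<epsilon> * a))" using t by (simp add: abs_mult \<tau>_def)
      then show ?thesis using t by simp
    qed
    have FP: "F j \<subseteq> P0" if j: "j < N" for j
    proof
      fix r assume "r \<in> F j"
      then obtain q where q: "q \<in> Pc" "r = (1/32) *\<^sub>R q + (real j * (2 * \<epsilon>)) *\<^sub>R b" by (auto simp: F_def)
      have "r \<bullet> (y - y0) \<le> \<tau> / 2" if y: "y \<in> S" for y
      proof -
        have "q \<bullet> (y - c) \<le> 4 * \<tau>" "q \<bullet> (z0 - c) \<le> 4 * \<tau>" using q y z0S by (auto simp: Pc_def)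
        moreover have "z0 - c = - (y0 - c)" unfolding yc by simp
        then have "q \<bullet> (z0 - c) = - (q \<bullet> (y0 - c))" by (simp only: inner_minus_right)
        moreover have "q \<bullet> (y - y0) = q \<bullet> (y - c) - q \<bullet> (y0 - c)" by (simp add: inner_diff_right)
        ultimately have 1: "q \<bullet> (y - y0) \<le> 8 * \<tau>" by linarith
        have "(real j * (2 * \<epsilon>)) * (b \<bullet> (y - y0)) \<le> (real j * (2 * \<epsilon>)) * (2 * \<tau>)"
          using bS[OF y] \<epsilon> by (intro mult_left_mono) auto
        also have "\<dots> \<le> (real N * (2 * \<epsilon>)) * (2 * \<tau>)" using j \<epsilon> \<tau>0 by (intro mult_right_mono) auto
        also have "\<dots> = (16 * (\<epsilon> * real N)) * (\<tau> / 4)" by simp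
        also have "\<dots> \<le> 1 * (\<tau> / 4)" using \<epsilon>N \<tau>0 by (intro mult_right_mono) auto
        finally show ?thesis using 1 by (simp add: q(2) inner_add_left)
      qed
      then show "r \<in> P0" by (simp add: P0_def)
    qed
    have disj: "disjoint_family_on F {..<N}"
      unfolding disjoint_family_on_def
    proof (intro ballI impI)
      fix i j :: nat assume ij: "i \<noteq> j"
      show "F i \<inter> F j = {}"
      proof (rule ccontr)
        assume "F i \<inter> F j \<noteq> {}"
        then obtain q q' where q: "q \<in> Pc" "q' \<in> Pc"
          "(1/32) *\<^sub>R q + (real i * (2 * \<epsilon>)) *\<^sub>R b = (1/32) *\<^sub>R q' + (real j * (2 * \<epsilon>)) *\<^sub>R b"
          unfolding F_def by blast
        have "((1/32) *\<^sub>R q + (real i * (2 * \<epsilon>)) *\<^sub>R b) \<bullet> e0 = ((1/32) *\<^sub>R q' + (real j * (2 * \<epsilon>)) *\<^sub>R b) \<bullet> e0"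
          by (simp only: q(3))
        then have eq: "(q \<bullet> e0) / 32 + real i * (2 * \<epsilon>) * a = (q' \<bullet> e0) / 32 + real j * (2 * \<epsilon>) * a"
          by (simp add: inner_add_left a_def)
        have "\<bar>(q' \<bullet> e0) / 32 - (q \<bullet> e0) / 32\<bar> \<le> \<epsilon> * a" using qe[OF q(1)] qe[OF q(2)] by linarith
        moreover have "(q' \<bullet> e0) / 32 - (q \<bullet> e0) / 32 = (real i - real j) * (2 * (\<epsilon> * a))"
          using eq by (simp add: algebra_simps)
        ultimately have "\<bar>real i - real j\<bar> * \<bar>2 * (\<epsilon> * a)\<bar> \<le> \<epsilon> * a" by (simp only: abs_mult[symmetric])
        moreover have "\<bar>2 * (\<epsilon> * a)\<bar> = 2 * (\<epsilon> * a)" by (rule abs_of_pos) (use ea in simp)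
        ultimately have "\<bar>real i - real j\<bar> * (2 * (\<epsilon> * a)) \<le> \<epsilon> * a" by (simp only:)
        moreover have "1 \<le> \<bar>real i - real j\<bar>" using ij by linarith
        then have "1 * (2 * (\<epsilon> * a)) \<le> \<bar>real i - real j\<bar> * (2 * (\<epsilon> * a))" using ea by (intro mult_right_mono) auto
        ultimately show False using ea by linarith
      qed
    qed
    have Fe: "emeasure lebesgue (F j) = ennreal (1 / 32 ^ ?n) * emeasure lebesgue Pc" for j
      unfolding F_def using emeasure_lebesgue_affine[of "1/32" "(real j * (2 * \<epsilon>)) *\<^sub>R b" Pc]
      by (simp add: ennreal_power power_divide)
    have "(\<Sum>j<N. emeasure lebesgue (F j)) = emeasure lebesgue (\<Union>j<N. F j)"
      by (rule sum_emeasure[OF _ disj]) (use Fm in auto)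
    also have "\<dots> \<le> emeasure lebesgue P0"
      by (rule emeasure_mono) (use FP P0c in auto)
    finally have "of_nat N * (ennreal (1 / 32 ^ ?n) * emeasure lebesgue Pc) \<le> emeasure lebesgue P0" by (simp add: Fe)
    moreover have "of_nat N * ennreal (1 / 32 ^ ?n) = ennreal (real N / 32 ^ ?n)"
      by (simp add: ennreal_of_nat_eq_real_of_nat ennreal_mult[symmetric])
    ultimately show ?thesis by (simp add: mult.assoc[symmetric])
  qed
  have "ennreal (real N / 32 ^ ?n) * ennreal (lo * m / 2 ^ ?n) \<le> ennreal (real N / 32 ^ ?n) * emeasure lebesgue Pc"
    by (rule mult_left_mono[OF ii]) simp
  also note iii
  also note i
  finally have "ennreal ((real N / 32 ^ ?n) * (lo * m / 2 ^ ?n)) \<le> ennreal (hi * m)"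
    using lohi m0 by (simp add: ennreal_mult[symmetric])
  then have "(real N / 32 ^ ?n) * (lo * m / 2 ^ ?n) \<le> hi * m" using lohi m0 by (subst (asm) ennreal_le_iff) auto
  moreover have "(real N / 32 ^ ?n) * (lo * m / 2 ^ ?n) = (real N * lo / 64 ^ ?n) * m"
  proof -
    have "(64::real) ^ ?n = 32 ^ ?n * 2 ^ ?n" by (simp flip: power_mult_distrib)
    then show ?thesis by simp
  qed
  ultimately have "(real N * lo / 64 ^ ?n) * m \<le> hi * m" by (simp only:)
  then have "real N * lo / 64 ^ ?n \<le> hi" using m0 by (rule mult_right_le_imp_le)
  then have "real N \<le> 64 ^ ?n * hi / lo" using lohi by (simp add: field_simps)
  then show False using N by simp
qed

text \<open>\<open>u\<close> is squeezed between the plane of slope \<open>p\<close> and the planes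
  of subgradients \<open>q\<close> at nearby points, and semicontinuity makes \<open>q\<close> close
  to \<open>p\<close>.\<close>

lemma gderiv_of_unique_subgradient:
  fixes u :: "'a::euclidean_space \<Rightarrow> real"
  assumes \<Omega>: "open \<Omega>" "y0 \<in> \<Omega>" and uc: "continuous_on \<Omega> u"
    and p: "subdifferential \<Omega> u y0 = {p}" and ne: "\<And>x. x \<in> \<Omega> \<Longrightarrow> subdifferential \<Omega> u x \<noteq> {}"
  shows "GDERIV u y0 :> p"
  unfolding gderiv_def has_derivative_at_alt
proof (intro conjI allI impI)
  show "bounded_linear (\<lambda>h. h \<bullet> p)" by (rule bounded_linear_inner_left)
  fix \<epsilon> :: real assume \<epsilon>: "0 < \<epsilon>"
  obtain \<delta> where \<delta>: "0 < \<delta>" "ball y0 \<delta> \<subseteq> \<Omega>" "\<And>x. x \<in> ball y0 \<delta> \<Longrightarrow> subdifferential \<Omega> u x \<subseteq> ball p \<epsilon>"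
    using subdifferential_usc[OF \<Omega> uc, of "ball p \<epsilon>"] p \<epsilon> by auto
  show "\<exists>d>0. \<forall>y. norm (y - y0) < d \<longrightarrow> norm (u y - u y0 - (y - y0) \<bullet> p) \<le> \<epsilon> * norm (y - y0)"
  proof (intro exI[of _ \<delta>] conjI allI impI \<delta>(1))
    fix y assume "norm (y - y0) < \<delta>"
    then have yb: "y \<in> ball y0 \<delta>" by (simp add: dist_norm norm_minus_commute)
    then have yO: "y \<in> \<Omega>" using \<delta> by blast
    obtain q where q: "q \<in> subdifferential \<Omega> u y" using ne[OF yO] by blast
    then have "norm (q - p) \<le> \<epsilon>" using \<delta>(3)[OF yb] by (force simp: dist_norm norm_minus_commute)
    have "u y + q \<bullet> (y0 - y) \<le> u y0" using q \<Omega>(2) by (simp add: subdifferential_def)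
    moreover have "u y0 + p \<bullet> (y - y0) \<le> u y" using p yO by (auto simp: subdifferential_def)
    moreover have "(q - p) \<bullet> (y - y0) \<le> \<epsilon> * norm (y - y0)"
      using norm_cauchy_schwarz[of "q - p" "y - y0"] mult_right_mono[OF \<open>norm (q - p) \<le> \<epsilon>\<close>, of "norm (y - y0)"] by simp
    moreover have "q \<bullet> (y0 - y) = - (q \<bullet> (y - y0))" by (simp add: inner_diff_right)
    moreover have "(q - p) \<bullet> (y - y0) = q \<bullet> (y - y0) - p \<bullet> (y - y0)" by (rule inner_diff_left)
    ultimately show "norm (u y - u y0 - (y - y0) \<bullet> p) \<le> \<epsilon> * norm (y - y0)"
      by (simp add: inner_commute[of "y - y0" p] abs_le_iff)
  qed
qed

section \<open>Estimates for the maximal section\<close>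

definition excess :: "('a::euclidean_space \<Rightarrow> real) \<Rightarrow> 'a \<Rightarrow> 'a \<Rightarrow> real \<Rightarrow> 'a \<Rightarrow> real" where
  "excess u y p h x = u x - (u y + p \<bullet> (x - y) + h)"

text \<open>Inclusion of the section in \<open>\<Omega>\<close> and tangency are reduced to the last
  two facts: the excess is nonnegative on the boundary and vanishes at \<open>z\<close>.\<close>

definition section_data where
  "section_data \<Omega> \<rho> R N \<alpha> lam Lam C6 u f z y0 p h \<longleftrightarrow>
     ma_data \<Omega> \<rho> R N \<alpha> lam Lam u f \<and> z \<in> frontier \<Omega> \<and>
     (\<exists>q. q \<bullet> N z = 0 \<and> (\<forall>x\<in>frontier \<Omega>. \<bar>u x - u z - q \<bullet> (x - z)\<bar> \<le> C6 * (norm (x - z))\<^sup>2)) \<and>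
     y0 \<in> \<Omega> \<and> p \<in> subdifferential \<Omega> u y0 \<and> 0 < h \<and>
     (\<forall>x\<in>frontier \<Omega>. 0 \<le> excess u y0 p h x) \<and> excess u y0 p h z = 0"

text \<open>\<open>upper_barrier\<close> bounds \<open>h\<close> from below because the excess is at
  least \<open>- h\<close>. \<open>lower_barrier\<close> is used twice: with the plane of the
  section, at \<open>y0\<close>, it bounds \<open>h\<close> from above; with that plane plus
  \<open>M - C5\<close> times the height it bounds the height of points of the section.\<close>

lemma section_core:
  assumes dim: "2 \<le> DIM('a::euclidean_space)" and pos: "0 < R" "0 < \<rho>" "0 \<le> C6"
    and \<alpha>: "1 \<le> \<alpha>" "\<alpha> < 2" and lam: "0 < lam" "0 < Lam"
    and prof: "lower_profile (DIM('a)) \<alpha> R F"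
  obtains A a Al :: real where "1 \<le> A" "0 < a" "a \<le> 1" "0 < Al"
    "\<And>(\<Omega> :: 'a set) N u f z y0 p h. section_data \<Omega> \<rho> R N \<alpha> lam Lam C6 u f z y0 p h \<Longrightarrow>
      - (2 * R * C6) \<le> - (p \<bullet> N z) \<and>
      (\<forall>x\<in>closure \<Omega>. excess u y0 p h x \<le> (1 + 2 * R * C6) * max (- (p \<bullet> N z)) 1 * (N z \<bullet> (x - z))) \<and>
      A * max (- (p \<bullet> N z)) 1 * upper_depth \<alpha> \<rho> (2 * A * max (- (p \<bullet> N z)) 1 ^ DIM('a) / a) \<le> h \<and>
      (\<exists>r. 0 < r \<and> r \<le> R / 2 \<and> r \<le> dist_bdry \<Omega> y0 \<and> h \<le> Al * F r) \<and>
      (\<forall>x\<in>\<Omega>. excess u y0 p h x < 0 \<longrightarrow>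
         (\<exists>r. 0 < r \<and> r \<le> R / 2 \<and> r \<le> dist_bdry \<Omega> x \<and>
            (- (p \<bullet> N z) - 2 * R * C6) * (N z \<bullet> (x - z)) \<le> Al * F r))"
proof -
  let ?n = "DIM('a)"
  define C5 where "C5 = 2 * R * C6"
  have C5: "0 \<le> C5" using pos by (simp add: C5_def)
  obtain Al where Al: "0 < Al"
    "\<And>(\<Omega> :: 'a set) \<rho> N u f a b x. \<lbrakk>ma_data \<Omega> \<rho> R N \<alpha> lam Lam u f;
        \<And>x. x \<in> frontier \<Omega> \<Longrightarrow> a \<bullet> x + b \<le> u x; x \<in> \<Omega>\<rbrakk>
      \<Longrightarrow> \<exists>r. 0 < r \<and> r \<le> R / 2 \<and> r \<le> dist_bdry \<Omega> x \<and> a \<bullet> x + b - Al * F r \<le> u x"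
    using lower_barrier[OF prof pos(1) \<alpha> lam] by blast
  have C31: "0 \<le> 1 + C5" using C5 by simp
  obtain A a :: real where A: "1 \<le> A" "0 < a" "a \<le> 1"
    "\<And>(\<Omega> :: 'a set) N u f z p b m. \<lbrakk>ma_data \<Omega> \<rho> R N \<alpha> lam Lam u f; z \<in> frontier \<Omega>; 1 \<le> m;
        \<And>x. x \<in> closure \<Omega> \<Longrightarrow> u x - (p \<bullet> x + b) \<le> (1 + C5) * m * (N z \<bullet> (x - z))\<rbrakk>
      \<Longrightarrow> \<exists>x\<in>\<Omega>. u x - (p \<bullet> x + b) \<le> - (A * m * upper_depth \<alpha> \<rho> (2 * A * m ^ ?n / a))"
    using upper_barrier[where 'a = 'a, OF pos(1,2) C31 \<alpha> lam] by blast
  show ?thesis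
  proof (rule that[OF A(1-3) Al(1)])
    fix \<Omega> :: "'a set" and N u f z y0 p h
    assume sd: "section_data \<Omega> \<rho> R N \<alpha> lam Lam C6 u f z y0 p h"
    have ma: "ma_data \<Omega> \<rho> R N \<alpha> lam Lam u f" and z: "z \<in> frontier \<Omega>" and y0: "y0 \<in> \<Omega>"
      and p: "p \<in> subdifferential \<Omega> u y0" and h: "0 < h"
      and fr: "\<And>x. x \<in> frontier \<Omega> \<Longrightarrow> 0 \<le> excess u y0 p h x" and ez: "excess u y0 p h z = 0"
      using sd by (auto simp: section_data_def)
    obtain q where q: "q \<bullet> N z = 0" "\<And>x. x \<in> frontier \<Omega> \<Longrightarrow> \<bar>u x - u z - q \<bullet> (x - z)\<bar> \<le> C6 * (norm (x - z))\<^sup>2"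
      using sd by (auto simp: section_data_def)
    have \<Omega>: "open \<Omega>" "bounded \<Omega>" and bn: "ball_normal \<Omega> \<rho> R z (N z)" and ucv: "convex_on (closure \<Omega>) u"
      using ma z by (auto simp: ma_data_def)
    have ex: "excess u y0 p h x = u x - (u z + p \<bullet> (x - z))" for x
      using ez by (simp add: excess_def inner_diff_right)
    have ex2: "excess u y0 p h x = u x - (p \<bullet> x + (u z - p \<bullet> z))" for x
      unfolding ex by (simp add: inner_diff_right)
    have P: "u z + p \<bullet> (x - z) \<le> u x" if "x \<in> frontier \<Omega>" for x using fr[OF that] unfolding ex by simp
    note aff = affine_touching_at_boundary[OF dim \<Omega> ucv pos z bn q P, folded C5_def]
    define M where "M = - (p \<bullet> N z)"
    define m where "m = max M 1"
    have M5: "- C5 \<le> M" using aff(2) by (simp add: M_def)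
    have up: "excess u y0 p h x \<le> (1 + C5) * m * (N z \<bullet> (x - z))" if "x \<in> closure \<Omega>" for x
      using aff(4)[OF _ _ that] unfolding ex by (simp add: M_def m_def)
    have lowb: "(M - C5) * (N z \<bullet> (x - z)) \<le> excess u y0 p h x" if "x \<in> frontier \<Omega>" for x
      using aff(3)[OF _ _ that] unfolding ex by (simp add: M_def)
    have exge: "- h \<le> excess u y0 p h x" if "x \<in> \<Omega>" for x
      using p that by (auto simp: subdifferential_def excess_def)
    have exy0: "excess u y0 p h y0 = - h" by (simp add: excess_def)
    have c3: "A * m * upper_depth \<alpha> \<rho> (2 * A * m ^ ?n / a) \<le> h"
    proof -
      obtain x where "x \<in> \<Omega>" "u x - (p \<bullet> x + (u z - p \<bullet> z)) \<le> - (A * m * upper_depth \<alpha> \<rho> (2 * A * m ^ ?n / a))"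
        using A(4)[OF ma z, of m p "u z - p \<bullet> z"] up unfolding ex2 by (auto simp: m_def)
      then show ?thesis using exge[of x] unfolding ex2 by simp
    qed
    have c4: "\<exists>r. 0 < r \<and> r \<le> R / 2 \<and> r \<le> dist_bdry \<Omega> y0 \<and> h \<le> Al * F r"
    proof -
      have "p \<bullet> x + (u z - p \<bullet> z) \<le> u x" if "x \<in> frontier \<Omega>" for x using fr[OF that] unfolding ex2 by simp
      from Al(2)[OF ma this y0] show ?thesis using exy0 unfolding ex2 by fastforce
    qed
    have c5: "\<exists>r. 0 < r \<and> r \<le> R / 2 \<and> r \<le> dist_bdry \<Omega> x \<and> (M - C5) * (N z \<bullet> (x - z)) \<le> Al * F r"
      if x: "x \<in> \<Omega>" "excess u y0 p h x < 0" for x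
    proof -
      define p' where "p' = p + (M - C5) *\<^sub>R N z"
      define b' where "b' = u z - p' \<bullet> z"
      have eq: "u x - (p' \<bullet> x + b') = excess u y0 p h x - (M - C5) * (N z \<bullet> (x - z))" for x
        unfolding ex2 by (simp add: p'_def b'_def inner_add_left inner_diff_right algebra_simps)
      have "p' \<bullet> x + b' \<le> u x" if "x \<in> frontier \<Omega>" for x using lowb[OF that] eq[of x] by linarith
      from Al(2)[OF ma this x(1)] obtain r where r: "0 < r" "r \<le> R / 2" "r \<le> dist_bdry \<Omega> x" "p' \<bullet> x + b' - Al * F r \<le> u x"
        by blast
      have "(M - C5) * (N z \<bullet> (x - z)) \<le> Al * F r" using r(4) eq[of x] x(2) by linarith
      then show ?thesis using r by blast
    qed
    show "- (2 * R * C6) \<le> - (p \<bullet> N z) \<and>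
      (\<forall>x\<in>closure \<Omega>. excess u y0 p h x \<le> (1 + 2 * R * C6) * max (- (p \<bullet> N z)) 1 * (N z \<bullet> (x - z))) \<and>
      A * max (- (p \<bullet> N z)) 1 * upper_depth \<alpha> \<rho> (2 * A * max (- (p \<bullet> N z)) 1 ^ ?n / a) \<le> h \<and>
      (\<exists>r. 0 < r \<and> r \<le> R / 2 \<and> r \<le> dist_bdry \<Omega> y0 \<and> h \<le> Al * F r) \<and>
      (\<forall>x\<in>\<Omega>. excess u y0 p h x < 0 \<longrightarrow>
         (\<exists>r. 0 < r \<and> r \<le> R / 2 \<and> r \<le> dist_bdry \<Omega> x \<and>
            (- (p \<bullet> N z) - 2 * R * C6) * (N z \<bullet> (x - z)) \<le> Al * F r))"
      unfolding C5_def[symmetric] M_def[symmetric] m_def[symmetric]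
      using M5 up c3 c4 c5 by blast
  qed
qed

lemma excess_segment:
  fixes u :: "'a::euclidean_space \<Rightarrow> real"
  assumes ucv: "convex_on S u" and S: "y0 \<in> S" "y0 + y \<in> S" and \<theta>: "0 \<le> \<theta>" "\<theta> \<le> 1"
    and up: "excess u y0 p h (y0 + y) \<le> B"
  shows "excess u y0 p h (y0 + \<theta> *\<^sub>R y) \<le> - h + \<theta> * (B + h)"
proof -
  have "u (y0 + \<theta> *\<^sub>R (y0 + y - y0)) \<le> u y0 + \<theta> * (u (y0 + y) - u y0)"
    by (rule convex_on_segment_le[OF ucv S \<theta>])
  then have "excess u y0 p h (y0 + \<theta> *\<^sub>R y) \<le> - h + \<theta> * (excess u y0 p h (y0 + y) + h)"
    by (simp add: excess_def algebra_simps)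
  also have "\<dots> \<le> - h + \<theta> * (B + h)" using up \<theta> by (simp add: mult_left_mono)
  finally show ?thesis .
qed

text \<open>If the segment left \<open>\<Omega>\<close> at \<open>z1\<close>, the height of
  \<open>y0\<close> over the tangent plane there would be at most
  \<open>\<bar>\<nu> \<bullet> y\<bar>\<close>. As \<open>z1\<close> has height of order
  \<open>\<delta>\<close>, its normal is tilted by at most order \<open>sqrt \<delta>\<close>, and a
  horizontal displacement of order \<open>sqrt \<delta>\<close> changes the height only by order
  \<open>\<delta>\<close>, with a small constant.\<close>

lemma parabolic_box_in_domain:
  fixes \<Omega> :: "('a::euclidean_space \<times> real) set"
  assumes N: "\<And>z. z \<in> frontier \<Omega> \<Longrightarrow> ball_normal \<Omega> \<rho> R z (N z)" and \<Omega>: "open \<Omega>" "0 \<in> frontier \<Omega>"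
    and N0: "N 0 = (0, 1)" and pos: "0 < R" "0 < \<rho>" "0 < k7" "0 \<le> k2" "0 < c0" "0 < \<delta>"
    and y0: "y0 \<in> \<Omega>" "k7 * \<delta> \<le> dist_bdry \<Omega> y0" "snd y0 \<le> k2 * \<delta>"
    and c0: "c0 \<le> 1" "c0 \<le> k7 / 4" "2 * (k2 + 1) * c0 / \<rho> \<le> (k7 / 4)\<^sup>2"
    and y: "(norm (fst y))\<^sup>2 + \<bar>snd y\<bar> \<le> c0 * \<delta>"
  shows "y0 + y \<in> \<Omega>"
proof (rule ccontr)
  assume "y0 + y \<notin> \<Omega>"
  then obtain s where s: "0 \<le> s" "s \<le> 1" "y0 + s *\<^sub>R (y0 + y - y0) \<in> frontier \<Omega>"
    using frontier_on_segment[OF y0(1)] by blast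
  define z1 where "z1 = y0 + s *\<^sub>R y"
  have z1: "z1 \<in> frontier \<Omega>" using s(3) by (simp add: z1_def)
  define \<nu> where "\<nu> = N z1"
  have bn: "ball_normal \<Omega> \<rho> R z1 \<nu>" unfolding \<nu>_def by (rule N[OF z1])
  have nn: "norm \<nu> = 1" using bn by (simp add: ball_normal_def)
  have "k7 * \<delta> \<le> \<nu> \<bullet> (y0 - z1)" using dist_bdry_le_height[OF bn \<Omega>(1) z1 y0(1) pos(1)] y0(2) by linarith
  also have "\<dots> = - s * (\<nu> \<bullet> y)" by (simp add: z1_def inner_diff_right inner_add_right)
  also have "\<dots> \<le> \<bar>\<nu> \<bullet> y\<bar>"
  proof -
    have "- s * (\<nu> \<bullet> y) \<le> s * \<bar>\<nu> \<bullet> y\<bar>" using s mult_left_mono[of "- (\<nu> \<bullet> y)" "\<bar>\<nu> \<bullet> y\<bar>" s] by simp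
    also have "\<dots> \<le> 1 * \<bar>\<nu> \<bullet> y\<bar>" using s by (intro mult_right_mono) auto
    finally show ?thesis by simp
  qed
  also have "\<dots> \<le> norm (fst \<nu>) * norm (fst y) + \<bar>snd \<nu>\<bar> * \<bar>snd y\<bar>"
  proof -
    have "\<nu> \<bullet> y = fst \<nu> \<bullet> fst y + snd \<nu> * snd y" by (simp add: inner_prod_def)
    then show ?thesis using Cauchy_Schwarz_ineq2[of "fst \<nu>" "fst y"] abs_triangle_ineq[of "fst \<nu> \<bullet> fst y" "snd \<nu> * snd y"]
      unfolding abs_mult by linarith
  qed
  finally have main: "k7 * \<delta> \<le> norm (fst \<nu>) * norm (fst y) + \<bar>snd \<nu>\<bar> * \<bar>snd y\<bar>" .
  have y1: "(norm (fst y))\<^sup>2 \<le> c0 * \<delta>" "\<bar>snd y\<bar> \<le> c0 * \<delta>" using y by (auto intro: order_trans[rotated])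
  have n2: "(norm (fst \<nu>))\<^sup>2 + (snd \<nu>)\<^sup>2 = 1"
    using nn by (simp add: norm_prod_def)
  then have "(snd \<nu>)\<^sup>2 \<le> 1" using zero_le_power2[of "norm (fst \<nu>)"] by linarith
  then have s1: "\<bar>snd \<nu>\<bar> \<le> 1" by (simp add: abs_square_le_1)
  have "\<rho> * (1 - (0, 1) \<bullet> \<nu>) \<le> (0, 1) \<bullet> (z1 - 0)"
    by (rule ball_normal_tilt[OF N[OF \<Omega>(2), unfolded N0] bn \<Omega> pos(1,2)])
  then have "\<rho> * (1 - snd \<nu>) \<le> snd z1" by (simp add: inner_prod_def)
  also have "\<dots> = snd y0 + s * snd y" by (simp add: z1_def)
  also have "s * snd y \<le> \<bar>snd y\<bar>"
  proof -
    have "s * snd y \<le> s * \<bar>snd y\<bar>" using s by (intro mult_left_mono) auto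
    also have "\<dots> \<le> 1 * \<bar>snd y\<bar>" using s by (intro mult_right_mono) auto
    finally show ?thesis by simp
  qed
  also have "\<bar>snd y\<bar> \<le> 1 * \<delta>" using y1(2) c0(1) pos mult_right_mono[of c0 1 \<delta>] by linarith
  finally have "\<rho> * (1 - snd \<nu>) \<le> (k2 + 1) * \<delta>" using y0(3) by (simp add: distrib_right)
  then have t: "1 - snd \<nu> \<le> (k2 + 1) * \<delta> / \<rho>" using pos by (simp add: field_simps)
  have "(norm (fst \<nu>))\<^sup>2 = (1 - snd \<nu>) * (1 + snd \<nu>)" using n2 by (simp add: power2_eq_square algebra_simps)
  also have "\<dots> \<le> (1 - snd \<nu>) * 2" using s1 by (intro mult_left_mono) auto
  also have "\<dots> \<le> ((k2 + 1) * \<delta> / \<rho>) * 2" using t by (intro mult_right_mono) auto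
  finally have f2: "(norm (fst \<nu>))\<^sup>2 \<le> 2 * ((k2 + 1) * \<delta> / \<rho>)" by (simp add: ac_simps)
  have "(norm (fst \<nu>) * norm (fst y))\<^sup>2 = (norm (fst \<nu>))\<^sup>2 * (norm (fst y))\<^sup>2" by (rule power_mult_distrib)
  also have "\<dots> \<le> (2 * ((k2 + 1) * \<delta> / \<rho>)) * (c0 * \<delta>)" using f2 y1(1) pos by (intro mult_mono) auto
  also have "\<dots> = (2 * (k2 + 1) * c0 / \<rho>) * \<delta>\<^sup>2" by (simp add: power2_eq_square)
  also have "\<dots> \<le> (k7 / 4)\<^sup>2 * \<delta>\<^sup>2" using c0(3) by (intro mult_right_mono) auto
  also have "\<dots> = (k7 / 4 * \<delta>)\<^sup>2" by (simp only: power_mult_distrib)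
  finally have "norm (fst \<nu>) * norm (fst y) \<le> k7 / 4 * \<delta>" by (rule power2_le_imp_le) (use pos in simp)
  moreover have "\<bar>snd \<nu>\<bar> * \<bar>snd y\<bar> \<le> 1 * (k7 / 4 * \<delta>)"
  proof (rule mult_mono[OF s1])
    show "\<bar>snd y\<bar> \<le> k7 / 4 * \<delta>" using y1(2) c0(2) pos mult_right_mono[of c0 "k7/4" \<delta>] by linarith
  qed auto
  moreover have "0 < k7 * \<delta>" using pos by simp
  ultimately show False using main by simp
qed

text \<open>\<open>m\<close> is replaced by a length \<open>\<delta>\<close> with
  \<open>m = \<delta> powr (\<gamma> - 1)\<close>. Then
  \<open>m * \<delta> = \<delta> powr \<gamma>\<close> is the scale of \<open>h\<close>, and
  heights, \<open>d(y0)\<close> and \<open>h powr (1 / \<gamma>)\<close> all have the scale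
  \<open>\<delta>\<close>.\<close>

lemma estimates_power:
  assumes pos: "0 < R" "0 < \<rho>" "0 \<le> C6" and \<alpha>: "1 < \<alpha>" "\<alpha> < 2" and lam: "0 < lam" "0 < Lam"
    and \<gamma>_def: "\<gamma> = (real (DIM('a::euclidean_space \<times> real)) + 1 - \<alpha>) / real (DIM('a \<times> real))"
  obtains c C :: real where "0 < c" "0 < C"
    "\<And>(\<Omega> :: ('a \<times> real) set) N u f y0 p h.
      section_data \<Omega> \<rho> R N \<alpha> lam Lam C6 u f 0 y0 p h \<Longrightarrow> N 0 = (0, 1) \<Longrightarrow>
      - C \<le> - snd p \<and>
      c * h powr ((\<gamma> - 1) / \<gamma>) \<le> max (- snd p) 1 \<and> max (- snd p) 1 \<le> C * h powr ((\<gamma> - 1) / \<gamma>) \<and>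
      c * h powr (1 / \<gamma>) \<le> dist_bdry \<Omega> y0 \<and> dist_bdry \<Omega> y0 \<le> C * h powr (1 / \<gamma>) \<and>
      (\<forall>y. (norm (fst y))\<^sup>2 + \<bar>snd y\<bar> \<le> c * h powr (1 / \<gamma>) \<longrightarrow> y0 + y \<in> \<Omega> \<and> excess u y0 p h (y0 + y) < 0) \<and>
      (\<forall>x\<in>\<Omega>. excess u y0 p h x < 0 \<longrightarrow> (norm (fst (x - y0)))\<^sup>2 + \<bar>snd (x - y0)\<bar> \<le> C * h powr (1 / \<gamma>))"
proof -
  let ?n = "DIM('a \<times> real)"
  have n2: "2 \<le> ?n" using DIM_positive[where 'a='a] by simp
  have nr: "2 \<le> real ?n" using n2 by linarith
  have \<gamma>: "0 < \<gamma>" "\<gamma> < 1" using nr \<alpha> by (auto simp: \<gamma>_def field_simps)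
  define \<sigma> where "\<sigma> = real ?n / (\<alpha> - 1)"
  have \<sigma>: "0 < \<sigma>" using nr \<alpha> by (simp add: \<sigma>_def)
  have \<gamma>\<sigma>: "(1 - \<gamma>) * \<sigma> = 1"
  proof -
    have "(1 - (k + 1 - \<alpha>) / k) * (k / (\<alpha> - 1)) = 1" if "2 \<le> k" for k :: real
    proof -
      have "1 - (k + 1 - \<alpha>) / k = (\<alpha> - 1) / k" using that by (simp add: field_simps)
      then show ?thesis using that \<alpha> by simp
    qed
    from this[OF nr] show ?thesis unfolding \<gamma>_def \<sigma>_def .
  qed
  have \<alpha>1: "1 \<le> \<alpha>" using \<alpha> by simp
  have prof: "lower_profile ?n \<alpha> R (\<lambda>r. r powr \<gamma>)"
    unfolding \<gamma>_def by (rule lower_profile_powr[OF n2 \<alpha> pos(1)])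
  obtain A a Al where Aa: "1 \<le> A" "0 < a" "a \<le> 1" "0 < Al" and core:
    "\<And>(\<Omega> :: ('a \<times> real) set) N u f z y0 p h. section_data \<Omega> \<rho> R N \<alpha> lam Lam C6 u f z y0 p h \<Longrightarrow>
      - (2 * R * C6) \<le> - (p \<bullet> N z) \<and>
      (\<forall>x\<in>closure \<Omega>. excess u y0 p h x \<le> (1 + 2 * R * C6) * max (- (p \<bullet> N z)) 1 * (N z \<bullet> (x - z))) \<and>
      A * max (- (p \<bullet> N z)) 1 * upper_depth \<alpha> \<rho> (2 * A * max (- (p \<bullet> N z)) 1 ^ ?n / a) \<le> h \<and>
      (\<exists>r. 0 < r \<and> r \<le> R / 2 \<and> r \<le> dist_bdry \<Omega> y0 \<and> h \<le> Al * r powr \<gamma>) \<and>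
      (\<forall>x\<in>\<Omega>. excess u y0 p h x < 0 \<longrightarrow>
         (\<exists>r. 0 < r \<and> r \<le> R / 2 \<and> r \<le> dist_bdry \<Omega> x \<and>
            (- (p \<bullet> N z) - 2 * R * C6) * (N z \<bullet> (x - z)) \<le> Al * r powr \<gamma>))"
    using section_core[OF n2 pos \<alpha>1 \<alpha>(2) lam prof] by blast
  define C5 where "C5 = 2 * R * C6"
  have C5: "0 \<le> C5" using pos by (simp add: C5_def)
  define Kd where "Kd = \<rho> powr (1 - \<alpha>) + (\<alpha> - 1) * (2 * A / a)"
  have "0 < (\<alpha> - 1) * (2 * A / a)" using Aa \<alpha> by simp
  then have Kd: "0 < Kd" unfolding Kd_def by (simp add: add_nonneg_pos)
  define k1 where "k1 = A * (Kd powr (- 1 / (\<alpha> - 1)) / 2)"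
  have k1: "0 < k1" using Aa Kd by (simp add: k1_def)
  \<comment> \<open>From this threshold on \<open>m = M\<close> and
    \<open>M - C5 \<ge> m / 2\<close>; below it \<open>\<delta>\<close> is bounded from below and
    the crude bound \<open>2 * R\<close> on heights suffices. The two summands of \<open>k2\<close>
    belong to these cases.\<close>
  define m0 where "m0 = 2 * C5 + 2"
  have m0: "1 \<le> m0" using C5 by (simp add: m0_def)
  define k2 where "k2 = (2 * Al) powr \<sigma> + 2 * R * m0 powr \<sigma>"
  have k2: "0 < k2" unfolding k2_def using Aa pos m0 by (intro add_pos_pos mult_pos_pos) auto
  define k5 where "k5 = k1 powr (1 / \<gamma>)"
  define k6 where "k6 = Al powr (1 / \<gamma>) * k2"
  have k56: "0 < k5" "0 < k6" using k1 k2 Aa by (auto simp: k5_def k6_def)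
  define k7 where "k7 = k5 / Al powr (1 / \<gamma>)"
  have k7: "0 < k7" using k56 Aa by (simp add: k7_def)
  \<comment> \<open>The smallness required by \<open>parabolic_box_in_domain\<close>.\<close>
  define c0 where "c0 = min 1 (min (k7 / 4) ((k7 / 4)\<^sup>2 * \<rho> / (2 * (k2 + 1))))"
  have c0: "0 < c0" using k7 k2 pos by (simp add: c0_def)
  have c0le: "c0 \<le> 1" "c0 \<le> k7 / 4" "c0 \<le> (k7 / 4)\<^sup>2 * \<rho> / (2 * (k2 + 1))"
    unfolding c0_def by linarith+
  have c03: "2 * (k2 + 1) * c0 / \<rho> \<le> (k7 / 4)\<^sup>2"
  proof -
    have "0 < 2 * (k2 + 1)" using k2 by simp
    then have "c0 * (2 * (k2 + 1)) \<le> (k7 / 4)\<^sup>2 * \<rho>" using c0le(3) by (simp only: pos_le_divide_eq)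
    then show ?thesis using pos by (simp add: pos_divide_le_eq mult.commute)
  qed
  \<comment> \<open>In the box the excess is at most \<open>C7 * h\<close>. Moving from the value
    \<open>- h\<close> at \<open>y0\<close> by the fraction \<open>\<theta>\<close> of the way keeps
    it negative.\<close>
  define C7 where "C7 = (1 + C5) * (k2 + 1) / k1"
  have C7: "0 \<le> C7" using C5 k2 k1 by (simp add: C7_def)
  define \<theta> where "\<theta> = 1 / (2 + C7)"
  have \<theta>: "0 < \<theta>" "\<theta> \<le> 1" using C7 by (auto simp: \<theta>_def)
  have \<theta>C: "\<theta> * (C7 + 1) < 1" using C7 by (simp add: \<theta>_def)
  define c where "c = min (k5 powr (1 - \<gamma>)) (min (1 / Al powr (1 / \<gamma>)) (\<theta>\<^sup>2 * c0 / k6))"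
  define C where "C = C5 + 1 + k6 powr (1 - \<gamma>) + (8 * R + 1) * k2 / k5"
  have cpos: "0 < c" using k56 Aa \<theta> c0 by (simp add: c_def)
  have cle: "c \<le> k5 powr (1 - \<gamma>)" "c \<le> 1 / Al powr (1 / \<gamma>)" "c \<le> \<theta>\<^sup>2 * c0 / k6" unfolding c_def by linarith+
  have Cparts: "0 \<le> k6 powr (1 - \<gamma>)" "0 \<le> (8 * R + 1) * k2 / k5" using k2 k56 pos by auto
  have k25: "k2 / k5 \<le> (8 * R + 1) * k2 / k5"
  proof -
    have "1 * (k2 / k5) \<le> (8 * R + 1) * (k2 / k5)" using pos k2 k56 by (intro mult_right_mono) auto
    then show ?thesis by simp
  qed
  have Cge: "C5 \<le> C" "k6 powr (1 - \<gamma>) \<le> C" "(8 * R + 1) * k2 / k5 \<le> C" "k2 / k5 \<le> C" "0 < C"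
    using Cparts C5 k25 unfolding C_def by linarith+
  show ?thesis
  proof (rule that[OF cpos Cge(5)])
    fix \<Omega> :: "('a \<times> real) set" and N u f y0 p h
    assume sd: "section_data \<Omega> \<rho> R N \<alpha> lam Lam C6 u f 0 y0 p h" and N0: "N 0 = (0, 1)"
    have N0i: "p \<bullet> N 0 = snd p" "N 0 \<bullet> x = snd x" for x by (simp_all add: N0 inner_prod_def)
    have ma: "ma_data \<Omega> \<rho> R N \<alpha> lam Lam u f" and z: "0 \<in> frontier \<Omega>" and y0: "y0 \<in> \<Omega>" and h: "0 < h"
      using sd by (auto simp: section_data_def)
    have \<Omega>: "open \<Omega>" "bounded \<Omega>" and N: "\<And>z. z \<in> frontier \<Omega> \<Longrightarrow> ball_normal \<Omega> \<rho> R z (N z)"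
      and ucv: "convex_on (closure \<Omega>) u"
      using ma by (auto simp: ma_data_def)
    have bn: "ball_normal \<Omega> \<rho> R 0 (0, 1)" using N[OF z] N0 by simp
    define M where "M = - snd p"
    define m where "m = max M 1"
    have m: "1 \<le> m" by (simp add: m_def)
    note cc = core[OF sd, unfolded N0i diff_zero, folded C5_def M_def, folded m_def]
    have M5: "- C5 \<le> M" using cc by blast
    have up: "\<And>x. x \<in> closure \<Omega> \<Longrightarrow> excess u y0 p h x \<le> (1 + C5) * m * snd x" using cc by blast
    have hlow: "A * m * upper_depth \<alpha> \<rho> (2 * A * m ^ ?n / a) \<le> h" using cc by blast
    have snd_pos: "0 < snd x" if "x \<in> \<Omega>" for x
      using ball_normal_pos[OF bn \<Omega>(1) z that pos(1)] by (simp add: inner_prod_def)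
    have dsnd: "dist_bdry \<Omega> x \<le> snd x" if "x \<in> \<Omega>" for x
      using dist_bdry_le_height[OF bn \<Omega>(1) z that pos(1)] by (simp add: inner_prod_def)
    have nsq: "(norm x)\<^sup>2 \<le> 2 * R * snd x" if "x \<in> \<Omega>" for x
    proof -
      have "x \<in> closure \<Omega>" using that closure_subset by blast
      from ball_normal_upper[OF bn this pos(1)] show ?thesis by (simp add: inner_prod_def)
    qed
    have fst_le: "(norm (fst x))\<^sup>2 \<le> (norm x)\<^sup>2" and snd_le: "(snd x)\<^sup>2 \<le> (norm x)\<^sup>2" for x :: "'a \<times> real"
      by (simp_all add: norm_prod_def)
    have snd2R: "snd x \<le> 2 * R" if "x \<in> \<Omega>" for x
    proof -
      have "snd x * snd x \<le> 2 * R * snd x" using nsq[OF that] snd_le[of x] by (simp add: power2_eq_square)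
      then show ?thesis using snd_pos[OF that] by simp
    qed
    define \<delta> where "\<delta> = m powr (- \<sigma>)"
    have \<delta>: "0 < \<delta>" using m by (simp add: \<delta>_def)
    have m\<delta>: "\<delta> powr (\<gamma> - 1) = m"
    proof -
      have "- \<sigma> * (\<gamma> - 1) = 1" using \<gamma>\<sigma> by (simp add: algebra_simps)
      then show ?thesis using m unfolding \<delta>_def powr_powr by simp
    qed
    have "\<delta> * \<delta> powr (\<gamma> - 1) = \<delta> powr \<gamma>" using \<delta> by (simp add: powr_mult_base)
    then have m\<delta>2: "m * \<delta> = \<delta> powr \<gamma>" by (simp add: m\<delta> mult.commute)
    \<comment> \<open>Since \<open>m ^ n \<ge> 1\<close>, the summand
      \<open>\<rho> powr (1 - \<alpha>)\<close> in \<open>upper_depth\<close> is absorbed and the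
      depth is at least a multiple of
      \<open>m powr (- n / (\<alpha> - 1)) = \<delta>\<close>.\<close>
    have a1: "k1 * \<delta> powr \<gamma> \<le> h"
    proof -
      have mn: "1 \<le> m ^ ?n" using m by (rule one_le_power)
      have "\<rho> powr (1 - \<alpha>) * 1 \<le> \<rho> powr (1 - \<alpha>) * m ^ ?n" using mn by (intro mult_left_mono) auto
      then have le: "\<rho> powr (1 - \<alpha>) + (\<alpha> - 1) * (2 * A * m ^ ?n / a) \<le> Kd * m ^ ?n"
        by (simp add: Kd_def distrib_right)
      have gt0: "0 < \<rho> powr (1 - \<alpha>) + (\<alpha> - 1) * (2 * A * m ^ ?n / a)"
      proof -
        have "0 \<le> (\<alpha> - 1) * (2 * A * m ^ ?n / a)" using \<alpha> Aa m by simp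
        moreover have "0 < \<rho> powr (1 - \<alpha>)" using pos by simp
        ultimately show ?thesis by linarith
      qed
      have "Kd powr (- 1 / (\<alpha> - 1)) * \<delta> = Kd powr (- 1 / (\<alpha> - 1)) * (m powr real ?n) powr (- 1 / (\<alpha> - 1))"
        unfolding powr_powr by (simp add: \<delta>_def \<sigma>_def)
      also have "\<dots> = (Kd * m ^ ?n) powr (- 1 / (\<alpha> - 1))"
      proof -
        have mp: "m powr real ?n = m ^ ?n" by (rule powr_realpow) (use m in linarith)
        show ?thesis unfolding mp using Kd m by (simp add: powr_mult)
      qed
      also have "\<dots> \<le> (\<rho> powr (1 - \<alpha>) + (\<alpha> - 1) * (2 * A * m ^ ?n / a)) powr (- 1 / (\<alpha> - 1))"
        using le gt0 \<alpha> by (intro powr_mono2') auto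
      also have "\<dots> = 2 * upper_depth \<alpha> \<rho> (2 * A * m ^ ?n / a)" using \<alpha> by (simp add: upper_depth_def)
      finally have "Kd powr (- 1 / (\<alpha> - 1)) * \<delta> / 2 \<le> upper_depth \<alpha> \<rho> (2 * A * m ^ ?n / a)" by simp
      then have "A * m * (Kd powr (- 1 / (\<alpha> - 1)) * \<delta> / 2) \<le> A * m * upper_depth \<alpha> \<rho> (2 * A * m ^ ?n / a)"
        using Aa m by (intro mult_left_mono) auto
      also note hlow
      finally show ?thesis unfolding m\<delta>2[symmetric] k1_def by (simp add: ac_simps)
    qed
    \<comment> \<open>For large \<open>m\<close>, \<open>r \<le> t\<close> turns the barrier
      inequality into \<open>m / 2 * t \<le> Al * t powr \<gamma>\<close>, so
      \<open>t powr (1 - \<gamma>)\<close> is at most of order \<open>1 / m\<close>; the power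
      \<open>\<sigma>\<close> of this is the claim.\<close>
    have b1: "snd x \<le> k2 * \<delta>" if x: "x \<in> \<Omega>" "excess u y0 p h x < 0" for x
    proof (cases "m0 \<le> m")
      case True
      then have mM: "m = M" using C5 by (simp add: m_def m0_def max_def split: if_splits)
      have half: "m / 2 \<le> M - C5" using True mM by (simp add: m0_def)
      obtain r where r: "0 < r" "r \<le> dist_bdry \<Omega> x" "(M - C5) * snd x \<le> Al * r powr \<gamma>" using cc x by blast
      define t where "t = snd x"
      have t: "0 < t" "r \<le> t" using snd_pos[OF x(1)] dsnd[OF x(1)] r by (auto simp: t_def)
      have "m / 2 * t \<le> (M - C5) * t" using half t by (intro mult_right_mono) auto
      also have "\<dots> \<le> Al * r powr \<gamma>" using r(3) by (simp add: t_def)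
      also have "\<dots> \<le> Al * t powr \<gamma>" using Aa r t \<gamma> by (intro mult_left_mono powr_mono2) auto
      finally have "m / 2 * t * t powr (- \<gamma>) \<le> Al * t powr \<gamma> * t powr (- \<gamma>)" by (intro mult_right_mono) auto
      moreover have "t powr \<gamma> * t powr (- \<gamma>) = 1" using t by (simp flip: powr_add)
      moreover have "t * t powr (- \<gamma>) = t powr (1 - \<gamma>)" using t by (simp add: powr_diff powr_minus field_simps)
      ultimately have "m / 2 * t powr (1 - \<gamma>) \<le> Al" by (simp only: mult.assoc mult_1_right)
      then have "t powr (1 - \<gamma>) \<le> 2 * Al / m" using m by (simp add: field_simps)
      then have "(t powr (1 - \<gamma>)) powr \<sigma> \<le> (2 * Al / m) powr \<sigma>" using \<sigma> by (intro powr_mono2) auto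
      moreover have "(2 * Al / m) powr \<sigma> = (2 * Al) powr \<sigma> * \<delta>"
        using m Aa by (subst powr_divide) (auto simp: \<delta>_def powr_minus divide_inverse)
      ultimately have "t \<le> (2 * Al) powr \<sigma> * \<delta>" unfolding powr_powr \<gamma>\<sigma> using t by simp
      also have "\<dots> \<le> k2 * \<delta>" using \<delta> pos by (intro mult_right_mono) (auto simp: k2_def)
      finally show ?thesis by (simp add: t_def)
    next
      case False
      have "1 = m powr \<sigma> * \<delta>" using m by (simp add: \<delta>_def flip: powr_add)
      also have "\<dots> \<le> m0 powr \<sigma> * \<delta>" using False m \<sigma> \<delta> by (intro mult_right_mono powr_mono2) auto
      finally have "2 * R * 1 \<le> 2 * R * (m0 powr \<sigma> * \<delta>)" using pos by (intro mult_left_mono) auto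
      then have "snd x \<le> (2 * R * m0 powr \<sigma>) * \<delta>" using snd2R[OF x(1)] by simp
      also have "\<dots> \<le> k2 * \<delta>" using \<delta> by (intro mult_right_mono) (auto simp: k2_def)
      finally show ?thesis .
    qed
    have exy0: "excess u y0 p h y0 < 0" using h by (simp add: excess_def)
    have y0k: "snd y0 \<le> k2 * \<delta>" by (rule b1[OF y0 exy0])
    define d where "d = dist_bdry \<Omega> y0"
    have d0: "0 < d" unfolding d_def by (rule dist_bdry_pos[OF \<Omega> y0])
    have dk: "d \<le> k2 * \<delta>" using dsnd[OF y0] y0k by (simp add: d_def)
    have hd: "h \<le> Al * d powr \<gamma>"
    proof -
      obtain r where r: "0 < r" "r \<le> d" "h \<le> Al * r powr \<gamma>" using cc unfolding d_def by blast
      have "Al * r powr \<gamma> \<le> Al * d powr \<gamma>" using Aa r \<gamma> by (intro mult_left_mono powr_mono2) auto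
      then show ?thesis using r by linarith
    qed
    \<comment> \<open>The chain
      \<open>k5 * \<delta> \<le> H \<le> Al powr (1 / \<gamma>) * d\<close> together with
      \<open>d \<le> k2 * \<delta>\<close> makes \<open>H\<close>, \<open>d\<close> and
      \<open>\<delta>\<close> comparable; the bounds on \<open>m\<close> and \<open>d\<close> only
      restate this.\<close>
    define H where "H = h powr (1 / \<gamma>)"
    have H0: "0 < H" using h by (simp add: H_def)
    have inv\<gamma>: "\<gamma> * (1 / \<gamma>) = 1" using \<gamma> by simp
    have H1: "k5 * \<delta> \<le> H"
    proof -
      have "k5 * \<delta> = (k1 * \<delta> powr \<gamma>) powr (1 / \<gamma>)"
        using k1 \<delta> \<gamma> by (simp add: k5_def powr_mult powr_powr)
      also have "\<dots> \<le> H" unfolding H_def using a1 k1 \<gamma> by (intro powr_mono2) auto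
      finally show ?thesis .
    qed
    have H2: "H \<le> Al powr (1 / \<gamma>) * d"
    proof -
      have "H \<le> (Al * d powr \<gamma>) powr (1 / \<gamma>)" unfolding H_def using hd h \<gamma> by (intro powr_mono2) auto
      also have "\<dots> = Al powr (1 / \<gamma>) * d" using Aa d0 \<gamma> by (simp add: powr_mult powr_powr)
      finally show ?thesis .
    qed
    have H3: "H \<le> k6 * \<delta>"
    proof -
      have "Al powr (1 / \<gamma>) * d \<le> Al powr (1 / \<gamma>) * (k2 * \<delta>)" using dk by (intro mult_left_mono) auto
      then show ?thesis using H2 by (simp add: k6_def)
    qed
    have hH: "h powr ((\<gamma> - 1) / \<gamma>) = H powr (\<gamma> - 1)" by (simp add: H_def powr_powr)
    have \<delta>H: "\<delta> \<le> H / k5" "H / k6 \<le> \<delta>" using H1 H3 k56 by (simp_all add: field_simps)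
    have mlow: "k5 powr (1 - \<gamma>) * H powr (\<gamma> - 1) \<le> m"
    proof -
      have "(H / k5) powr (\<gamma> - 1) \<le> \<delta> powr (\<gamma> - 1)" using \<delta>H(1) \<delta> \<gamma> by (intro powr_mono2') auto
      moreover have "(H / k5) powr (\<gamma> - 1) = k5 powr (1 - \<gamma>) * H powr (\<gamma> - 1)"
        using H0 k56 by (simp add: powr_divide powr_diff field_simps)
      ultimately show ?thesis by (simp add: m\<delta>)
    qed
    have mup: "m \<le> k6 powr (1 - \<gamma>) * H powr (\<gamma> - 1)"
    proof -
      have "\<delta> powr (\<gamma> - 1) \<le> (H / k6) powr (\<gamma> - 1)" using \<delta>H(2) H0 k56 \<gamma> by (intro powr_mono2') auto
      moreover have "(H / k6) powr (\<gamma> - 1) = k6 powr (1 - \<gamma>) * H powr (\<gamma> - 1)"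
        using H0 k56 by (simp add: powr_divide powr_diff field_simps)
      ultimately show ?thesis by (simp add: m\<delta>)
    qed
    have r1: "c * H powr (\<gamma> - 1) \<le> m"
      using mult_right_mono[OF cle(1), of "H powr (\<gamma> - 1)"] mlow by simp
    have r2: "m \<le> C * H powr (\<gamma> - 1)"
      using mult_right_mono[OF Cge(2), of "H powr (\<gamma> - 1)"] mup by simp
    have r3: "c * H \<le> d"
    proof -
      have "c * H \<le> 1 / Al powr (1 / \<gamma>) * (Al powr (1 / \<gamma>) * d)" using cle(2) H2 H0 Aa by (intro mult_mono) auto
      then show ?thesis using Aa by simp
    qed
    have r4: "d \<le> C * H"
    proof -
      have "k2 * \<delta> \<le> k2 * (H / k5)" using \<delta>H(1) k2 by (intro mult_left_mono) auto
      also have "\<dots> = k2 / k5 * H" by simp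
      also have "\<dots> \<le> C * H" using Cge(4) H0 by (intro mult_right_mono) auto
      finally show ?thesis using dk by linarith
    qed
    have k7d: "k7 * \<delta> \<le> d"
    proof -
      have "k7 * \<delta> \<le> H / Al powr (1 / \<gamma>)" using H1 Aa by (simp add: k7_def divide_right_mono)
      also have "\<dots> \<le> d" using H2 Aa by (simp add: pos_divide_le_eq mult.commute)
      finally show ?thesis .
    qed
    have r5: "y0 + y \<in> \<Omega> \<and> excess u y0 p h (y0 + y) < 0" if y: "(norm (fst y))\<^sup>2 + \<bar>snd y\<bar> \<le> c * H" for y
    proof -
      have cH: "c * H \<le> \<theta>\<^sup>2 * (c0 * \<delta>)"
      proof -
        have "c * H \<le> \<theta>\<^sup>2 * c0 / k6 * (k6 * \<delta>)" using cle(3) H3 H0 \<theta> c0 k56 by (intro mult_mono) auto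
        then show ?thesis using k56 by simp
      qed
      have box: "y0 + w \<in> \<Omega>" if "(norm (fst w))\<^sup>2 + \<bar>snd w\<bar> \<le> c0 * \<delta>" for w
        by (rule parabolic_box_in_domain[OF N \<Omega>(1) z N0 pos(1,2) k7 _ c0 \<delta> y0 k7d[unfolded d_def] y0k c0le(1,2) c03 that])
           (use k2 in auto)
      \<comment> \<open>The gauge \<open>(norm (fst y))\<^sup>2 + \<bar>snd y\<bar>\<close> is not
        homogeneous: dividing \<open>y\<close> by \<open>\<theta>\<close> costs up to
        \<open>\<theta>\<^sup>2\<close>, hence this factor in \<open>c\<close>.\<close>
      define w where "w = (1 / \<theta>) *\<^sub>R y"
      have yw: "y = \<theta> *\<^sub>R w" using \<theta> by (simp add: w_def)
      have w: "(norm (fst w))\<^sup>2 + \<bar>snd w\<bar> \<le> c0 * \<delta>"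
      proof -
        have "\<theta>\<^sup>2 * ((norm (fst w))\<^sup>2 + \<bar>snd w\<bar>) \<le> (norm (fst y))\<^sup>2 + \<bar>snd y\<bar>"
        proof -
          have "\<theta>\<^sup>2 \<le> \<theta>" using \<theta> by (simp add: power2_eq_square mult_left_le_one_le)
          then have "\<theta>\<^sup>2 * \<bar>snd w\<bar> \<le> \<theta> * \<bar>snd w\<bar>" by (rule mult_right_mono) simp
          moreover have "\<bar>snd y\<bar> = \<theta> * \<bar>snd w\<bar>" using \<theta> by (simp add: yw abs_mult)
          moreover have "(norm (fst y))\<^sup>2 = \<theta>\<^sup>2 * (norm (fst w))\<^sup>2" by (simp add: yw power_mult_distrib)
          ultimately show ?thesis by (simp add: distrib_left)
        qed
        also have "\<dots> \<le> \<theta>\<^sup>2 * (c0 * \<delta>)" using y cH by linarith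
        finally show ?thesis using \<theta> by simp
      qed
      have wO: "y0 + w \<in> \<Omega>" by (rule box[OF w])
      have wc: "y0 + w \<in> closure \<Omega>" "y0 \<in> closure \<Omega>" using wO y0 closure_subset by auto
      have "snd (y0 + w) \<le> (k2 + 1) * \<delta>"
      proof -
        have "\<bar>snd w\<bar> \<le> c0 * \<delta>" using w zero_le_power2[of "norm (fst w)"] by linarith
        also have "\<dots> \<le> 1 * \<delta>" using c0le(1) \<delta> by (intro mult_right_mono) auto
        finally show ?thesis using y0k by (simp add: distrib_right)
      qed
      then have "(1 + C5) * m * snd (y0 + w) \<le> (1 + C5) * m * ((k2 + 1) * \<delta>)"
        using C5 m by (intro mult_left_mono) auto
      also have "\<dots> = C7 * (k1 * (m * \<delta>))" using k1 by (simp add: C7_def)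
      also have "\<dots> \<le> C7 * h" using a1 C7 unfolding m\<delta>2 by (intro mult_left_mono) auto
      finally have "excess u y0 p h (y0 + w) \<le> C7 * h" using up[OF wc(1)] by linarith
      then have "excess u y0 p h (y0 + \<theta> *\<^sub>R w) \<le> - h + \<theta> * (C7 * h + h)"
        using excess_segment[OF ucv wc(2) wc(1)] \<theta> by simp
      also have "\<dots> = - h + (\<theta> * (C7 + 1)) * h" by (simp add: algebra_simps)
      also have "\<dots> < - h + 1 * h" using \<theta>C h by (intro add_strict_left_mono mult_strict_right_mono) auto
      finally have "excess u y0 p h (y0 + y) < 0" by (simp add: yw)
      moreover have "y0 + y \<in> \<Omega>"
      proof (rule box)
        have "\<theta>\<^sup>2 * (c0 * \<delta>) \<le> 1 * (c0 * \<delta>)" using \<theta> c0 \<delta> by (intro mult_right_mono) (auto simp: power_le_one)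
        then show "(norm (fst y))\<^sup>2 + \<bar>snd y\<bar> \<le> c0 * \<delta>" using y cH by linarith
      qed
      ultimately show ?thesis by simp
    qed
    \<comment> \<open>Both points have height at most \<open>k2 * \<delta>\<close>, and the outer
      ball at 0 bounds squared norms by heights.\<close>
    have r6: "(norm (fst (x - y0)))\<^sup>2 + \<bar>snd (x - y0)\<bar> \<le> C * H" if x: "x \<in> \<Omega>" "excess u y0 p h x < 0" for x
    proof -
      have fx: "(norm (fst w))\<^sup>2 \<le> 2 * R * (k2 * \<delta>)" if "w \<in> \<Omega>" "snd w \<le> k2 * \<delta>" for w
      proof -
        have "2 * R * snd w \<le> 2 * R * (k2 * \<delta>)" using that pos by (intro mult_left_mono) auto
        then show ?thesis using nsq[OF that(1)] fst_le[of w] by linarith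
      qed
      have "(norm (fst (x - y0)))\<^sup>2 \<le> (norm (fst x) + norm (fst y0))\<^sup>2"
        by (intro power_mono) (auto simp: norm_triangle_ineq4)
      also have "\<dots> \<le> 2 * (norm (fst x))\<^sup>2 + 2 * (norm (fst y0))\<^sup>2"
        using zero_le_power2[of "norm (fst x) - norm (fst y0)"] by (simp add: power2_sum power2_diff)
      also have "\<dots> \<le> 8 * R * (k2 * \<delta>)" using fx[OF x(1) b1[OF x]] fx[OF y0 y0k] by linarith
      finally have "(norm (fst (x - y0)))\<^sup>2 \<le> 8 * R * (k2 * \<delta>)" .
      moreover have "\<bar>snd (x - y0)\<bar> \<le> k2 * \<delta>"
        using b1[OF x] y0k snd_pos[OF x(1)] snd_pos[OF y0] by (simp add: abs_le_iff)
      ultimately have "(norm (fst (x - y0)))\<^sup>2 + \<bar>snd (x - y0)\<bar> \<le> (8 * R + 1) * k2 * \<delta>" by (simp add: algebra_simps)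
      also have "\<dots> \<le> (8 * R + 1) * k2 * (H / k5)" using \<delta>H(1) pos k2 by (intro mult_left_mono) auto
      also have "\<dots> = (8 * R + 1) * k2 / k5 * H" by simp
      also have "\<dots> \<le> C * H" using Cge(3) H0 by (intro mult_right_mono) auto
      finally show ?thesis .
    qed
    show "- C \<le> - snd p \<and>
      c * h powr ((\<gamma> - 1) / \<gamma>) \<le> max (- snd p) 1 \<and> max (- snd p) 1 \<le> C * h powr ((\<gamma> - 1) / \<gamma>) \<and>
      c * h powr (1 / \<gamma>) \<le> dist_bdry \<Omega> y0 \<and> dist_bdry \<Omega> y0 \<le> C * h powr (1 / \<gamma>) \<and>
      (\<forall>y. (norm (fst y))\<^sup>2 + \<bar>snd y\<bar> \<le> c * h powr (1 / \<gamma>) \<longrightarrow> y0 + y \<in> \<Omega> \<and> excess u y0 p h (y0 + y) < 0) \<and>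
      (\<forall>x\<in>\<Omega>. excess u y0 p h x < 0 \<longrightarrow> (norm (fst (x - y0)))\<^sup>2 + \<bar>snd (x - y0)\<bar> \<le> C * h powr (1 / \<gamma>))"
      unfolding hH H_def[symmetric] M_def[symmetric] m_def[symmetric] d_def[symmetric]
      using r1 r2 r3 r4 r5 r6 M5 Cge(1) by auto
  qed
qed

text \<open>With \<open>X = m ^ n\<close> the barriers place \<open>h\<close> between multiples of
  \<open>exp (- (k8 * X))\<close> and \<open>exp (- (k12 * X))\<close>. Logarithms of this give the
  bounds on \<open>M\<close>; eliminating \<open>X\<close> gives powers of \<open>h\<close> whose
  exponents reflect the different rates.\<close>

lemma estimates_log:
  assumes pos: "0 < R" "0 < \<rho>" "0 \<le> C6" and lam: "0 < lam" "0 < Lam"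
  obtains c C :: real where "0 < c" "0 < C"
    "\<And>(\<Omega> :: ('a::euclidean_space \<times> real) set) N u f y0 p h.
      section_data \<Omega> \<rho> R N 1 lam Lam C6 u f 0 y0 p h \<Longrightarrow> N 0 = (0, 1) \<Longrightarrow>
      - C \<le> - snd p \<and>
      - c * ln (C * h) \<le> \<bar>- snd p\<bar> ^ DIM('a \<times> real) \<and> \<bar>- snd p\<bar> ^ DIM('a \<times> real) \<le> - C * ln (c * h) \<and>
      c * min h 1 powr C \<le> dist_bdry \<Omega> y0 \<and> dist_bdry \<Omega> y0 \<le> C * min h 1 powr c \<and>
      (\<forall>y. norm y < c * min h 1 powr C \<longrightarrow> y0 + y \<in> \<Omega> \<and> excess u y0 p h (y0 + y) < 0) \<and>
      (\<forall>x\<in>\<Omega>. excess u y0 p h x < 0 \<longrightarrow> norm (x - y0) < C * min h 1 powr c)"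
proof -
  let ?n = "DIM('a \<times> real)"
  have n2: "2 \<le> ?n" using DIM_positive[where 'a='a] by simp
  have npos: "0 < ?n" using n2 by linarith
  have \<alpha>: "(1::real) \<le> 1" "(1::real) < 2" by simp_all
  have prof: "lower_profile ?n 1 R (log_profile ?n R)" by (rule lower_profile_log[OF n2 pos(1)])
  obtain A a Al where Aa: "1 \<le> A" "0 < a" "a \<le> 1" "0 < Al" and core:
    "\<And>(\<Omega> :: ('a \<times> real) set) N u f z y0 p h. section_data \<Omega> \<rho> R N 1 lam Lam C6 u f z y0 p h \<Longrightarrow>
      - (2 * R * C6) \<le> - (p \<bullet> N z) \<and>
      (\<forall>x\<in>closure \<Omega>. excess u y0 p h x \<le> (1 + 2 * R * C6) * max (- (p \<bullet> N z)) 1 * (N z \<bullet> (x - z))) \<and>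
      A * max (- (p \<bullet> N z)) 1 * upper_depth 1 \<rho> (2 * A * max (- (p \<bullet> N z)) 1 ^ ?n / a) \<le> h \<and>
      (\<exists>r. 0 < r \<and> r \<le> R / 2 \<and> r \<le> dist_bdry \<Omega> y0 \<and> h \<le> Al * log_profile ?n R r) \<and>
      (\<forall>x\<in>\<Omega>. excess u y0 p h x < 0 \<longrightarrow>
         (\<exists>r. 0 < r \<and> r \<le> R / 2 \<and> r \<le> dist_bdry \<Omega> x \<and>
            (- (p \<bullet> N z) - 2 * R * C6) * (N z \<bullet> (x - z)) \<le> Al * log_profile ?n R r))"
    using section_core[OF n2 pos \<alpha> lam prof] by blast
  define C5 where "C5 = 2 * R * C6"
  have C5: "0 \<le> C5" using pos by (simp add: C5_def)
  define k1 where "k1 = \<rho> / 2"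
  have k1: "0 < k1" using pos by (simp add: k1_def)
  define k8 where "k8 = 2 * A / a"
  have k8: "0 < k8" using Aa by (simp add: k8_def)
  define m0 where "m0 = 2 * C5 + 2"
  have m0: "1 \<le> m0" using C5 by (simp add: m0_def)
  define B where "B = exp 2 * R"
  have B: "0 < B" using pos by (simp add: B_def)
  \<comment> \<open>The rate that comes from \<open>m / (2 * Al) \<le> L powr (1 / n)\<close>; each
    of two later square roots halves it, to \<open>k9\<close> and to \<open>k12\<close>.\<close>
  define j where "j = 1 / (2 * Al) ^ ?n"
  have j: "0 < j" using Aa by (simp add: j_def)
  define k9 where "k9 = j / 2"
  have k9: "0 < k9" using j by (simp add: k9_def)
  define k2 where "k2 = 4 * Al * B + 2 * R * exp (k9 * m0 ^ ?n)"
  have k2: "0 < k2" unfolding k2_def using Aa B pos by (intro add_pos_pos mult_pos_pos) auto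
  define k10 where "k10 = 1 / (4 * Al\<^sup>2 * B)"
  have k10: "0 < k10" using Aa B by (simp add: k10_def)
  define k11 where "k11 = 2 * Al * sqrt (B * k2)"
  have k11: "0 < k11" using Aa B k2 by (simp add: k11_def)
  define k12 where "k12 = k9 / 2"
  have k12: "0 < k12" using k9 by (simp add: k12_def)
  \<comment> \<open>Converts \<open>exp (- (k9 * X))\<close> into a power of \<open>h\<close>, by
    means of \<open>exp (- (k8 * X)) \<le> h / k1\<close>.\<close>
  define s where "s = k9 / k8"
  have s: "0 < s" using k9 k8 by (simp add: s_def)
  \<comment> \<open>The maximum with 1 covers \<open>h > 1\<close>, where \<open>min h 1\<close> is
    1.\<close>
  define G where "G = k2 * max 1 (k1 powr (- s))"
  have G: "0 < G" using k2 by (simp add: G_def less_max_iff_disj)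
  define K where "K = (1 + C5) * (2 * R) * k11 / k12"
  have K: "0 \<le> K" using C5 pos k11 k12 by (simp add: K_def)
  define c1 where "c1 = 1 / (2 * (K + 1))"
  have c1: "0 < c1" "c1 \<le> 1 / 2" using K by (auto simp: c1_def field_simps)
  define c where "c = min (1 / k8) (min (1 / k11) (min k10 (min (s / 2) (c1 * k10))))"
  \<comment> \<open>The summand 4 is the exponent of the inner ball, whose radius is of order
    \<open>hs powr 4\<close>; as \<open>hs \<le> 1\<close>, a larger exponent is harmless. The other
    summands are the constants of the separate bounds.\<close>
  define C where "C = 4 + C5 + exp k8 / k1 + (1 + C5) ^ ?n / k12 + G + 2 * sqrt (2 * R * G)"
  have cle: "c \<le> 1 / k8" "c \<le> 1 / k11" "c \<le> k10" "c \<le> s / 2" "c \<le> c1 * k10" unfolding c_def by linarith+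
  have cpos: "0 < c" using k8 k11 k10 s c1 by (simp add: c_def)
  have parts: "0 < exp k8 / k1" "0 < (1 + C5) ^ ?n / k12" "0 \<le> sqrt (2 * R * G)"
    using k1 k12 C5 pos G by (auto simp: add_nonneg_pos)
  have Cge: "4 \<le> C" "C5 \<le> C" "exp k8 / k1 \<le> C" "(1 + C5) ^ ?n / k12 \<le> C" "G \<le> C" "2 * sqrt (2 * R * G) < C" "0 < C"
    unfolding C_def using parts C5 G by linarith+
  show ?thesis
  proof (rule that[OF cpos Cge(7)])
    fix \<Omega> :: "('a \<times> real) set" and N u f y0 p h
    assume sd: "section_data \<Omega> \<rho> R N 1 lam Lam C6 u f 0 y0 p h" and N0: "N 0 = (0, 1)"
    have N0i: "p \<bullet> N 0 = snd p" "N 0 \<bullet> x = snd x" for x by (simp_all add: N0 inner_prod_def)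
    have ma: "ma_data \<Omega> \<rho> R N 1 lam Lam u f" and z: "0 \<in> frontier \<Omega>" and y0: "y0 \<in> \<Omega>" and h: "0 < h"
      using sd by (auto simp: section_data_def)
    have \<Omega>: "open \<Omega>" "bounded \<Omega>" and N: "\<And>z. z \<in> frontier \<Omega> \<Longrightarrow> ball_normal \<Omega> \<rho> R z (N z)"
      and ucv: "convex_on (closure \<Omega>) u"
      using ma by (auto simp: ma_data_def)
    have bn: "ball_normal \<Omega> \<rho> R 0 (0, 1)" using N[OF z] N0 by simp
    define M where "M = - snd p"
    define m where "m = max M 1"
    have m: "1 \<le> m" by (simp add: m_def)
    define X where "X = m ^ ?n"
    have X1: "1 \<le> X" unfolding X_def using m by (rule one_le_power)
    have mX: "m \<le> X" unfolding X_def using m npos by (simp add: self_le_power)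
    note cc = core[OF sd, unfolded N0i diff_zero, folded C5_def M_def, folded m_def, folded X_def]
    have M5: "- C5 \<le> M" using cc by blast
    have up: "\<And>x. x \<in> closure \<Omega> \<Longrightarrow> excess u y0 p h x \<le> (1 + C5) * m * snd x" using cc by blast
    have hlow: "A * m * upper_depth 1 \<rho> (2 * A * X / a) \<le> h" using cc by blast
    have snd_pos: "0 < snd x" if "x \<in> \<Omega>" for x
      using ball_normal_pos[OF bn \<Omega>(1) z that pos(1)] by (simp add: inner_prod_def)
    have dsnd: "dist_bdry \<Omega> x \<le> snd x" if "x \<in> \<Omega>" for x
      using dist_bdry_le_height[OF bn \<Omega>(1) z that pos(1)] by (simp add: inner_prod_def)
    have nsq: "(norm x)\<^sup>2 \<le> 2 * R * snd x" if "x \<in> \<Omega>" for x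
    proof -
      have "x \<in> closure \<Omega>" using that closure_subset by blast
      from ball_normal_upper[OF bn this pos(1)] show ?thesis by (simp add: inner_prod_def)
    qed
    have snd2R: "snd x \<le> 2 * R" if "x \<in> \<Omega>" for x
    proof -
      have "(snd x)\<^sup>2 \<le> (norm x)\<^sup>2" by (simp add: norm_prod_def)
      then have "snd x * snd x \<le> 2 * R * snd x" using nsq[OF that] by (simp add: power2_eq_square)
      then show ?thesis using snd_pos[OF that] by simp
    qed
    have a1: "k1 * exp (- (k8 * X)) \<le> h"
    proof -
      have "upper_depth 1 \<rho> (2 * A * X / a) = k1 * exp (- (k8 * X))" by (simp add: upper_depth_def k1_def k8_def)
      moreover have "1 * (k1 * exp (- (k8 * X))) \<le> (A * m) * (k1 * exp (- (k8 * X)))"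
        using Aa m k1 mult_mono[of 1 A 1 m] by (intro mult_right_mono) auto
      ultimately show ?thesis using hlow by simp
    qed
    have lp: "log_profile ?n R r \<le> 2 * sqrt (B * r)" if "0 < r" "r \<le> R / 2" for r
      unfolding B_def by (rule log_profile_le_sqrt(1)[OF n2 that(1)]) (use that pos in simp)
    have b1: "snd x \<le> k2 * exp (- (k9 * X))" if x: "x \<in> \<Omega>" "excess u y0 p h x < 0" for x
    proof (cases "m0 \<le> m")
      case True
      then have mM: "m = M" using C5 by (simp add: m_def m0_def max_def split: if_splits)
      have half: "m / 2 \<le> M - C5" using True mM by (simp add: m0_def)
      obtain r where r: "0 < r" "r \<le> R / 2" "r \<le> dist_bdry \<Omega> x" "(M - C5) * snd x \<le> Al * log_profile ?n R r" using cc x by blast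
      define t where "t = snd x"
      have t: "0 < t" "r \<le> t" using snd_pos[OF x(1)] dsnd[OF x(1)] r by (auto simp: t_def)
      have "m / 2 * t \<le> (M - C5) * t" using half t by (intro mult_right_mono) auto
      also have "\<dots> \<le> Al * log_profile ?n R r" using r(4) by (simp add: t_def)
      finally have mt: "m / 2 * t \<le> Al * log_profile ?n R r" .
      \<comment> \<open>The logarithm is kept here: cancelling \<open>t\<close> shows that
        \<open>m ^ n\<close> is at most of order \<open>L\<close>, so \<open>r\<close> is
        exponentially small in \<open>X\<close>, and the square root bound then transfers this to
        \<open>t\<close>.\<close>
      define L where "L = ln (B / r)"
      have "exp 2 < B / r" using r pos by (simp add: B_def field_simps)
      then have "ln (exp 2) < L" unfolding L_def by (subst ln_less_cancel_iff) (use r B in auto)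
      then have L: "2 < L" by simp
      have "m / 2 * t \<le> Al * (r * L powr (1 / real ?n))" using mt by (simp add: log_profile_def L_def B_def)
      also have "\<dots> \<le> Al * (t * L powr (1 / real ?n))" using Aa t by (intro mult_left_mono mult_right_mono) auto
      finally have "(m / 2) * t \<le> (Al * L powr (1 / real ?n)) * t" by (simp add: ac_simps)
      then have "m / 2 \<le> Al * L powr (1 / real ?n)" using t by simp
      then have "m / (2 * Al) \<le> L powr (1 / real ?n)" using Aa by (simp add: field_simps)
      then have "(m / (2 * Al)) ^ ?n \<le> (L powr (1 / real ?n)) ^ ?n" using m Aa by (intro power_mono) auto
      also have "\<dots> = L"
      proof -
        have "(L powr (1 / real k)) ^ k = L" if "0 < k" for k
          using L that by (simp add: powr_realpow[symmetric] powr_powr)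
        from this[OF npos] show ?thesis .
      qed
      finally have jX: "j * X \<le> L" by (simp add: j_def X_def power_divide)
      have rL: "r = B * exp (- L)" using r B by (simp add: L_def exp_minus exp_ln)
      have "B * r \<le> B * (B * exp (- (j * X)))" unfolding rL using jX B by (intro mult_left_mono) auto
      also have "\<dots> = (B * exp (- (k9 * X)))\<^sup>2"
        by (simp add: power2_eq_square k9_def exp_add[symmetric])
      finally have "sqrt (B * r) \<le> sqrt ((B * exp (- (k9 * X)))\<^sup>2)" by (rule real_sqrt_le_mono)
      also have "\<dots> = B * exp (- (k9 * X))" using B by simp
      finally have sq: "sqrt (B * r) \<le> B * exp (- (k9 * X))" .
      have "1 / 2 * t \<le> m / 2 * t" using m t by (intro mult_right_mono) auto
      also note mt
      also have "Al * log_profile ?n R r \<le> Al * (2 * sqrt (B * r))" using lp[OF r(1,2)] Aa by (intro mult_left_mono) auto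
      also have "\<dots> \<le> Al * (2 * (B * exp (- (k9 * X))))" using sq Aa by (intro mult_left_mono) auto
      finally have "t \<le> 4 * Al * B * exp (- (k9 * X))" by simp
      also have "\<dots> \<le> k2 * exp (- (k9 * X))" using pos by (intro mult_right_mono) (auto simp: k2_def)
      finally show ?thesis by (simp add: t_def)
    next
      case False
      have "X \<le> m0 ^ ?n" unfolding X_def using False m by (intro power_mono) auto
      then have "k9 * X \<le> k9 * m0 ^ ?n" using k9 by (intro mult_left_mono) auto
      then have "1 \<le> exp (k9 * m0 ^ ?n) * exp (- (k9 * X))" by (simp flip: exp_add)
      then have "2 * R * 1 \<le> 2 * R * (exp (k9 * m0 ^ ?n) * exp (- (k9 * X)))" using pos by (intro mult_left_mono) auto
      then have "snd x \<le> (2 * R * exp (k9 * m0 ^ ?n)) * exp (- (k9 * X))" using snd2R[OF x(1)] by simp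
      also have "\<dots> \<le> k2 * exp (- (k9 * X))" using Aa B by (intro mult_right_mono) (auto simp: k2_def)
      finally show ?thesis .
    qed
    have exy0: "excess u y0 p h y0 < 0" using h by (simp add: excess_def)
    define d where "d = dist_bdry \<Omega> y0"
    have d0: "0 < d" unfolding d_def by (rule dist_bdry_pos[OF \<Omega> y0])
    have dk: "d \<le> k2 * exp (- (k9 * X))" using dsnd[OF y0] b1[OF y0 exy0] by (simp add: d_def)
    have hd: "h \<le> 2 * Al * sqrt (B * d)"
    proof -
      obtain r where r: "0 < r" "r \<le> R / 2" "r \<le> d" "h \<le> Al * log_profile ?n R r" using cc unfolding d_def by blast
      have "Al * log_profile ?n R r \<le> Al * (2 * sqrt (B * r))" using lp[OF r(1,2)] Aa by (intro mult_left_mono) auto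
      also have "\<dots> \<le> Al * (2 * sqrt (B * d))" using r B Aa by (intro mult_left_mono) auto
      finally show ?thesis using r by simp
    qed
    have dlow: "k10 * h\<^sup>2 \<le> d"
    proof -
      have "h\<^sup>2 \<le> (2 * Al * sqrt (B * d))\<^sup>2" using hd h by (intro power_mono) auto
      also have "\<dots> = 4 * Al\<^sup>2 * B * d" using B d0 by (simp add: power_mult_distrib)
      finally have "h\<^sup>2 \<le> d * (4 * Al\<^sup>2 * B)" by (simp add: ac_simps)
      then show ?thesis using Aa B by (simp add: k10_def pos_divide_le_eq)
    qed
    have hup: "h \<le> k11 * exp (- (k12 * X))"
    proof -
      have "B * d \<le> B * (k2 * exp (- (k9 * X)))" using dk B by (intro mult_left_mono) auto
      also have "\<dots> = (sqrt (B * k2) * exp (- (k12 * X)))\<^sup>2"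
      proof -
        have "(exp (- (k12 * X)))\<^sup>2 = exp (- (k9 * X))" by (simp add: power2_eq_square k12_def exp_add[symmetric])
        moreover have "(sqrt (B * k2))\<^sup>2 = B * k2" using B k2 by simp
        ultimately show ?thesis by (simp only: power_mult_distrib mult.assoc)
      qed
      finally have "sqrt (B * d) \<le> sqrt ((sqrt (B * k2) * exp (- (k12 * X)))\<^sup>2)" by (rule real_sqrt_le_mono)
      also have "\<dots> = sqrt (B * k2) * exp (- (k12 * X))" using B k2 by simp
      finally have "2 * Al * sqrt (B * d) \<le> 2 * Al * (sqrt (B * k2) * exp (- (k12 * X)))" using Aa by (intro mult_left_mono) auto
      then show ?thesis using hd by (simp add: k11_def)
    qed
    have ln12: "k12 * X \<le> ln (k11 / h)"
    proof -
      have "exp (k12 * X) * h \<le> exp (k12 * X) * (k11 * exp (- (k12 * X)))" using hup by (intro mult_left_mono) auto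
      also have "\<dots> = k11" by (simp add: exp_minus)
      finally have "exp (k12 * X) \<le> k11 / h" using h by (simp add: field_simps)
      then show ?thesis using h k11 by (simp add: ln_ge_iff)
    qed
    define hs where "hs = min h 1"
    have hs: "0 < hs" "hs \<le> 1" "hs \<le> h" using h by (auto simp: hs_def)
    \<comment> \<open>The claim has content only if \<open>C * h < 1\<close>. Then \<open>h\<close>
      is so small that \<open>X > 1\<close>, hence \<open>m = M\<close> and \<open>X\<close> is the
      power of \<open>\<bar>M\<bar>\<close>.\<close>
    have r1: "- c * ln (C * h) \<le> \<bar>M\<bar> ^ ?n"
    proof (cases "0 \<le> ln (C * h)")
      case True
      have "- c * ln (C * h) \<le> 0" using True cpos by simp
      also have "0 \<le> \<bar>M\<bar> ^ ?n" by simp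
      finally show ?thesis .
    next
      case False
      have Ch: "0 < C * h" using Cge h by simp
      have "C * h < 1" using False Ch by simp
      moreover have "exp k8 / k1 * h \<le> C * h" using Cge(3) h by (intro mult_right_mono) auto
      ultimately have "exp k8 / k1 * h < 1" by linarith
      then have "exp k8 * h < k1" using k1 by (simp add: field_simps)
      moreover have "exp k8 * (k1 * exp (- (k8 * X))) \<le> exp k8 * h" using a1 by (intro mult_left_mono) auto
      ultimately have "exp k8 * (k1 * exp (- (k8 * X))) < k1 * 1" by linarith
      then have "k1 * (exp k8 * exp (- (k8 * X))) < k1 * 1" by (simp add: ac_simps)
      then have "exp k8 * exp (- (k8 * X)) < 1" using k1 by (simp only: mult_less_cancel_left_pos)
      then have "k8 * 1 < k8 * X" by (simp flip: exp_add)
      then have "1 < X" using k8 by (simp only: mult_less_cancel_left_pos)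
      then have "m \<noteq> 1" by (auto simp: X_def)
      then have mM: "m = M" by (auto simp: m_def split: if_splits)
      have "exp (- (k8 * X)) \<le> C * h"
      proof -
        have "exp (- (k8 * X)) \<le> h / k1" using a1 k1 by (simp add: field_simps)
        also have "\<dots> \<le> exp k8 / k1 * h" using h k1 k8 by (simp add: field_simps)
        also have "\<dots> \<le> C * h" using Cge(3) h by (intro mult_right_mono) auto
        finally show ?thesis .
      qed
      then have "- (k8 * X) \<le> ln (C * h)" using Ch by (simp add: ln_ge_iff)
      then have "c * (- ln (C * h)) \<le> c * (k8 * X)" using cpos by (intro mult_left_mono) auto
      also have "\<dots> \<le> 1 / k8 * (k8 * X)" using cle(1) k8 X1 by (intro mult_right_mono) auto
      also have "\<dots> = X" using k8 by simp
      also have "X = \<bar>M\<bar> ^ ?n" using m unfolding X_def mM by simp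
      finally show ?thesis by simp
    qed
    \<comment> \<open>For negative \<open>M\<close> only \<open>- C5 \<le> M\<close> is known, and
      \<open>C5 \<le> C5 * m\<close> covers this case.\<close>
    have Mm: "\<bar>M\<bar> \<le> (1 + C5) * m"
    proof -
      have "C5 * 1 \<le> C5 * m" using m C5 by (intro mult_left_mono) auto
      moreover have "M \<le> m" by (simp add: m_def)
      ultimately show ?thesis using M5 m C5 by (simp add: distrib_right abs_le_iff)
    qed
    have r2: "\<bar>M\<bar> ^ ?n \<le> - C * ln (c * h)"
    proof -
      have "c * h \<le> 1 / k11 * h" using cle(2) h by (intro mult_right_mono) auto
      then have "ln (c * h) \<le> ln (1 / k11 * h)" using cpos h k11 by (subst ln_le_cancel_iff) auto
      also have "\<dots> = - ln (k11 / h)" using k11 h by (simp add: ln_div)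
      finally have l: "k12 * X \<le> - ln (c * h)" using ln12 by linarith
      have "\<bar>M\<bar> ^ ?n \<le> ((1 + C5) * m) ^ ?n" using Mm by (intro power_mono) auto
      also have "\<dots> = (1 + C5) ^ ?n / k12 * (k12 * X)" using k12 by (simp add: power_mult_distrib X_def)
      also have "\<dots> \<le> (1 + C5) ^ ?n / k12 * (- ln (c * h))" using l parts(2) by (intro mult_left_mono) auto
      also have "\<dots> \<le> C * (- ln (c * h))"
      proof (rule mult_right_mono[OF Cge(4)])
        have "0 \<le> k12 * X" using k12 X1 by simp
        then show "0 \<le> - ln (c * h)" using l by linarith
      qed
      finally show ?thesis by simp
    qed
    have hs4: "hs powr C \<le> hs powr 4" using hs Cge(1) by (intro powr_mono') auto
    have hs2: "hs powr 4 \<le> hs powr 2" using hs by (intro powr_mono') auto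
    have p2: "hs powr 2 = hs\<^sup>2" and p4: "hs powr 4 = hs\<^sup>2 * hs\<^sup>2"
      using hs powr_realpow[of hs 2] powr_realpow[of hs 4] by (simp_all add: power2_eq_square power4_eq_xxxx mult.assoc)
    have dhs: "k10 * hs\<^sup>2 \<le> d"
    proof -
      have "hs\<^sup>2 \<le> h\<^sup>2" using hs by (intro power_mono) auto
      then have "k10 * hs\<^sup>2 \<le> k10 * h\<^sup>2" using k10 by (intro mult_left_mono) auto
      then show ?thesis using dlow by linarith
    qed
    have r3: "c * hs powr C \<le> d"
    proof -
      have "c * hs powr C \<le> k10 * hs powr 2" using cle(3) hs4 hs2 k10 by (intro mult_mono) auto
      then show ?thesis using dhs by (simp add: p2)
    qed
    have b2: "snd x \<le> G * hs powr s" if x: "x \<in> \<Omega>" "excess u y0 p h x < 0" for x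
    proof -
      have "exp (- (k9 * X)) \<le> max 1 (k1 powr (- s)) * hs powr s"
      proof (cases "h \<le> 1")
        case True
        then have hh: "hs = h" by (simp add: hs_def)
        have "exp (- (k8 * X)) \<le> h / k1" using a1 k1 by (simp add: field_simps)
        then have "exp (- (k8 * X)) powr s \<le> (h / k1) powr s" using s by (intro powr_mono2) auto
        moreover have "exp (- (k8 * X)) powr s = exp (- (k9 * X))" using k8 by (simp add: powr_def s_def)
        moreover have "(h / k1) powr s = k1 powr (- s) * hs powr s" using h k1 by (simp add: hh powr_divide powr_minus field_simps)
        moreover have "k1 powr (- s) * hs powr s \<le> max 1 (k1 powr (- s)) * hs powr s" by (intro mult_right_mono) auto
        ultimately show ?thesis by linarith
      next
        case False
        then have hh: "hs = 1" by (simp add: hs_def)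
        have "exp (- (k9 * X)) \<le> 1" using k9 X1 by simp
        then show ?thesis by (simp add: hh le_max_iff_disj)
      qed
      then have "k2 * exp (- (k9 * X)) \<le> k2 * (max 1 (k1 powr (- s)) * hs powr s)" using k2 by (intro mult_left_mono) auto
      then show ?thesis using b1[OF x] by (simp add: G_def)
    qed
    have hsc: "hs powr s \<le> hs powr c" "hs powr (s / 2) \<le> hs powr c" using hs cle(4) s by (auto intro!: powr_mono')
    have r4: "d \<le> C * hs powr c"
    proof -
      have "d \<le> G * hs powr s" using dsnd[OF y0] b2[OF y0 exy0] by (simp add: d_def)
      also have "\<dots> \<le> C * hs powr c" using Cge(5) G hsc by (intro mult_mono) auto
      finally show ?thesis .
    qed
    have r6: "norm (x - y0) < C * hs powr c" if x: "x \<in> \<Omega>" "excess u y0 p h x < 0" for x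
    proof -
      have nb: "norm w \<le> sqrt (2 * R * G) * hs powr (s / 2)" if "w \<in> \<Omega>" "excess u y0 p h w < 0" for w
      proof -
        have "2 * R * snd w \<le> 2 * R * (G * hs powr s)" using b2[OF that] pos by (intro mult_left_mono) auto
        then have "(norm w)\<^sup>2 \<le> 2 * R * (G * hs powr s)" using nsq[OF that(1)] by linarith
        also have "\<dots> = (sqrt (2 * R * G) * hs powr (s / 2))\<^sup>2"
        proof -
          have "(hs powr (s / 2))\<^sup>2 = hs powr s" using hs by (simp add: power2_eq_square flip: powr_add)
          moreover have "(sqrt (2 * R * G))\<^sup>2 = 2 * R * G" using pos G by simp
          ultimately show ?thesis by (simp only: power_mult_distrib mult.assoc)
        qed
        finally show ?thesis by (rule power2_le_imp_le) (use pos G in simp)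
      qed
      have "norm (x - y0) \<le> norm x + norm y0" by (rule norm_triangle_ineq4)
      also have "\<dots> \<le> 2 * sqrt (2 * R * G) * hs powr (s / 2)" using nb[OF x] nb[OF y0 exy0] by simp
      also have "\<dots> \<le> 2 * sqrt (2 * R * G) * hs powr c" using hsc(2) parts(3) by (intro mult_left_mono) auto
      also have "\<dots> < C * hs powr c" using Cge(6) hs by (intro mult_strict_right_mono) auto
      finally show ?thesis .
    qed
    \<comment> \<open>The segment from \<open>y0\<close> to a point closer than \<open>d\<close> is
      used; there the excess is at most \<open>V\<close>, of order \<open>m\<close>, with
      \<open>V * h \<le> K\<close>. The fraction \<open>\<theta>\<close> of order
      \<open>hs\<^sup>2\<close> gives \<open>\<theta> * (V + h) \<le> h / 2\<close>, and
      \<open>d\<close>, at least of order \<open>hs\<^sup>2\<close>, contributes the other two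
      powers.\<close>
    have r5: "y0 + y \<in> \<Omega> \<and> excess u y0 p h (y0 + y) < 0" if y: "norm y < c * hs powr C" for y
    proof -
      define \<theta> where "\<theta> = c1 * hs\<^sup>2"
      have \<theta>: "0 < \<theta>" "\<theta> \<le> 1"
      proof -
        show "0 < \<theta>" using c1 hs by (simp add: \<theta>_def)
        have "c1 * hs\<^sup>2 \<le> 1 * 1" using c1 hs by (intro mult_mono) (auto simp: power_le_one)
        then show "\<theta> \<le> 1" by (simp add: \<theta>_def)
      qed
      have "c * hs powr C \<le> (c1 * k10) * hs powr 4" using cle(5) hs4 c1 k10 by (intro mult_mono) auto
      also have "\<dots> = \<theta> * (k10 * hs\<^sup>2)" by (simp add: p4 \<theta>_def)
      also have "\<dots> \<le> \<theta> * d" using dhs \<theta> by (intro mult_left_mono) auto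
      finally have ny: "norm y < \<theta> * d" using y by linarith
      define w where "w = (1 / \<theta>) *\<^sub>R y"
      have yw: "y = \<theta> *\<^sub>R w" using \<theta> by (simp add: w_def)
      have "norm w < d" using ny \<theta> by (simp add: yw)
      then have "y0 + w \<in> ball y0 d" by (simp add: dist_norm)
      then have wO: "y0 + w \<in> \<Omega>" using dist_bdry_ball_subset[OF y0] by (auto simp: d_def)
      have wc: "y0 + w \<in> closure \<Omega>" "y0 \<in> closure \<Omega>" using wO y0 closure_subset by auto
      have "\<theta> * d \<le> 1 * d" using \<theta> d0 by (intro mult_right_mono) auto
      then have "y0 + y \<in> ball y0 d" using ny by (simp add: dist_norm)
      then have yO: "y0 + y \<in> \<Omega>" using dist_bdry_ball_subset[OF y0] by (auto simp: d_def)
      have mh: "m * h \<le> k11 / k12"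
      proof -
        have "ln (k11 / h) \<le> k11 / h" using k11 h by (intro order_trans[OF ln_le_minus_one]) auto
        then have "k12 * X \<le> k11 / h" using ln12 by linarith
        then have "X * h \<le> k11 / k12" using h k12 by (simp add: field_simps)
        moreover have "m * h \<le> X * h" using mX h by (intro mult_right_mono) auto
        ultimately show ?thesis by linarith
      qed
      have hs2h: "hs\<^sup>2 \<le> h * h" "hs\<^sup>2 * h \<le> h"
      proof -
        show "hs\<^sup>2 \<le> h * h" unfolding power2_eq_square using hs by (intro mult_mono) auto
        have "hs\<^sup>2 * h \<le> 1 * h" using hs h by (intro mult_right_mono) (auto simp: power_le_one)
        then show "hs\<^sup>2 * h \<le> h" by simp
      qed
      define V where "V = (1 + C5) * m * (2 * R)"
      have V0: "0 \<le> V" using C5 m pos by (simp add: V_def)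
      have "excess u y0 p h (y0 + w) \<le> V"
      proof -
        have "(1 + C5) * m * snd (y0 + w) \<le> (1 + C5) * m * (2 * R)" using snd2R[OF wO] C5 m by (intro mult_left_mono) auto
        then show ?thesis using up[OF wc(1)] by (simp add: V_def)
      qed
      then have ex: "excess u y0 p h (y0 + \<theta> *\<^sub>R w) \<le> - h + \<theta> * (V + h)"
        using excess_segment[OF ucv wc(2) wc(1)] \<theta> by simp
      have Vh: "V * h \<le> K"
      proof -
        have "(1 + C5) * (2 * R) * (m * h) \<le> (1 + C5) * (2 * R) * (k11 / k12)" using mh C5 pos by (intro mult_left_mono) auto
        then show ?thesis by (simp add: V_def K_def ac_simps)
      qed
      have "hs\<^sup>2 * V \<le> (h * h) * V" using hs2h V0 by (intro mult_right_mono) auto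
      also have "\<dots> = h * (V * h)" by simp
      also have "\<dots> \<le> h * K" using Vh h by (intro mult_left_mono) auto
      finally have "hs\<^sup>2 * (V + h) \<le> h * (K + 1)" using hs2h(2) by (simp add: distrib_left)
      then have "c1 * (hs\<^sup>2 * (V + h)) \<le> c1 * (h * (K + 1))" using c1 by (intro mult_left_mono) auto
      also have "\<dots> = h / 2"
      proof -
        have "K + 1 \<noteq> 0" using K by simp
        have gen: "1 / (2 * k) * (h * k) = h / 2" if "k \<noteq> 0" for k using that by simp
        show ?thesis unfolding c1_def by (rule gen) fact
      qed
      finally have "\<theta> * (V + h) \<le> h / 2" by (simp add: \<theta>_def mult.assoc)
      then have "excess u y0 p h (y0 + y) < 0" using ex h by (simp add: yw)
      then show ?thesis using yO by simp
    qed
    show "- C \<le> - snd p \<and>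
      - c * ln (C * h) \<le> \<bar>- snd p\<bar> ^ ?n \<and> \<bar>- snd p\<bar> ^ ?n \<le> - C * ln (c * h) \<and>
      c * min h 1 powr C \<le> dist_bdry \<Omega> y0 \<and> dist_bdry \<Omega> y0 \<le> C * min h 1 powr c \<and>
      (\<forall>y. norm y < c * min h 1 powr C \<longrightarrow> y0 + y \<in> \<Omega> \<and> excess u y0 p h (y0 + y) < 0) \<and>
      (\<forall>x\<in>\<Omega>. excess u y0 p h x < 0 \<longrightarrow> norm (x - y0) < C * min h 1 powr c)"
      unfolding M_def[symmetric] d_def[symmetric] hs_def[symmetric]
      using r1 r2 r3 r4 r5 r6 M5 Cge(2) by auto
  qed
qed

section \<open>Geometry of the domain and conclusion\<close>

lemma uniform_ball_normals:
  fixes \<Omega> :: "('a::euclidean_space \<times> real) set"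
  assumes uc: "unif_convex_C2_domain \<Omega> \<kappa> K" and \<kappa>: "0 < \<kappa>"
  obtains N where "\<And>z. z \<in> frontier \<Omega> \<Longrightarrow> ball_normal \<Omega> (1 / (4 * max K 1)) (2 / \<kappa>) z (N z)"
proof -
  have \<Omega>: "open \<Omega>" "bounded \<Omega>" "convex \<Omega>" "\<Omega> \<noteq> {}" using uc by (auto simp: unif_convex_C2_domain_def)
  have dim: "2 \<le> DIM('a \<times> real)" using DIM_positive[where 'a='a] by simp
  note pin = unif_convex_pinched[OF uc \<kappa>]
  have "\<exists>\<nu>. ball_normal \<Omega> (1 / (4 * max K 1)) (2 / \<kappa>) z \<nu>" if z: "z \<in> frontier \<Omega>" for z
  proof -
    obtain \<nu> where \<nu>: "pinched \<Omega> (\<kappa> / 4) (max K 1) z \<nu>" using pin[OF z] by blast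
    have c: "0 < \<kappa> / 4" "0 \<le> \<kappa> / 4" "0 < max K 1" using \<kappa> by auto
    have R: "2 / \<kappa> = 1 / (2 * (\<kappa> / 4))" by simp
    have "norm \<nu> = 1" using \<nu> by (simp add: pinched_def)
    moreover have "closure \<Omega> \<subseteq> cball (z + (2 / \<kappa>) *\<^sub>R \<nu>) (2 / \<kappa>)"
      unfolding R by (rule pinched_outer_ball[OF dim \<Omega> c(1) _ z \<nu>]) (rule pin)
    moreover have "ball (z + (1 / (4 * max K 1)) *\<^sub>R \<nu>) (1 / (4 * max K 1)) \<subseteq> \<Omega>"
      by (rule pinched_inner_ball[OF dim \<Omega> c(2,3) _ z \<nu>]) (rule pin)
    ultimately show ?thesis unfolding ball_normal_def by (intro exI[of _ \<nu>] conjI)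
  qed
  then show ?thesis using that by metis
qed

text \<open>The constant is written with \<open>\<bar>K\<bar>\<close> because it has to be
  nonnegative before a boundary point is at hand to show \<open>0 \<le> K\<close>.\<close>

lemma boundary_expansion:
  fixes \<Omega> :: "('a::euclidean_space \<times> real) set"
  assumes bd: "C2_boundary_data \<Omega> \<phi> K" and \<Omega>: "open \<Omega>" "convex \<Omega>" and pos: "0 < R" "0 < \<rho>"
    and N: "\<And>z. z \<in> frontier \<Omega> \<Longrightarrow> ball_normal \<Omega> \<rho> R z (N z)" and z: "z \<in> frontier \<Omega>"
  obtains q where "q \<bullet> N z = 0" "\<And>x. x \<in> frontier \<Omega> \<Longrightarrow>
    \<bar>\<phi> x - \<phi> z - q \<bullet> (x - z)\<bar> \<le> (5 * (\<bar>K\<bar> + 1) + 6 * \<bar>K\<bar> / \<rho> + 8 * \<bar>K\<bar> / \<rho>\<^sup>2) * (norm (x - z))\<^sup>2"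
proof -
  have jet: "\<exists>q. q \<bullet> N z = 0 \<and> norm q \<le> K \<and> \<bar>\<phi> z\<bar> \<le> K \<and>
        (\<exists>\<delta>>0. \<forall>x\<in>frontier \<Omega>. norm (x - z) < \<delta> \<longrightarrow> \<bar>\<phi> x - \<phi> z - q \<bullet> (x - z)\<bar> \<le> (K + 1) * (norm (x - z))\<^sup>2)"
    if "z \<in> frontier \<Omega>" for z
    by (rule boundary_jet[OF bd \<Omega> pos(1) that N[OF that]])
  have "\<bar>\<phi> z\<bar> \<le> K" using jet[OF z] by blast
  then have K0: "0 \<le> K" and K: "\<bar>K\<bar> = K" by linarith+
  show ?thesis
  proof (rule boundary_taylor[OF \<Omega>(1) pos K0 _ _ z])
    show "ball_normal \<Omega> \<rho> R w (N w)" if "w \<in> frontier \<Omega>" for w by (rule N[OF that])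
    show "\<exists>q. q \<bullet> N w = 0 \<and> norm q \<le> K \<and> \<bar>\<phi> w\<bar> \<le> K \<and>
        (\<exists>\<delta>>0. \<forall>x\<in>frontier \<Omega>. norm (x - w) < \<delta> \<longrightarrow> \<bar>\<phi> x - \<phi> w - q \<bullet> (x - w)\<bar> \<le> (K + 1) * (norm (x - w))\<^sup>2)"
      if "w \<in> frontier \<Omega>" for w by (rule jet[OF that])
    fix q assume "q \<bullet> N z = 0" "\<And>x. x \<in> frontier \<Omega> \<Longrightarrow>
      \<bar>\<phi> x - \<phi> z - q \<bullet> (x - z)\<bar> \<le> (5 * (K + 1) + 6 * K / \<rho> + 8 * K / \<rho>\<^sup>2) * (norm (x - z))\<^sup>2"
    then show thesis by (intro that[of q]) (simp_all only: K)
  qed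
qed

text \<open>A supporting plane at \<open>y0\<close> that meets \<open>u\<close> at a boundary point
  would satisfy the hypothesis of \<open>upper_barrier\<close> there, which forces \<open>u\<close>
  below the plane somewhere. Hence supporting planes are strictly below \<open>u\<close> on the
  boundary, as the uniqueness of subgradients requires.\<close>

lemma gradient_exists:
  fixes \<Omega> :: "'a::euclidean_space set"
  assumes dim: "2 \<le> DIM('a)" and pos: "0 < R" "0 < \<rho>" "0 \<le> C6"
    and \<alpha>: "1 \<le> \<alpha>" "\<alpha> < 2" and lam: "0 < lam" "0 < Lam" and ma: "ma_data \<Omega> \<rho> R N \<alpha> lam Lam u f"
    and tay: "\<And>z. z \<in> frontier \<Omega> \<Longrightarrow>
      \<exists>q. q \<bullet> N z = 0 \<and> (\<forall>x\<in>frontier \<Omega>. \<bar>u x - u z - q \<bullet> (x - z)\<bar> \<le> C6 * (norm (x - z))\<^sup>2)"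
    and y0: "y0 \<in> \<Omega>"
  obtains p where "GDERIV u y0 :> p" "p \<in> subdifferential \<Omega> u y0"
proof -
  have \<Omega>: "open \<Omega>" "bounded \<Omega>" "convex \<Omega>" and N: "\<And>z. z \<in> frontier \<Omega> \<Longrightarrow> ball_normal \<Omega> \<rho> R z (N z)"
    and uc: "continuous_on (closure \<Omega>) u" and ucv: "convex_on (closure \<Omega>) u" and MA: "alexandrov_solution \<Omega> u f"
    and f: "\<And>x. x \<in> \<Omega> \<Longrightarrow> lam * dist_bdry \<Omega> x powr (-\<alpha>) \<le> f x" "\<And>x. x \<in> \<Omega> \<Longrightarrow> f x \<le> Lam * dist_bdry \<Omega> x powr (-\<alpha>)"
    using ma by (auto simp: ma_data_def)
  have ucO: "continuous_on \<Omega> u" by (rule continuous_on_subset[OF uc closure_subset])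
  have ne: "subdifferential \<Omega> u x \<noteq> {}" if x: "x \<in> \<Omega>" for x
  proof -
    have d: "0 < dist_bdry \<Omega> x" by (rule dist_bdry_pos[OF \<Omega>(1,2) x])
    show ?thesis
    proof (rule subdifferential_nonempty[OF \<Omega>(1) x ucO MA, of "dist_bdry \<Omega> x / 2" "lam / 4 * dist_bdry \<Omega> x powr (-\<alpha>)"])
      fix y assume "y \<in> ball x (dist_bdry \<Omega> x / 2)"
      then have "norm (y - x) < dist_bdry \<Omega> x / 2" by (simp add: dist_norm norm_minus_commute)
      then show "lam / 4 * dist_bdry \<Omega> x powr (-\<alpha>) \<le> f y" by (rule ma_data_density_near(1)[OF ma \<alpha> lam x])
    qed (use d lam in auto)
  qed
  have contact: "u y0 + p \<bullet> (z - y0) < u z" if p: "p \<in> subdifferential \<Omega> u y0" and z: "z \<in> frontier \<Omega>" for p z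
  proof (rule ccontr)
    assume nl: "\<not> u y0 + p \<bullet> (z - y0) < u z"
    have cl: "u y0 + p \<bullet> (x - y0) \<le> u x" if x: "x \<in> closure \<Omega>" for x
    proof -
      have "u y0 \<le> u x - p \<bullet> (x - y0)"
      proof (rule continuous_ge_on_closure[OF _ x])
        show "continuous_on (closure \<Omega>) (\<lambda>x. u x - p \<bullet> (x - y0))" by (intro continuous_intros uc)
        show "u y0 \<le> u w - p \<bullet> (w - y0)" if "w \<in> \<Omega>" for w
          using p that by (simp add: subdifferential_def le_diff_eq)
      qed
      then show ?thesis by simp
    qed
    have frc: "x \<in> closure \<Omega>" if "x \<in> frontier \<Omega>" for x using that by (simp add: frontier_def)
    have eq: "u z = u y0 + p \<bullet> (z - y0)" using cl[OF frc[OF z]] nl by linarith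
    have above: "u z + p \<bullet> (x - z) \<le> u x" if "x \<in> closure \<Omega>" for x
      using cl[OF that] unfolding eq by (simp add: inner_diff_right)
    obtain q where q: "q \<bullet> N z = 0" "\<And>x. x \<in> frontier \<Omega> \<Longrightarrow> \<bar>u x - u z - q \<bullet> (x - z)\<bar> \<le> C6 * (norm (x - z))\<^sup>2"
      using tay[OF z] by blast
    define m where "m = max (- (p \<bullet> N z)) 1"
    have m: "1 \<le> m" by (simp add: m_def)
    have up: "u x - (p \<bullet> x + (u z - p \<bullet> z)) \<le> (1 + 2 * R * C6) * m * (N z \<bullet> (x - z))" if "x \<in> closure \<Omega>" for x
    proof -
      have "u x - (u z + p \<bullet> (x - z)) \<le> (1 + 2 * R * C6) * m * (N z \<bullet> (x - z))" unfolding m_def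
        by (rule affine_touching_at_boundary(4)[OF dim \<Omega>(1,2) ucv pos z N[OF z] q(1) _ _ that])
           (use q(2) above frc in blast)+
      then show ?thesis by (simp add: inner_diff_right)
    qed
    have C3: "0 \<le> 1 + 2 * R * C6" using pos by simp
    obtain A a :: real where A: "1 \<le> A" "0 < a" "a \<le> 1"
      "\<And>(\<Omega> :: 'a set) N u f z p b m. \<lbrakk>ma_data \<Omega> \<rho> R N \<alpha> lam Lam u f; z \<in> frontier \<Omega>; 1 \<le> m;
          \<And>x. x \<in> closure \<Omega> \<Longrightarrow> u x - (p \<bullet> x + b) \<le> (1 + 2 * R * C6) * m * (N z \<bullet> (x - z))\<rbrakk>
        \<Longrightarrow> \<exists>x\<in>\<Omega>. u x - (p \<bullet> x + b) \<le> - (A * m * upper_depth \<alpha> \<rho> (2 * A * m ^ DIM('a) / a))"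
      using upper_barrier[where 'a = 'a, OF pos(1,2) C3 \<alpha> lam] by blast
    obtain x where x: "x \<in> \<Omega>" "u x - (p \<bullet> x + (u z - p \<bullet> z)) \<le> - (A * m * upper_depth \<alpha> \<rho> (2 * A * m ^ DIM('a) / a))"
      using A(4)[OF ma z m up] by blast
    have "0 < upper_depth \<alpha> \<rho> (2 * A * m ^ DIM('a) / a)"
      by (rule upper_depth_pos[OF pos(2) _ \<alpha>(1)]) (use A m in auto)
    then have "0 < A * m * upper_depth \<alpha> \<rho> (2 * A * m ^ DIM('a) / a)" using A m by (intro mult_pos_pos) auto
    moreover have "0 \<le> u x - (p \<bullet> x + (u z - p \<bullet> z))"
      using above[of x] x(1) closure_subset[of \<Omega>] by (auto simp: inner_diff_right)
    ultimately show False using x(2) by linarith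
  qed
  have K: "\<exists>lo hi. 0 < lo \<and> lo \<le> hi \<and> (\<forall>x\<in>K. lo \<le> f x \<and> f x \<le> hi)" if K: "compact K" "K \<subseteq> \<Omega>" for K
  proof (cases "K = {}")
    case True
    then show ?thesis by (auto intro!: exI[of _ "1::real"])
  next
    case False
    have cd: "continuous_on K (dist_bdry \<Omega>)"
    proof -
      have "continuous_on K (\<lambda>x. infdist x (frontier \<Omega>))" by (intro continuous_intros)
      then show ?thesis by (simp add: dist_bdry_def[abs_def])
    qed
    obtain x0 where x0: "x0 \<in> K" "\<And>x. x \<in> K \<Longrightarrow> dist_bdry \<Omega> x0 \<le> dist_bdry \<Omega> x"
      using continuous_attains_inf[OF K(1) False cd] by blast
    obtain x1 where x1: "x1 \<in> K" "\<And>x. x \<in> K \<Longrightarrow> dist_bdry \<Omega> x \<le> dist_bdry \<Omega> x1"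
      using continuous_attains_sup[OF K(1) False cd] by blast
    have dp: "0 < dist_bdry \<Omega> x" if "x \<in> K" for x by (rule dist_bdry_pos[OF \<Omega>(1,2)]) (use that K in blast)
    define lo hi where "lo = lam * dist_bdry \<Omega> x1 powr (-\<alpha>)" and "hi = Lam * dist_bdry \<Omega> x0 powr (-\<alpha>)"
    have b: "lo \<le> f x" "f x \<le> hi" if x: "x \<in> K" for x
    proof -
      have "lo \<le> lam * dist_bdry \<Omega> x powr (-\<alpha>)"
        unfolding lo_def using lam \<alpha> dp[OF x] x1(2)[OF x] by (intro mult_left_mono powr_mono2') auto
      then show "lo \<le> f x" using f(1)[of x] x K by (meson order_trans subsetD)
      have "Lam * dist_bdry \<Omega> x powr (-\<alpha>) \<le> hi"
        unfolding hi_def using lam \<alpha> dp[OF x0(1)] x0(2)[OF x] by (intro mult_left_mono powr_mono2') auto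
      then show "f x \<le> hi" using f(2)[of x] x K by (meson order_trans subsetD)
    qed
    have "0 < lo" unfolding lo_def using lam dp[OF x1(1)] by simp
    moreover have "lo \<le> hi" using b[OF x0(1)] by linarith
    ultimately show ?thesis using b by blast
  qed
  obtain p where p: "p \<in> subdifferential \<Omega> u y0" using ne[OF y0] by blast
  have "p' = p" if "p' \<in> subdifferential \<Omega> u y0" for p'
    by (rule subgradient_unique[OF \<Omega> y0 uc ucv MA K contact that p])
  then have "subdifferential \<Omega> u y0 = {p}" using p by blast
  from gderiv_of_unique_subgradient[OF \<Omega>(1) y0 ucO this ne] have "GDERIV u y0 :> p" by blast
  then show ?thesis by (rule that) (rule p)
qed

text \<open>The frame behind \<open>inner_unit_normal\<close> may rotate the horizontal coordinates,
  whereas \<open>has_tangential_grad_at_0\<close> uses the given ones. A frame that fixes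
  \<open>(0, 1)\<close> is an orthogonal map of the horizontal space times the identity, and
  \<open>g\<close> is composed with the inverse of that map.\<close>

lemma tangent_graph_rotate:
  fixes \<Omega> :: "('a::euclidean_space \<times> real) set"
  assumes tg: "tangent_graph \<Omega> 0 T r g" and T1: "T (0, 1) = (0, 1)"
  obtains g' where "tangent_graph \<Omega> 0 id r g'"
proof -
  have r: "0 < r" and T: "orthogonal_transformation T" and g0: "g 0 = 0" and dg: "GDERIV g 0 :> 0"
    and gb: "\<And>x'. norm x' < r \<Longrightarrow> \<bar>g x'\<bar> < r"
    and gr: "\<And>x' t. norm x' < r \<Longrightarrow> \<bar>t\<bar> < r \<Longrightarrow> 0 + T (x', t) \<in> \<Omega> \<longleftrightarrow> g x' < t"
    using tg by (auto simp: tangent_graph_def)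
  have lin: "linear T" using T by (simp add: orthogonal_transformation_def)
  define A where "A y = fst (T (y, 0))" for y
  have sT: "snd (T (y, 0)) = 0" for y
  proof -
    have "T (y, 0) \<bullet> T (0, 1) = (y, 0::real) \<bullet> (0, 1)" by (rule orthogonal_transformation_inner[OF T])
    then show ?thesis by (simp add: T1 inner_prod_def)
  qed
  have TA: "T (y, t) = (A y, t)" for y t
  proof -
    have "T (y, t) = T ((y, 0) + t *\<^sub>R (0, 1))" by simp
    also have "\<dots> = T (y, 0) + t *\<^sub>R (0, 1)" by (simp only: linear_add[OF lin] linear_scale[OF lin] T1)
    finally show ?thesis using sT[of y] by (simp add: A_def prod_eq_iff)
  qed
  have A: "orthogonal_transformation A" unfolding orthogonal_transformation
  proof (intro conjI allI)
    show "linear A"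
    proof (rule linearI)
      show "A (x + y) = A x + A y" for x y
        using linear_add[OF lin, of "(x, 0)" "(y, 0)"] by (simp add: TA)
      show "A (c *\<^sub>R x) = c *\<^sub>R A x" for c x
        using linear_scale[OF lin, of c "(x, 0)"] by (simp add: TA)
    qed
    fix y
    have "norm (T (y, 0)) = norm (y, 0::real)" using T by (simp add: orthogonal_transformation)
    then show "norm (A y) = norm y" by (simp add: TA norm_prod_def)
  qed
  define B where "B = inv A"
  have B: "orthogonal_transformation B" unfolding B_def by (rule orthogonal_transformation_inv[OF A])
  have AB: "A (B x) = x" for x unfolding B_def by (rule surj_f_inv_f[OF orthogonal_transformation_surj[OF A]])
  have nB: "norm (B x) = norm x" for x using B by (simp add: orthogonal_transformation)
  have linB: "linear B" using B by (simp add: orthogonal_transformation_def)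
  have B0: "B 0 = 0" by (rule linear_0[OF linB])
  have dB: "(B has_derivative B) (at 0)" using linB by (simp add: linear_imp_has_derivative)
  have "(g \<circ> B has_derivative (\<lambda>h. h \<bullet> 0) \<circ> B) (at 0)"
    by (rule diff_chain_at[OF dB]) (use dg in \<open>simp add: B0 gderiv_def\<close>)
  then have "GDERIV (g \<circ> B) 0 :> 0" by (simp add: gderiv_def o_def)
  moreover have "0 + id (x', t) \<in> \<Omega> \<longleftrightarrow> g (B x') < t" if "norm x' < r" "\<bar>t\<bar> < r" for x' t
    using gr[of "B x'" t] that by (simp add: nB TA AB)
  moreover have "orthogonal_transformation (id :: 'a \<times> real \<Rightarrow> 'a \<times> real)"
    unfolding orthogonal_transformation_def using linear_id by simp
  ultimately have "tangent_graph \<Omega> 0 id r (g \<circ> B)"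
    unfolding tangent_graph_def using r gb by (simp add: B0 g0 nB)
  then show ?thesis by (rule that)
qed

lemma graph_in_frontier:
  fixes \<Omega> :: "('a::euclidean_space \<times> real) set"
  assumes tg: "tangent_graph \<Omega> 0 id r g" and \<Omega>: "open \<Omega>" and y: "norm y < r"
  shows "(y, g y) \<in> frontier \<Omega>"
proof -
  have gb: "\<bar>g y\<bar> < r" and gr: "\<And>t. \<bar>t\<bar> < r \<Longrightarrow> (y, t) \<in> \<Omega> \<longleftrightarrow> g y < t"
    using tg y by (auto simp: tangent_graph_def)
  have "(y, g y) \<notin> \<Omega>" using gr[OF gb] by simp
  moreover have "(y, g y) \<in> closure \<Omega>" unfolding closure_approachable
  proof (intro allI impI)
    fix e :: real assume e: "0 < e"
    define s where "s = min (e / 2) ((r - g y) / 2)"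
    have s: "0 < s" "s < e" "g y + s < r" using e gb by (auto simp: s_def min_def field_simps)
    then have "(y, g y + s) \<in> \<Omega>" using gr[of "g y + s"] gb by auto
    moreover have "dist (y, g y + s) (y, g y) < e" using s by (simp add: dist_Pair_Pair dist_real_def)
    ultimately show "\<exists>w\<in>\<Omega>. dist w (y, g y) < e" by blast
  qed
  ultimately show ?thesis using \<Omega> by (simp add: frontier_def interior_open)
qed

text \<open>Along the graph \<open>norm (y, g y)\<close> is at most a multiple of
  \<open>norm y\<close>, so the error of the boundary expansion remains quadratic and the horizontal
  part of \<open>q\<close> is the gradient.\<close>

lemma has_tangential_gradI:
  fixes \<Omega> :: "('a::euclidean_space \<times> real) set"
  assumes tg: "tangent_graph \<Omega> 0 id r g" and \<Omega>: "open \<Omega>" and q: "snd q = 0"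
    and exp: "\<And>x. x \<in> frontier \<Omega> \<Longrightarrow> \<bar>\<phi> x - \<phi> 0 - q \<bullet> x\<bar> \<le> C * (norm x)\<^sup>2" and C: "0 \<le> C"
  shows "has_tangential_grad_at_0 \<Omega> \<phi> (fst q)"
proof -
  have r: "0 < r" and g0: "g 0 = 0" and dg: "GDERIV g 0 :> 0" using tg by (auto simp: tangent_graph_def)
  obtain d where d: "0 < d" "\<And>y. norm y < d \<Longrightarrow> \<bar>g y\<bar> \<le> norm y"
  proof -
    have "\<exists>d>0. \<forall>y. norm (y - 0) < d \<longrightarrow> norm (g y - g 0 - (y - 0) \<bullet> 0) \<le> 1 * norm (y - 0)"
      using dg zero_less_one unfolding gderiv_def has_derivative_at_alt by blast
    then show ?thesis using that by (auto simp: g0)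
  qed
  have "GDERIV (\<lambda>y. \<phi> (y, g y)) 0 :> fst q" unfolding gderiv_def has_derivative_at_alt
  proof (intro conjI allI impI)
    show "bounded_linear (\<lambda>h. h \<bullet> fst q)" by (rule bounded_linear_inner_left)
    fix e :: real assume e: "0 < e"
    define d1 where "d1 = min (min d r) (e / (2 * C + 1))"
    have d1: "0 < d1" "d1 \<le> d" "d1 \<le> r" "d1 \<le> e / (2 * C + 1)" using d(1) r e C by (auto simp: d1_def)
    show "\<exists>d>0. \<forall>y. norm (y - 0) < d \<longrightarrow> norm (\<phi> (y, g y) - \<phi> (0, g 0) - (y - 0) \<bullet> fst q) \<le> e * norm (y - 0)"
    proof (intro exI[of _ d1] conjI allI impI d1(1))
      fix y :: 'a assume "norm (y - 0) < d1"
      then have y: "norm y < d" "norm y < r" "norm y \<le> e / (2 * C + 1)" using d1 by auto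
      have gy: "\<bar>g y\<bar> \<le> norm y" by (rule d(2)[OF y(1)])
      have "\<bar>\<phi> (y, g y) - \<phi> 0 - q \<bullet> (y, g y)\<bar> \<le> C * (norm (y, g y))\<^sup>2" by (rule exp[OF graph_in_frontier[OF tg \<Omega> y(2)]])
      also have "\<dots> \<le> C * (2 * (norm y)\<^sup>2)"
      proof (rule mult_left_mono[OF _ C])
        have "(g y)\<^sup>2 \<le> (norm y)\<^sup>2" using gy by (simp add: abs_le_square_iff[symmetric])
        then show "(norm (y, g y))\<^sup>2 \<le> 2 * (norm y)\<^sup>2" by (simp add: norm_prod_def)
      qed
      also have "\<dots> = (2 * C * norm y) * norm y" by (simp add: power2_eq_square)
      also have "\<dots> \<le> e * norm y"
      proof (rule mult_right_mono)
        have "norm y * (2 * C + 1) \<le> e" using y(3) C by (simp add: pos_le_divide_eq)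
        then have "2 * C * norm y + norm y \<le> e" by (simp add: algebra_simps)
        then show "2 * C * norm y \<le> e" using norm_ge_zero[of y] by linarith
      qed simp
      finally show "norm (\<phi> (y, g y) - \<phi> (0, g 0) - (y - 0) \<bullet> fst q) \<le> e * norm (y - 0)"
        by (simp add: g0 inner_prod_def q zero_prod_def inner_commute)
    qed
  qed
  then show ?thesis using tg unfolding has_tangential_grad_at_0_def by blast
qed

text \<open>At 0 the excess is nonnegative because the section lies in \<open>\<Omega>\<close>, and
  nonpositive because 0 is a limit of points of the section. The gradient at \<open>y0\<close> and
  the Taylor vector \<open>q\<close> at 0 then differ by a multiple of the normal, so their
  horizontal parts agree.\<close>

lemma section_setup:
  fixes \<Omega> :: "('a::euclidean_space \<times> real) set"
  assumes \<alpha>: "1 \<le> \<alpha>" "\<alpha> < 2" and lam: "0 < lam" "lam \<le> Lam" and \<kappa>: "0 < \<kappa>"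
    and \<rho>: "\<rho> = 1 / (4 * max K\<^sub>\<Omega> 1)" and R: "R = 2 / \<kappa>"
    and C6: "C6 = 5 * (\<bar>K\<^sub>\<phi>\<bar> + 1) + 6 * \<bar>K\<^sub>\<phi>\<bar> / \<rho> + 8 * \<bar>K\<^sub>\<phi>\<bar> / \<rho>\<^sup>2"
    and dom: "unif_convex_C2_domain \<Omega> \<kappa> K\<^sub>\<Omega>" and z: "0 \<in> frontier \<Omega>" and nu: "inner_unit_normal \<Omega> 0 (0, 1)"
    and u: "continuous_on (closure \<Omega>) u" "convex_on (closure \<Omega>) u" "alexandrov_solution \<Omega> u f"
    and f: "\<forall>x\<in>\<Omega>. lam * dist_bdry \<Omega> x powr (-\<alpha>) \<le> f x \<and> f x \<le> Lam * dist_bdry \<Omega> x powr (-\<alpha>)"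
    and bd: "C2_boundary_data \<Omega> \<phi> K\<^sub>\<phi>" "\<forall>x\<in>frontier \<Omega>. u x = \<phi> x"
    and y0: "y0 \<in> \<Omega>" and h: "maximal_section_height \<Omega> u y0 h" "0 \<in> closure (MA_section \<Omega> u y0 h)"
  shows "has_tangential_grad_at_0 \<Omega> \<phi> (fst (grad u y0)) \<and>
    (\<exists>N. section_data \<Omega> \<rho> R N \<alpha> lam Lam C6 u f 0 y0 (grad u y0) h \<and> N 0 = (0, 1)) \<and>
    (\<forall>x. x \<in> MA_section \<Omega> u y0 h \<longleftrightarrow> x \<in> \<Omega> \<and> excess u y0 (grad u y0) h x < 0)"
proof -
  have \<Omega>: "open \<Omega>" "bounded \<Omega>" "convex \<Omega>" "\<Omega> \<noteq> {}" using dom by (auto simp: unif_convex_C2_domain_def)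
  have dim: "2 \<le> DIM('a \<times> real)" using DIM_positive[where 'a='a] by simp
  have pos: "0 < R" "0 < \<rho>" using \<kappa> by (auto simp: R \<rho> less_max_iff_disj)
  have C60: "0 \<le> C6" using pos by (simp add: C6)
  have Lam: "0 < Lam" using lam by simp
  obtain N where N: "\<And>z. z \<in> frontier \<Omega> \<Longrightarrow> ball_normal \<Omega> \<rho> R z (N z)"
    using uniform_ball_normals[OF dom \<kappa>] unfolding \<rho> R by blast
  obtain T r g where tg: "tangent_graph \<Omega> 0 T r g" and T1: "T (0, 1) = (0, 1)"
    using nu by (auto simp: inner_unit_normal_def)
  have "T (0, 1) = N 0"
  proof (rule tangent_graph_normal[OF tg])
    show "norm (N 0) = 1" using N[OF z] by (simp add: ball_normal_def)
    show "0 \<le> N 0 \<bullet> (x - 0)" if "x \<in> \<Omega>" for x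
      by (rule ball_normal_nonneg[OF N[OF z] _ pos(1)]) (use that closure_subset in blast)
  qed
  then have N0: "N 0 = (0, 1)" using T1 by simp
  have ma: "ma_data \<Omega> \<rho> R N \<alpha> lam Lam u f" unfolding ma_data_def using \<Omega> N u f by blast
  have tay: "\<exists>q. q \<bullet> N z = 0 \<and> (\<forall>x\<in>frontier \<Omega>. \<bar>u x - u z - q \<bullet> (x - z)\<bar> \<le> C6 * (norm (x - z))\<^sup>2)"
    if z: "z \<in> frontier \<Omega>" for z
  proof (rule boundary_expansion[OF bd(1) \<Omega>(1,3) pos _ z, of N])
    fix q assume q: "q \<bullet> N z = 0" "\<And>x. x \<in> frontier \<Omega> \<Longrightarrow>
      \<bar>\<phi> x - \<phi> z - q \<bullet> (x - z)\<bar> \<le> (5 * (\<bar>K\<^sub>\<phi>\<bar> + 1) + 6 * \<bar>K\<^sub>\<phi>\<bar> / \<rho> + 8 * \<bar>K\<^sub>\<phi>\<bar> / \<rho>\<^sup>2) * (norm (x - z))\<^sup>2"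
    have "\<bar>u x - u z - q \<bullet> (x - z)\<bar> \<le> C6 * (norm (x - z))\<^sup>2" if "x \<in> frontier \<Omega>" for x
      using q(2)[OF that] that z bd(2) unfolding C6 by simp
    then show ?thesis using q(1) by blast
  qed (rule N)
  obtain p where dp: "GDERIV u y0 :> p" and p: "p \<in> subdifferential \<Omega> u y0"
    by (rule gradient_exists[OF dim pos C60 \<alpha> lam(1) Lam ma tay y0])
  \<comment> \<open>\<open>grad\<close> is a definite description; its value is determined only now
    that a derivative exists and is unique.\<close>
  have gp: "grad u y0 = p" unfolding grad_def by (rule the_equality[where P = "\<lambda>p. GDERIV u y0 :> p", OF dp]) (rule gderiv_unique[OF _ dp])
  have sec: "x \<in> MA_section \<Omega> u y0 h \<longleftrightarrow> x \<in> closure \<Omega> \<and> excess u y0 p h x < 0" for x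
    by (simp add: MA_section_def excess_def gp)
  have h0: "0 < h" and sub: "MA_section \<Omega> u y0 h \<subseteq> \<Omega>" using h(1) by (auto simp: maximal_section_height_def)
  have fr: "0 \<le> excess u y0 p h x" if x: "x \<in> frontier \<Omega>" for x
  proof (rule ccontr)
    assume "\<not> 0 \<le> excess u y0 p h x"
    then have "x \<in> MA_section \<Omega> u y0 h" using x by (simp add: sec frontier_def)
    then have "x \<in> \<Omega>" using sub by blast
    then show False using x \<Omega>(1) by (simp add: frontier_def interior_open)
  qed
  have "excess u y0 p h 0 \<le> 0"
  proof (rule continuous_le_on_closure[OF _ h(2)])
    have "MA_section \<Omega> u y0 h \<subseteq> closure \<Omega>" by (auto simp: MA_section_def)
    then have "closure (MA_section \<Omega> u y0 h) \<subseteq> closure \<Omega>" by (simp add: closure_minimal)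
    then show "continuous_on (closure (MA_section \<Omega> u y0 h)) (excess u y0 p h)"
      unfolding excess_def[abs_def] by (intro continuous_intros continuous_on_subset[OF u(1)])
    show "excess u y0 p h x \<le> 0" if "x \<in> MA_section \<Omega> u y0 h" for x using that by (simp add: sec)
  qed
  then have ez: "excess u y0 p h 0 = 0" using fr[OF z] by simp
  have sd: "section_data \<Omega> \<rho> R N \<alpha> lam Lam C6 u f 0 y0 p h"
    unfolding section_data_def using ma z tay[OF z] y0 p h0 fr ez by blast
  obtain q where q: "q \<bullet> N 0 = 0" "\<And>x. x \<in> frontier \<Omega> \<Longrightarrow> \<bar>u x - u 0 - q \<bullet> (x - 0)\<bar> \<le> C6 * (norm (x - 0))\<^sup>2"
    using tay[OF z] by blast
  have P: "u 0 + p \<bullet> (x - 0) \<le> u x" if "x \<in> frontier \<Omega>" for x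
    using fr[OF that] ez by (simp add: excess_def inner_diff_right)
  have "p = q + (p \<bullet> N 0) *\<^sub>R N 0"
    by (rule affine_touching_at_boundary(1)[OF dim \<Omega>(1,2) u(2) pos C60 z N[OF z] q(1)]) (use q(2) P in blast)+
  then have fp: "fst p = fst q" by (simp add: N0 prod_eq_iff)
  have q0: "snd q = 0" using q(1) by (simp add: N0 inner_prod_def)
  obtain g' where tg': "tangent_graph \<Omega> 0 id r g'" by (rule tangent_graph_rotate[OF tg T1])
  have "\<bar>\<phi> x - \<phi> 0 - q \<bullet> x\<bar> \<le> C6 * (norm x)\<^sup>2" if "x \<in> frontier \<Omega>" for x
    using q(2)[OF that] that z bd(2) by simp
  from has_tangential_gradI[OF tg' \<Omega>(1) q0 this C60] have "has_tangential_grad_at_0 \<Omega> \<phi> (fst p)" by (simp add: fp)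
  moreover have "x \<in> MA_section \<Omega> u y0 h \<longleftrightarrow> x \<in> \<Omega> \<and> excess u y0 p h x < 0" for x
    using sec[of x] sub closure_subset[of \<Omega>] by blast
  ultimately show ?thesis unfolding gp using sd N0 by blast
qed

theorem theorem1p4:
  fixes \<alpha> lam\<^sub>0 Lam\<^sub>0 D \<kappa> K\<^sub>\<Omega> K\<^sub>\<phi> :: real
  assumes "1 \<le> \<alpha>" "\<alpha> < 2" and "0 < lam\<^sub>0" "lam\<^sub>0 \<le> Lam\<^sub>0" and "0 < \<kappa>"
  shows "\<exists>c>0. \<exists>C>0.
    \<forall>(\<Omega> :: ('a::euclidean_space \<times> real) set) \<phi> u f y\<^sub>0 h.
      unif_convex_C2_domain \<Omega> \<kappa> K\<^sub>\<Omega> \<and> diameter \<Omega> \<le> D \<and>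
      0 \<in> frontier \<Omega> \<and> inner_unit_normal \<Omega> 0 (0, 1) \<and>
      continuous_on (closure \<Omega>) u \<and> convex_on (closure \<Omega>) u \<and>
      alexandrov_solution \<Omega> u f \<and>
      (\<forall>x\<in>\<Omega>. lam\<^sub>0 * dist_bdry \<Omega> x powr (-\<alpha>) \<le> f x \<and>
              f x \<le> Lam\<^sub>0 * dist_bdry \<Omega> x powr (-\<alpha>)) \<and>
      C2_boundary_data \<Omega> \<phi> K\<^sub>\<phi> \<and> (\<forall>x\<in>frontier \<Omega>. u x = \<phi> x) \<and>
      y\<^sub>0 \<in> \<Omega> \<and> maximal_section_height \<Omega> u y\<^sub>0 h \<and> 0 \<in> closure (MA_section \<Omega> u y\<^sub>0 h)
      \<longrightarrow>
      (let n = DIM('a \<times> real);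
           M = - snd (grad u y\<^sub>0);
           S = (\<lambda>x. x - y\<^sub>0) ` MA_section \<Omega> u y\<^sub>0 h
       in
         has_tangential_grad_at_0 \<Omega> \<phi> (fst (grad u y\<^sub>0)) \<and> M \<ge> - C \<and>
         (1 < \<alpha> \<longrightarrow>
           (let \<beta> = (real n + \<alpha> - 1) / real n in
             c * h powr ((1 - \<beta>) / (2 - \<beta>)) \<le> max M 1 \<and>
             max M 1 \<le> C * h powr ((1 - \<beta>) / (2 - \<beta>)) \<and>
             c * h powr (1 / (2 - \<beta>)) \<le> dist_bdry \<Omega> y\<^sub>0 \<and>
             dist_bdry \<Omega> y\<^sub>0 \<le> C * h powr (1 / (2 - \<beta>)) \<and>
             {x. (norm (fst x))\<^sup>2 + \<bar>snd x\<bar> \<le> c * h powr (1 / (2 - \<beta>))} \<subseteq> S \<and>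
             S \<subseteq> {x. (norm (fst x))\<^sup>2 + \<bar>snd x\<bar> \<le> C * h powr (1 / (2 - \<beta>))})) \<and>
         (\<alpha> = 1 \<longrightarrow>
           (let hs = min h 1 in
             - c * ln (C * h) \<le> \<bar>M\<bar> ^ n \<and> \<bar>M\<bar> ^ n \<le> - C * ln (c * h) \<and>
             c * hs powr C \<le> dist_bdry \<Omega> y\<^sub>0 \<and> dist_bdry \<Omega> y\<^sub>0 \<le> C * hs powr c \<and>
             ball 0 (c * hs powr C) \<subseteq> S \<and> S \<subseteq> ball 0 (C * hs powr c))))"
proof -
  \<comment> \<open>The radii and the Taylor constant depend only on the curvature bounds and
    \<open>K\<^sub>\<phi>\<close>, so they precede the choice of \<open>c\<close> and
    \<open>C\<close>.\<close>
  define \<rho> where "\<rho> = 1 / (4 * max K\<^sub>\<Omega> 1)"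
  define R where "R = 2 / \<kappa>"
  define C6 where "C6 = 5 * (\<bar>K\<^sub>\<phi>\<bar> + 1) + 6 * \<bar>K\<^sub>\<phi>\<bar> / \<rho> + 8 * \<bar>K\<^sub>\<phi>\<bar> / \<rho>\<^sup>2"
  have pos: "0 < R" "0 < \<rho>" using assms(5) by (auto simp: R_def \<rho>_def less_max_iff_disj)
  have C6: "0 \<le> C6" using pos by (simp add: C6_def)
  have Lam: "0 < Lam\<^sub>0" using assms by simp
  have geometry: "has_tangential_grad_at_0 \<Omega> \<phi> (fst (grad u y\<^sub>0)) \<and>
      (\<exists>N. section_data \<Omega> \<rho> R N \<alpha> lam\<^sub>0 Lam\<^sub>0 C6 u f 0 y\<^sub>0 (grad u y\<^sub>0) h \<and> N 0 = (0, 1)) \<and>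
      (\<forall>x. x \<in> MA_section \<Omega> u y\<^sub>0 h \<longleftrightarrow> x \<in> \<Omega> \<and> excess u y\<^sub>0 (grad u y\<^sub>0) h x < 0)"
    if "unif_convex_C2_domain \<Omega> \<kappa> K\<^sub>\<Omega> \<and> diameter \<Omega> \<le> D \<and>
      0 \<in> frontier \<Omega> \<and> inner_unit_normal \<Omega> 0 (0, 1) \<and>
      continuous_on (closure \<Omega>) u \<and> convex_on (closure \<Omega>) u \<and>
      alexandrov_solution \<Omega> u f \<and>
      (\<forall>x\<in>\<Omega>. lam\<^sub>0 * dist_bdry \<Omega> x powr (-\<alpha>) \<le> f x \<and>
              f x \<le> Lam\<^sub>0 * dist_bdry \<Omega> x powr (-\<alpha>)) \<and>
      C2_boundary_data \<Omega> \<phi> K\<^sub>\<phi> \<and> (\<forall>x\<in>frontier \<Omega>. u x = \<phi> x) \<and>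
      y\<^sub>0 \<in> \<Omega> \<and> maximal_section_height \<Omega> u y\<^sub>0 h \<and> 0 \<in> closure (MA_section \<Omega> u y\<^sub>0 h)"
    for \<Omega> :: "('a \<times> real) set" and \<phi> u f y\<^sub>0 h
    using that by (elim conjE) (rule section_setup[OF assms \<rho>_def R_def C6_def])
  have mem: "y \<in> (\<lambda>x. x - y\<^sub>0) ` S \<longleftrightarrow> y\<^sub>0 + y \<in> S" for y y\<^sub>0 :: "'a \<times> real" and S
    by (auto simp: image_iff algebra_simps intro!: bexI[of _ "y\<^sub>0 + y"])
  show ?thesis
  \<comment> \<open>\<open>\<alpha>\<close> is fixed before the constants, so each range of
    \<open>\<alpha>\<close> may use its own; the implication for the other range is then
    vacuous.\<close>
  proof (cases "1 < \<alpha>")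
    case True
    define \<gamma> where "\<gamma> = (real DIM('a \<times> real) + 1 - \<alpha>) / real DIM('a \<times> real)"
    have "(real DIM('a \<times> real) + \<alpha> - 1) / real DIM('a \<times> real) = 2 - \<gamma>"
    proof -
      have "(k + \<alpha> - 1) / k = 2 - (k + 1 - \<alpha>) / k" if "0 < k" for k :: real using that by (simp add: field_simps)
      then show ?thesis unfolding \<gamma>_def using DIM_positive[where 'a = "'a \<times> real"] of_nat_0_less_iff by blast
    qed
    then have \<beta>: "(real DIM('a \<times> real) + \<alpha> - 1) / real DIM('a \<times> real) = 2 - \<gamma>" "1 - (2 - \<gamma>) = \<gamma> - 1" "2 - (2 - \<gamma>) = \<gamma>"
      by simp_all
    obtain c C :: real where c: "0 < c" and C: "0 < C" and est: "\<And>(\<Omega> :: ('a \<times> real) set) N u f y0 p h.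
        section_data \<Omega> \<rho> R N \<alpha> lam\<^sub>0 Lam\<^sub>0 C6 u f 0 y0 p h \<Longrightarrow> N 0 = (0, 1) \<Longrightarrow>
        - C \<le> - snd p \<and>
        c * h powr ((\<gamma> - 1) / \<gamma>) \<le> max (- snd p) 1 \<and> max (- snd p) 1 \<le> C * h powr ((\<gamma> - 1) / \<gamma>) \<and>
        c * h powr (1 / \<gamma>) \<le> dist_bdry \<Omega> y0 \<and> dist_bdry \<Omega> y0 \<le> C * h powr (1 / \<gamma>) \<and>
        (\<forall>y. (norm (fst y))\<^sup>2 + \<bar>snd y\<bar> \<le> c * h powr (1 / \<gamma>) \<longrightarrow> y0 + y \<in> \<Omega> \<and> excess u y0 p h (y0 + y) < 0) \<and>
        (\<forall>x\<in>\<Omega>. excess u y0 p h x < 0 \<longrightarrow> (norm (fst (x - y0)))\<^sup>2 + \<bar>snd (x - y0)\<bar> \<le> C * h powr (1 / \<gamma>))"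
      using estimates_power[OF pos C6 True assms(2,3) Lam \<gamma>_def] by blast
    show ?thesis
    proof (rule exI[of _ c], rule conjI[OF c], rule exI[of _ C], rule conjI[OF C], intro allI impI, goal_cases)
      case (1 \<Omega> \<phi> u f y\<^sub>0 h)
      obtain N where tan: "has_tangential_grad_at_0 \<Omega> \<phi> (fst (grad u y\<^sub>0))"
        and sd: "section_data \<Omega> \<rho> R N \<alpha> lam\<^sub>0 Lam\<^sub>0 C6 u f 0 y\<^sub>0 (grad u y\<^sub>0) h" "N 0 = (0, 1)"
        and sec: "\<And>x. x \<in> MA_section \<Omega> u y\<^sub>0 h \<longleftrightarrow> x \<in> \<Omega> \<and> excess u y\<^sub>0 (grad u y\<^sub>0) h x < 0"
        using geometry[OF 1] by blast
      note e = est[OF sd]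
      have S1: "{x. (norm (fst x))\<^sup>2 + \<bar>snd x\<bar> \<le> c * h powr (1 / \<gamma>)} \<subseteq> (\<lambda>x. x - y\<^sub>0) ` MA_section \<Omega> u y\<^sub>0 h"
        using e by (auto simp only: subset_iff mem_Collect_eq mem sec)
      have S2: "(\<lambda>x. x - y\<^sub>0) ` MA_section \<Omega> u y\<^sub>0 h \<subseteq> {x. (norm (fst x))\<^sup>2 + \<bar>snd x\<bar> \<le> C * h powr (1 / \<gamma>)}"
        using e by (auto simp only: image_subset_iff mem_Collect_eq sec)
      show ?case unfolding Let_def \<beta>
      proof (intro conjI impI tan S1 S2)
        assume "\<alpha> = 1"
        then show "- c * ln (C * h) \<le> \<bar>- snd (grad u y\<^sub>0)\<bar> ^ DIM('a \<times> real)"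
          "\<bar>- snd (grad u y\<^sub>0)\<bar> ^ DIM('a \<times> real) \<le> - C * ln (c * h)"
          "c * min h 1 powr C \<le> dist_bdry \<Omega> y\<^sub>0" "dist_bdry \<Omega> y\<^sub>0 \<le> C * min h 1 powr c"
          "ball 0 (c * min h 1 powr C) \<subseteq> (\<lambda>x. x - y\<^sub>0) ` MA_section \<Omega> u y\<^sub>0 h"
          "(\<lambda>x. x - y\<^sub>0) ` MA_section \<Omega> u y\<^sub>0 h \<subseteq> ball 0 (C * min h 1 powr c)"
          using True by simp_all
      qed (use e in blast)+
    qed
  next
    case False
    then have \<alpha>: "\<alpha> = 1" using assms(1) by simp
    obtain c C :: real where c: "0 < c" and C: "0 < C" and est: "\<And>(\<Omega> :: ('a \<times> real) set) N u f y0 p h.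
        section_data \<Omega> \<rho> R N 1 lam\<^sub>0 Lam\<^sub>0 C6 u f 0 y0 p h \<Longrightarrow> N 0 = (0, 1) \<Longrightarrow>
        - C \<le> - snd p \<and>
        - c * ln (C * h) \<le> \<bar>- snd p\<bar> ^ DIM('a \<times> real) \<and> \<bar>- snd p\<bar> ^ DIM('a \<times> real) \<le> - C * ln (c * h) \<and>
        c * min h 1 powr C \<le> dist_bdry \<Omega> y0 \<and> dist_bdry \<Omega> y0 \<le> C * min h 1 powr c \<and>
        (\<forall>y. norm y < c * min h 1 powr C \<longrightarrow> y0 + y \<in> \<Omega> \<and> excess u y0 p h (y0 + y) < 0) \<and>
        (\<forall>x\<in>\<Omega>. excess u y0 p h x < 0 \<longrightarrow> norm (x - y0) < C * min h 1 powr c)"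
      using estimates_log[where 'a = 'a, OF pos C6 assms(3) Lam] by blast
    show ?thesis
    proof (rule exI[of _ c], rule conjI[OF c], rule exI[of _ C], rule conjI[OF C], intro allI impI, goal_cases)
      case (1 \<Omega> \<phi> u f y\<^sub>0 h)
      obtain N where tan: "has_tangential_grad_at_0 \<Omega> \<phi> (fst (grad u y\<^sub>0))"
        and sd: "section_data \<Omega> \<rho> R N 1 lam\<^sub>0 Lam\<^sub>0 C6 u f 0 y\<^sub>0 (grad u y\<^sub>0) h" "N 0 = (0, 1)"
        and sec: "\<And>x. x \<in> MA_section \<Omega> u y\<^sub>0 h \<longleftrightarrow> x \<in> \<Omega> \<and> excess u y\<^sub>0 (grad u y\<^sub>0) h x < 0"
        using geometry[OF 1] unfolding \<alpha> by blast
      note e = est[OF sd]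
      have S1: "ball 0 (c * min h 1 powr C) \<subseteq> (\<lambda>x. x - y\<^sub>0) ` MA_section \<Omega> u y\<^sub>0 h"
        using e by (auto simp only: subset_iff mem_ball_0 mem sec)
      have S2: "(\<lambda>x. x - y\<^sub>0) ` MA_section \<Omega> u y\<^sub>0 h \<subseteq> ball 0 (C * min h 1 powr c)"
        using e by (auto simp only: image_subset_iff mem_ball_0 sec)
      have e1: "- C \<le> - snd (grad u y\<^sub>0)" "- c * ln (C * h) \<le> \<bar>- snd (grad u y\<^sub>0)\<bar> ^ DIM('a \<times> real)"
        "\<bar>- snd (grad u y\<^sub>0)\<bar> ^ DIM('a \<times> real) \<le> - C * ln (c * h)"
        "c * min h 1 powr C \<le> dist_bdry \<Omega> y\<^sub>0" "dist_bdry \<Omega> y\<^sub>0 \<le> C * min h 1 powr c"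
        using e by blast+
      show ?case unfolding Let_def
        using tan e1 S1 S2 False by (intro conjI impI) (assumption | blast)+
    qed
  qed
qed


end
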